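(* Let $n\in\{1,2,3\}$, let $k$ be a kernel satisfying the standing assumptions (C1)–(C4) listed in the context, and let $u_0\in H^2(\mathbb{R}^n)$. Then the Cauchy problem $$\mathscr{D}_{(k)}u(t,x)=\triangle u(t,x),\quad t>0,\ x\in\mathbb{R}^n,\qquad u(0,x)=u_0(x),\quad x\in\mathbb{R}^n,$$ has a unique solution $u\in C([0,\infty);H^2(\mathbb{R}^n)\cap L^\infty(\mathbb{R}^n))$. Moreover, the following relations hold, where $K_n$ is a constant depending only on the dimension $n$: $$\|u(t,\cdot)\|_{L^2(\mathbb{R}^n)}\le\|u_0\|_{L^2(\mathbb{R}^n)},\quad t\ge0;$$ $$\|u(t,\cdot)\|_{H^2(\mathbb{R}^n)}\le\|u_0\|_{H^2(\mathbb{R}^n)},\quad t\ge0;$$ $$\lim_{t\to0}\|u(t,\cdot)-u_0\|_{H^2(\mathbb{R}^n)}=0;$$ $$\left\|\frac{\partial^j u(t,\cdot)}{\partial t^j}\right\|_{L^2(\mathbb{R}^n)}\le\left(\frac{j}{et}\right)^j\|u_0\|_{L^2(\mathbb{R}^n)},\quad j\in\mathbb{N},\ t>0;$$ $$\left\|\frac{\partial^j u(t,\cdot)}{\partial t^j}\right\|_{H^2(\mathbb{R}^n)}\le\left(\frac{j}{et}\right)^j\|u_0\|_{H^2(\mathbb{R}^n)},\quad j\in\mathbb{N},\ t>0;$$ $$\|\mathscr{D}_{(k)}u(t,\cdot)\|_{L^2(\mathbb{R}^n)}\le\|u_0\|_{H^2(\mathbb{R}^n)},\quad t>0;$$ $$\|u(t,\cdot)\|_{L^\infty(\mathbb{R}^n)}\le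 K_n\,\|u_0\|_{L^2(\mathbb{R}^n)}\left(\frac{\|k\|_{L^1(0,t)}}{t}\right)^{n/4},\quad t>0.$$ If $u_0$ is nonnegative, then the solution is also nonnegative. If $u_0$ is bounded, then the solution is also bounded.
   Context: Kernel. $k\in L^1_{loc}(\mathbb{R}_+)$ (integrable on $(0,T)$ for every $T>0$) satisfies: (C1) the Laplace transform $\hat k(s)=\int_0^\infty k(t)e^{-ts}\,dt$ exists for all $s>0$; (C2) $\hat k$ is a Stieltjes function, i.e. $\hat k(s)=\frac{a}{s}+b+\int_{(0,\infty)}\frac{1}{s+r}\,\sigma(dr)$ for $s>0$, with $a,b\ge0$ and $\sigma$ a nonnegative measure on $(0,\infty)$ with $\int_{(0,\infty)}(1+r)^{-1}\sigma(dr)<\infty$; (C3) $\hat k(s)\to0$ and $s\hat k(s)\to\infty$ as $s\to\infty$; (C4) $\hat k(s)\to\infty$ and $s\hat k(s)\to0$ as $s\to0$. General Caputo-type operator (acting on the time variable): $\mathscr{D}_{(k)}v(t)=\frac{d}{dt}\int_0^t k(t-\tau)v(\tau)\,d\tau-k(t)v(0)$. Fourier transform: $\tilde w(\xi)=Fw(\xi)=(2\pi)^{-n/2}\int_{\mathbb{R}^n}w(x)e^{-ix\xi}\,dx$ (extended to $L^2$ as usual), with inverse $F^{-1}w(x)=(2\pi)^{-n/2}\int_{\mathbb{R}^n}w(\xi)e^{ix\xi}\,d\xi$. The Laplacian is $\triangle w=-F^{-1}(|\xi|^2\tilde w(\xi))$, and $\|w\|_{H^2(\mathbb{R}^n)}=\|(1+|\cdot|^2)\tilde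 w\|_{L^2(\mathbb{R}^n)}$. Solution. Solutions are understood via the spatial Fourier transform: $u$ solves the Cauchy problem if $\tilde u(t,\xi)$ (Fourier transform in $x$, for a suitable representative) is such that for almost every $\xi$ the function $t\mapsto\tilde u(t,\xi)$ is continuous on $[0,\infty)$, $\tilde u(0,\xi)=\tilde u_0(\xi)$, and $\mathscr{D}_{(k)}\tilde u(t,\xi)=-|\xi|^2\tilde u(t,\xi)$ for $t>0$. Correspondingly $\mathscr{D}_{(k)}u(t,\cdot)$ and $\partial^j u(t,\cdot)/\partial t^j$ are the functions whose spatial Fourier transforms are $\mathscr{D}_{(k)}\tilde u(t,\cdot)$ and $\partial^j\tilde u(t,\cdot)/\partial t^j$. $\mathbb{N}=\{1,2,\dots\}$. *)

theory Defs
  imports "HOL-Analysis.Analysis" "HOL-Probability.Essential_Supremum"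
begin

section \<open>Function spaces on Euclidean space\<close>

text \<open>Elements of the function spaces are represented by complex-valued, Lebesgue measurable
  functions; equality in these spaces is equality almost everywhere. The real-valued norms
  are meaningful only together with the corresponding membership predicate.\<close>

definition L2_fun :: "(real ^ 'n \<Rightarrow> complex) \<Rightarrow> bool" where
  "L2_fun f \<longleftrightarrow> f \<in> borel_measurable lebesgue \<and> integrable lebesgue (\<lambda>x. (norm (f x))\<^sup>2)"

definition L2_norm :: "(real ^ 'n \<Rightarrow> complex) \<Rightarrow> real" where
  "L2_norm f = sqrt (LINT x|lebesgue. (norm (f x))\<^sup>2)"

definition Linf_fun :: "(real ^ 'n \<Rightarrow> complex) \<Rightarrow> bool" where
  "Linf_fun f \<longleftrightarrow> f \<in> borel_measurable lebesgue \<and> esssup lebesgue (\<lambda>x. ereal (norm (f x))) < \<infinity>"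

definition Linf_norm :: "(real ^ 'n \<Rightarrow> complex) \<Rightarrow> real" where
  "Linf_norm f = real_of_ereal (esssup lebesgue (\<lambda>x. ereal (norm (f x))))"

definition fourier_L1 :: "(real ^ 'n \<Rightarrow> complex) \<Rightarrow> real ^ 'n \<Rightarrow> complex" where
  "fourier_L1 w \<xi> = complex_of_real ((2 * pi) powr (- real CARD('n) / 2)) *
     (LINT x|lebesgue. w x * exp (- \<i> * complex_of_real (x \<bullet> \<xi>)))"

text \<open>The extension to \<open>L\<^sup>2\<close>: \<open>g\<close> is (a representative of) the transform of \<open>w\<close> if it is the
  \<open>L\<^sup>2\<close>-limit of the classical transforms of the truncations of \<open>w\<close> to balls. Such a \<open>g\<close> is
  determined up to a null set. The distance is an extended nonnegative integral, so that
  convergence to \<open>0\<close> cannot hold by a divergent integral defaulting to \<open>0\<close>.\<close>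

definition has_fourier :: "(real ^ 'n \<Rightarrow> complex) \<Rightarrow> (real ^ 'n \<Rightarrow> complex) \<Rightarrow> bool" where
  "has_fourier w g \<longleftrightarrow> L2_fun w \<and> L2_fun g \<and>
     ((\<lambda>R::real. \<integral>\<^sup>+ \<xi>. ennreal ((norm (fourier_L1 (\<lambda>x. indicat_real (cball 0 R) x *\<^sub>R w x) \<xi> - g \<xi>))\<^sup>2)
         \<partial>lebesgue) \<longlongrightarrow> 0) at_top"

definition fourier :: "(real ^ 'n \<Rightarrow> complex) \<Rightarrow> real ^ 'n \<Rightarrow> complex" where
  "fourier w = (SOME g. has_fourier w g)"

definition H2_fun :: "(real ^ 'n \<Rightarrow> complex) \<Rightarrow> bool" where
  "H2_fun w \<longleftrightarrow> L2_fun w \<and> L2_fun (\<lambda>\<xi>. complex_of_real (1 + (norm \<xi>)\<^sup>2) * fourier w \<xi>)"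

definition H2_norm :: "(real ^ 'n \<Rightarrow> complex) \<Rightarrow> real" where
  "H2_norm w = L2_norm (\<lambda>\<xi>. complex_of_real (1 + (norm \<xi>)\<^sup>2) * fourier w \<xi>)"

text \<open>The space \<open>C([0,\<infinity>); H\<^sup>2 \<inter> L\<^sup>\<infinity>)\<close>; the intersection carries the sum of the two norms.
  Values at negative times are irrelevant.\<close>

definition C_H2_Linf :: "(real \<Rightarrow> real ^ 'n \<Rightarrow> complex) \<Rightarrow> bool" where
  "C_H2_Linf u \<longleftrightarrow> (\<forall>t\<ge>0. H2_fun (u t) \<and> Linf_fun (u t) \<and>
     ((\<lambda>s. H2_norm (\<lambda>x. u s x - u t x) + Linf_norm (\<lambda>x. u s x - u t x)) \<longlongrightarrow> 0) (at t within {0..}))"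

section \<open>The kernel\<close>

definition L1_loc :: "(real \<Rightarrow> real) \<Rightarrow> bool" where
  "L1_loc k \<longleftrightarrow> (\<forall>T>0. set_integrable lebesgue {0<..<T} k)"

definition laplace :: "(real \<Rightarrow> real) \<Rightarrow> real \<Rightarrow> real" where
  "laplace k s = (LINT t:{0<..}|lebesgue. k t * exp (- t * s))"

definition stieltjes_function :: "(real \<Rightarrow> real) \<Rightarrow> bool" where
  "stieltjes_function f \<longleftrightarrow> (\<exists>(a::real) (b::real) (\<sigma>::real measure). a \<ge> 0 \<and> b \<ge> 0 \<and>
     sets \<sigma> = sets (restrict_space borel {0<..}) \<and>
     integrable \<sigma> (\<lambda>r. 1 / (1 + r)) \<and>
     (\<forall>s>0. f s = a / s + b + (LINT r|\<sigma>. 1 / (s + r))))"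

definition admissible_kernel :: "(real \<Rightarrow> real) \<Rightarrow> bool" where
  "admissible_kernel k \<longleftrightarrow> L1_loc k \<and>
     (\<forall>s>0. set_integrable lebesgue {0<..} (\<lambda>t. k t * exp (- t * s))) \<and>
     stieltjes_function (laplace k) \<and>
     (laplace k \<longlongrightarrow> 0) at_top \<and> filterlim (\<lambda>s. s * laplace k s) at_top at_top \<and>
     filterlim (laplace k) at_top (at_right 0) \<and> ((\<lambda>s. s * laplace k s) \<longlongrightarrow> 0) (at_right 0)"

section \<open>The Caputo-type operator\<close>

text \<open>A kernel is an element of \<open>L\<^sup>1\<^sub>l\<^sub>o\<^sub>c\<close>, defined only up to null sets, whereas the operator
  below evaluates it at a point and is used at every \<open>t > 0\<close>. The value at a point is therefore
  the Lebesgue value (limit of averages), which does not depend on the representative and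
  agrees with \<open>k t\<close> for almost every \<open>t\<close>, and for every \<open>t > 0\<close> if \<open>k\<close> is continuous there.
  An admissible kernel is almost everywhere equal to a completely monotone function, whose
  value this is at every \<open>t > 0\<close>.\<close>

definition lebesgue_value :: "(real \<Rightarrow> real) \<Rightarrow> real \<Rightarrow> real" where
  "lebesgue_value k t = Lim (at_right 0) (\<lambda>h. (LINT s:{t-h..t+h}|lebesgue. k s) / (2 * h))"

lemma lebesgue_value_continuous:
  assumes "continuous_on {0<..} k" "t > 0"
  shows "lebesgue_value k t = k t"
proof -
  have "((\<lambda>h. (LINT s:{t-h..t+h}|lebesgue. k s) / (2 * h)) \<longlongrightarrow> k t) (at_right 0)"
  proof (rule tendstoI)
    fix e :: real assume e: "e > 0"
    have "isCont k t" using assms by (simp add: continuous_on_eq_continuous_at)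
    then obtain d where d: "d > 0" "\<And>s. \<bar>s - t\<bar> < d \<Longrightarrow> \<bar>k s - k t\<bar> < e / 2"
      using e unfolding continuous_at_eps_delta dist_real_def by (metis half_gt_zero)
    define m where "m = min d t"
    have "m > 0" using d assms by (simp add: m_def)
    have main: "dist ((LINT s:{t-h..t+h}|lebesgue. k s) / (2 * h)) (k t) < e"
      if h: "0 < h" "h < m" for h
    proof -
      let ?I = "{t-h..t+h}"
      have cont: "continuous_on ?I k"
        using h assms by (intro continuous_on_subset[OF assms(1)]) (auto simp: m_def)
      have "continuous_on ?I (\<lambda>s. k s - k t)" using cont by (intro continuous_intros)
      have int: "set_integrable lebesgue ?I f" if "continuous_on ?I f" for f :: "real \<Rightarrow> real"
        using borel_integrable_compact[OF compact_Icc that]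
        unfolding set_integrable_def
        by (subst integrable_completion) auto
      have "(LINT s:?I|lebesgue. k s - k t) = (LINT s:?I|lebesgue. k s) - (LINT s:?I|lebesgue. k t)"
        by (intro set_integral_diff int cont continuous_intros)
      also have "(LINT s:?I|lebesgue. k t) = 2 * h * k t"
        using h by (subst set_integral_const) (auto simp: measure_def)
      finally have eq: "(LINT s:?I|lebesgue. k s) - 2 * h * k t = (LINT s:?I|lebesgue. k s - k t)"
        by simp
      have "\<bar>LINT s:?I|lebesgue. k s - k t\<bar> \<le> (LINT s:?I|lebesgue. \<bar>k s - k t\<bar>)"
        using set_integral_norm_bound[OF int[OF \<open>continuous_on ?I (\<lambda>s. k s - k t)\<close>]] by simp
      also have "\<dots> \<le> (LINT s:?I|lebesgue. e / 2)"
        using cont d(2) h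
        by (intro set_integral_mono int continuous_intros) (force simp: m_def intro!: less_imp_le)+
      also have "\<dots> = h * e"
        using h by (subst set_integral_const) (auto simp: measure_def)
      finally have "\<bar>(LINT s:?I|lebesgue. k s) - 2 * h * k t\<bar> \<le> h * e" using eq by simp
      moreover have "(LINT s:?I|lebesgue. k s) / (2 * h) - k t
          = ((LINT s:?I|lebesgue. k s) - 2 * h * k t) / (2 * h)"
        using h by (simp add: field_simps)
      ultimately have "\<bar>(LINT s:?I|lebesgue. k s) / (2 * h) - k t\<bar> \<le> h * e / (2 * h)"
        using h by (simp add: abs_divide field_simps)
      also have "\<dots> < e" using h e by simp
      finally show ?thesis by (simp add: dist_real_def)
    qed
    show "\<forall>\<^sub>F h in at_right 0. dist ((LINT s:{t-h..t+h}|lebesgue. k s) / (2 * h)) (k t) < e"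
      unfolding eventually_at_right_field using \<open>m > 0\<close> main by blast
  qed
  then show ?thesis unfolding lebesgue_value_def by (intro tendsto_Lim) auto
qed

definition conv :: "(real \<Rightarrow> real) \<Rightarrow> (real \<Rightarrow> complex) \<Rightarrow> real \<Rightarrow> complex" where
  "conv k v t = (LINT \<tau>:{0<..<t}|lebesgue. k (t - \<tau>) *\<^sub>R v \<tau>)"

definition caputo_exists :: "(real \<Rightarrow> real) \<Rightarrow> (real \<Rightarrow> complex) \<Rightarrow> real \<Rightarrow> bool" where
  "caputo_exists k v t \<longleftrightarrow> conv k v differentiable (at t)"

definition caputo :: "(real \<Rightarrow> real) \<Rightarrow> (real \<Rightarrow> complex) \<Rightarrow> real \<Rightarrow> complex" where
  "caputo k v t = vector_derivative (conv k v) (at t) - lebesgue_value k t *\<^sub>R v 0"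

section \<open>Solutions and their time derivatives, via the spatial Fourier transform\<close>

text \<open>A representative of the transform of \<open>u\<close> that is continuous in time for almost every
  \<open>\<xi>\<close>. Two such representatives agree at all times \<open>t \<ge> 0\<close>, for almost every \<open>\<xi>\<close>.\<close>

definition fourier_rep ::
  "(real \<Rightarrow> real ^ 'n \<Rightarrow> complex) \<Rightarrow> (real \<Rightarrow> real ^ 'n \<Rightarrow> complex) \<Rightarrow> bool" where
  "fourier_rep u U \<longleftrightarrow> (\<forall>t\<ge>0. has_fourier (u t) (U t)) \<and>
     (AE \<xi> in lebesgue. continuous_on {0..} (\<lambda>t. U t \<xi>))"

definition solves_cauchy ::
  "(real \<Rightarrow> real) \<Rightarrow> (real ^ 'n \<Rightarrow> complex) \<Rightarrow> (real \<Rightarrow> real ^ 'n \<Rightarrow> complex) \<Rightarrow> bool" where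
  "solves_cauchy k u0 u \<longleftrightarrow> (\<exists>U. fourier_rep u U \<and>
     (AE \<xi> in lebesgue. U 0 \<xi> = fourier u0 \<xi> \<and>
        (\<forall>t>0. caputo_exists k (\<lambda>s. U s \<xi>) t \<and>
               caputo k (\<lambda>s. U s \<xi>) t = - complex_of_real ((norm \<xi>)\<^sup>2) * U t \<xi>)))"

definition has_caputo ::
  "(real \<Rightarrow> real) \<Rightarrow> (real \<Rightarrow> real ^ 'n \<Rightarrow> complex) \<Rightarrow> real \<Rightarrow> (real ^ 'n \<Rightarrow> complex) \<Rightarrow> bool" where
  "has_caputo k u t w \<longleftrightarrow> (\<exists>U. fourier_rep u U \<and>
     (AE \<xi> in lebesgue. caputo_exists k (\<lambda>s. U s \<xi>) t) \<and>
     has_fourier w (\<lambda>\<xi>. caputo k (\<lambda>s. U s \<xi>) t))"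

definition nth_deriv :: "nat \<Rightarrow> (real \<Rightarrow> complex) \<Rightarrow> real \<Rightarrow> complex" where
  "nth_deriv j f = ((\<lambda>g t. vector_derivative g (at t)) ^^ j) f"

definition has_time_deriv ::
  "nat \<Rightarrow> (real \<Rightarrow> real ^ 'n \<Rightarrow> complex) \<Rightarrow> real \<Rightarrow> (real ^ 'n \<Rightarrow> complex) \<Rightarrow> bool" where
  "has_time_deriv j u t w \<longleftrightarrow> (\<exists>U. fourier_rep u U \<and>
     (AE \<xi> in lebesgue. \<forall>i<j. \<forall>s>0. nth_deriv i (\<lambda>r. U r \<xi>) differentiable (at s)) \<and>
     has_fourier w (\<lambda>\<xi>. nth_deriv j (\<lambda>r. U r \<xi>) t))"

end

theory Submission
  imports Defs "HOL-Probability.Probability" "HOL-Real_Asymp.Real_Asymp" "HOL-Computational_Algebra.Polynomial"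
begin

text \<open>The Fourier transform in space decouples the problem: the transform of the solution at \<open>\<xi>\<close> is
  \<open>E(|\<xi>|\<^sup>2, t)\<close> times that of \<open>u\<^sub>0\<close>, where \<open>E(l, \<cdot>)\<close> solves \<open>k * E + l (1 * E) = 1 * k\<close>. Its Laplace
  transform is \<open>G(s) / (l + s G(s))\<close> with \<open>G\<close> the transform of \<open>k\<close>. If \<open>\<sigma>\<close> is discrete, this is a rational
  function with positive residues whose poles interlace those of \<open>G\<close>, hence the Stieltjes transform of a
  probability measure; by Helly's selection theorem the same holds for every admissible \<open>k\<close>. So \<open>E(l, \<cdot>)\<close> is the
  Laplace transform of a probability measure, whence \<open>0 \<le> E \<le> 1\<close> and the bounds \<open>(j / (e t))\<^sup>j\<close> for its
  derivatives. As \<open>E\<close> is nonincreasing in time, its equation gives \<open>E(l, t) \<le> 1 / (1 + l t / \<parallel>k\<parallel>)\<close> with the norm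
  of \<open>L\<^sup>1(0, t)\<close>, and the supremum bound follows by Cauchy--Schwarz, \<open>1 / (1 + |\<xi>|\<^sup>2)\<close> being square
  integrable for \<open>n \<le> 3\<close>.

  Positivity: with \<open>l = |\<xi>|\<^sup>2\<close>, the resolvents \<open>1 / (l + a)\<close> are mixtures of the heat multipliers \<open>exp (- l \<tau>)\<close>
  and so preserve nonnegativity, and by the Post--Widder formula \<open>E\<close> is a limit of elements of the cone of
  multipliers they generate.

  Uniqueness: if \<open>W\<close> is the difference of two solutions at a fixed \<open>\<xi> \<noteq> 0\<close>, then convolving
  \<open>k * W = - l (1 * W)\<close> with \<open>E\<close> and using the equation of \<open>E\<close> leaves \<open>1 * k * W = 0\<close>, thus \<open>1 * 1 * W = 0\<close>.\<close>

section \<open>Square integrable functions\<close>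

text \<open>Three obstacles shape the proof. (1) The residue argument covers finitely many poles
  only, and in the limit the probability measures could lose mass at infinity; (C3), in the form s
  G(s) -> \<infinity>, makes s G(s) / (l + s G(s)) tend to 1 and so gives tightness. (2) The
  representing measure is chosen separately for every l, so nothing is known a priori about the
  dependence of E on l = |\<xi>|^2. Measurability in \<xi>, without which E could not act as a
  multiplier, is recovered from the Post-Widder formula, whose terms are rational in l. (3) A
  competing solution at a fixed frequency is merely continuous in time, with no growth bound, so its
  Laplace transform need not exist; hence uniqueness works with convolutions on bounded intervals.
  The kernel, given up to null sets, is replaced by the continuous mixture of exponentials with the
  same Laplace transform, and its pointwise equations are proved in integrated form and then
  differentiated.\<close>

definition sq_int :: "'a measure \<Rightarrow> ('a \<Rightarrow> complex) \<Rightarrow> bool" where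
  "sq_int M f \<longleftrightarrow> f \<in> borel_measurable M \<and> integrable M (\<lambda>x. (norm (f x))\<^sup>2)"

text \<open>The measure is a parameter because the analysis is done with Borel functions under
  \<open>lborel\<close>, while the spaces of the problem refer to \<open>lebesgue\<close>.\<close>

definition l2_norm :: "'a measure \<Rightarrow> ('a \<Rightarrow> complex) \<Rightarrow> real" where
  "l2_norm M f = sqrt (LINT x|M. (norm (f x))\<^sup>2)"

lemma l2_norm_nonneg [simp]: "l2_norm M f \<ge> 0"
  by (simp add: l2_norm_def)

lemma l2_norm_square: "(l2_norm M f)\<^sup>2 = (LINT x|M. (norm (f x))\<^sup>2)"
  by (simp add: l2_norm_def)

lemma nn_integral_l2_norm:
  assumes "sq_int M f"
  shows "(\<integral>\<^sup>+x. ennreal ((norm (f x))\<^sup>2) \<partial>M) = ennreal ((l2_norm M f)\<^sup>2)"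
  unfolding l2_norm_square using assms by (intro nn_integral_eq_integral) (auto simp: sq_int_def)

lemma sq_int_bound:
  assumes "sq_int M f" "g \<in> borel_measurable M" "AE x in M. norm (g x) \<le> C * norm (f x)"
  shows "sq_int M g"
  unfolding sq_int_def
proof (intro conjI)
  show "integrable M (\<lambda>x. (norm (g x))\<^sup>2)"
  proof (rule Bochner_Integration.integrable_bound)
    show "integrable M (\<lambda>x. C\<^sup>2 * (norm (f x))\<^sup>2)" using assms(1) by (auto simp: sq_int_def)
    show "AE x in M. norm ((norm (g x))\<^sup>2) \<le> norm (C\<^sup>2 * (norm (f x))\<^sup>2)"
      using assms(3)
    proof eventually_elim
      case (elim x)
      have "(norm (g x))\<^sup>2 \<le> (C * norm (f x))\<^sup>2" using elim by (intro power_mono) auto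
      then show ?case by (simp add: power_mult_distrib)
    qed
  qed (use assms(2) in auto)
qed fact

lemma l2_norm_bound:
  assumes f: "sq_int M f" and g: "g \<in> borel_measurable M" and le: "AE x in M. norm (g x) \<le> C * norm (f x)"
    and C: "C \<ge> 0"
  shows "l2_norm M g \<le> C * l2_norm M f"
proof -
  have "(LINT x|M. (norm (g x))\<^sup>2) \<le> (LINT x|M. C\<^sup>2 * (norm (f x))\<^sup>2)"
  proof (rule integral_mono_AE)
    show "integrable M (\<lambda>x. (norm (g x))\<^sup>2)" using sq_int_bound[OF f g le] by (simp add: sq_int_def)
    show "integrable M (\<lambda>x. C\<^sup>2 * (norm (f x))\<^sup>2)" using f by (auto simp: sq_int_def)
    show "AE x in M. (norm (g x))\<^sup>2 \<le> C\<^sup>2 * (norm (f x))\<^sup>2"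
      using le by eventually_elim (metis norm_ge_zero power_mono power_mult_distrib)
  qed
  then have "sqrt (LINT x|M. (norm (g x))\<^sup>2) \<le> sqrt (C\<^sup>2 * (LINT x|M. (norm (f x))\<^sup>2))"
    by (intro real_sqrt_le_mono) simp
  then show ?thesis using C by (simp add: l2_norm_def real_sqrt_mult)
qed

lemma l2_norm_cong_AE:
  assumes "f \<in> borel_measurable M" "g \<in> borel_measurable M" "AE x in M. f x = g x"
  shows "l2_norm M f = l2_norm M g"
  unfolding l2_norm_def using assms by (intro arg_cong[of _ _ sqrt] integral_cong_AE) auto

lemma sq_int_add:
  assumes "sq_int M f" "sq_int M g"
  shows "sq_int M (\<lambda>x. f x + g x)"
  unfolding sq_int_def
proof (intro conjI)
  have [measurable]: "f \<in> borel_measurable M" "g \<in> borel_measurable M" using assms by (auto simp: sq_int_def)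
  show "(\<lambda>x. f x + g x) \<in> borel_measurable M" by measurable
  show "integrable M (\<lambda>x. (norm (f x + g x))\<^sup>2)"
  proof (rule Bochner_Integration.integrable_bound)
    show "integrable M (\<lambda>x. 2 * (norm (f x))\<^sup>2 + 2 * (norm (g x))\<^sup>2)"
      using assms by (auto simp: sq_int_def)
    show "AE x in M. norm ((norm (f x + g x))\<^sup>2) \<le> norm (2 * (norm (f x))\<^sup>2 + 2 * (norm (g x))\<^sup>2)"
    proof (rule AE_I2)
      fix x
      have "(norm (f x + g x))\<^sup>2 \<le> (norm (f x) + norm (g x))\<^sup>2"
        by (intro power_mono norm_triangle_ineq) auto
      also have "\<dots> \<le> 2 * (norm (f x))\<^sup>2 + 2 * (norm (g x))\<^sup>2"
        using sum_squares_bound[of "norm (f x)" "norm (g x)"] by (simp add: power2_sum)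
      finally show "norm ((norm (f x + g x))\<^sup>2) \<le> norm (2 * (norm (f x))\<^sup>2 + 2 * (norm (g x))\<^sup>2)" by simp
    qed
  qed measurable
qed

lemma sq_int_cmult:
  assumes "sq_int M f" shows "sq_int M (\<lambda>x. c * f x)"
  by (rule sq_int_bound[OF assms, where C = "norm c"]) (use assms in \<open>auto simp: sq_int_def norm_mult\<close>)

lemma sq_int_diff:
  assumes "sq_int M f" "sq_int M g"
  shows "sq_int M (\<lambda>x. f x - g x)"
  using sq_int_add[OF assms(1) sq_int_cmult[OF assms(2), of "-1"]] by simp

lemma borel_measurable_cnj [measurable (raw)]:
  "f \<in> borel_measurable M \<Longrightarrow> (\<lambda>x. cnj (f x)) \<in> borel_measurable M"
  by (rule measurable_compose[where N = borel])
    (auto intro!: borel_measurable_continuous_onI continuous_on_cnj continuous_on_id)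

lemma sq_int_cnj:
  assumes "sq_int M f" shows "sq_int M (\<lambda>x. cnj (f x))"
  by (rule sq_int_bound[OF assms, where C = 1]) (use assms in \<open>auto simp: sq_int_def\<close>)

lemma sq_int_zero: "sq_int M (\<lambda>x. 0)"
  by (simp add: sq_int_def)

lemma l2_norm_cmult: "l2_norm M (\<lambda>x. c * f x) = norm c * l2_norm M f"
  by (simp add: l2_norm_def norm_mult power_mult_distrib real_sqrt_mult)

lemma l2_norm_minus_commute: "l2_norm M (\<lambda>x. f x - g x) = l2_norm M (\<lambda>x. g x - f x)"
  by (simp add: l2_norm_def norm_minus_commute)

lemma l2_norm_eq_0_imp_AE:
  assumes "sq_int M f" "l2_norm M f = 0"
  shows "AE x in M. f x = 0"
proof -
  have "(LINT x|M. (norm (f x))\<^sup>2) = 0" using assms(2) by (simp add: l2_norm_def)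
  then have "AE x in M. (norm (f x))\<^sup>2 = 0"
    using assms(1) by (subst (asm) integral_nonneg_eq_0_iff_AE) (auto simp: sq_int_def)
  then show ?thesis by eventually_elim auto
qed

lemma ennreal_power2_le_imp_le:
  fixes x :: ennreal
  assumes "x\<^sup>2 \<le> (ennreal y)\<^sup>2" "y \<ge> 0"
  shows "x \<le> ennreal y"
proof (cases x)
  case (real r)
  then have "r\<^sup>2 \<le> y\<^sup>2" using assms by (simp add: ennreal_power)
  then show ?thesis using real assms(2) by (auto intro!: ennreal_leI power2_le_imp_le)
next
  case top
  then show ?thesis using assms by (simp add: ennreal_power top_unique)
qed

text \<open>Proved for extended integrals first, so that it also delivers the integrability of the
  product.\<close>

lemma l2_Cauchy_Schwarz_nn:
  assumes f: "sq_int M f" and g: "sq_int M g"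
  shows "(\<integral>\<^sup>+x. ennreal (norm (f x * g x)) \<partial>M) \<le> ennreal (l2_norm M f * l2_norm M g)"
proof -
  have [measurable]: "f \<in> borel_measurable M" "g \<in> borel_measurable M" using assms by (auto simp: sq_int_def)
  have "(\<integral>\<^sup>+x. ennreal (norm (f x)) * ennreal (norm (g x)) \<partial>M)\<^sup>2 \<le>
     (\<integral>\<^sup>+x. ennreal (norm (f x)) ^ 2 \<partial>M) * (\<integral>\<^sup>+x. ennreal (norm (g x)) ^ 2 \<partial>M)"
    by (intro Cauchy_Schwarz_nn_integral) measurable
  also have "\<dots> = ennreal ((l2_norm M f)\<^sup>2) * ennreal ((l2_norm M g)\<^sup>2)"
    by (simp add: ennreal_power nn_integral_l2_norm[OF f] nn_integral_l2_norm[OF g])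
  also have "\<dots> = (ennreal (l2_norm M f * l2_norm M g))\<^sup>2"
    by (simp add: ennreal_power power_mult_distrib flip: ennreal_mult)
  finally have "(\<integral>\<^sup>+x. ennreal (norm (f x)) * ennreal (norm (g x)) \<partial>M) \<le> ennreal (l2_norm M f * l2_norm M g)"
    by (rule ennreal_power2_le_imp_le) simp
  then show ?thesis by (simp add: norm_mult ennreal_mult)
qed

lemma l2_mult_integrable:
  assumes f: "sq_int M f" and g: "sq_int M g"
  shows "integrable M (\<lambda>x. f x * g x)"
proof (rule integrableI_bounded)
  show "(\<integral>\<^sup>+x. ennreal (norm (f x * g x)) \<partial>M) < \<infinity>"
    using l2_Cauchy_Schwarz_nn[OF assms] by (rule le_less_trans) simp
qed (use assms in \<open>auto simp: sq_int_def\<close>)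

lemma l2_Cauchy_Schwarz_norm:
  assumes f: "sq_int M f" and g: "sq_int M g"
  shows "(LINT x|M. norm (f x * g x)) \<le> l2_norm M f * l2_norm M g"
proof -
  have "ennreal (LINT x|M. norm (f x * g x)) = (\<integral>\<^sup>+x. ennreal (norm (f x * g x)) \<partial>M)"
    by (rule nn_integral_eq_integral[symmetric]) (use l2_mult_integrable[OF assms] in auto)
  with l2_Cauchy_Schwarz_nn[OF assms]
  have "ennreal (LINT x|M. norm (f x * g x)) \<le> ennreal (l2_norm M f * l2_norm M g)" by simp
  then show ?thesis by (subst (asm) ennreal_le_iff) auto
qed

lemma l2_Cauchy_Schwarz:
  assumes f: "sq_int M f" and g: "sq_int M g"
  shows "norm (LINT x|M. f x * g x) \<le> l2_norm M f * l2_norm M g"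
  using integral_norm_bound[of M "\<lambda>x. f x * g x"] l2_Cauchy_Schwarz_norm[OF assms] by linarith

lemma l2_norm_triangle:
  assumes f: "sq_int M f" and g: "sq_int M g"
  shows "l2_norm M (\<lambda>x. f x + g x) \<le> l2_norm M f + l2_norm M g"
proof -
  have "(l2_norm M (\<lambda>x. f x + g x))\<^sup>2 \<le> (LINT x|M. (norm (f x))\<^sup>2 + 2 * norm (f x * g x) + (norm (g x))\<^sup>2)"
    unfolding l2_norm_square
  proof (rule integral_mono)
    fix x
    have "(norm (f x + g x))\<^sup>2 \<le> (norm (f x) + norm (g x))\<^sup>2"
      by (intro power_mono norm_triangle_ineq) auto
    then show "(norm (f x + g x))\<^sup>2 \<le> (norm (f x))\<^sup>2 + 2 * norm (f x * g x) + (norm (g x))\<^sup>2"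
      by (simp add: power2_sum norm_mult algebra_simps)
  qed (use sq_int_add[OF assms] l2_mult_integrable[OF assms] assms in \<open>auto simp: sq_int_def\<close>)
  also have "\<dots> = (l2_norm M f)\<^sup>2 + 2 * (LINT x|M. norm (f x * g x)) + (l2_norm M g)\<^sup>2"
    using l2_mult_integrable[OF assms] assms
    by (simp add: l2_norm_square sq_int_def)
  also have "\<dots> \<le> (l2_norm M f)\<^sup>2 + 2 * (l2_norm M f * l2_norm M g) + (l2_norm M g)\<^sup>2"
    using l2_Cauchy_Schwarz_norm[OF assms] by simp
  also have "\<dots> = (l2_norm M f + l2_norm M g)\<^sup>2" by (simp add: power2_sum)
  finally show ?thesis by (rule power2_le_imp_le) simp
qed

lemma l2_norm_triangle_diff:
  assumes f: "sq_int M f" and g: "sq_int M g" and h: "sq_int M h"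
  shows "l2_norm M (\<lambda>x. f x - h x) \<le> l2_norm M (\<lambda>x. f x - g x) + l2_norm M (\<lambda>x. g x - h x)"
  using l2_norm_triangle[OF sq_int_diff[OF f g] sq_int_diff[OF g h]] by simp

lemma l2_norm_diff_abs_le:
  assumes f: "sq_int M f" and g: "sq_int M g"
  shows "\<bar>l2_norm M f - l2_norm M g\<bar> \<le> l2_norm M (\<lambda>x. f x - g x)"
  using l2_norm_triangle_diff[OF f g sq_int_zero] l2_norm_triangle_diff[OF g f sq_int_zero]
  by (simp add: l2_norm_minus_commute[of M g f])

lemma l2_norm_tendsto:
  assumes "\<And>n. sq_int M (f n)" "sq_int M g" "((\<lambda>n. l2_norm M (\<lambda>x. f n x - g x)) \<longlongrightarrow> 0) F"
  shows "((\<lambda>n. l2_norm M (f n)) \<longlongrightarrow> l2_norm M g) F"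
  by (rule Lim_null_comparison[THEN LIM_zero_cancel, OF _ assms(3)])
    (auto intro!: always_eventually l2_norm_diff_abs_le assms)

text \<open>Norm convergence implies weak convergence. The pairing is bilinear, without conjugation,
  since that is the form in which the Fourier transform is symmetric.\<close>

lemma l2_mult_tendsto:
  assumes "\<And>n. sq_int M (f n)" "sq_int M g" "sq_int M h" "((\<lambda>n. l2_norm M (\<lambda>x. f n x - g x)) \<longlongrightarrow> 0) F"
  shows "((\<lambda>n. LINT x|M. f n x * h x) \<longlongrightarrow> (LINT x|M. g x * h x)) F"
proof (rule LIM_zero_cancel, rule Lim_null_comparison)
  show "((\<lambda>n. l2_norm M (\<lambda>x. f n x - g x) * l2_norm M h) \<longlongrightarrow> 0) F"
    using tendsto_mult_right[OF assms(4), of "l2_norm M h"] by simp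
  have "norm ((LINT x|M. f n x * h x) - (LINT x|M. g x * h x)) \<le> l2_norm M (\<lambda>x. f n x - g x) * l2_norm M h" for n
  proof -
    have "(LINT x|M. f n x * h x) - (LINT x|M. g x * h x) = (LINT x|M. (f n x - g x) * h x)"
      by (subst Bochner_Integration.integral_diff[symmetric])
        (auto simp: algebra_simps intro!: l2_mult_integrable assms)
    then show ?thesis using l2_Cauchy_Schwarz[OF sq_int_diff[OF assms(1)[of n] assms(2)] assms(3)] by simp
  qed
  then show "\<forall>\<^sub>F n in F. norm ((LINT x|M. f n x * h x) - (LINT x|M. g x * h x)) \<le> l2_norm M (\<lambda>x. f n x - g x) * l2_norm M h"
    by simp
qed

lemma l2_dominated_convergence:
  assumes f: "\<And>n::nat. f n \<in> borel_measurable M" and g: "g \<in> borel_measurable M" and h: "sq_int M h"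
    and lim: "AE x in M. (\<lambda>n. f n x) \<longlonglongrightarrow> g x"
    and bd: "\<And>n. AE x in M. norm (f n x) \<le> C * norm (h x)"
  shows "(\<lambda>n. l2_norm M (\<lambda>x. f n x - g x)) \<longlonglongrightarrow> 0"
proof -
  have bdg: "AE x in M. norm (g x) \<le> C * norm (h x)"
  proof -
    have "AE x in M. \<forall>n. norm (f n x) \<le> C * norm (h x)" using bd by (subst AE_all_countable) auto
    with lim show ?thesis
      by eventually_elim (auto intro!: LIMSEQ_le_const2[OF tendsto_norm])
  qed
  have "(\<lambda>n. LINT x|M. (norm (f n x - g x))\<^sup>2) \<longlonglongrightarrow> (LINT x|M. 0)"
  proof (rule integral_dominated_convergence)
    show "integrable M (\<lambda>x. 4 * C\<^sup>2 * (norm (h x))\<^sup>2)" using h by (auto simp: sq_int_def)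
    show "AE x in M. (\<lambda>n. (norm (f n x - g x))\<^sup>2) \<longlonglongrightarrow> 0"
      using lim
    proof eventually_elim
      case (elim x)
      have "(\<lambda>n. (norm (f n x - g x))\<^sup>2) \<longlonglongrightarrow> (norm (g x - g x))\<^sup>2" by (intro tendsto_intros elim)
      then show ?case by simp
    qed
    show "AE x in M. norm ((norm (f n x - g x))\<^sup>2) \<le> 4 * C\<^sup>2 * (norm (h x))\<^sup>2" for n
      using bdg bd[of n]
    proof eventually_elim
      case (elim x)
      have "norm (f n x - g x) \<le> 2 * (C * norm (h x))"
        using norm_triangle_ineq4[of "f n x" "g x"] elim by linarith
      then have "(norm (f n x - g x))\<^sup>2 \<le> (2 * (C * norm (h x)))\<^sup>2" by (intro power_mono) auto
      then show ?case by (simp add: power_mult_distrib)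
    qed
  qed (use f g in auto)
  then have "(\<lambda>n. sqrt (LINT x|M. (norm (f n x - g x))\<^sup>2)) \<longlonglongrightarrow> sqrt 0"
    by (intro tendsto_real_sqrt) simp
  then show ?thesis by (simp add: l2_norm_def)
qed

text \<open>Along indices whose increments \<open>d k\<close> have norm at most
  \<open>(1/2) ^ k\<close>, the series of \<open>2 ^ k * (norm (d k x))\<^sup>2\<close> has finite
  integral. Where it converges, \<open>d k x\<close> is bounded by a geometric sequence of ratio
  \<open>sqrt (1/2)\<close>, so the subsequence converges pointwise. Fatou's lemma then turns the
  Cauchy property into norm convergence of the whole sequence.\<close>

lemma l2_complete:
  assumes f: "\<And>n::nat. sq_int M (f n)"
    and cauchy: "\<And>e. e > 0 \<Longrightarrow> \<exists>N. \<forall>m\<ge>N. \<forall>n\<ge>N. l2_norm M (\<lambda>x. f m x - f n x) < e"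
  shows "\<exists>g. sq_int M g \<and> (\<lambda>n. l2_norm M (\<lambda>x. f n x - g x)) \<longlonglongrightarrow> 0"
proof -
  have fm [measurable]: "f n \<in> borel_measurable M" for n using f by (auto simp: sq_int_def)
  have "\<forall>k. \<exists>N. \<forall>m\<ge>N. \<forall>n\<ge>N. l2_norm M (\<lambda>x. f m x - f n x) < (1/2) ^ k"
    using cauchy by simp
  then obtain N where N: "\<And>k m n. m \<ge> N k \<Longrightarrow> n \<ge> N k \<Longrightarrow> l2_norm M (\<lambda>x. f m x - f n x) < (1/2) ^ k"
    by metis
  \<comment> \<open>Partial sums of the thresholds: \<open>r j\<close> is past \<open>N k\<close>
    for every \<open>k \<le> j\<close>, which both the increments and the Fatou argument
    use.\<close>
  define r where "r k = (\<Sum>i\<le>k. N i)" for k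
  have rN: "r j \<ge> N k" if "j \<ge> k" for j k
    unfolding r_def using that by (intro member_le_sum) auto
  define d where "d k x = f (r (Suc k)) x - f (r k) x" for k x
  have d [measurable]: "d k \<in> borel_measurable M" for k unfolding d_def by measurable
  have dsq: "sq_int M (d k)" for k unfolding d_def by (intro sq_int_diff f)
  have dn: "l2_norm M (d k) \<le> (1/2) ^ k" for k
    unfolding d_def using N[OF rN[of k "Suc k"] rN[of k k]] by simp
  have "(\<integral>\<^sup>+x. (\<Sum>k. ennreal (2 ^ k * (norm (d k x))\<^sup>2)) \<partial>M) = (\<Sum>k. \<integral>\<^sup>+x. ennreal (2 ^ k * (norm (d k x))\<^sup>2) \<partial>M)"
    by (rule nn_integral_suminf) measurable
  also have "\<dots> = (\<Sum>k. ennreal (2 ^ k * (l2_norm M (d k))\<^sup>2))"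
    by (intro suminf_cong) (simp add: ennreal_mult nn_integral_cmult nn_integral_l2_norm[OF dsq])
  also have "\<dots> \<le> (\<Sum>k. ennreal ((1/2) ^ k))"
  proof (rule suminf_le)
    fix k
    have "(2::real) ^ k * (l2_norm M (d k))\<^sup>2 \<le> 2 ^ k * ((1/2) ^ k)\<^sup>2"
      by (intro mult_left_mono power_mono dn) auto
    also have "\<dots> = (1/2) ^ k" by (simp add: power2_eq_square field_simps flip: power_mult_distrib)
    finally show "ennreal (2 ^ k * (l2_norm M (d k))\<^sup>2) \<le> ennreal ((1/2) ^ k)" by (rule ennreal_leI)
  qed auto
  also have "\<dots> = ennreal (\<Sum>k. (1/2) ^ k)"
    by (intro suminf_ennreal2 summable_geometric) auto
  also have "\<dots> < \<infinity>" by simp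
  finally have "AE x in M. (\<Sum>k. ennreal (2 ^ k * (norm (d k x))\<^sup>2)) \<noteq> \<infinity>"
    by (intro nn_integral_PInf_AE) auto
  then have conv: "AE x in M. convergent (\<lambda>k. f (r k) x)"
  proof eventually_elim
    case (elim x)
    define B where "B = enn2real (\<Sum>k. ennreal (2 ^ k * (norm (d k x))\<^sup>2))"
    have B: "2 ^ k * (norm (d k x))\<^sup>2 \<le> B" for k
    proof -
      define D where "D = (\<lambda>k. ennreal (2 ^ k * (norm (d k x))\<^sup>2))"
      have "sum D {k} \<le> suminf D" by (rule sum_le_suminf) auto
      then have "D k \<le> suminf D" by simp
      moreover have "suminf D < top" using elim unfolding D_def by (simp add: less_top)
      ultimately have "enn2real (D k) \<le> enn2real (suminf D)" by (rule enn2real_mono)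
      moreover have "enn2real (D k) = 2 ^ k * (norm (d k x))\<^sup>2" unfolding D_def by simp
      moreover have "B = enn2real (suminf D)" unfolding B_def D_def by (rule refl)
      ultimately show ?thesis by linarith
    qed
    have "summable (\<lambda>k. d k x)"
    proof (rule summable_norm_cancel, rule summable_comparison_test')
      show "summable (\<lambda>k. sqrt B * (sqrt (1/2)) ^ k)"
        by (intro summable_mult summable_geometric) (simp add: real_sqrt_less_iff)
      fix k
      have "(norm (d k x))\<^sup>2 \<le> B * (1/2) ^ k" using B[of k] by (simp add: field_simps)
      then have "sqrt ((norm (d k x))\<^sup>2) \<le> sqrt (B * (1/2) ^ k)" by (rule real_sqrt_le_mono)
      then show "norm (norm (d k x)) \<le> sqrt B * (sqrt (1/2)) ^ k"
        by (simp add: real_sqrt_mult real_sqrt_power)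
    qed
    then have "convergent (\<lambda>n. \<Sum>k<n. d k x)" by (simp add: summable_iff_convergent)
    moreover have "(\<Sum>k<n. d k x) = f (r n) x - f (r 0) x" for n
      unfolding d_def by (rule sum_lessThan_telescope)
    ultimately have "convergent (\<lambda>n. f (r n) x - f (r 0) x)" by simp
    then show ?case using convergent_add_const_right_iff[of "\<lambda>n. f (r n) x" "- f (r 0) x"] by simp
  qed
  define g where "g x = lim (\<lambda>k. f (r k) x)" for x
  have g [measurable]: "g \<in> borel_measurable M" unfolding g_def by measurable
  have lim: "AE x in M. (\<lambda>k. f (r k) x) \<longlonglongrightarrow> g x"
    using conv unfolding g_def by eventually_elim (simp add: convergent_LIMSEQ_iff)
  have fatou: "(\<integral>\<^sup>+x. ennreal ((norm (f n x - g x))\<^sup>2) \<partial>M) \<le> ennreal (((1/2) ^ k)\<^sup>2)" if n: "n \<ge> N k" for n k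
  proof -
    have "(\<integral>\<^sup>+x. ennreal ((norm (f n x - g x))\<^sup>2) \<partial>M)
        = (\<integral>\<^sup>+x. liminf (\<lambda>j. ennreal ((norm (f n x - f (r j) x))\<^sup>2)) \<partial>M)"
    proof (rule nn_integral_cong_AE)
      show "AE x in M. ennreal ((norm (f n x - g x))\<^sup>2) = liminf (\<lambda>j. ennreal ((norm (f n x - f (r j) x))\<^sup>2))"
        using lim
      proof eventually_elim
        case (elim x)
        have "(\<lambda>j. ennreal ((norm (f n x - f (r j) x))\<^sup>2)) \<longlonglongrightarrow> ennreal ((norm (f n x - g x))\<^sup>2)"
          by (intro tendsto_ennrealI tendsto_intros elim)
        then show ?case by (intro lim_imp_Liminf[symmetric]) auto
      qed
    qed
    also have "\<dots> \<le> liminf (\<lambda>j. \<integral>\<^sup>+x. ennreal ((norm (f n x - f (r j) x))\<^sup>2) \<partial>M)"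
      by (rule nn_integral_liminf) measurable
    also have "\<dots> \<le> ennreal (((1/2) ^ k)\<^sup>2)"
    proof (rule Liminf_le)
      show "\<forall>\<^sub>F j in sequentially. (\<integral>\<^sup>+x. ennreal ((norm (f n x - f (r j) x))\<^sup>2) \<partial>M) \<le> ennreal (((1/2) ^ k)\<^sup>2)"
        using eventually_ge_at_top[of k]
      proof eventually_elim
        case (elim j)
        show ?case unfolding nn_integral_l2_norm[OF sq_int_diff[OF f f]]
          by (intro ennreal_leI power_mono less_imp_le[OF N[OF n rN[OF elim]]]) simp
      qed
    qed auto
    finally show ?thesis .
  qed
  have diff: "sq_int M (\<lambda>x. f (N 0) x - g x)"
    unfolding sq_int_def
  proof (intro conjI integrableI_bounded)
    have "(\<integral>\<^sup>+x. ennreal (norm ((norm (f (N 0) x - g x))\<^sup>2)) \<partial>M) \<le> ennreal (((1/2) ^ 0)\<^sup>2)"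
      using fatou[of 0 "N 0"] by simp
    then show "(\<integral>\<^sup>+x. ennreal (norm ((norm (f (N 0) x - g x))\<^sup>2)) \<partial>M) < \<infinity>"
      by (rule le_less_trans) simp
  qed measurable
  have gsq: "sq_int M g"
    using sq_int_diff[OF f[of "N 0"] diff] by simp
  moreover have "(\<lambda>n. l2_norm M (\<lambda>x. f n x - g x)) \<longlonglongrightarrow> 0"
  proof (rule LIMSEQ_I)
    fix e :: real assume "e > 0"
    then obtain k where k: "(1/2) ^ k < e" using real_arch_pow_inv[of e "1/2"] by auto
    have "l2_norm M (\<lambda>x. f n x - g x) \<le> (1/2) ^ k" if "n \<ge> N k" for n
    proof -
      have "ennreal ((l2_norm M (\<lambda>x. f n x - g x))\<^sup>2) \<le> ennreal (((1/2) ^ k)\<^sup>2)"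
        using fatou[OF that] nn_integral_l2_norm[OF sq_int_diff[OF f gsq], of n] by simp
      then have "(l2_norm M (\<lambda>x. f n x - g x))\<^sup>2 \<le> ((1/2) ^ k)\<^sup>2" by (subst (asm) ennreal_le_iff) auto
      then show ?thesis by (rule power2_le_imp_le) simp
    qed
    with k show "\<exists>no. \<forall>n\<ge>no. norm (l2_norm M (\<lambda>x. f n x - g x) - 0) < e"
      by (intro exI[of _ "N k"]) force
  qed
  ultimately show ?thesis by blast
qed

text \<open>Truncation radii are real. The limit along the integers is a limit along the reals
  because of the Cauchy condition.\<close>

lemma l2_complete_at_top:
  fixes f :: "real \<Rightarrow> 'a \<Rightarrow> complex"
  assumes f: "\<And>R. sq_int M (f R)"
    and cauchy: "\<And>e. e > 0 \<Longrightarrow> \<exists>N. \<forall>m\<ge>N. \<forall>n\<ge>N. l2_norm M (\<lambda>x. f m x - f n x) < e"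
  shows "\<exists>g. sq_int M g \<and> ((\<lambda>R. l2_norm M (\<lambda>x. f R x - g x)) \<longlongrightarrow> 0) at_top"
proof -
  have "\<exists>g. sq_int M g \<and> (\<lambda>n. l2_norm M (\<lambda>x. f (real n) x - g x)) \<longlonglongrightarrow> 0"
  proof (rule l2_complete)
    fix e :: real assume "e > 0"
    then obtain N where "\<forall>m\<ge>N. \<forall>n\<ge>N. l2_norm M (\<lambda>x. f m x - f n x) < e" using cauchy by blast
    moreover obtain K :: nat where "real K \<ge> N" using real_arch_simple by blast
    ultimately show "\<exists>N. \<forall>m\<ge>N. \<forall>n\<ge>N. l2_norm M (\<lambda>x. f (real m) x - f (real n) x) < e"
      by (intro exI[of _ K]) force
  qed (rule f)
  then obtain g where g: "sq_int M g" "(\<lambda>n. l2_norm M (\<lambda>x. f (real n) x - g x)) \<longlonglongrightarrow> 0" by blast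
  have "((\<lambda>R. l2_norm M (\<lambda>x. f R x - g x)) \<longlongrightarrow> 0) at_top"
  proof (rule tendstoI)
    fix e :: real assume e: "e > 0"
    obtain N where N: "\<forall>m\<ge>N. \<forall>n\<ge>N. l2_norm M (\<lambda>x. f m x - f n x) < e / 2" using cauchy[of "e/2"] e by auto
    have "\<forall>\<^sub>F n in sequentially. l2_norm M (\<lambda>x. f (real n) x - g x) < e / 2"
      using order_tendstoD(2)[OF g(2), of "e/2"] e by simp
    moreover have "\<forall>\<^sub>F n in sequentially. real n \<ge> N"
      using filterlim_real_sequentially unfolding filterlim_at_top by blast
    ultimately have "\<forall>\<^sub>F n in sequentially. l2_norm M (\<lambda>x. f (real n) x - g x) < e / 2 \<and> real n \<ge> N"
      by (rule eventually_conj)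
    then obtain n where n: "l2_norm M (\<lambda>x. f (real n) x - g x) < e / 2" "real n \<ge> N"
      by (auto simp: eventually_at_top_linorder)
    have "l2_norm M (\<lambda>x. f R x - g x) < e" if "R \<ge> N" for R
    proof -
      have "l2_norm M (\<lambda>x. f R x - f (real n) x) < e / 2" using N n that by blast
      then show ?thesis using n l2_norm_triangle_diff[OF f[of R] f[of "real n"] g(1)] by linarith
    qed
    then show "\<forall>\<^sub>F R in at_top. dist (l2_norm M (\<lambda>x. f R x - g x)) 0 < e"
      by (auto simp: eventually_at_top_linorder dist_real_def)
  qed
  with g(1) show ?thesis by blast
qed

text \<open>The sets over which \<open>f\<close> integrates to 0 form a Dynkin system, hence contain
  everything generated; the sets where \<open>f\<close> is positive or negative then serve as test
  sets. Applied with boxes for Fourier inversion and with half-lines for the uniqueness of Laplace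
  transforms.\<close>

lemma AE_eq_0_generator:
  fixes f :: "'a \<Rightarrow> real"
  assumes f: "integrable M f" and G: "sets M = sigma_sets (space M) G" "Int_stable G" "G \<subseteq> Pow (space M)"
    and whole: "(LINT x|M. f x) = 0" and zero: "\<And>A. A \<in> G \<Longrightarrow> (LINT x|M. indicator A x * f x) = 0"
  shows "AE x in M. f x = 0"
proof -
  have all: "(LINT x|M. indicator A x * f x) = 0" if "A \<in> sets M" for A
  proof -
    have "A \<in> sigma_sets (space M) G" using that G by simp
    then show ?thesis
    proof (induction rule: sigma_sets_induct_disjoint[OF G(2,3), consumes 1, case_names basic empty compl union])
      case (basic A)
      then show ?case by (rule zero)
    next
      case empty
      then show ?case by simp
    next
      case (compl A)
      then have [measurable]: "A \<in> sets M" using G by simp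
      have "(LINT x|M. indicator (space M - A) x * f x) = (LINT x|M. f x - indicator A x * f x)"
        by (intro Bochner_Integration.integral_cong) (auto split: split_indicator)
      also have "\<dots> = 0"
        using compl f whole by (subst Bochner_Integration.integral_diff) (auto intro: integrable_real_mult_indicator simp: mult.commute)
      finally show ?case .
    next
      case (union A)
      then have A: "A i \<in> sets M" for i using G by auto
      have "(LINT x:(\<Union>i. A i)|M. f x) = (\<Sum>i. (LINT x:(A i)|M. f x))"
      proof (rule lebesgue_integral_countable_add)
        show "set_integrable M (\<Union>i. A i) f"
          unfolding set_integrable_def using f A by (intro integrable_mult_indicator) auto
      qed (use A union in \<open>auto simp: disjoint_family_on_def\<close>)
      then show ?case using union by (simp add: set_lebesgue_integral_def)
    qed
  qed
  have [measurable]: "f \<in> borel_measurable M" using f by auto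
  have pos: "AE x in M. indicator {x\<in>space M. s * f x > 0} x * (s * f x) = 0" if "s = 1 \<or> s = -1" for s :: real
  proof -
    have "(LINT x|M. indicator {x\<in>space M. s * f x > 0} x * (s * f x)) = s * (LINT x|M. indicator {x\<in>space M. s * f x > 0} x * f x)"
      by (subst integral_mult_right_zero[symmetric]) (simp add: ac_simps)
    also have "\<dots> = 0" by (subst all) auto
    finally show ?thesis
      using f by (subst (asm) integral_nonneg_eq_0_iff_AE)
        (auto split: split_indicator intro!: integrable_real_mult_indicator simp: mult.commute[of "indicator _ _"])
  qed
  have "AE x in M. indicator {x\<in>space M. 1 * f x > 0} x * (1 * f x) = 0" by (rule pos) simp
  moreover have "AE x in M. indicator {x\<in>space M. -1 * f x > 0} x * (-1 * f x) = 0" by (rule pos) simp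
  ultimately show ?thesis using AE_space
    by eventually_elim (auto split: split_indicator_asm)
qed

lemma lborel_integral_prod:
  fixes f :: "'a::euclidean_space \<Rightarrow> real \<Rightarrow> complex"
  assumes f: "\<And>b. b \<in> Basis \<Longrightarrow> integrable lborel (f b)"
  shows "integrable lborel (\<lambda>x. \<Prod>b\<in>Basis. f b (x \<bullet> b))"
    and "(LINT x|lborel. (\<Prod>b\<in>Basis. f b (x \<bullet> b))) = (\<Prod>b\<in>Basis. (LINT x|lborel. f b x))"
proof -
  interpret product_sigma_finite "\<lambda>_::'a. lborel :: real measure" ..
  have [measurable]: "f b \<in> borel_measurable borel" if "b \<in> Basis" for b
    using f[OF that] by auto
  have eq: "(\<Prod>b\<in>Basis. f b ((\<Sum>b\<in>Basis. y b *\<^sub>R b) \<bullet> b)) = (\<Prod>b\<in>Basis. f b (y b))" for y :: "'a \<Rightarrow> real"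
    by (intro prod.cong) auto
  have m: "(\<lambda>x::'a. \<Prod>b\<in>Basis. f b (x \<bullet> b)) \<in> borel_measurable borel" by measurable
  show "integrable lborel (\<lambda>x. \<Prod>b\<in>Basis. f b (x \<bullet> b))"
    using m by (subst lborel_eq) (auto simp: integrable_distr_eq eq intro!: product_integrable_prod f)
  show "(LINT x|lborel. (\<Prod>b\<in>Basis. f b (x \<bullet> b))) = (\<Prod>b\<in>Basis. (LINT x|lborel. f b x))"
    using m by (subst lborel_eq) (auto simp: integral_distr eq intro!: product_integral_prod f)
qed

section \<open>The Fourier transform on Euclidean space\<close>

lemma gaussian_integral_1:
  fixes c z :: real
  assumes c: "c > 0"
  shows "integrable lborel (\<lambda>x. complex_of_real (exp (- c * x\<^sup>2)) * exp (- \<i> * complex_of_real (x * z)))" (is ?A)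
    and "(LINT x|lborel. complex_of_real (exp (- c * x\<^sup>2)) * exp (- \<i> * complex_of_real (x * z)))
      = complex_of_real (sqrt (pi / c) * exp (- z\<^sup>2 / (4 * c)))" (is ?B)
proof -
  \<comment> \<open>With this \<open>t\<close> the substitution
    \<open>x \<mapsto> sqrt (2 * c) * x\<close> turns the integral into the characteristic function
    of the standard normal distribution.\<close>
  define t where "t = - z / sqrt (2 * c)"
  let ?f = "\<lambda>x. std_normal_density x *\<^sub>R iexp (t * x)"
  let ?g = "\<lambda>x. complex_of_real (exp (- c * x\<^sup>2)) * exp (- \<i> * complex_of_real (x * z))"
  have int: "integrable lborel ?f"
    by (rule Bochner_Integration.integrable_bound[OF integrable_normal_density[of 1 0]]) (auto simp: norm_mult)
  have feq: "?f (0 + sqrt (2 * c) * x) = (1 / sqrt (2 * pi)) *\<^sub>R ?g x" for x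
  proof -
    have "t * (sqrt (2 * c) * x) = - (x * z)" using c by (simp add: t_def)
    moreover have "(sqrt (2 * c) * x)\<^sup>2 / 2 = c * x\<^sup>2" using c by (simp add: power_mult_distrib)
    ultimately show ?thesis unfolding std_normal_density_def by (simp add: scaleR_conv_of_real field_simps)
  qed
  have s: "sqrt (2 * c) \<noteq> 0" using c by simp
  have "integrable lborel (\<lambda>x. (1 / sqrt (2 * pi)) *\<^sub>R ?g x)"
    using lborel_integrable_real_affine[OF int s, of 0] unfolding feq .
  then have "integrable lborel (\<lambda>x. sqrt (2 * pi) *\<^sub>R ((1 / sqrt (2 * pi)) *\<^sub>R ?g x))"
    by (rule integrable_scaleR_right)
  then show ?A by simp
  have "complex_of_real (exp (- (t^2) / 2)) = char std_normal_distribution t"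
    by (simp add: char_std_normal_distribution)
  also have "\<dots> = integral\<^sup>L lborel ?f"
    unfolding char_def by (subst integral_density) auto
  also have "\<dots> = sqrt (2 * c) *\<^sub>R (LINT x|lborel. (1 / sqrt (2 * pi)) *\<^sub>R ?g x)"
    using c by (subst lborel_integral_real_affine[OF s, of _ 0]) (simp only: feq, simp)
  also have "\<dots> = (sqrt (2 * c) / sqrt (2 * pi)) *\<^sub>R integral\<^sup>L lborel ?g"
    by simp
  finally have "(sqrt (2 * pi) / sqrt (2 * c)) *\<^sub>R complex_of_real (exp (- (t^2) / 2)) = integral\<^sup>L lborel ?g"
    using c by simp
  moreover have "sqrt (2 * pi) / sqrt (2 * c) = sqrt (pi / c)"
    by (simp add: real_sqrt_divide real_sqrt_mult)
  moreover have "t^2/2 = z\<^sup>2 / (4 * c)"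
    using c by (simp add: t_def power_divide)
  ultimately show ?B by (simp add: scaleR_conv_of_real)
qed

lemma norm_square_Basis: "(norm (x::'a::euclidean_space))\<^sup>2 = (\<Sum>b\<in>Basis. (x \<bullet> b)\<^sup>2)"
  by (subst power2_norm_eq_inner, subst euclidean_inner) (simp add: power2_eq_square)

lemma gaussian_integral:
  fixes z :: "'a::euclidean_space" and c :: real
  assumes c: "c > 0"
  shows "integrable lborel (\<lambda>x::'a. complex_of_real (exp (- c * (norm x)\<^sup>2)) * exp (- \<i> * complex_of_real (x \<bullet> z)))" (is ?A)
    and "(LINT x|lborel. complex_of_real (exp (- c * (norm x)\<^sup>2)) * exp (- \<i> * complex_of_real (x \<bullet> z)))
      = complex_of_real ((pi / c) powr (real DIM('a) / 2) * exp (- (norm z)\<^sup>2 / (4 * c)))" (is ?B)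
proof -
  let ?f = "\<lambda>b x. complex_of_real (exp (- c * x\<^sup>2)) * exp (- \<i> * complex_of_real (x * (z \<bullet> b)))"
  have eq: "complex_of_real (exp (- c * (norm x)\<^sup>2)) * exp (- \<i> * complex_of_real (x \<bullet> z)) = (\<Prod>b\<in>Basis. ?f b (x \<bullet> b))" for x
  proof -
    have "- c * (norm x)\<^sup>2 = (\<Sum>b\<in>Basis. - c * (x \<bullet> b)\<^sup>2)"
      by (simp only: norm_square_Basis sum_distrib_left)
    then have 1: "complex_of_real (exp (- c * (norm x)\<^sup>2)) = (\<Prod>b\<in>Basis. complex_of_real (exp (- c * (x \<bullet> b)\<^sup>2)))"
      by (simp only: exp_sum finite_Basis of_real_prod)
    have "- \<i> * complex_of_real (x \<bullet> z) = (\<Sum>b\<in>Basis. - \<i> * complex_of_real ((x \<bullet> b) * (z \<bullet> b)))"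
      by (simp only: euclidean_inner[of x z] sum_distrib_left of_real_sum)
    then have 2: "exp (- \<i> * complex_of_real (x \<bullet> z)) = (\<Prod>b\<in>Basis. exp (- \<i> * complex_of_real ((x \<bullet> b) * (z \<bullet> b))))"
      by (simp only: exp_sum finite_Basis)
    show ?thesis unfolding 1 2 by (simp only: prod.distrib)
  qed
  have int: "integrable lborel (?f b)" for b by (rule gaussian_integral_1[OF c])
  show ?A unfolding eq by (rule lborel_integral_prod[OF int])
  have "(LINT x|lborel. (\<Prod>b\<in>Basis. ?f b (x \<bullet> b))) = (\<Prod>b\<in>Basis. complex_of_real (sqrt (pi / c) * exp (- (z \<bullet> b)\<^sup>2 / (4 * c))))"
    by (subst lborel_integral_prod[OF int]) (simp only: gaussian_integral_1[OF c])
  also have "\<dots> = complex_of_real ((\<Prod>b\<in>(Basis::'a set). sqrt (pi / c)) * (\<Prod>b\<in>Basis. exp (- (z \<bullet> b)\<^sup>2 / (4 * c))))"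
    by (simp only: of_real_prod[symmetric] prod.distrib[symmetric])
  also have "(\<Prod>b\<in>Basis. exp (- (z \<bullet> b)\<^sup>2 / (4 * c))) = exp (- (norm z)\<^sup>2 / (4 * c))"
    by (simp add: norm_square_Basis exp_sum[symmetric] sum_negf sum_divide_distrib)
  also have "(\<Prod>b\<in>(Basis::'a set). sqrt (pi / c)) = (pi / c) powr (real DIM('a) / 2)"
    using c by (simp add: powr_half_sqrt[symmetric] powr_realpow[symmetric] powr_powr)
  finally show ?B unfolding eq .
qed

lemma gaussian_integrable:
  assumes "c > 0"
  shows "integrable lborel (\<lambda>x::'a::euclidean_space. exp (- c * (norm x)\<^sup>2))"
proof -
  have "integrable lborel (\<lambda>x::'a. complex_of_real (exp (- c * (norm x)\<^sup>2)))"
    using gaussian_integral(1)[OF assms, of 0] by simp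
  then show ?thesis by (simp add: complex_of_real_integrable_eq)
qed

text \<open>The Gauss-Weierstrass kernel at time \<open>d\<close>, normalised to total mass 1; up to
  the factor (2 \<pi>)^n it is the unnormalised Fourier integral of exp (- d |\<xi>|^2).\<close>

definition heat_kernel :: "real \<Rightarrow> 'a::euclidean_space \<Rightarrow> real" where
  "heat_kernel d z = (4 * pi * d) powr (- real DIM('a) / 2) * exp (- (norm z)\<^sup>2 / (4 * d))"

lemma heat_kernel_nonneg [simp]: "heat_kernel d z \<ge> 0"
  by (simp add: heat_kernel_def)

lemma heat_kernel_le: "d > 0 \<Longrightarrow> heat_kernel d (z::'a::euclidean_space) \<le> (4 * pi * d) powr (- real DIM('a) / 2)"
  unfolding heat_kernel_def by (rule mult_left_le) auto

lemma heat_kernel_minus_commute: "heat_kernel d (x - y) = heat_kernel d (y - x)"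
  by (simp add: heat_kernel_def norm_minus_commute)

lemma heat_kernel_measurable [measurable]: "heat_kernel d \<in> borel_measurable borel"
  unfolding heat_kernel_def by measurable

lemma heat_kernel_integral:
  assumes d: "d > 0"
  shows "integrable lborel (heat_kernel d :: 'a::euclidean_space \<Rightarrow> real)" "(LINT z::'a|lborel. heat_kernel d z) = 1"
proof -
  let ?c = "1 / (4 * d)"
  have c: "?c > 0" using d by simp
  have "integrable lborel (\<lambda>z::'a. exp (- ?c * (norm z)\<^sup>2))" by (rule gaussian_integrable[OF c])
  then show "integrable lborel (heat_kernel d :: 'a \<Rightarrow> real)"
    unfolding heat_kernel_def by simp
  have "complex_of_real (LINT z::'a|lborel. heat_kernel d z) = (LINT z::'a|lborel. complex_of_real (heat_kernel d z))" by simp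
  also have "\<dots> = (LINT z::'a|lborel. complex_of_real ((4 * pi * d) powr (- real DIM('a) / 2)) * (complex_of_real (exp (- ?c * (norm z)\<^sup>2)) * exp (- \<i> * complex_of_real (z \<bullet> 0))))"
    by (simp add: heat_kernel_def)
  also have "\<dots> = complex_of_real ((4 * pi * d) powr (- real DIM('a) / 2) * ((4 * pi * d) powr (real DIM('a) / 2)))"
    by (subst integral_mult_right_zero, subst gaussian_integral(2)[OF c]) (simp add: mult_ac)
  also have "\<dots> = 1" using d by (simp flip: powr_add)
  finally show "(LINT z::'a|lborel. heat_kernel d z) = 1" by (metis of_real_eq_1_iff)
qed

lemma gaussian_fourier_heat_kernel:
  fixes z :: "'a::euclidean_space"
  assumes d: "d > 0"
  shows "(LINT x|lborel. complex_of_real (exp (- d * (norm x)\<^sup>2)) * exp (- \<i> * complex_of_real (x \<bullet> z)))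
      = complex_of_real ((2 * pi) powr real DIM('a) * heat_kernel d z)"
proof -
  have "(pi / d) powr (real DIM('a) / 2) = ((2 * pi) powr 2 / (4 * pi * d)) powr (real DIM('a) / 2)"
    using d by (simp add: power2_eq_square)
  also have "\<dots> = (2 * pi) powr real DIM('a) * (4 * pi * d) powr (- real DIM('a) / 2)"
  proof (subst powr_divide)
    have "((2 * pi) powr 2) powr (real DIM('a) / 2) = (2 * pi) powr real DIM('a)"
      by (simp only: powr_powr) simp
    then show "((2 * pi) powr 2) powr (real DIM('a) / 2) / (4 * pi * d) powr (real DIM('a) / 2)
       = (2 * pi) powr real DIM('a) * (4 * pi * d) powr (- real DIM('a) / 2)"
      by (simp only: powr_minus minus_divide_left[symmetric] divide_inverse[of "_ powr _" "_ powr _"])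
  qed
  finally show ?thesis unfolding gaussian_integral(2)[OF d] heat_kernel_def by simp
qed

lemma lborel_nn_integral_affine:
  fixes f :: "'a::euclidean_space \<Rightarrow> ennreal"
  assumes [measurable]: "f \<in> borel_measurable borel" and c: "c \<noteq> 0"
  shows "(\<integral>\<^sup>+x. f x \<partial>lborel) = ennreal (\<bar>c\<bar> ^ DIM('a)) * (\<integral>\<^sup>+x. f (t + c *\<^sub>R x) \<partial>lborel)"
  by (subst lborel_affine[OF c, of t])
    (simp add: nn_integral_density nn_integral_distr nn_integral_cmult)

lemma lborel_integral_affine:
  fixes f :: "'a::euclidean_space \<Rightarrow> 'b::{banach, second_countable_topology}"
  assumes f [measurable]: "f \<in> borel_measurable borel" and c: "c \<noteq> 0"
  shows "(LINT x|lborel. f x) = (\<bar>c\<bar> ^ DIM('a)) *\<^sub>R (LINT x|lborel. f (t + c *\<^sub>R x))"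
  by (subst lborel_affine[OF c, of t])
    (simp add: integral_density integral_distr)

lemma nn_integral_heat_kernel:
  assumes "d > 0"
  shows "(\<integral>\<^sup>+y. ennreal (heat_kernel d (x - y :: 'a::euclidean_space)) \<partial>lborel) = 1"
proof -
  have "(\<integral>\<^sup>+(y::'a). ennreal (heat_kernel d y) \<partial>lborel) = 1"
    using heat_kernel_integral[OF assms, where 'a = 'a] by (subst nn_integral_eq_integral) auto
  then show ?thesis
    by (subst (asm) lborel_nn_integral_affine[where c = "-1" and t = x]) (auto simp: one_ennreal_def[symmetric])
qed

lemma heat_kernel_scale:
  assumes d: "d > 0"
  shows "(sqrt d) ^ DIM('a) * heat_kernel d (sqrt d *\<^sub>R u) = heat_kernel 1 (u::'a::euclidean_space)"
proof -
  have "(sqrt d) ^ DIM('a) = d powr (real DIM('a) / 2)"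
    using d by (simp add: powr_half_sqrt[symmetric] powr_realpow[symmetric] powr_powr)
  moreover have "(4 * pi * d) powr (- real DIM('a) / 2) = (4 * pi) powr (- real DIM('a) / 2) * d powr (- real DIM('a) / 2)"
    using d by (simp add: powr_mult)
  moreover have "d powr (real DIM('a) / 2) * d powr (- real DIM('a) / 2) = 1" using d by (simp flip: powr_add)
  ultimately show ?thesis using d
    unfolding heat_kernel_def by (simp add: power_mult_distrib field_simps)
qed

text \<open>The substitution y = x + sqrt d u moves the dependence on \<open>d\<close> from the
  kernel into the argument of \<open>\<phi>\<close>; continuity at the single point \<open>x\<close>
  then suffices for dominated convergence.\<close>

lemma heat_kernel_approx:
  fixes \<phi> :: "'a::euclidean_space \<Rightarrow> complex"
  assumes [measurable]: "\<phi> \<in> borel_measurable borel" and bd: "\<And>y. norm (\<phi> y) \<le> B" and cont: "isCont \<phi> x"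
  shows "(\<lambda>n. LINT y|lborel. \<phi> y * complex_of_real (heat_kernel (1 / real (Suc n)) (x - y))) \<longlonglongrightarrow> \<phi> x"
proof -
  have eq: "(LINT y|lborel. \<phi> y * complex_of_real (heat_kernel d (x - y)))
     = (LINT u|lborel. \<phi> (x + sqrt d *\<^sub>R u) * complex_of_real (heat_kernel 1 u))" if d: "d > 0" for d
  proof -
    have "(LINT y|lborel. \<phi> y * complex_of_real (heat_kernel d (x - y)))
      = \<bar>sqrt d\<bar> ^ DIM('a) *\<^sub>R (LINT u|lborel. \<phi> (x + sqrt d *\<^sub>R u) * complex_of_real (heat_kernel d (- (sqrt d *\<^sub>R u))))"
      using d by (subst lborel_integral_affine[where c = "sqrt d" and t = x]) auto
    also have "\<dots> = (LINT u|lborel. complex_of_real (sqrt d ^ DIM('a)) * (\<phi> (x + sqrt d *\<^sub>R u) * complex_of_real (heat_kernel d (- (sqrt d *\<^sub>R u)))))"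
      using d by (subst integral_mult_right_zero) (simp add: scaleR_conv_of_real)
    also have "\<dots> = (LINT u|lborel. \<phi> (x + sqrt d *\<^sub>R u) * complex_of_real ((sqrt d) ^ DIM('a) * heat_kernel d (- (sqrt d *\<^sub>R u))))"
      by (intro Bochner_Integration.integral_cong) (auto simp: mult_ac)
    also have "\<dots> = (LINT u|lborel. \<phi> (x + sqrt d *\<^sub>R u) * complex_of_real ((sqrt d) ^ DIM('a) * heat_kernel d (sqrt d *\<^sub>R u)))"
      by (simp add: heat_kernel_def)
    finally show ?thesis by (simp only: heat_kernel_scale[OF d])
  qed
  have "(\<lambda>n. LINT u|lborel. \<phi> (x + sqrt (1 / real (Suc n)) *\<^sub>R u) * complex_of_real (heat_kernel 1 u))
     \<longlonglongrightarrow> (LINT u::'a|lborel. \<phi> x * complex_of_real (heat_kernel 1 u))"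
  proof (rule integral_dominated_convergence[where w = "\<lambda>u::'a. B * heat_kernel 1 u"])
    show "integrable lborel (\<lambda>u::'a. B * heat_kernel 1 u)" using heat_kernel_integral(1)[of 1, where 'a = 'a] by simp
    show "AE u in lborel. (\<lambda>n. \<phi> (x + sqrt (1 / real (Suc n)) *\<^sub>R u) * complex_of_real (heat_kernel 1 u))
       \<longlonglongrightarrow> \<phi> x * complex_of_real (heat_kernel 1 u)"
    proof (rule AE_I2)
      fix u :: 'a
      have "(\<lambda>n. sqrt (1 / real (Suc n))) \<longlonglongrightarrow> sqrt 0"
        by (intro tendsto_real_sqrt LIMSEQ_Suc[OF lim_1_over_n])
      then have "(\<lambda>n. x + sqrt (1 / real (Suc n)) *\<^sub>R u) \<longlonglongrightarrow> x + sqrt 0 *\<^sub>R u"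
        by (rule tendsto_add[OF tendsto_const tendsto_scaleR[OF _ tendsto_const]])
      then have "(\<lambda>n. x + sqrt (1 / real (Suc n)) *\<^sub>R u) \<longlonglongrightarrow> x" by simp
      then have "(\<lambda>n. \<phi> (x + sqrt (1 / real (Suc n)) *\<^sub>R u)) \<longlonglongrightarrow> \<phi> x"
        by (rule isCont_tendsto_compose[OF cont])
      then show "(\<lambda>n. \<phi> (x + sqrt (1 / real (Suc n)) *\<^sub>R u) * complex_of_real (heat_kernel 1 u))
       \<longlonglongrightarrow> \<phi> x * complex_of_real (heat_kernel 1 u)" by (intro tendsto_mult_right)
    qed
    show "AE u in lborel. norm (\<phi> (x + sqrt (1 / real (Suc n)) *\<^sub>R u) * complex_of_real (heat_kernel 1 u)) \<le> B * heat_kernel 1 u" for n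
      by (auto simp: norm_mult intro!: mult_right_mono bd)
  qed auto
  also have "(LINT u::'a|lborel. \<phi> x * complex_of_real (heat_kernel 1 u)) = \<phi> x"
    using heat_kernel_integral(2)[of 1, where 'a = 'a] by simp
  finally show ?thesis by (simp add: eq)
qed

lemma fubini_bounded_kernel:
  fixes f :: "'a::euclidean_space \<Rightarrow> complex" and g :: "'b::euclidean_space \<Rightarrow> complex"
  assumes f: "integrable lborel f" and g: "integrable lborel g"
    and K [measurable]: "(\<lambda>(x, y). K x y) \<in> borel_measurable (borel \<Otimes>\<^sub>M borel)" and bd: "\<And>x y. norm (K x y) \<le> C"
  shows "(LINT x|lborel. f x * (LINT y|lborel. g y * K x y)) = (LINT y|lborel. g y * (LINT x|lborel. f x * K x y))"
    and "integrable lborel (\<lambda>x. f x * (LINT y|lborel. g y * K x y))"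
proof -
  have [measurable]: "f \<in> borel_measurable borel" "g \<in> borel_measurable borel" using f g by auto
  have fg: "integrable (lborel \<Otimes>\<^sub>M lborel) (\<lambda>(x, y). f x * g y)"
  proof (rule lborel_pair.Fubini_integrable)
    show "integrable lborel (\<lambda>x. LINT y|lborel. norm (case (x, y) of (x, y) \<Rightarrow> f x * g y))"
      using f by (simp add: norm_mult)
  qed (use g in auto)
  have int: "integrable (lborel \<Otimes>\<^sub>M lborel) (\<lambda>(x, y). f x * g y * K x y)"
  proof (rule Bochner_Integration.integrable_bound)
    show "integrable (lborel \<Otimes>\<^sub>M lborel) (\<lambda>p. C *\<^sub>R (case p of (x, y) \<Rightarrow> f x * g y))"
      by (intro integrable_scaleR_right fg)
    show "AE p in lborel \<Otimes>\<^sub>M lborel. norm (case p of (x, y) \<Rightarrow> f x * g y * K x y) \<le> norm (C *\<^sub>R (case p of (x, y) \<Rightarrow> f x * g y))"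
    proof (rule AE_I2)
      fix p :: "'a \<times> 'b"
      obtain x y where p: "p = (x, y)" by (cases p)
      have "norm (f x * g y * K x y) \<le> norm (f x * g y) * C"
        unfolding norm_mult[of "f x * g y"] by (intro mult_left_mono bd) simp
      also have "\<dots> \<le> norm (C *\<^sub>R (f x * g y))" by (simp add: mult.commute mult_right_mono)
      finally show "norm (case p of (x, y) \<Rightarrow> f x * g y * K x y) \<le> norm (C *\<^sub>R (case p of (x, y) \<Rightarrow> f x * g y))"
        by (simp add: p)
    qed
  qed measurable
  have "(LINT x|lborel. f x * (LINT y|lborel. g y * K x y)) = (LINT x|lborel. (LINT y|lborel. f x * g y * K x y))"
    by (simp add: mult.assoc)
  also have "\<dots> = (LINT y|lborel. (LINT x|lborel. f x * g y * K x y))"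
    using lborel_pair.Fubini_integral[of "\<lambda>x y. f x * g y * K x y"] int by simp
  also have "\<dots> = (LINT y|lborel. (LINT x|lborel. g y * (f x * K x y)))"
    by (simp add: ac_simps)
  also have "\<dots> = (LINT y|lborel. g y * (LINT x|lborel. f x * K x y))" by simp
  finally show "(LINT x|lborel. f x * (LINT y|lborel. g y * K x y)) = (LINT y|lborel. g y * (LINT x|lborel. f x * K x y))" .
  show "integrable lborel (\<lambda>x. f x * (LINT y|lborel. g y * K x y))"
    using lborel_pair.integrable_fst[OF int] by (simp add: mult.assoc)
qed

section \<open>The transform of integrable functions and its contraction property\<close>

definition ft :: "('a::euclidean_space \<Rightarrow> complex) \<Rightarrow> 'a \<Rightarrow> complex" where
  "ft w \<xi> = complex_of_real ((2 * pi) powr (- real DIM('a) / 2)) *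
     (LINT x|lborel. w x * exp (- \<i> * complex_of_real (x \<bullet> \<xi>)))"

lemma ft_measurable [measurable]:
  assumes [measurable]: "w \<in> borel_measurable borel"
  shows "ft w \<in> borel_measurable borel"
  unfolding ft_def by measurable

lemma norm_character [simp]: "norm (exp (- (\<i> * complex_of_real r))) = 1" "norm (exp (\<i> * complex_of_real r)) = 1"
  by (simp_all add: norm_exp_eq_Re)

lemma character_integrable:
  assumes w: "integrable lborel w"
  shows "integrable lborel (\<lambda>x. w x * exp (- \<i> * complex_of_real (x \<bullet> \<xi>)))"
proof (rule Bochner_Integration.integrable_bound[OF w])
  have [measurable]: "w \<in> borel_measurable borel" using w by auto
  show "(\<lambda>x. w x * exp (- \<i> * complex_of_real (x \<bullet> \<xi>))) \<in> borel_measurable lborel" by measurable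
qed (auto simp: norm_mult)

lemma ft_bounded:
  fixes w :: "'a::euclidean_space \<Rightarrow> complex"
  shows "norm (ft w \<xi>) \<le> (2 * pi) powr (- real DIM('a) / 2) * (LINT x|lborel. norm (w x))"
proof -
  have "norm (LINT x|lborel. w x * exp (- \<i> * complex_of_real (x \<bullet> \<xi>))) \<le> (LINT x|lborel. norm (w x))"
    using integral_norm_bound[of lborel "\<lambda>x. w x * exp (- \<i> * complex_of_real (x \<bullet> \<xi>))"] by (simp add: norm_mult)
  then show ?thesis by (simp add: ft_def norm_mult mult_left_mono)
qed

lemma ft_diff:
  assumes "integrable lborel w" "integrable lborel v"
  shows "ft (\<lambda>x. w x - v x) \<xi> = ft w \<xi> - ft v \<xi>"
  unfolding ft_def
  by (simp only: left_diff_distrib Bochner_Integration.integral_diff[OF assms[THEN character_integrable]] right_diff_distrib)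

lemma ft_add:
  assumes "integrable lborel w" "integrable lborel v"
  shows "ft (\<lambda>x. w x + v x) \<xi> = ft w \<xi> + ft v \<xi>"
  unfolding ft_def
  by (simp only: distrib_right Bochner_Integration.integral_add[OF assms[THEN character_integrable]] distrib_left)

lemma ft_cmult: "ft (\<lambda>x. c * w x) \<xi> = c * ft w \<xi>"
  unfolding ft_def by (simp add: mult.assoc mult.left_commute)

lemma ft_mult_formula:
  fixes f g :: "'a::euclidean_space \<Rightarrow> complex"
  assumes f: "integrable lborel f" and g: "integrable lborel g"
  shows "(LINT x|lborel. ft f x * g x) = (LINT x|lborel. f x * ft g x)"
proof -
  let ?c = "complex_of_real ((2 * pi) powr (- real DIM('a) / 2))"
  have "(LINT x|lborel. ft f x * g x) = ?c * (LINT x|lborel. g x * (LINT y|lborel. f y * exp (- \<i> * complex_of_real (y \<bullet> x))))"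
    unfolding ft_def by (subst integral_mult_right_zero[symmetric]) (simp add: ac_simps)
  also have "\<dots> = ?c * (LINT y|lborel. f y * (LINT x|lborel. g x * exp (- \<i> * complex_of_real (y \<bullet> x))))"
    by (subst fubini_bounded_kernel(1)[OF g f, where C = 1]) auto
  also have "\<dots> = (LINT x|lborel. f x * ft g x)"
    unfolding ft_def by (subst integral_mult_right_zero[symmetric]) (simp add: ac_simps inner_commute)
  finally show ?thesis .
qed

text \<open>The Gaussian factor makes the frequency integral absolutely convergent, so Fubini
  applies; on the space side it becomes an average against the heat kernel. Letting \<open>d\<close>
  tend to 0 yields the contraction property and Parseval identities before any inversion theorem is
  known.\<close>

lemma ft_gauss_parseval:
  fixes w v :: "'a::euclidean_space \<Rightarrow> complex"
  assumes w: "integrable lborel w" and v: "integrable lborel v" and d: "d > 0"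
  shows "(LINT \<xi>|lborel. complex_of_real (exp (- d * (norm \<xi>)\<^sup>2)) * (ft w \<xi> * cnj (ft v \<xi>)))
    = (LINT x|lborel. w x * (LINT y|lborel. cnj (v y) * complex_of_real (heat_kernel d (x - y))))"
    and "integrable lborel (\<lambda>x. w x * (LINT y|lborel. cnj (v y) * complex_of_real (heat_kernel d (x - y))))"
proof -
  let ?c = "complex_of_real ((2 * pi) powr (- real DIM('a) / 2))"
  let ?C = "complex_of_real ((2 * pi) powr (real DIM('a)))"
  let ?g = "\<lambda>\<xi>. complex_of_real (exp (- d * (norm (\<xi>::'a))\<^sup>2))"
  have [measurable]: "w \<in> borel_measurable borel" "v \<in> borel_measurable borel" using w v by auto
  define V where "V \<xi> = (LINT y|lborel. cnj (v y) * exp (\<i> * complex_of_real (y \<bullet> \<xi>)))" for \<xi>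
  have V [measurable]: "V \<in> borel_measurable borel" unfolding V_def by measurable
  have Vb: "norm (V \<xi>) \<le> (LINT y|lborel. norm (v y))" for \<xi>
    using integral_norm_bound[of lborel "\<lambda>y. cnj (v y) * exp (\<i> * complex_of_real (y \<bullet> \<xi>))"] by (simp add: V_def norm_mult)
  have cV: "cnj (ft v \<xi>) = ?c * V \<xi>" for \<xi>
  proof -
    have "cnj (LINT x|lborel. v x * exp (- \<i> * complex_of_real (x \<bullet> \<xi>))) = (LINT x|lborel. cnj (v x * exp (- \<i> * complex_of_real (x \<bullet> \<xi>))))"
      by (rule Bochner_Integration.integral_cnj[symmetric])
    also have "\<dots> = V \<xi>"
      unfolding V_def by (intro Bochner_Integration.integral_cong) (auto simp: exp_cnj)
    finally show ?thesis unfolding ft_def by simp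
  qed
  have gi: "integrable lborel ?g" using gaussian_integrable[OF d, where 'a = 'a] by (simp add: complex_of_real_integrable_eq)
  have gV: "integrable lborel (\<lambda>\<xi>. ?g \<xi> * V \<xi>)"
  proof (rule Bochner_Integration.integrable_bound)
    show "integrable lborel (\<lambda>\<xi>. (LINT y|lborel. norm (v y)) *\<^sub>R ?g \<xi>)" by (intro integrable_scaleR_right gi)
    show "AE \<xi> in lborel. norm (?g \<xi> * V \<xi>) \<le> norm ((LINT y|lborel. norm (v y)) *\<^sub>R ?g \<xi>)"
      using Vb by (auto simp: norm_mult mult.commute intro!: mult_right_mono)
  qed measurable
  have cC: "?c * ?c * ?C = 1"
    by (simp flip: of_real_mult powr_add)
  have inner: "(LINT \<xi>|lborel. ?g \<xi> * V \<xi> * exp (- \<i> * complex_of_real (x \<bullet> \<xi>)))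
     = ?C * (LINT y|lborel. cnj (v y) * complex_of_real (heat_kernel d (x - y)))" for x
  proof -
    have "(LINT \<xi>|lborel. ?g \<xi> * V \<xi> * exp (- \<i> * complex_of_real (x \<bullet> \<xi>)))
      = (LINT \<xi>|lborel. (?g \<xi> * exp (- \<i> * complex_of_real (\<xi> \<bullet> x))) * V \<xi>)"
      by (simp add: ac_simps inner_commute)
    also have "\<dots> = (LINT y|lborel. cnj (v y) * (LINT \<xi>|lborel. (?g \<xi> * exp (- \<i> * complex_of_real (\<xi> \<bullet> x))) * exp (\<i> * complex_of_real (y \<bullet> \<xi>))))"
      unfolding V_def
    proof (rule fubini_bounded_kernel(1)[where C = 1])
      show "integrable lborel (\<lambda>y. cnj (v y))" using v by (rule integrable_cnj)
      show "integrable lborel (\<lambda>\<xi>. ?g \<xi> * exp (- \<i> * complex_of_real (\<xi> \<bullet> x)))"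
        using gi by (rule character_integrable)
    qed auto
    also have "(\<lambda>y. LINT \<xi>|lborel. (?g \<xi> * exp (- \<i> * complex_of_real (\<xi> \<bullet> x))) * exp (\<i> * complex_of_real (y \<bullet> \<xi>)))
       = (\<lambda>y. LINT \<xi>|lborel. ?g \<xi> * exp (- \<i> * complex_of_real (\<xi> \<bullet> (x - y))))"
    proof (intro ext Bochner_Integration.integral_cong refl)
      fix y \<xi> :: 'a
      have "exp (- \<i> * complex_of_real (\<xi> \<bullet> (x - y))) = exp (- \<i> * complex_of_real (\<xi> \<bullet> x)) * exp (\<i> * complex_of_real (y \<bullet> \<xi>))"
        by (subst exp_add[symmetric]) (simp add: inner_diff_right inner_commute[of y] algebra_simps)
      then show "(?g \<xi> * exp (- \<i> * complex_of_real (\<xi> \<bullet> x))) * exp (\<i> * complex_of_real (y \<bullet> \<xi>))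
          = ?g \<xi> * exp (- \<i> * complex_of_real (\<xi> \<bullet> (x - y)))" by simp
    qed
    also have "\<dots> = (\<lambda>y. ?C * complex_of_real (heat_kernel d (x - y)))"
      by (simp only: gaussian_fourier_heat_kernel[OF d] of_real_mult)
    also have "(LINT y|lborel. cnj (v y) * (?C * complex_of_real (heat_kernel d (x - y))))
      = ?C * (LINT y|lborel. cnj (v y) * complex_of_real (heat_kernel d (x - y)))"
      by (subst integral_mult_right_zero[symmetric]) (simp add: ac_simps)
    finally show ?thesis .
  qed
  have K: "(\<lambda>(x, y::'a). exp (- \<i> * complex_of_real (x \<bullet> y))) \<in> borel_measurable (borel \<Otimes>\<^sub>M borel)" by measurable
  have "(LINT \<xi>|lborel. ?g \<xi> * (ft w \<xi> * cnj (ft v \<xi>)))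
      = ?c * ?c * (LINT \<xi>|lborel. (?g \<xi> * V \<xi>) * (LINT x|lborel. w x * exp (- \<i> * complex_of_real (\<xi> \<bullet> x))))"
    unfolding cV unfolding ft_def by (subst integral_mult_right_zero[symmetric]) (simp add: ac_simps inner_commute)
  also have "\<dots> = ?c * ?c * (LINT x|lborel. w x * (LINT \<xi>|lborel. ?g \<xi> * V \<xi> * exp (- \<i> * complex_of_real (\<xi> \<bullet> x))))"
    by (subst fubini_bounded_kernel(1)[OF gV w K, where C = 1]) auto
  also have "\<dots> = ?c * ?c * (LINT x|lborel. ?C * (w x * (LINT y|lborel. cnj (v y) * complex_of_real (heat_kernel d (x - y)))))"
    using inner by (simp add: inner_commute ac_simps)
  also have "\<dots> = (?c * ?c * ?C) * (LINT x|lborel. (w x * (LINT y|lborel. cnj (v y) * complex_of_real (heat_kernel d (x - y)))))"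
    by (simp only: integral_mult_right_zero mult.assoc)
  finally show "(LINT \<xi>|lborel. ?g \<xi> * (ft w \<xi> * cnj (ft v \<xi>)))
    = (LINT x|lborel. w x * (LINT y|lborel. cnj (v y) * complex_of_real (heat_kernel d (x - y))))"
    by (simp only: cC mult_1_left)
  show "integrable lborel (\<lambda>x. w x * (LINT y|lborel. cnj (v y) * complex_of_real (heat_kernel d (x - y))))"
    by (rule fubini_bounded_kernel(2)[OF w integrable_cnj[OF v], where C = "(4 * pi * d) powr (- real DIM('a) / 2)"])
      (use heat_kernel_le[OF d, where 'a = 'a] in auto)
qed

text \<open>A Schur test: 2 |w(x) w(y)| is at most |w(x)|^2 + |w(y)|^2, and the kernel has mass 1 in
  each variable.\<close>

lemma heat_kernel_quadratic_form:
  fixes w :: "'a::euclidean_space \<Rightarrow> complex"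
  assumes w: "integrable lborel w" and sq: "sq_int lborel w" and d: "d > 0"
  shows "norm (LINT x|lborel. w x * (LINT y|lborel. cnj (w y) * complex_of_real (heat_kernel d (x - y)))) \<le> (l2_norm lborel w)\<^sup>2"
proof -
  have [measurable]: "w \<in> borel_measurable borel" using w by auto
  have wk: "integrable lborel (\<lambda>y. cnj (w y) * complex_of_real (heat_kernel d (x - y)))" for x
  proof (rule Bochner_Integration.integrable_bound)
    show "integrable lborel (\<lambda>y. (4 * pi * d) powr (- real DIM('a) / 2) *\<^sub>R w y)" using w by simp
    show "AE y in lborel. norm (cnj (w y) * complex_of_real (heat_kernel d (x - y))) \<le> norm ((4 * pi * d) powr (- real DIM('a) / 2) *\<^sub>R w y)"
      using heat_kernel_le[OF d, where 'a = 'a] by (auto simp: norm_mult mult.commute intro!: mult_left_mono)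
  qed measurable
  obtain h :: real where h: "h = 1 / 2" "h \<ge> 0" "h + h = 1" by (rule that[of "1 / 2"]) auto
  let ?h = "\<lambda>x y. ennreal (heat_kernel d (x - y))" and ?n = "\<lambda>x. ennreal ((norm (w x))\<^sup>2)"
  have "ennreal (norm (LINT x|lborel. w x * (LINT y|lborel. cnj (w y) * complex_of_real (heat_kernel d (x - y)))))
     \<le> (\<integral>\<^sup>+x. ennreal (norm (w x * (LINT y|lborel. cnj (w y) * complex_of_real (heat_kernel d (x - y))))) \<partial>lborel)"
    by (intro integral_norm_bound_ennreal ft_gauss_parseval(2) w d)
  also have "\<dots> \<le> (\<integral>\<^sup>+x. (\<integral>\<^sup>+y. ennreal h * (?n x * ?h x y) + ennreal h * (?n y * ?h x y) \<partial>lborel) \<partial>lborel)"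
  proof (rule nn_integral_mono)
    fix x :: 'a
    have "ennreal (norm (w x * (LINT y|lborel. cnj (w y) * complex_of_real (heat_kernel d (x - y)))))
       = ennreal (norm (w x)) * ennreal (norm (LINT y|lborel. cnj (w y) * complex_of_real (heat_kernel d (x - y))))"
      by (simp add: norm_mult ennreal_mult)
    also have "\<dots> \<le> ennreal (norm (w x)) * (\<integral>\<^sup>+y. ennreal (norm (cnj (w y) * complex_of_real (heat_kernel d (x - y)))) \<partial>lborel)"
      by (intro mult_left_mono integral_norm_bound_ennreal wk) simp
    also have "\<dots> = (\<integral>\<^sup>+y. ennreal (norm (w x)) * ennreal (norm (cnj (w y) * complex_of_real (heat_kernel d (x - y)))) \<partial>lborel)"
      by (subst nn_integral_cmult) auto
    also have "\<dots> \<le> (\<integral>\<^sup>+y. ennreal h * (?n x * ?h x y) + ennreal h * (?n y * ?h x y) \<partial>lborel)"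
    proof (rule nn_integral_mono)
      fix y :: 'a
      have "norm (w x) * norm (w y) \<le> h * (norm (w x))\<^sup>2 + h * (norm (w y))\<^sup>2"
        unfolding h(1) using sum_squares_bound[of "norm (w x)" "norm (w y)"] by (simp add: field_simps)
      then have "norm (w x) * (norm (w y) * heat_kernel d (x - y)) \<le> (h * (norm (w x))\<^sup>2 + h * (norm (w y))\<^sup>2) * heat_kernel d (x - y)"
        by (subst mult.assoc[symmetric], intro mult_right_mono) auto
      also have "\<dots> = h * ((norm (w x))\<^sup>2 * heat_kernel d (x - y)) + h * ((norm (w y))\<^sup>2 * heat_kernel d (x - y))"
        by (simp add: algebra_simps)
      finally show "ennreal (norm (w x)) * ennreal (norm (cnj (w y) * complex_of_real (heat_kernel d (x - y))))
         \<le> ennreal h * (?n x * ?h x y) + ennreal h * (?n y * ?h x y)"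
        using h(2) by (simp add: norm_mult flip: ennreal_mult ennreal_plus)
    qed
    finally show "ennreal (norm (w x * (LINT y|lborel. cnj (w y) * complex_of_real (heat_kernel d (x - y)))))
       \<le> (\<integral>\<^sup>+y. ennreal h * (?n x * ?h x y) + ennreal h * (?n y * ?h x y) \<partial>lborel)" .
  qed
  also have "\<dots> = (\<integral>\<^sup>+x. (\<integral>\<^sup>+y. ennreal h * (?n x * ?h x y) \<partial>lborel) \<partial>lborel) + (\<integral>\<^sup>+x. (\<integral>\<^sup>+y. ennreal h * (?n y * ?h x y) \<partial>lborel) \<partial>lborel)"
    by (simp add: nn_integral_add)
  also have "(\<integral>\<^sup>+x. (\<integral>\<^sup>+y. ennreal h * (?n x * ?h x y) \<partial>lborel) \<partial>lborel) = ennreal h * ennreal ((l2_norm lborel w)\<^sup>2)"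
    by (simp add: nn_integral_cmult nn_integral_heat_kernel[OF d] nn_integral_l2_norm[OF sq])
  also have "(\<integral>\<^sup>+x. (\<integral>\<^sup>+y. ennreal h * (?n y * ?h x y) \<partial>lborel) \<partial>lborel)
     = (\<integral>\<^sup>+y. (\<integral>\<^sup>+x. ennreal h * (?n y * ?h x y) \<partial>lborel) \<partial>lborel)"
    by (rule lborel_pair.Fubini'[symmetric]) measurable
  also have "\<dots> = ennreal h * ennreal ((l2_norm lborel w)\<^sup>2)"
    by (subst heat_kernel_minus_commute)
      (simp add: nn_integral_cmult nn_integral_heat_kernel[OF d] nn_integral_l2_norm[OF sq])
  also have "ennreal h * ennreal ((l2_norm lborel w)\<^sup>2) + ennreal h * ennreal ((l2_norm lborel w)\<^sup>2) = ennreal ((l2_norm lborel w)\<^sup>2)"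
    using h(2,3) by (simp flip: ennreal_mult ennreal_plus distrib_right)
  finally show ?thesis by (subst (asm) ennreal_le_iff) auto
qed

lemma gauss_factor_tendsto: "(\<lambda>n. exp (- (1 / real (Suc n)) * r)) \<longlonglongrightarrow> 1"
proof -
  have "(\<lambda>n. exp (- (1 / real (Suc n)) * r)) \<longlonglongrightarrow> exp (- 0 * r)"
    by (intro tendsto_intros LIMSEQ_Suc[OF lim_1_over_n])
  then show ?thesis by simp
qed

text \<open>Fatou's lemma for \<open>d\<close> tending to 0 gives only an inequality. Equality of
  the norms follows once inversion is known, by using the inequality in both directions.\<close>

lemma ft_contraction:
  fixes w :: "'a::euclidean_space \<Rightarrow> complex"
  assumes w: "integrable lborel w" and sq: "sq_int lborel w"
  shows "sq_int lborel (ft w)" "l2_norm lborel (ft w) \<le> l2_norm lborel w"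
proof -
  have [measurable]: "w \<in> borel_measurable borel" using w by auto
  let ?e = "\<lambda>n \<xi>. exp (- (1 / real (Suc n)) * (norm (\<xi>::'a))\<^sup>2)"
  have bd: "(\<integral>\<^sup>+\<xi>. ennreal (?e n \<xi> * (norm (ft w \<xi>))\<^sup>2) \<partial>lborel) \<le> ennreal ((l2_norm lborel w)\<^sup>2)" for n
  proof -
    define B where "B = (2 * pi) powr (- real DIM('a) / 2) * (LINT x|lborel. norm (w x))"
    have B: "norm (ft w \<xi>) \<le> B" for \<xi> unfolding B_def by (rule ft_bounded)
    have int: "integrable lborel (\<lambda>\<xi>. ?e n \<xi> * (norm (ft w \<xi>))\<^sup>2)"
    proof (rule Bochner_Integration.integrable_bound)
      show "integrable lborel (\<lambda>\<xi>. B\<^sup>2 * ?e n \<xi>)" by (intro integrable_mult_right gaussian_integrable) simp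
      show "AE \<xi> in lborel. norm (?e n \<xi> * (norm (ft w \<xi>))\<^sup>2) \<le> norm (B\<^sup>2 * ?e n \<xi>)"
        using B by (auto simp: mult.commute intro!: mult_right_mono power_mono)
    qed measurable
    have "complex_of_real (LINT \<xi>|lborel. ?e n \<xi> * (norm (ft w \<xi>))\<^sup>2) = (LINT \<xi>|lborel. complex_of_real (?e n \<xi> * (norm (ft w \<xi>))\<^sup>2))"
      by (rule integral_complex_of_real[symmetric])
    also have "\<dots> = (LINT \<xi>|lborel. complex_of_real (?e n \<xi>) * (ft w \<xi> * cnj (ft w \<xi>)))"
      by (simp add: complex_norm_square[symmetric])
    also have "\<dots> = (LINT x|lborel. w x * (LINT y|lborel. cnj (w y) * complex_of_real (heat_kernel (1 / real (Suc n)) (x - y))))"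
      by (rule ft_gauss_parseval(1)[OF w w]) simp
    finally have "norm (complex_of_real (LINT \<xi>|lborel. ?e n \<xi> * (norm (ft w \<xi>))\<^sup>2)) \<le> (l2_norm lborel w)\<^sup>2"
      using heat_kernel_quadratic_form[OF w sq, of "1 / real (Suc n)"] by simp
    then have "(LINT \<xi>|lborel. ?e n \<xi> * (norm (ft w \<xi>))\<^sup>2) \<le> (l2_norm lborel w)\<^sup>2" by simp
    then show ?thesis using int by (subst nn_integral_eq_integral) (auto intro!: ennreal_leI)
  qed
  have "(\<integral>\<^sup>+\<xi>. ennreal ((norm (ft w \<xi>))\<^sup>2) \<partial>lborel) = (\<integral>\<^sup>+\<xi>. liminf (\<lambda>n. ennreal (?e n \<xi> * (norm (ft w \<xi>))\<^sup>2)) \<partial>lborel)"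
  proof (rule nn_integral_cong)
    fix \<xi> :: 'a
    have "(\<lambda>n. ennreal (?e n \<xi> * (norm (ft w \<xi>))\<^sup>2)) \<longlonglongrightarrow> ennreal (1 * (norm (ft w \<xi>))\<^sup>2)"
      by (intro tendsto_ennrealI tendsto_mult gauss_factor_tendsto tendsto_const)
    then have "liminf (\<lambda>n. ennreal (?e n \<xi> * (norm (ft w \<xi>))\<^sup>2)) = ennreal (1 * (norm (ft w \<xi>))\<^sup>2)"
      by (intro lim_imp_Liminf) auto
    then show "ennreal ((norm (ft w \<xi>))\<^sup>2) = liminf (\<lambda>n. ennreal (?e n \<xi> * (norm (ft w \<xi>))\<^sup>2))"
      by simp
  qed
  also have "\<dots> \<le> liminf (\<lambda>n. \<integral>\<^sup>+\<xi>. ennreal (?e n \<xi> * (norm (ft w \<xi>))\<^sup>2) \<partial>lborel)"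
    by (rule nn_integral_liminf) measurable
  also have "\<dots> \<le> ennreal ((l2_norm lborel w)\<^sup>2)"
    by (intro Liminf_le always_eventually allI bd) simp
  finally have main: "(\<integral>\<^sup>+\<xi>. ennreal ((norm (ft w \<xi>))\<^sup>2) \<partial>lborel) \<le> ennreal ((l2_norm lborel w)\<^sup>2)" .
  show s: "sq_int lborel (ft w)"
    unfolding sq_int_def
  proof (intro conjI integrableI_bounded)
    show "(\<integral>\<^sup>+\<xi>. ennreal (norm ((norm (ft w \<xi>))\<^sup>2)) \<partial>lborel) < \<infinity>" using main by (simp add: le_less_trans)
  qed measurable
  have "(l2_norm lborel (ft w))\<^sup>2 \<le> (l2_norm lborel w)\<^sup>2"
    using main unfolding nn_integral_l2_norm[OF s] by (subst (asm) ennreal_le_iff) auto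
  then show "l2_norm lborel (ft w) \<le> l2_norm lborel w" by (rule power2_le_imp_le) simp
qed

abbreviation box_fun :: "'a::euclidean_space \<Rightarrow> 'a \<Rightarrow> 'a \<Rightarrow> complex" where
  "box_fun a b x \<equiv> complex_of_real (indicator (box a b) x)"

lemma box_fun_integrable: "integrable lborel (box_fun a b)"
  by (simp add: complex_of_real_integrable_eq emeasure_lborel_box_eq)

lemma box_fun_sq_int: "sq_int lborel (box_fun a b)"
proof -
  have "(\<lambda>x. (norm (box_fun a b x))\<^sup>2) = indicator (box a b)" by (auto split: split_indicator)
  then show ?thesis unfolding sq_int_def by (simp add: emeasure_lborel_box_eq)
qed

text \<open>Boxes suffice as test functions since they generate the Borel sets. They are continuous
  off a null set, so the heat averages of \<open>box_fun a b\<close> converge almost everywhere,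
  with the uniform bound 1.\<close>

lemma ft_parseval_box:
  fixes w :: "'a::euclidean_space \<Rightarrow> complex"
  assumes w: "integrable lborel w" and sq: "sq_int lborel w"
  shows "(LINT \<xi>|lborel. ft w \<xi> * cnj (ft (box_fun a b) \<xi>)) = (LINT x|lborel. w x * box_fun a b x)"
proof (rule LIMSEQ_unique)
  have [measurable]: "w \<in> borel_measurable borel" using w by auto
  let ?e = "\<lambda>n \<xi>. complex_of_real (exp (- (1 / real (Suc n)) * (norm (\<xi>::'a))\<^sup>2))"
  have sq2: "sq_int lborel (\<lambda>\<xi>. cnj (ft (box_fun a b) \<xi>))"
    by (intro sq_int_cnj ft_contraction box_fun_integrable box_fun_sq_int)
  show "(\<lambda>n. LINT \<xi>|lborel. ?e n \<xi> * (ft w \<xi> * cnj (ft (box_fun a b) \<xi>))) \<longlonglongrightarrow> (LINT \<xi>|lborel. ft w \<xi> * cnj (ft (box_fun a b) \<xi>))"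
  proof (rule integral_dominated_convergence[where w = "\<lambda>\<xi>. norm (ft w \<xi> * cnj (ft (box_fun a b) \<xi>))"])
    show "integrable lborel (\<lambda>\<xi>. norm (ft w \<xi> * cnj (ft (box_fun a b) \<xi>)))"
      by (intro integrable_norm l2_mult_integrable ft_contraction w sq sq2)
    show "AE \<xi> in lborel. (\<lambda>n. ?e n \<xi> * (ft w \<xi> * cnj (ft (box_fun a b) \<xi>))) \<longlonglongrightarrow> ft w \<xi> * cnj (ft (box_fun a b) \<xi>)"
    proof (rule AE_I2)
      fix \<xi> :: 'a
      have "(\<lambda>n. ?e n \<xi> * (ft w \<xi> * cnj (ft (box_fun a b) \<xi>))) \<longlonglongrightarrow> complex_of_real 1 * (ft w \<xi> * cnj (ft (box_fun a b) \<xi>))"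
        by (intro tendsto_mult tendsto_of_real gauss_factor_tendsto tendsto_const)
      then show "(\<lambda>n. ?e n \<xi> * (ft w \<xi> * cnj (ft (box_fun a b) \<xi>))) \<longlonglongrightarrow> ft w \<xi> * cnj (ft (box_fun a b) \<xi>)" by simp
    qed
    show "AE \<xi> in lborel. norm (?e n \<xi> * (ft w \<xi> * cnj (ft (box_fun a b) \<xi>))) \<le> norm (ft w \<xi> * cnj (ft (box_fun a b) \<xi>))" for n
      by (auto simp: norm_mult intro!: mult_left_le_one_le)
  qed measurable
  let ?k = "\<lambda>n x. LINT y|lborel. box_fun a b y * complex_of_real (heat_kernel (1 / real (Suc n)) (x - y))"
  have "(\<lambda>n. LINT x|lborel. w x * ?k n x) \<longlonglongrightarrow> (LINT x|lborel. w x * box_fun a b x)"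
  proof (rule integral_dominated_convergence[where w = "\<lambda>x. norm (w x)"])
    \<comment> \<open>The frontier of a convex set is null, so the box function is continuous at
      almost every point.\<close>
    have "AE x in lborel. x \<notin> frontier (box a b)"
      using negligible_convex_frontier[OF convex_box(2)[of a b]]
      by (subst AE_iff_null_sets[symmetric, where N = "frontier (box a b)"])
        (auto simp: negligible_iff_null_sets null_sets_completion_iff[symmetric])
    then show "AE x in lborel. (\<lambda>n. w x * ?k n x) \<longlonglongrightarrow> w x * box_fun a b x"
    proof eventually_elim
      case (elim x)
      then have c: "isCont (\<lambda>x. box_fun a b x) x" by (intro continuous_of_real) (simp add: isCont_indicator)
      show ?case
        by (intro tendsto_mult tendsto_const heat_kernel_approx[where B = 1] c) (auto split: split_indicator)
    qed
    show "AE x in lborel. norm (w x * ?k n x) \<le> norm (w x)" for n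
    proof (rule AE_I2)
      fix x :: 'a
      have "integrable lborel (\<lambda>y. heat_kernel (1 / real (Suc n)) (x - y))" "(LINT y|lborel. heat_kernel (1 / real (Suc n)) (x - y)) = 1"
        using nn_integral_heat_kernel[of "1 / real (Suc n)" x]
        by (auto intro!: integrableI_nonneg simp: integral_eq_nn_integral)
      note hk = this
      have "norm (?k n x) \<le> (LINT y|lborel. norm (box_fun a b y * complex_of_real (heat_kernel (1 / real (Suc n)) (x - y))))"
        by (rule integral_norm_bound)
      also have "\<dots> \<le> (LINT y|lborel. heat_kernel (1 / real (Suc n)) (x - y))"
      proof (rule integral_mono_AE'[OF hk(1)])
        show "AE y in lborel. norm (box_fun a b y * complex_of_real (heat_kernel (1 / real (Suc n)) (x - y))) \<le> heat_kernel (1 / real (Suc n)) (x - y)"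
          by (auto simp: norm_mult split: split_indicator)
      qed auto
      finally have "norm (?k n x) \<le> 1" using hk(2) by simp
      then show "norm (w x * ?k n x) \<le> norm (w x)" by (simp add: norm_mult mult_left_le)
    qed
  qed (use w in auto)
  moreover have "(LINT \<xi>|lborel. ?e n \<xi> * (ft w \<xi> * cnj (ft (box_fun a b) \<xi>))) = (LINT x|lborel. w x * ?k n x)" for n
    using ft_gauss_parseval(1)[OF w box_fun_integrable[of a b], of "1 / real (Suc n)"] by simp
  ultimately show "(\<lambda>n. LINT \<xi>|lborel. ?e n \<xi> * (ft w \<xi> * cnj (ft (box_fun a b) \<xi>))) \<longlonglongrightarrow> (LINT x|lborel. w x * box_fun a b x)" by simp
qed

section \<open>Extension to square integrable functions by truncation\<close>

definition trunc :: "real \<Rightarrow> ('a::euclidean_space \<Rightarrow> complex) \<Rightarrow> 'a \<Rightarrow> complex" where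
  "trunc R w x = indicat_real (cball 0 R) x *\<^sub>R w x"

lemma trunc_measurable [measurable]:
  "w \<in> borel_measurable borel \<Longrightarrow> trunc R w \<in> borel_measurable borel"
  unfolding trunc_def by (intro borel_measurable_scaleR borel_measurable_indicator) (auto simp: borel_closed)

lemma trunc_norm_le: "norm (trunc R w x) \<le> norm (w x)"
  by (simp add: trunc_def split: split_indicator)

lemma trunc_sq_int: "sq_int lborel w \<Longrightarrow> sq_int lborel (trunc R w)"
  by (rule sq_int_bound[where C = 1]) (auto simp: trunc_norm_le sq_int_def)

text \<open>On a ball |w| is at most 1 + |w|^2, and both terms are integrable there.\<close>

lemma trunc_integrable:
  fixes w :: "'a::euclidean_space \<Rightarrow> complex"
  assumes w: "sq_int lborel w"
  shows "integrable lborel (trunc R w)"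
proof (rule Bochner_Integration.integrable_bound)
  show "integrable lborel (\<lambda>x. indicat_real (cball (0::'a) R) x + (norm (w x))\<^sup>2)"
    using w by (intro Bochner_Integration.integrable_add integrable_real_indicator)
      (use w emeasure_bounded_finite[OF bounded_cball, of "0::'a" R] in \<open>auto simp: sq_int_def\<close>)
  show "AE x in lborel. norm (trunc R w x) \<le> norm (indicat_real (cball 0 R) x + (norm (w x))\<^sup>2)"
  proof (rule AE_I2)
    fix x
    have "norm (w x) \<le> 1 + (norm (w x))\<^sup>2"
      using sum_squares_bound[of "norm (w x)" 1] by (simp add: power2_eq_square) (smt (verit) norm_ge_zero)
    then show "norm (trunc R w x) \<le> norm (indicat_real (cball 0 R) x + (norm (w x))\<^sup>2)"
      by (simp add: trunc_def split: split_indicator)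
  qed
qed (use w in \<open>auto simp: sq_int_def\<close>)

lemma trunc_tendsto_nat:
  fixes w :: "'a::euclidean_space \<Rightarrow> complex"
  assumes w: "sq_int lborel w"
  shows "(\<lambda>n. l2_norm lborel (\<lambda>x. trunc (real n) w x - w x)) \<longlonglongrightarrow> 0"
proof (rule l2_dominated_convergence[OF _ _ w, where C = 1])
  show "AE x in lborel. (\<lambda>n. trunc (real n) w x) \<longlonglongrightarrow> w x"
  proof (rule AE_I2, rule tendsto_eventually)
    fix x :: 'a
    obtain N :: nat where N: "norm x \<le> real N" using real_arch_simple by blast
    show "\<forall>\<^sub>F n in sequentially. trunc (real n) w x = w x"
      using eventually_ge_at_top[of N] by eventually_elim (use N in \<open>auto simp: trunc_def\<close>)
  qed
qed (use w in \<open>auto simp: sq_int_def trunc_norm_le\<close>)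

text \<open>Truncations at radii beyond \<open>N\<close> differ from \<open>w\<close> only where
  \<open>trunc N w\<close> vanishes, so the tail at \<open>N\<close> controls all larger real radii
  at once.\<close>

lemma trunc_dist_mono:
  fixes w :: "'a::euclidean_space \<Rightarrow> complex"
  assumes w: "sq_int lborel w" and le: "N \<le> m" "N \<le> n"
  shows "l2_norm lborel (\<lambda>x. trunc m w x - trunc n w x) \<le> l2_norm lborel (\<lambda>x. trunc N w x - w x)"
    "l2_norm lborel (\<lambda>x. trunc m w x - w x) \<le> l2_norm lborel (\<lambda>x. trunc N w x - w x)"
proof -
  have s: "sq_int lborel (\<lambda>x. trunc N w x - w x)" by (intro sq_int_diff trunc_sq_int w)
  have [measurable]: "w \<in> borel_measurable borel" using w by (auto simp: sq_int_def)
  have "l2_norm lborel (\<lambda>x. trunc m w x - trunc n w x) \<le> 1 * l2_norm lborel (\<lambda>x. trunc N w x - w x)"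
  proof (rule l2_norm_bound[OF s])
    show "AE x in lborel. norm (trunc m w x - trunc n w x) \<le> 1 * norm (trunc N w x - w x)"
      using le by (auto simp: trunc_def split: split_indicator)
  qed simp_all
  then show "l2_norm lborel (\<lambda>x. trunc m w x - trunc n w x) \<le> l2_norm lborel (\<lambda>x. trunc N w x - w x)" by simp
  have "l2_norm lborel (\<lambda>x. trunc m w x - w x) \<le> 1 * l2_norm lborel (\<lambda>x. trunc N w x - w x)"
  proof (rule l2_norm_bound[OF s])
    show "AE x in lborel. norm (trunc m w x - w x) \<le> 1 * norm (trunc N w x - w x)"
      using le by (auto simp: trunc_def split: split_indicator)
  qed simp_all
  then show "l2_norm lborel (\<lambda>x. trunc m w x - w x) \<le> l2_norm lborel (\<lambda>x. trunc N w x - w x)" by simp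
qed

lemma trunc_close:
  fixes w :: "'a::euclidean_space \<Rightarrow> complex"
  assumes w: "sq_int lborel w" and e: "e > 0"
  shows "\<exists>N::nat. l2_norm lborel (\<lambda>x. trunc (real N) w x - w x) < e"
  using order_tendstoD(2)[OF trunc_tendsto_nat[OF w] e] by (auto simp: eventually_at_top_linorder)

lemma trunc_tendsto:
  fixes w :: "'a::euclidean_space \<Rightarrow> complex"
  assumes w: "sq_int lborel w"
  shows "((\<lambda>R. l2_norm lborel (\<lambda>x. trunc R w x - w x)) \<longlongrightarrow> 0) at_top"
proof (rule tendstoI)
  fix e :: real assume "e > 0"
  then obtain N :: nat where N: "l2_norm lborel (\<lambda>x. trunc (real N) w x - w x) < e" using trunc_close[OF w] by blast
  show "\<forall>\<^sub>F R in at_top. dist (l2_norm lborel (\<lambda>x. trunc R w x - w x)) 0 < e"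
    using eventually_ge_at_top[of "real N"]
  proof eventually_elim
    case (elim R)
    show ?case using le_less_trans[OF trunc_dist_mono(2)[OF w elim elim] N] by simp
  qed
qed

text \<open>The real-valued norm is unambiguous here because the transform of a truncation is square
  integrable (\<open>ft_trunc_sq_int\<close>); the link with the extended-valued definition is
  \<open>has_fourier_borel_iff\<close>.\<close>

definition is_ft :: "('a::euclidean_space \<Rightarrow> complex) \<Rightarrow> ('a \<Rightarrow> complex) \<Rightarrow> bool" where
  "is_ft w g \<longleftrightarrow> sq_int lborel w \<and> sq_int lborel g \<and>
     ((\<lambda>R. l2_norm lborel (\<lambda>\<xi>. ft (trunc R w) \<xi> - g \<xi>)) \<longlongrightarrow> 0) at_top"

lemma ft_trunc_sq_int: "sq_int lborel w \<Longrightarrow> sq_int lborel (ft (trunc R w))"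
  by (intro ft_contraction trunc_integrable trunc_sq_int)

lemma is_ft_exists:
  fixes w :: "'a::euclidean_space \<Rightarrow> complex"
  assumes w: "sq_int lborel w"
  shows "\<exists>g. is_ft w g"
proof -
  have "\<exists>g. sq_int lborel g \<and> ((\<lambda>R. l2_norm lborel (\<lambda>x. ft (trunc R w) x - g x)) \<longlongrightarrow> 0) at_top"
  proof (rule l2_complete_at_top)
    show "sq_int lborel (ft (trunc R w))" for R by (rule ft_trunc_sq_int[OF w])
    fix e :: real assume "e > 0"
    then obtain N :: nat where N: "l2_norm lborel (\<lambda>x. trunc (real N) w x - w x) < e" using trunc_close[OF w] by blast
    have "l2_norm lborel (\<lambda>x. ft (trunc m w) x - ft (trunc n w) x) < e" if "m \<ge> real N" "n \<ge> real N" for m n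
    proof -
      have "ft (\<lambda>x. trunc m w x - trunc n w x) = (\<lambda>x. ft (trunc m w) x - ft (trunc n w) x)"
        by (intro ext ft_diff trunc_integrable w)
      then have "l2_norm lborel (\<lambda>x. ft (trunc m w) x - ft (trunc n w) x) = l2_norm lborel (ft (\<lambda>x. trunc m w x - trunc n w x))"
        by simp
      also have "\<dots> \<le> l2_norm lborel (\<lambda>x. trunc m w x - trunc n w x)"
        by (intro ft_contraction sq_int_diff trunc_sq_int w Bochner_Integration.integrable_diff trunc_integrable)
      also have "\<dots> < e" using trunc_dist_mono(1)[OF w that] N by linarith
      finally show ?thesis .
    qed
    then show "\<exists>N. \<forall>m\<ge>N. \<forall>n\<ge>N. l2_norm lborel (\<lambda>x. ft (trunc m w) x - ft (trunc n w) x) < e" by blast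
  qed
  then show ?thesis using w by (auto simp: is_ft_def)
qed

lemma is_ft_sq_int: "is_ft w g \<Longrightarrow> sq_int lborel w" "is_ft w g \<Longrightarrow> sq_int lborel g"
  by (auto simp: is_ft_def)

lemma is_ft_tendsto: "is_ft w g \<Longrightarrow> ((\<lambda>R. l2_norm lborel (\<lambda>\<xi>. ft (trunc R w) \<xi> - g \<xi>)) \<longlongrightarrow> 0) at_top"
  by (auto simp: is_ft_def)

lemma is_ft_norm_le:
  assumes "is_ft w g"
  shows "l2_norm lborel g \<le> l2_norm lborel w"
proof (rule tendsto_upperbound)
  note s = is_ft_sq_int[OF assms]
  show "((\<lambda>R. l2_norm lborel (ft (trunc R w))) \<longlongrightarrow> l2_norm lborel g) at_top"
    by (rule l2_norm_tendsto[OF ft_trunc_sq_int[OF s(1)] s(2) is_ft_tendsto[OF assms]])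
  have "l2_norm lborel (ft (trunc R w)) \<le> l2_norm lborel w" for R
  proof -
    have "l2_norm lborel (ft (trunc R w)) \<le> l2_norm lborel (trunc R w)"
      by (intro ft_contraction trunc_integrable trunc_sq_int s)
    also have "\<dots> \<le> 1 * l2_norm lborel w"
      by (rule l2_norm_bound[OF s(1)]) (use s in \<open>auto simp: trunc_norm_le sq_int_def\<close>)
    finally show ?thesis by simp
  qed
  then show "\<forall>\<^sub>F R in at_top. l2_norm lborel (ft (trunc R w)) \<le> l2_norm lborel w" by simp
qed simp

lemma is_ft_unique:
  assumes "is_ft w g" "is_ft w g'"
  shows "AE \<xi> in lborel. g \<xi> = g' \<xi>"
proof -
  note s = is_ft_sq_int[OF assms(1)] is_ft_sq_int[OF assms(2)]
  have "((\<lambda>R. l2_norm lborel (\<lambda>\<xi>. ft (trunc R w) \<xi> - g \<xi>) + l2_norm lborel (\<lambda>\<xi>. ft (trunc R w) \<xi> - g' \<xi>)) \<longlongrightarrow> 0 + 0) at_top"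
    by (intro tendsto_add is_ft_tendsto assms)
  then have "l2_norm lborel (\<lambda>\<xi>. g \<xi> - g' \<xi>) \<le> 0 + 0"
  proof (rule tendsto_lowerbound)
    show "\<forall>\<^sub>F R in at_top. l2_norm lborel (\<lambda>\<xi>. g \<xi> - g' \<xi>) \<le> l2_norm lborel (\<lambda>\<xi>. ft (trunc R w) \<xi> - g \<xi>) + l2_norm lborel (\<lambda>\<xi>. ft (trunc R w) \<xi> - g' \<xi>)"
      using l2_norm_triangle_diff[OF s(2) ft_trunc_sq_int[OF s(1)] s(4)] by (auto simp: l2_norm_minus_commute[of _ g])
  qed simp
  then have "l2_norm lborel (\<lambda>\<xi>. g \<xi> - g' \<xi>) = 0" using l2_norm_nonneg[of lborel "\<lambda>\<xi>. g \<xi> - g' \<xi>"] by linarith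
  then have "AE \<xi> in lborel. g \<xi> - g' \<xi> = 0" by (intro l2_norm_eq_0_imp_AE sq_int_diff s)
  then show ?thesis by simp
qed

text \<open>The symmetry of the transform, extended in two stages: first \<open>w\<close> is
  approximated by truncations while \<open>v\<close> is still truncated, then
  \<open>v\<close>.\<close>

lemma is_ft_mult_formula:
  assumes 1: "is_ft w g" and 2: "is_ft v h"
  shows "(LINT x|lborel. g x * v x) = (LINT x|lborel. w x * h x)"
proof -
  note s = is_ft_sq_int[OF 1] is_ft_sq_int[OF 2]
  have t: "(LINT x|lborel. g x * trunc S v x) = (LINT x|lborel. w x * ft (trunc S v) x)" for S
  proof (rule tendsto_unique[OF trivial_limit_at_top_linorder])
    show "((\<lambda>R. LINT x|lborel. ft (trunc R w) x * trunc S v x) \<longlongrightarrow> (LINT x|lborel. g x * trunc S v x)) at_top"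
      by (rule l2_mult_tendsto[OF ft_trunc_sq_int[OF s(1)] s(2) trunc_sq_int[OF s(3)] is_ft_tendsto[OF 1]])
    have "((\<lambda>R. LINT x|lborel. trunc R w x * ft (trunc S v) x) \<longlongrightarrow> (LINT x|lborel. w x * ft (trunc S v) x)) at_top"
      by (rule l2_mult_tendsto[OF trunc_sq_int[OF s(1)] s(1) ft_trunc_sq_int[OF s(3)] trunc_tendsto[OF s(1)]])
    then show "((\<lambda>R. LINT x|lborel. ft (trunc R w) x * trunc S v x) \<longlongrightarrow> (LINT x|lborel. w x * ft (trunc S v) x)) at_top"
      by (simp add: ft_mult_formula trunc_integrable s)
  qed
  show ?thesis
  proof (rule tendsto_unique[OF trivial_limit_at_top_linorder])
    have "((\<lambda>R. LINT x|lborel. trunc R v x * g x) \<longlongrightarrow> (LINT x|lborel. v x * g x)) at_top"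
      by (rule l2_mult_tendsto[OF trunc_sq_int[OF s(3)] s(3) s(2) trunc_tendsto[OF s(3)]])
    then show "((\<lambda>R. LINT x|lborel. g x * trunc R v x) \<longlongrightarrow> (LINT x|lborel. g x * v x)) at_top"
      by (simp add: mult.commute)
    have "((\<lambda>R. LINT x|lborel. ft (trunc R v) x * w x) \<longlongrightarrow> (LINT x|lborel. h x * w x)) at_top"
      by (rule l2_mult_tendsto[OF ft_trunc_sq_int[OF s(3)] s(4) s(1) is_ft_tendsto[OF 2]])
    then show "((\<lambda>R. LINT x|lborel. g x * trunc R v x) \<longlongrightarrow> (LINT x|lborel. w x * h x)) at_top"
      by (simp add: t mult.commute)
  qed
qed

lemma is_ft_integrable:
  assumes w: "integrable lborel w" and s: "sq_int lborel w"
  shows "is_ft w (ft w)"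
  unfolding is_ft_def
proof (intro conjI s ft_contraction w)
  show "((\<lambda>R. l2_norm lborel (\<lambda>\<xi>. ft (trunc R w) \<xi> - ft w \<xi>)) \<longlongrightarrow> 0) at_top"
  proof (rule Lim_null_comparison[OF _ trunc_tendsto[OF s]], rule always_eventually, rule allI)
    fix R
    have "ft (\<lambda>x. trunc R w x - w x) = (\<lambda>x. ft (trunc R w) x - ft w x)"
      by (intro ext ft_diff trunc_integrable s w)
    then have "l2_norm lborel (\<lambda>\<xi>. ft (trunc R w) \<xi> - ft w \<xi>) = l2_norm lborel (ft (\<lambda>x. trunc R w x - w x))"
      by simp
    also have "\<dots> \<le> l2_norm lborel (\<lambda>x. trunc R w x - w x)"
      by (intro ft_contraction sq_int_diff trunc_sq_int s w Bochner_Integration.integrable_diff trunc_integrable)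
    finally show "norm (l2_norm lborel (\<lambda>\<xi>. ft (trunc R w) \<xi> - ft w \<xi>)) \<le> l2_norm lborel (\<lambda>x. trunc R w x - w x)" by simp
  qed
qed

section \<open>Parseval against boxes, inversion and isometry\<close>

lemma is_ft_parseval_box:
  assumes 1: "is_ft w g"
  shows "(LINT \<xi>|lborel. g \<xi> * cnj (ft (box_fun a b) \<xi>)) = (LINT x|lborel. w x * box_fun a b x)"
proof (rule tendsto_unique[OF trivial_limit_at_top_linorder])
  note s = is_ft_sq_int[OF 1]
  have sb: "sq_int lborel (\<lambda>\<xi>. cnj (ft (box_fun a b) \<xi>))"
    by (intro sq_int_cnj ft_contraction box_fun_integrable box_fun_sq_int)
  show "((\<lambda>R. LINT \<xi>|lborel. ft (trunc R w) \<xi> * cnj (ft (box_fun a b) \<xi>)) \<longlongrightarrow> (LINT \<xi>|lborel. g \<xi> * cnj (ft (box_fun a b) \<xi>))) at_top"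
    by (rule l2_mult_tendsto[OF ft_trunc_sq_int[OF s(1)] s(2) sb is_ft_tendsto[OF 1]])
  have "((\<lambda>R. LINT x|lborel. trunc R w x * box_fun a b x) \<longlongrightarrow> (LINT x|lborel. w x * box_fun a b x)) at_top"
    by (rule l2_mult_tendsto[OF trunc_sq_int[OF s(1)] s(1) box_fun_sq_int trunc_tendsto[OF s(1)]])
  then show "((\<lambda>R. LINT \<xi>|lborel. ft (trunc R w) \<xi> * cnj (ft (box_fun a b) \<xi>)) \<longlongrightarrow> (LINT x|lborel. w x * box_fun a b x)) at_top"
    by (simp add: ft_parseval_box trunc_integrable trunc_sq_int s)
qed

text \<open>\<open>AE_eq_0_generator\<close> asks for integrability on the whole space, so it is
  applied to the restrictions of \<open>f\<close> to the growing boxes \<open>?B n\<close>. Boxes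
  are closed under intersection, which keeps all test integrals of the assumed form.\<close>

lemma AE_eq_0_boxes_real:
  fixes f :: "'a::euclidean_space \<Rightarrow> real"
  assumes int: "\<And>a b. integrable lborel (\<lambda>x. indicator (box a b) x * f x)"
    and zero: "\<And>a b. (LINT x|lborel. indicator (box a b) x * f x) = 0"
  shows "AE x in lborel. f x = 0"
proof -
  let ?B = "\<lambda>n. box (- (real n *\<^sub>R One)) (real n *\<^sub>R One) :: 'a set"
  have *: "indicator (box a b) x * (indicator (box c d) x * f x) = indicator (box a b \<inter> box c d) x * f x" for a b c d x
    by (auto split: split_indicator)
  have "AE x in lborel. indicator (?B n) x * f x = 0" for n
  proof (rule AE_eq_0_generator[where G = "range (\<lambda>(a, b). box a b)"])
    show "sets lborel = sigma_sets (space lborel) (range (\<lambda>(a, b). box a b :: 'a set))"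
      by (simp add: borel_eq_box)
    show "Int_stable (range (\<lambda>(a, b). box a b :: 'a set))"
      by (auto simp: Int_stable_def box_Int_box)
    show "(LINT x|lborel. indicator A x * (indicator (?B n) x * f x)) = 0"
      if "A \<in> range (\<lambda>(a, b). box a b)" for A
      using that by (auto simp: * box_Int_box zero)
  qed (auto simp: int zero)
  then have "AE x in lborel. \<forall>n. indicator (?B n) x * f x = 0" by (subst AE_all_countable) auto
  then show ?thesis
  proof eventually_elim
    case (elim x)
    obtain n :: nat where n: "norm x < real n" using reals_Archimedean2 by blast
    have "x \<in> ?B n"
    proof -
      have "\<bar>x \<bullet> b\<bar> < real n" if "b \<in> Basis" for b using Basis_le_norm[OF that, of x] n by linarith
      moreover have "One \<bullet> b = 1" if "b \<in> Basis" for b :: 'a using that by (simp add: inner_sum_left inner_Basis)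
      ultimately have "- (real n) < x \<bullet> b \<and> x \<bullet> b < real n \<and> One \<bullet> b = 1" if "b \<in> Basis" for b
        using that by (smt (verit))
      then show ?thesis by (auto simp: mem_box)
    qed
    then show ?case using elim[rule_format, of n] by simp
  qed
qed

lemma AE_eq_0_boxes:
  fixes u :: "'a::euclidean_space \<Rightarrow> complex"
  assumes u: "sq_int lborel u" and zero: "\<And>a b. (LINT x|lborel. u x * box_fun a b x) = 0"
  shows "AE x in lborel. u x = 0"
proof -
  have int: "integrable lborel (\<lambda>x. u x * box_fun a b x)" for a b
    by (intro l2_mult_integrable u box_fun_sq_int)
  have "AE x in lborel. Re (u x) = 0"
  proof (rule AE_eq_0_boxes_real)
    fix a b :: 'a
    have eq: "indicator (box a b) x * Re (u x) = Re (u x * box_fun a b x)" for x by simp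
    show "integrable lborel (\<lambda>x. indicator (box a b) x * Re (u x))" unfolding eq by (rule integrable_Re[OF int])
    show "(LINT x|lborel. indicator (box a b) x * Re (u x)) = 0" unfolding eq by (subst integral_Re[OF int]) (simp only: zero zero_complex.sel)
  qed
  moreover have "AE x in lborel. Im (u x) = 0"
  proof (rule AE_eq_0_boxes_real)
    fix a b :: 'a
    have eq: "indicator (box a b) x * Im (u x) = Im (u x * box_fun a b x)" for x by simp
    show "integrable lborel (\<lambda>x. indicator (box a b) x * Im (u x))" unfolding eq by (rule integrable_Im[OF int])
    show "(LINT x|lborel. indicator (box a b) x * Im (u x)) = 0" unfolding eq by (subst integral_Im[OF int]) (simp only: zero zero_complex.sel)
  qed
  ultimately show ?thesis by eventually_elim (simp add: complex_eq_iff)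
qed

text \<open>Inversion in the form F (conj (F w)) = conj w. Tested against a box, the symmetry of the
  transform moves F onto the box, and conjugation gives the Parseval pairing of \<open>g\<close>
  with that box. The conjugates spare a separate treatment of the inverse transform.\<close>

lemma is_ft_cnj_inverse:
  assumes 1: "is_ft w g" and 2: "is_ft (\<lambda>\<xi>. cnj (g \<xi>)) h"
  shows "AE x in lborel. h x = cnj (w x)"
proof -
  note s = is_ft_sq_int[OF 1] is_ft_sq_int[OF 2]
  have "AE x in lborel. h x - cnj (w x) = 0"
  proof (rule AE_eq_0_boxes)
    show "sq_int lborel (\<lambda>x. h x - cnj (w x))" by (intro sq_int_diff sq_int_cnj s)
    fix a b
    have "(LINT x|lborel. h x * box_fun a b x) = (LINT x|lborel. cnj (g x) * ft (box_fun a b) x)"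
      by (rule is_ft_mult_formula[OF 2 is_ft_integrable[OF box_fun_integrable box_fun_sq_int]])
    also have "\<dots> = (LINT x|lborel. cnj (g x * cnj (ft (box_fun a b) x)))" by simp
    also have "\<dots> = cnj (LINT x|lborel. w x * box_fun a b x)"
      by (simp only: Bochner_Integration.integral_cnj is_ft_parseval_box[OF 1])
    also have "\<dots> = (LINT x|lborel. cnj (w x * box_fun a b x))" by (rule Bochner_Integration.integral_cnj[symmetric])
    also have "\<dots> = (LINT x|lborel. cnj (w x) * box_fun a b x)" by simp
    finally have "(LINT x|lborel. h x * box_fun a b x) = (LINT x|lborel. cnj (w x) * box_fun a b x)" .
    then show "(LINT x|lborel. (h x - cnj (w x)) * box_fun a b x) = 0"
      by (simp only: left_diff_distrib) (subst Bochner_Integration.integral_diff, auto intro!: l2_mult_integrable s sq_int_cnj box_fun_sq_int)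
  qed
  then show ?thesis by simp
qed

lemma is_ft_cong_AE:
  assumes 1: "is_ft w g" and w: "AE x in lborel. w x = w' x" "w' \<in> borel_measurable borel"
    and g: "AE x in lborel. g x = g' x" "g' \<in> borel_measurable borel"
  shows "is_ft w' g'"
proof -
  note s = is_ft_sq_int[OF 1]
  have [measurable]: "w \<in> borel_measurable borel" "g \<in> borel_measurable borel" using s by (auto simp: sq_int_def)
  note [measurable] = w(2) g(2)
  have "ft (trunc R w) \<xi> = ft (trunc R w') \<xi>" for R \<xi>
  proof -
    have "(LINT x|lborel. trunc R w x * exp (- \<i> * complex_of_real (x \<bullet> \<xi>))) = (LINT x|lborel. trunc R w' x * exp (- \<i> * complex_of_real (x \<bullet> \<xi>)))"
    proof (rule integral_cong_AE)
      show "AE x in lborel. trunc R w x * exp (- \<i> * complex_of_real (x \<bullet> \<xi>)) = trunc R w' x * exp (- \<i> * complex_of_real (x \<bullet> \<xi>))"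
        using w(1) by eventually_elim (simp add: trunc_def)
    qed simp_all
    then show ?thesis by (simp add: ft_def)
  qed
  moreover have "l2_norm lborel (\<lambda>\<xi>. ft (trunc R w') \<xi> - g \<xi>) = l2_norm lborel (\<lambda>\<xi>. ft (trunc R w') \<xi> - g' \<xi>)" for R
    by (intro l2_norm_cong_AE) (use g(1) in auto)
  moreover have "sq_int lborel w'" by (rule sq_int_bound[OF s(1), where C = 1]) (use w in auto)
  moreover have "sq_int lborel g'" by (rule sq_int_bound[OF s(2), where C = 1]) (use g in auto)
  ultimately show ?thesis using 1 by (simp add: is_ft_def)
qed

lemma is_ft_cnj:
  assumes "is_ft w g"
  shows "is_ft (\<lambda>\<xi>. cnj (g \<xi>)) (\<lambda>x. cnj (w x))"
proof -
  note s = is_ft_sq_int[OF assms]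
  obtain h where h: "is_ft (\<lambda>\<xi>. cnj (g \<xi>)) h" using is_ft_exists[OF sq_int_cnj[OF s(2)]] by blast
  show ?thesis
    by (rule is_ft_cong_AE[OF h]) (use is_ft_cnj_inverse[OF assms h] s in \<open>auto simp: sq_int_def\<close>)
qed

lemma is_ft_surj:
  assumes "sq_int lborel g" shows "\<exists>w. is_ft w g"
proof -
  obtain h where "is_ft (\<lambda>\<xi>. cnj (g \<xi>)) h" using is_ft_exists[OF sq_int_cnj[OF assms]] by blast
  from is_ft_cnj[OF this] show ?thesis by auto
qed

text \<open>The transform and, by \<open>is_ft_cnj\<close>, its inverse are both
  contractions.\<close>

lemma is_ft_norm_eq:
  assumes "is_ft w g" shows "l2_norm lborel g = l2_norm lborel w"
proof (rule antisym)
  show "l2_norm lborel g \<le> l2_norm lborel w" by (rule is_ft_norm_le[OF assms])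
  have "l2_norm lborel (\<lambda>x. cnj (w x)) \<le> l2_norm lborel (\<lambda>x. cnj (g x))" by (rule is_ft_norm_le[OF is_ft_cnj[OF assms]])
  then show "l2_norm lborel w \<le> l2_norm lborel g" by (simp add: l2_norm_def)
qed

lemma is_ft_inj:
  assumes "is_ft w g" "is_ft w' g"
  shows "AE x in lborel. w x = w' x"
  using is_ft_unique[OF is_ft_cnj[OF assms(1)] is_ft_cnj[OF assms(2)]] by simp

lemma is_ft_add:
  assumes 1: "is_ft w g" and 2: "is_ft v h"
  shows "is_ft (\<lambda>x. w x + v x) (\<lambda>x. g x + h x)"
  unfolding is_ft_def
proof (intro conjI sq_int_add)
  note s = is_ft_sq_int[OF 1] is_ft_sq_int[OF 2]
  show "sq_int lborel w" "sq_int lborel v" "sq_int lborel g" "sq_int lborel h" by fact+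
  have tr: "trunc R (\<lambda>x. w x + v x) = (\<lambda>x. trunc R w x + trunc R v x)" for R
    by (auto simp: trunc_def algebra_simps)
  show "((\<lambda>R. l2_norm lborel (\<lambda>\<xi>. ft (trunc R (\<lambda>x. w x + v x)) \<xi> - (g \<xi> + h \<xi>))) \<longlongrightarrow> 0) at_top"
  proof (rule Lim_null_comparison[OF always_eventually, rule_format])
    fix R
    have "l2_norm lborel (\<lambda>\<xi>. ft (trunc R (\<lambda>x. w x + v x)) \<xi> - (g \<xi> + h \<xi>))
      = l2_norm lborel (\<lambda>\<xi>. (ft (trunc R w) \<xi> - g \<xi>) + (ft (trunc R v) \<xi> - h \<xi>))"
      unfolding tr by (subst ft_add[OF trunc_integrable[OF s(1)] trunc_integrable[OF s(3)]]) (simp add: algebra_simps)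
    also have "\<dots> \<le> l2_norm lborel (\<lambda>\<xi>. ft (trunc R w) \<xi> - g \<xi>) + l2_norm lborel (\<lambda>\<xi>. ft (trunc R v) \<xi> - h \<xi>)"
      by (intro l2_norm_triangle sq_int_diff ft_trunc_sq_int s)
    finally show "norm (l2_norm lborel (\<lambda>\<xi>. ft (trunc R (\<lambda>x. w x + v x)) \<xi> - (g \<xi> + h \<xi>)))
       \<le> l2_norm lborel (\<lambda>\<xi>. ft (trunc R w) \<xi> - g \<xi>) + l2_norm lborel (\<lambda>\<xi>. ft (trunc R v) \<xi> - h \<xi>)" by simp
  next
    have "((\<lambda>R. l2_norm lborel (\<lambda>\<xi>. ft (trunc R w) \<xi> - g \<xi>) + l2_norm lborel (\<lambda>\<xi>. ft (trunc R v) \<xi> - h \<xi>)) \<longlongrightarrow> 0 + 0) at_top"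
      by (intro tendsto_add is_ft_tendsto 1 2)
    then show "((\<lambda>R. l2_norm lborel (\<lambda>\<xi>. ft (trunc R w) \<xi> - g \<xi>) + l2_norm lborel (\<lambda>\<xi>. ft (trunc R v) \<xi> - h \<xi>)) \<longlongrightarrow> 0) at_top" by simp
  qed
qed

lemma is_ft_cmult:
  assumes 1: "is_ft w g"
  shows "is_ft (\<lambda>x. c * w x) (\<lambda>x. c * g x)"
  unfolding is_ft_def
proof (intro conjI sq_int_cmult is_ft_sq_int[OF 1])
  have tr: "trunc R (\<lambda>x. c * w x) = (\<lambda>x. c * trunc R w x)" for R
    by (auto simp: trunc_def)
  have "((\<lambda>R. norm c * l2_norm lborel (\<lambda>\<xi>. ft (trunc R w) \<xi> - g \<xi>)) \<longlongrightarrow> norm c * 0) at_top"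
    by (intro tendsto_mult tendsto_const is_ft_tendsto 1)
  moreover have "l2_norm lborel (\<lambda>\<xi>. ft (trunc R (\<lambda>x. c * w x)) \<xi> - c * g \<xi>) = norm c * l2_norm lborel (\<lambda>\<xi>. ft (trunc R w) \<xi> - g \<xi>)" for R
    unfolding tr ft_cmult by (subst l2_norm_cmult[symmetric]) (simp add: algebra_simps)
  ultimately show "((\<lambda>R. l2_norm lborel (\<lambda>\<xi>. ft (trunc R (\<lambda>x. c * w x)) \<xi> - c * g \<xi>)) \<longlongrightarrow> 0) at_top" by simp
qed

text \<open>By inversion the conjugate of \<open>w\<close> is the classical transform of the
  conjugate of \<open>g\<close>, and a classical transform is bounded by the L^1 norm.\<close>

lemma is_ft_sup_bound:
  fixes w :: "'a::euclidean_space \<Rightarrow> complex"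
  assumes 1: "is_ft w g" and g: "integrable lborel g"
  shows "AE x in lborel. norm (w x) \<le> (2 * pi) powr (- real DIM('a) / 2) * (LINT \<xi>|lborel. norm (g \<xi>))"
proof -
  note s = is_ft_sq_int[OF 1]
  have "AE x in lborel. cnj (w x) = ft (\<lambda>\<xi>. cnj (g \<xi>)) x"
    by (rule is_ft_unique[OF is_ft_cnj[OF 1] is_ft_integrable]) (use g s sq_int_cnj in auto)
  then show ?thesis
  proof eventually_elim
    case (elim x)
    have "norm (w x) = norm (ft (\<lambda>\<xi>. cnj (g \<xi>)) x)" by (subst elim[symmetric]) simp
    then show ?case using ft_bounded[of "\<lambda>\<xi>. cnj (g \<xi>)" x] by simp
  qed
qed

section \<open>The spaces \<open>L\<^sup>2\<close>, \<open>H\<^sup>2\<close> and \<open>L\<^sup>\<infinity>\<close>\<close>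

lemma L2_fun_sq_int: "L2_fun f \<longleftrightarrow> sq_int lebesgue f"
  by (simp add: L2_fun_def sq_int_def)

lemma L2_norm_l2_norm: "L2_norm f = l2_norm lebesgue f"
  by (simp add: L2_norm_def l2_norm_def)

lemma sq_int_lebesgue_iff: "f \<in> borel_measurable borel \<Longrightarrow> sq_int lebesgue f \<longleftrightarrow> sq_int lborel f"
  by (auto simp: sq_int_def integrable_completion measurable_completion)

lemma l2_norm_lebesgue: "f \<in> borel_measurable borel \<Longrightarrow> l2_norm lebesgue f = l2_norm lborel f"
  by (simp add: l2_norm_def integral_completion)

lemma sq_int_cong_AE:
  assumes f: "sq_int lebesgue f" and ae: "AE x in lebesgue. f x = g x"
  shows "sq_int lebesgue g"
  by (rule sq_int_bound[OF f, where C = 1])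
    (use borel_measurable_AE[OF _ ae] f ae in \<open>auto simp: sq_int_def\<close>)

lemma l2_norm_lebesgue_cong_AE:
  fixes f :: "'a::euclidean_space \<Rightarrow> complex"
  assumes f: "f \<in> borel_measurable lebesgue" and ae: "AE x in lebesgue. f x = g x"
  shows "l2_norm lebesgue f = l2_norm lebesgue g"
  by (rule l2_norm_cong_AE[OF f borel_measurable_AE[OF f ae] ae])

lemma lebesgue_borel_representative:
  fixes f :: "'a::euclidean_space \<Rightarrow> complex"
  assumes f: "f \<in> borel_measurable lebesgue"
  shows "\<exists>g\<in>borel_measurable borel. AE x in lebesgue. f x = g x"
proof -
  have "(\<lambda>x. Re (f x)) \<in> borel_measurable lebesgue" "(\<lambda>x. Im (f x)) \<in> borel_measurable lebesgue"
    using f by measurable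
  from this[THEN completion_ex_borel_measurable_real] obtain r i where
    [measurable]: "r \<in> borel_measurable borel" "i \<in> borel_measurable borel" and
    ae: "AE x in lborel. Re (f x) = r x" "AE x in lborel. Im (f x) = i x"
    by (auto simp: measurable_lborel1)
  show ?thesis
  proof (intro bexI[of _ "\<lambda>x. complex_of_real (r x) + \<i> * complex_of_real (i x)"])
    show "AE x in lebesgue. f x = complex_of_real (r x) + \<i> * complex_of_real (i x)"
      unfolding AE_completion_iff using ae by eventually_elim (simp add: complex_eq_iff)
  qed measurable
qed

lemma tendsto_ennreal_square_0_iff:
  assumes "\<And>x. f x \<ge> (0::real)"
  shows "((\<lambda>x. ennreal ((f x)\<^sup>2)) \<longlongrightarrow> 0) F \<longleftrightarrow> (f \<longlongrightarrow> 0) F"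
proof
  assume "((\<lambda>x. ennreal ((f x)\<^sup>2)) \<longlongrightarrow> 0) F"
  then have "((\<lambda>x. (f x)\<^sup>2) \<longlongrightarrow> 0) F"
    by (subst (asm) ennreal_0[symmetric], subst (asm) tendsto_ennreal_iff) auto
  then have "((\<lambda>x. sqrt ((f x)\<^sup>2)) \<longlongrightarrow> sqrt 0) F" by (rule tendsto_real_sqrt)
  then show "(f \<longlongrightarrow> 0) F" using assms by simp
next
  assume "(f \<longlongrightarrow> 0) F"
  then have "((\<lambda>x. ennreal ((f x)\<^sup>2)) \<longlongrightarrow> ennreal (0\<^sup>2)) F" by (intro tendsto_ennrealI tendsto_power)
  then show "((\<lambda>x. ennreal ((f x)\<^sup>2)) \<longlongrightarrow> 0) F" by simp
qed

lemma fourier_L1_cong_AE: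
  fixes w :: "real ^ 'n \<Rightarrow> complex"
  assumes w: "w \<in> borel_measurable lebesgue" and ae: "AE x in lebesgue. w x = w' x"
  shows "fourier_L1 (\<lambda>x. indicat_real (cball 0 R) x *\<^sub>R w x) \<xi> = fourier_L1 (\<lambda>x. indicat_real (cball 0 R) x *\<^sub>R w' x) \<xi>"
proof -
  have w': "w' \<in> borel_measurable lebesgue" by (rule borel_measurable_AE[OF w ae])
  have i: "indicat_real (cball 0 R) \<in> borel_measurable lebesgue"
    by (intro borel_measurable_indicator) auto
  have e: "(\<lambda>x. exp (- \<i> * complex_of_real (x \<bullet> \<xi>))) \<in> borel_measurable lebesgue"
    by (intro measurable_completion) measurable
  have "(LINT x|lebesgue. indicat_real (cball 0 R) x *\<^sub>R w x * exp (- \<i> * complex_of_real (x \<bullet> \<xi>)))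
    = (LINT x|lebesgue. indicat_real (cball 0 R) x *\<^sub>R w' x * exp (- \<i> * complex_of_real (x \<bullet> \<xi>)))"
    using ae by (intro integral_cong_AE borel_measurable_times borel_measurable_scaleR i e w w') auto
  then show ?thesis unfolding fourier_L1_def by simp
qed

lemma fourier_L1_trunc:
  fixes w :: "real ^ 'n \<Rightarrow> complex"
  assumes [measurable]: "w \<in> borel_measurable borel"
  shows "fourier_L1 (\<lambda>x. indicat_real (cball 0 R) x *\<^sub>R w x) = ft (trunc R w)"
proof
  fix \<xi>
  have "(LINT x|lebesgue. trunc R w x * exp (- \<i> * complex_of_real (x \<bullet> \<xi>)))
    = (LINT x|lborel. trunc R w x * exp (- \<i> * complex_of_real (x \<bullet> \<xi>)))"
    by (rule integral_completion) measurable
  then show "fourier_L1 (\<lambda>x. indicat_real (cball 0 R) x *\<^sub>R w x) \<xi> = ft (trunc R w) \<xi>"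
    by (simp add: fourier_L1_def ft_def trunc_def)
qed

text \<open>The extended distance in the definition is finite here, hence is the square of the norm
  used in \<open>is_ft\<close>. Where square integrability fails, both sides are false.\<close>

lemma has_fourier_borel_iff:
  fixes w g :: "real ^ 'n \<Rightarrow> complex"
  assumes w [measurable]: "w \<in> borel_measurable borel" and g [measurable]: "g \<in> borel_measurable borel"
  shows "has_fourier w g \<longleftrightarrow> is_ft w g"
proof (cases "sq_int lborel w \<and> sq_int lborel g")
  case True
  have "(\<integral>\<^sup>+ \<xi>. ennreal ((norm (ft (trunc R w) \<xi> - g \<xi>))\<^sup>2) \<partial>lebesgue) = ennreal ((l2_norm lborel (\<lambda>\<xi>. ft (trunc R w) \<xi> - g \<xi>))\<^sup>2)" for R
    unfolding nn_integral_completion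
    by (rule nn_integral_l2_norm) (use True in \<open>auto intro!: sq_int_diff ft_trunc_sq_int\<close>)
  then show ?thesis using True
    by (simp add: has_fourier_def is_ft_def L2_fun_sq_int sq_int_lebesgue_iff fourier_L1_trunc tendsto_ennreal_square_0_iff)
next
  case False
  then show ?thesis by (auto simp: has_fourier_def is_ft_def L2_fun_sq_int sq_int_lebesgue_iff)
qed

lemma has_fourier_cong_AE:
  fixes w g :: "real ^ 'n \<Rightarrow> complex"
  assumes 1: "has_fourier w g" and w: "AE x in lebesgue. w x = w' x" and g: "AE x in lebesgue. g x = g' x"
  shows "has_fourier w' g'"
proof -
  have m: "w \<in> borel_measurable lebesgue" "g \<in> borel_measurable lebesgue"
    using 1 by (auto simp: has_fourier_def L2_fun_def)
  have "(\<integral>\<^sup>+ \<xi>. ennreal ((norm (fourier_L1 (\<lambda>x. indicat_real (cball 0 R) x *\<^sub>R w x) \<xi> - g \<xi>))\<^sup>2) \<partial>lebesgue)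
    = (\<integral>\<^sup>+ \<xi>. ennreal ((norm (fourier_L1 (\<lambda>x. indicat_real (cball 0 R) x *\<^sub>R w' x) \<xi> - g' \<xi>))\<^sup>2) \<partial>lebesgue)" for R
    unfolding fourier_L1_cong_AE[OF m(1) w] using g by (intro nn_integral_cong_AE) auto
  then show ?thesis using 1 sq_int_cong_AE[OF _ w] sq_int_cong_AE[OF _ g]
    by (auto simp: has_fourier_def L2_fun_sq_int)
qed

text \<open>The device by which facts about \<open>is_ft\<close> are transferred to
  \<open>has_fourier\<close>: both functions are exchanged for Borel ones, at the cost of a null
  set.\<close>

lemma has_fourier_representatives:
  fixes w g :: "real ^ 'n \<Rightarrow> complex"
  assumes 1: "has_fourier w g"
  obtains w' g' where "is_ft w' g'" "AE x in lebesgue. w x = w' x" "AE x in lebesgue. g x = g' x"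
proof -
  have "w \<in> borel_measurable lebesgue" "g \<in> borel_measurable lebesgue"
    using 1 by (auto simp: has_fourier_def L2_fun_def)
  from this[THEN lebesgue_borel_representative] obtain w' g'
    where *: "w' \<in> borel_measurable borel" "g' \<in> borel_measurable borel" "AE x in lebesgue. w x = w' x" "AE x in lebesgue. g x = g' x"
    by blast
  from has_fourier_cong_AE[OF 1 *(3,4)] have "is_ft w' g'" by (simp add: has_fourier_borel_iff *(1,2))
  with * that show ?thesis by blast
qed

lemma is_ft_imp_has_fourier:
  fixes w g :: "real ^ 'n \<Rightarrow> complex"
  assumes 1: "is_ft w g" and "AE x in lebesgue. w x = w' x" "AE x in lebesgue. g x = g' x"
  shows "has_fourier w' g'"
proof -
  have "w \<in> borel_measurable borel" "g \<in> borel_measurable borel"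
    using is_ft_sq_int[OF 1] by (auto simp: sq_int_def)
  then have "has_fourier w g" using 1 by (simp add: has_fourier_borel_iff)
  then show ?thesis by (rule has_fourier_cong_AE) fact+
qed

lemma has_fourier_fourier:
  fixes w :: "real ^ 'n \<Rightarrow> complex"
  assumes w: "L2_fun w"
  shows "has_fourier w (fourier w)"
proof -
  obtain w' where w': "w' \<in> borel_measurable borel" "AE x in lebesgue. w x = w' x"
    using w lebesgue_borel_representative by (auto simp: L2_fun_def)
  then have "sq_int lborel w'"
    using sq_int_cong_AE[OF _ w'(2)] w by (simp add: L2_fun_sq_int sq_int_lebesgue_iff)
  then obtain g where "is_ft w' g" using is_ft_exists by blast
  then have "has_fourier w g"
    by (rule is_ft_imp_has_fourier) (use w'(2) in \<open>auto simp: eq_commute\<close>)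
  then show ?thesis unfolding fourier_def by (rule someI[of "has_fourier w"])
qed

lemma has_fourier_surj:
  fixes g :: "real ^ 'n \<Rightarrow> complex"
  assumes g: "L2_fun g"
  shows "\<exists>w. has_fourier w g"
proof -
  obtain g' where g': "g' \<in> borel_measurable borel" "AE x in lebesgue. g x = g' x"
    using g lebesgue_borel_representative by (auto simp: L2_fun_def)
  then have "sq_int lborel g'"
    using sq_int_cong_AE[OF _ g'(2)] g by (simp add: L2_fun_sq_int sq_int_lebesgue_iff)
  then obtain w where "is_ft w g'" using is_ft_surj by blast
  then have "has_fourier w g"
    by (rule is_ft_imp_has_fourier) (use g'(2) in \<open>auto simp: eq_commute\<close>)
  then show ?thesis by blast
qed

lemma has_fourier_unique:
  fixes w :: "real ^ 'n \<Rightarrow> complex"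
  assumes 1: "has_fourier w g" and 2: "has_fourier w' g'" and ae: "AE x in lebesgue. w x = w' x"
  shows "AE \<xi> in lebesgue. g \<xi> = g' \<xi>"
proof -
  obtain v h where v: "is_ft v h" "AE x in lebesgue. w x = v x" "AE x in lebesgue. g x = h x"
    using has_fourier_representatives[OF 1] by blast
  obtain v' h' where v': "is_ft v' h'" "AE x in lebesgue. w' x = v' x" "AE x in lebesgue. g' x = h' x"
    using has_fourier_representatives[OF 2] by blast
  have "AE x in lebesgue. v' x = v x" using ae v(2) v'(2) by eventually_elim simp
  then have "is_ft v h'"
    using is_ft_sq_int[OF v(1)] is_ft_sq_int[OF v'(1)]
    by (intro is_ft_cong_AE[OF v'(1)]) (auto simp: AE_completion_iff sq_int_def)
  from is_ft_unique[OF v(1) this] have "AE x in lebesgue. h x = h' x" by (rule AE_completion)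
  then show ?thesis using v(3) v'(3) by eventually_elim simp
qed

lemma has_fourier_inj:
  fixes w :: "real ^ 'n \<Rightarrow> complex"
  assumes 1: "has_fourier w g" and 2: "has_fourier w' g'" and ae: "AE x in lebesgue. g x = g' x"
  shows "AE \<xi> in lebesgue. w \<xi> = w' \<xi>"
proof -
  obtain v h where v: "is_ft v h" "AE x in lebesgue. w x = v x" "AE x in lebesgue. g x = h x"
    using has_fourier_representatives[OF 1] by blast
  obtain v' h' where v': "is_ft v' h'" "AE x in lebesgue. w' x = v' x" "AE x in lebesgue. g' x = h' x"
    using has_fourier_representatives[OF 2] by blast
  have "AE x in lebesgue. h' x = h x" using ae v(3) v'(3) by eventually_elim simp
  then have "is_ft v' h"
    using is_ft_sq_int[OF v(1)] is_ft_sq_int[OF v'(1)]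
    by (intro is_ft_cong_AE[OF v'(1)]) (auto simp: AE_completion_iff sq_int_def)
  from is_ft_inj[OF v(1) this] have "AE x in lebesgue. v x = v' x" by (rule AE_completion)
  then show ?thesis using v(2) v'(2) by eventually_elim simp
qed

lemma has_fourier_norm_eq:
  fixes w :: "real ^ 'n \<Rightarrow> complex"
  assumes 1: "has_fourier w g" shows "L2_norm w = L2_norm g"
proof -
  obtain v h where v: "is_ft v h" "AE x in lebesgue. w x = v x" "AE x in lebesgue. g x = h x"
    using has_fourier_representatives[OF 1] by blast
  have "w \<in> borel_measurable lebesgue" "g \<in> borel_measurable lebesgue"
    using 1 by (auto simp: has_fourier_def L2_fun_def)
  then have "L2_norm w = l2_norm lebesgue v" "L2_norm g = l2_norm lebesgue h"
    unfolding L2_norm_l2_norm by (auto intro!: l2_norm_lebesgue_cong_AE v(2,3))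
  then show ?thesis using is_ft_norm_eq[OF v(1)] is_ft_sq_int[OF v(1)]
    by (simp add: l2_norm_lebesgue sq_int_def)
qed

lemma has_fourier_add:
  fixes w v :: "real ^ 'n \<Rightarrow> complex"
  assumes 1: "has_fourier w g" and 2: "has_fourier v h"
  shows "has_fourier (\<lambda>x. w x + v x) (\<lambda>x. g x + h x)"
proof -
  obtain w' g' where w: "is_ft w' g'" "AE x in lebesgue. w x = w' x" "AE x in lebesgue. g x = g' x"
    using has_fourier_representatives[OF 1] by blast
  obtain v' h' where v: "is_ft v' h'" "AE x in lebesgue. v x = v' x" "AE x in lebesgue. h x = h' x"
    using has_fourier_representatives[OF 2] by blast
  show ?thesis
    by (rule is_ft_imp_has_fourier[OF is_ft_add[OF w(1) v(1)]]) (use w v in auto)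
qed

lemma has_fourier_cmult:
  fixes w :: "real ^ 'n \<Rightarrow> complex"
  assumes 1: "has_fourier w g"
  shows "has_fourier (\<lambda>x. c * w x) (\<lambda>x. c * g x)"
proof -
  obtain w' g' where w: "is_ft w' g'" "AE x in lebesgue. w x = w' x" "AE x in lebesgue. g x = g' x"
    using has_fourier_representatives[OF 1] by blast
  show ?thesis
    by (rule is_ft_imp_has_fourier[OF is_ft_cmult[OF w(1)]]) (use w in auto)
qed

lemma has_fourier_diff:
  fixes w v :: "real ^ 'n \<Rightarrow> complex"
  assumes 1: "has_fourier w g" and 2: "has_fourier v h"
  shows "has_fourier (\<lambda>x. w x - v x) (\<lambda>x. g x - h x)"
  using has_fourier_add[OF 1 has_fourier_cmult[OF 2, of "-1"]] by simp

lemma has_fourier_sup_bound: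
  fixes w :: "real ^ 'n \<Rightarrow> complex"
  assumes 1: "has_fourier w g" and g: "integrable lebesgue g"
  shows "AE x in lebesgue. norm (w x) \<le> (2 * pi) powr (- real CARD('n) / 2) * (LINT \<xi>|lebesgue. norm (g \<xi>))"
proof -
  obtain w' g' where w: "is_ft w' g'" "AE x in lebesgue. w x = w' x" "AE x in lebesgue. g x = g' x"
    using has_fourier_representatives[OF 1] by blast
  have g'm: "g' \<in> borel_measurable borel" using is_ft_sq_int[OF w(1)] by (auto simp: sq_int_def)
  have g'l: "g' \<in> borel_measurable lebesgue" by (intro measurable_completion) (simp add: g'm)
  have "integrable lebesgue g'"
    using g by (rule Bochner_Integration.integrable_cong_AE[THEN iffD1, rotated 3])
      (use g g'l w(3) in auto)
  then have "integrable lborel g'" using g'm by (simp add: integrable_completion)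
  moreover have "(LINT \<xi>|lborel. norm (g' \<xi>)) = (LINT \<xi>|lebesgue. norm (g' \<xi>))"
    using g'm by (subst integral_completion) auto
  moreover have "(LINT \<xi>|lebesgue. norm (g' \<xi>)) = (LINT \<xi>|lebesgue. norm (g \<xi>))"
    using w(3) g g'm by (intro integral_cong_AE) (auto intro: measurable_completion)
  ultimately have "AE x in lebesgue. norm (w' x) \<le> (2 * pi) powr (- real CARD('n) / 2) * (LINT \<xi>|lebesgue. norm (g \<xi>))"
    using is_ft_sup_bound[OF w(1)] by (simp add: AE_completion_iff)
  then show ?thesis using w(2) by eventually_elim simp
qed

lemma has_fourier_fourier_AE:
  fixes w :: "real ^ 'n \<Rightarrow> complex"
  assumes "has_fourier w g"
  shows "AE \<xi> in lebesgue. fourier w \<xi> = g \<xi>"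
  by (rule has_fourier_unique[OF has_fourier_fourier assms]) (use assms in \<open>auto simp: has_fourier_def\<close>)

lemma continuous_lebesgue_measurable:
  fixes f :: "'a::euclidean_space \<Rightarrow> 'b::euclidean_space"
  shows "continuous_on UNIV f \<Longrightarrow> f \<in> borel_measurable lebesgue"
  by (intro measurable_completion) (simp add: borel_measurable_continuous_onI)

text \<open>Frees the H^2 norm from the arbitrary representative chosen by
  \<open>fourier\<close>.\<close>

lemma H2_via_has_fourier:
  fixes w :: "real ^ 'n \<Rightarrow> complex"
  assumes 1: "has_fourier w g"
  shows "H2_fun w \<longleftrightarrow> L2_fun (\<lambda>\<xi>. complex_of_real (1 + (norm \<xi>)\<^sup>2) * g \<xi>)"
    and "H2_norm w = L2_norm (\<lambda>\<xi>. complex_of_real (1 + (norm \<xi>)\<^sup>2) * g \<xi>)"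
proof -
  have w: "L2_fun w" using 1 by (simp add: has_fourier_def)
  have ae: "AE \<xi> in lebesgue. complex_of_real (1 + (norm \<xi>)\<^sup>2) * fourier w \<xi> = complex_of_real (1 + (norm \<xi>)\<^sup>2) * g \<xi>"
    using has_fourier_fourier_AE[OF 1] by eventually_elim simp
  then have ae': "AE \<xi> in lebesgue. complex_of_real (1 + (norm \<xi>)\<^sup>2) * g \<xi> = complex_of_real (1 + (norm \<xi>)\<^sup>2) * fourier w \<xi>"
    by eventually_elim (rule sym)
  show "H2_fun w \<longleftrightarrow> L2_fun (\<lambda>\<xi>. complex_of_real (1 + (norm \<xi>)\<^sup>2) * g \<xi>)"
    using w sq_int_cong_AE[OF _ ae] sq_int_cong_AE[OF _ ae'] by (auto simp: H2_fun_def L2_fun_sq_int)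
  have "(\<lambda>\<xi>. complex_of_real (1 + (norm \<xi>)\<^sup>2) * fourier w \<xi>) \<in> borel_measurable lebesgue"
    using has_fourier_fourier[OF w]
    by (intro borel_measurable_times[OF continuous_lebesgue_measurable] continuous_intros) (auto simp: has_fourier_def L2_fun_def)
  then show "H2_norm w = L2_norm (\<lambda>\<xi>. complex_of_real (1 + (norm \<xi>)\<^sup>2) * g \<xi>)"
    unfolding H2_norm_def L2_norm_l2_norm by (rule l2_norm_lebesgue_cong_AE[OF _ ae])
qed

lemma Linf_boundI:
  fixes w :: "real^'n \<Rightarrow> complex"
  assumes w: "w \<in> borel_measurable lebesgue" and bd: "AE x in lebesgue. norm (w x) \<le> C"
  shows "Linf_fun w" "Linf_norm w \<le> C" "Linf_norm w \<ge> 0"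
proof -
  have m: "(\<lambda>x. ereal (norm (w x))) \<in> borel_measurable lebesgue" using w by measurable
  have le: "esssup lebesgue (\<lambda>x. ereal (norm (w x))) \<le> ereal C"
    by (rule esssup_I[OF m]) (use bd in auto)
  \<comment> \<open>Comparison with 0 rules out the value -\<infinity>, which
    \<open>real_of_ereal\<close> would silently turn into 0.\<close>
  have "esssup lebesgue (\<lambda>x::real^'n. 0::ereal) \<le> esssup lebesgue (\<lambda>x. ereal (norm (w x)))"
    by (rule esssup_mono) auto
  then have ge: "0 \<le> esssup lebesgue (\<lambda>x. ereal (norm (w x)))"
    by (subst (asm) esssup_const) auto
  show "Linf_fun w" using w le by (auto simp: Linf_fun_def)
  show "Linf_norm w \<ge> 0" using ge by (simp add: Linf_norm_def real_of_ereal_pos)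
  show "Linf_norm w \<le> C" using le ge unfolding Linf_norm_def
    by (cases "esssup lebesgue (\<lambda>x. ereal (norm (w x)))") auto
qed

section \<open>The weight 1 / (1 + |\<xi>|^2) in dimension at most three\<close>

lemma nn_integral_powr_decay: "(\<integral>\<^sup>+x. ennreal ((1 + \<bar>x\<bar>) powr (- 4 / 3)) \<partial>lborel) < \<infinity>"
proof -
  let ?f = "\<lambda>x::real. (1 + x) powr (- 4 / 3)"
  have half: "(\<integral>\<^sup>+x. ennreal (?f x) * indicator {0..} x \<partial>lborel) = ennreal (0 - (- 3 * (1 + 0) powr (- 1 / 3)))"
  proof (rule nn_integral_FTC_atLeast)
    show "DERIV (\<lambda>x. - 3 * (1 + x) powr (- 1 / 3)) x :> ?f x" if "0 \<le> x" for x :: real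
      using that by (auto intro!: derivative_eq_intros simp: powr_diff field_simps)
    show "((\<lambda>x::real. - 3 * (1 + x) powr (- 1 / 3)) \<longlongrightarrow> 0) at_top"
      by real_asymp
  qed auto
  have "(\<integral>\<^sup>+x. ennreal ((1 + \<bar>x\<bar>) powr (- 4 / 3)) \<partial>lborel)
     \<le> (\<integral>\<^sup>+x. ennreal (?f x) * indicator {0..} x + ennreal (?f (- x)) * indicator {0..} (- x) \<partial>lborel)"
    by (intro nn_integral_mono) (auto split: split_indicator)
  also have "\<dots> = (\<integral>\<^sup>+x. ennreal (?f x) * indicator {0..} x \<partial>lborel) + (\<integral>\<^sup>+x. ennreal (?f (- x)) * indicator {0..} (- x) \<partial>lborel)"
    by (rule nn_integral_add) auto
  also have "(\<integral>\<^sup>+x. ennreal (?f (- x)) * indicator {0..} (- x) \<partial>lborel) = (\<integral>\<^sup>+x. ennreal (?f x) * indicator {0..} x \<partial>lborel)"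
    by (subst lborel_nn_integral_affine[of "\<lambda>x. ennreal (?f x) * indicator {0..} x" "-1" 0]) auto
  finally show ?thesis unfolding half by (rule le_less_trans) simp
qed

text \<open>The decay of order 4 is shared equally among at most three coordinates, which leaves the
  exponent 4/3 > 1 for each, integrable on the line by \<open>nn_integral_powr_decay\<close>. The
  restriction on the dimension enters in the comparison of \<open>r powr (-4)\<close> with the
  n-fold product of \<open>r powr (- 4 / 3)\<close>, where \<open>r \<ge> 1\<close>.\<close>

lemma weight_bound:
  fixes \<xi> :: "'a::euclidean_space"
  assumes n: "DIM('a) \<le> 3"
  shows "1 / (1 + (norm \<xi>)\<^sup>2)\<^sup>2 \<le> 4 * (\<Prod>b\<in>Basis. (1 + \<bar>\<xi> \<bullet> b\<bar>) powr (- 4 / 3))"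
proof -
  define r where "r = sqrt 2 * sqrt (1 + (norm \<xi>)\<^sup>2)"
  have r1: "r \<ge> 1" unfolding r_def
    by (rule order_trans[OF _ mult_mono[of 1 "sqrt 2" 1]]) auto
  have le: "1 + \<bar>\<xi> \<bullet> b\<bar> \<le> r" if "b \<in> Basis" for b
  proof -
    have "(1 + \<bar>\<xi> \<bullet> b\<bar>)\<^sup>2 \<le> (1 + norm \<xi>)\<^sup>2" using Basis_le_norm[OF that, of \<xi>] by (intro power_mono) auto
    also have "\<dots> \<le> 2 * (1 + (norm \<xi>)\<^sup>2)" using sum_squares_bound[of 1 "norm \<xi>"] by (simp add: power2_sum)
    finally have "sqrt ((1 + \<bar>\<xi> \<bullet> b\<bar>)\<^sup>2) \<le> sqrt (2 * (1 + (norm \<xi>)\<^sup>2))" by (rule real_sqrt_le_mono)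
    then show ?thesis by (simp add: r_def flip: real_sqrt_mult)
  qed
  have "(\<Prod>b\<in>(Basis::'a set). r powr (- 4 / 3)) \<le> (\<Prod>b\<in>Basis. (1 + \<bar>\<xi> \<bullet> b\<bar>) powr (- 4 / 3))"
    using le by (intro prod_mono) (auto intro!: powr_mono2')
  moreover have "(\<Prod>b\<in>(Basis::'a set). r powr (- 4 / 3)) = r powr (- (4 / 3) * real DIM('a))"
    using r1 by (simp add: powr_powr powr_realpow[symmetric] mult.commute)
  moreover have "r powr (-4) \<le> r powr (- (4 / 3) * real DIM('a))"
    using n r1 by (intro powr_mono) auto
  moreover have "r powr (-4) = 1 / (4 * (1 + (norm \<xi>)\<^sup>2)\<^sup>2)"
  proof -
    have "r powr 4 = r ^ 4" using r1 by (simp add: powr_realpow[of r 4, simplified])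
    also have "\<dots> = (r\<^sup>2)\<^sup>2" by (simp flip: power_mult)
    also have "r\<^sup>2 = 2 * (1 + (norm \<xi>)\<^sup>2)" by (simp add: r_def power_mult_distrib)
    finally have "r powr 4 = 4 * (1 + (norm \<xi>)\<^sup>2)\<^sup>2" by (simp only: power_mult_distrib) simp
    then show ?thesis by (simp add: powr_minus_divide)
  qed
  ultimately have "1 / (4 * (1 + (norm \<xi>)\<^sup>2)\<^sup>2) \<le> (\<Prod>b\<in>Basis. (1 + \<bar>\<xi> \<bullet> b\<bar>) powr (- 4 / 3))" by linarith
  then show ?thesis by (simp add: field_simps)
qed

lemma weight_integrable:
  assumes n: "DIM('a::euclidean_space) \<le> 3"
  shows "integrable lborel (\<lambda>\<xi>::'a. 1 / (1 + (norm \<xi>)\<^sup>2)\<^sup>2)"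
proof (rule integrableI_nonneg)
  have "(\<integral>\<^sup>+(\<xi>::'a). ennreal (1 / (1 + (norm \<xi>)\<^sup>2)\<^sup>2) \<partial>lborel)
     \<le> (\<integral>\<^sup>+(\<xi>::'a). ennreal 4 * ennreal (\<Prod>b\<in>Basis. (1 + \<bar>\<xi> \<bullet> b\<bar>) powr (- 4 / 3)) \<partial>lborel)"
  proof (rule nn_integral_mono)
    fix \<xi> :: 'a
    have "ennreal 4 * ennreal (\<Prod>b\<in>Basis. (1 + \<bar>\<xi> \<bullet> b\<bar>) powr (- 4 / 3)) = ennreal (4 * (\<Prod>b\<in>Basis. (1 + \<bar>\<xi> \<bullet> b\<bar>) powr (- 4 / 3)))"
      by (rule ennreal_mult[symmetric]) (auto intro: prod_nonneg)
    then show "ennreal (1 / (1 + (norm \<xi>)\<^sup>2)\<^sup>2) \<le> ennreal 4 * ennreal (\<Prod>b\<in>Basis. (1 + \<bar>\<xi> \<bullet> b\<bar>) powr (- 4 / 3))"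
      using ennreal_leI[OF weight_bound[OF n, of \<xi>]] by (simp only:)
  qed
  also have "\<dots> = ennreal 4 * (\<integral>\<^sup>+(\<xi>::'a). (\<Prod>b\<in>Basis. ennreal ((1 + \<bar>\<xi> \<bullet> b\<bar>) powr (- 4 / 3))) \<partial>lborel)"
    by (subst nn_integral_cmult) (auto simp: prod_ennreal)
  also have "(\<integral>\<^sup>+(\<xi>::'a). (\<Prod>b\<in>Basis. ennreal ((1 + \<bar>\<xi> \<bullet> b\<bar>) powr (- 4 / 3))) \<partial>lborel) = (\<Prod>b\<in>(Basis::'a set). (\<integral>\<^sup>+x. ennreal ((1 + \<bar>x\<bar>) powr (- 4 / 3)) \<partial>lborel))"
    by (rule nn_integral_lborel_prod) auto
  also have "ennreal 4 * \<dots> < \<infinity>"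
    using nn_integral_powr_decay by (auto simp: ennreal_mult_less_top power_less_top_ennreal)
  finally show "(\<integral>\<^sup>+(\<xi>::'a). ennreal (1 / (1 + (norm \<xi>)\<^sup>2)\<^sup>2) \<partial>lborel) < \<infinity>" .
qed auto

text \<open>The L^2 norm of 1 / (1 + |\<xi>|^2). Only the dimension enters, through the type
  argument; (2 \<pi>)^(-n/2) times this number is the constant K_n of the theorem.\<close>

definition weight_const :: "'n::finite itself \<Rightarrow> real" where
  "weight_const _ = sqrt (LINT \<xi>::real^'n|lborel. 1 / (1 + (norm \<xi>)\<^sup>2)\<^sup>2)"

text \<open>Rescaling \<xi> by 1 / sqrt \<tau> gives \<tau>^(-n/2) for the squared norm, hence
  \<tau>^(-n/4) for the norm: the origin of the exponent n/4 in the decay estimate.\<close>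

lemma scaled_weight:
  assumes n: "CARD('n::finite) \<in> {1, 2, 3}" and \<tau>: "\<tau> > 0"
  defines "p \<equiv> \<lambda>\<xi>::real^'n. complex_of_real (1 / (1 + \<tau> * (norm \<xi>)\<^sup>2))"
  shows "sq_int lebesgue p" "l2_norm lebesgue p = \<tau> powr (- real CARD('n) / 4) * weight_const TYPE('n)"
proof -
  let ?I = "LINT \<xi>::real^'n|lborel. 1 / (1 + (norm \<xi>)\<^sup>2)\<^sup>2"
  let ?f = "\<lambda>\<xi>::real^'n. 1 / (1 + \<tau> * (norm \<xi>)\<^sup>2)\<^sup>2"
  have pm [measurable]: "p \<in> borel_measurable borel" unfolding p_def by measurable
  have np: "(norm (p \<xi>))\<^sup>2 = ?f \<xi>" for \<xi>
    by (simp only: p_def norm_of_real power2_abs power_divide power_one)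
  have c: "1 / sqrt \<tau> \<noteq> 0" using \<tau> by simp
  have sc: "?f (0 + (1 / sqrt \<tau>) *\<^sub>R \<xi>) = 1 / (1 + (norm \<xi>)\<^sup>2)\<^sup>2" for \<xi>
    using \<tau> by (simp add: power_mult_distrib power_divide)
  have cp: "\<bar>1 / sqrt \<tau>\<bar> ^ DIM(real^'n) = \<tau> powr (- real CARD('n) / 2)"
    using \<tau> by (simp add: powr_half_sqrt[symmetric] powr_realpow[symmetric] powr_powr powr_divide powr_minus_divide)
  have w: "integrable lborel (\<lambda>\<xi>::real^'n. 1 / (1 + (norm \<xi>)\<^sup>2)\<^sup>2)" using n by (intro weight_integrable) auto
  have "(\<integral>\<^sup>+\<xi>. ennreal (?f \<xi>) \<partial>lborel) = ennreal (\<bar>1 / sqrt \<tau>\<bar> ^ DIM(real^'n)) * (\<integral>\<^sup>+(\<xi>::real^'n). ennreal (1 / (1 + (norm \<xi>)\<^sup>2)\<^sup>2) \<partial>lborel)"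
    by (subst lborel_nn_integral_affine[OF _ c, of _ 0]) (simp_all only: sc, measurable)
  also have "\<dots> = ennreal (\<tau> powr (- real CARD('n) / 2) * ?I)"
    unfolding cp using w by (subst nn_integral_eq_integral) (auto simp: ennreal_mult)
  finally have nn: "(\<integral>\<^sup>+\<xi>. ennreal (?f \<xi>) \<partial>lborel) = ennreal (\<tau> powr (- real CARD('n) / 2) * ?I)" .
  have fi: "integrable lborel ?f"
    by (rule integrableI_nonneg) (auto simp: nn)
  have I0: "?I \<ge> 0" by simp
  have "(LINT \<xi>|lborel. ?f \<xi>) = \<tau> powr (- real CARD('n) / 2) * ?I"
    by (rule integral_eq_nn_integral[THEN trans]) (use nn I0 in auto)
  then have "l2_norm lborel p = sqrt (\<tau> powr (- real CARD('n) / 2) * ?I)"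
    unfolding l2_norm_def np by simp
  also have "\<dots> = \<tau> powr (- real CARD('n) / 4) * weight_const TYPE('n)"
    by (simp add: real_sqrt_mult weight_const_def powr_half_sqrt[symmetric] powr_powr)
  finally show "l2_norm lebesgue p = \<tau> powr (- real CARD('n) / 4) * weight_const TYPE('n)"
    by (simp add: l2_norm_lebesgue)
  have "sq_int lborel p" unfolding sq_int_def np using fi by simp
  then show "sq_int lebesgue p" by (simp add: sq_int_lebesgue_iff)
qed

text \<open>Cauchy-Schwarz bounds the L^1 norm of \<open>g\<close>, and inversion then bounds
  \<open>w\<close>. With \<open>\<tau> = 1\<close> this is the Sobolev embedding
  \<open>H2_sup_bound\<close>; with \<tau> = t / ||k|| it is the decay in time.\<close>

lemma has_fourier_weighted_sup_bound:
  fixes w :: "real^'n \<Rightarrow> complex"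
  assumes n: "CARD('n::finite) \<in> {1, 2, 3}" and \<tau>: "\<tau> > 0"
    and 1: "has_fourier w g" and h: "sq_int lebesgue h"
    and le: "AE \<xi> in lebesgue. norm (g \<xi>) \<le> norm (h \<xi>) / (1 + \<tau> * (norm \<xi>)\<^sup>2)"
  shows "AE x in lebesgue. norm (w x) \<le> (2 * pi) powr (- real CARD('n) / 2) * weight_const TYPE('n) * l2_norm lebesgue h * \<tau> powr (- real CARD('n) / 4)"
proof -
  let ?p = "\<lambda>\<xi>::real^'n. complex_of_real (1 / (1 + \<tau> * (norm \<xi>)\<^sup>2))"
  note p = scaled_weight[OF n \<tau>]
  have gm: "g \<in> borel_measurable lebesgue" using 1 by (auto simp: has_fourier_def L2_fun_def)
  have np: "norm (?p \<xi> * h \<xi>) = norm (h \<xi>) / (1 + \<tau> * (norm \<xi>)\<^sup>2)" for \<xi>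
  proof -
    have "0 \<le> 1 / (1 + \<tau> * (norm \<xi>)\<^sup>2)" using \<tau> by simp
    then show ?thesis by (simp only: norm_mult norm_of_real abs_of_nonneg) simp
  qed
  have int: "integrable lebesgue (\<lambda>\<xi>. ?p \<xi> * h \<xi>)" by (rule l2_mult_integrable[OF p(1) h])
  have gint: "integrable lebesgue g"
    by (rule Bochner_Integration.integrable_bound[OF int gm]) (use le in \<open>simp only: np\<close>)
  have "(LINT \<xi>|lebesgue. norm (g \<xi>)) \<le> (LINT \<xi>|lebesgue. norm (?p \<xi> * h \<xi>))"
    using le by (intro integral_mono_AE integrable_norm gint int) (simp only: np)
  also have "\<dots> \<le> l2_norm lebesgue ?p * l2_norm lebesgue h"
    by (rule l2_Cauchy_Schwarz_norm[OF p(1) h])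
  finally have "(2 * pi) powr (- real CARD('n) / 2) * (LINT \<xi>|lebesgue. norm (g \<xi>))
     \<le> (2 * pi) powr (- real CARD('n) / 2) * (l2_norm lebesgue ?p * l2_norm lebesgue h)"
    by (intro mult_left_mono) auto
  also have "\<dots> = (2 * pi) powr (- real CARD('n) / 2) * weight_const TYPE('n) * l2_norm lebesgue h * \<tau> powr (- real CARD('n) / 4)"
    unfolding p(2) by (simp only: mult_ac)
  finally have le2: "(2 * pi) powr (- real CARD('n) / 2) * (LINT \<xi>|lebesgue. norm (g \<xi>)) \<le> \<dots>" .
  show ?thesis using has_fourier_sup_bound[OF 1 gint]
    by eventually_elim (rule order_trans[OF _ le2])
qed

lemma H2_sup_bound:
  fixes w :: "real^'n \<Rightarrow> complex"
  assumes n: "CARD('n::finite) \<in> {1, 2, 3}" and w: "H2_fun w"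
  shows "AE x in lebesgue. norm (w x) \<le> (2 * pi) powr (- real CARD('n) / 2) * weight_const TYPE('n) * H2_norm w"
proof -
  have f: "has_fourier w (fourier w)" using w by (auto simp: H2_fun_def has_fourier_fourier)
  have "AE x in lebesgue. norm (w x) \<le> (2 * pi) powr (- real CARD('n) / 2) * weight_const TYPE('n) *
     l2_norm lebesgue (\<lambda>\<xi>. complex_of_real (1 + (norm \<xi>)\<^sup>2) * fourier w \<xi>) * 1 powr (- real CARD('n) / 4)"
  proof (rule has_fourier_weighted_sup_bound[OF n _ f])
    show "sq_int lebesgue (\<lambda>\<xi>. complex_of_real (1 + (norm \<xi>)\<^sup>2) * fourier w \<xi>)"
      using w by (simp add: H2_fun_def L2_fun_sq_int)
    show "AE \<xi> in lebesgue. norm (fourier w \<xi>) \<le> norm (complex_of_real (1 + (norm \<xi>)\<^sup>2) * fourier w \<xi>) / (1 + 1 * (norm \<xi>)\<^sup>2)"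
      by (rule AE_I2) (simp add: norm_mult add_pos_nonneg less_imp_neq[symmetric] del: of_real_add)
  qed simp
  then show ?thesis by (simp add: H2_norm_def L2_norm_l2_norm)
qed

section \<open>Positive multipliers\<close>

text \<open>Multipliers act through |\<xi>|^2, hence the measurability of
  \<open>m (r\<^sup>2)\<close>. Measurability and boundedness are part of the definition so that
  products with square integrable functions remain square integrable, and so that limits in the
  class stay measurable; this is how the measurability of \<open>E\<close> in \<open>l\<close> is
  obtained.\<close>

definition positive_multiplier :: "'n::finite itself \<Rightarrow> (real \<Rightarrow> real) \<Rightarrow> bool" where
  "positive_multiplier _ m \<longleftrightarrow> (\<lambda>r. m (r\<^sup>2)) \<in> borel_measurable borel \<and> (\<exists>C. \<forall>l\<ge>0. \<bar>m l\<bar> \<le> C) \<and>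
     (\<forall>(w::real^'n \<Rightarrow> complex) g w'. has_fourier w g \<longrightarrow> (AE x in lebesgue. w x \<in> \<real>\<^sub>\<ge>\<^sub>0) \<longrightarrow>
        has_fourier w' (\<lambda>\<xi>. complex_of_real (m ((norm \<xi>)\<^sup>2)) * g \<xi>) \<longrightarrow> (AE x in lebesgue. w' x \<in> \<real>\<^sub>\<ge>\<^sub>0))"

lemma multiplier_measurable:
  assumes "(\<lambda>r. m (r\<^sup>2)) \<in> borel_measurable borel"
  shows "(\<lambda>\<xi>::real^'n. complex_of_real (m ((norm \<xi>)\<^sup>2))) \<in> borel_measurable lebesgue"
proof (intro measurable_completion)
  have [measurable]: "(\<lambda>\<xi>::real^'n. m ((norm \<xi>)\<^sup>2)) \<in> borel_measurable borel"
    using measurable_compose[OF borel_measurable_norm assms] by simp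
  show "(\<lambda>\<xi>::real^'n. complex_of_real (m ((norm \<xi>)\<^sup>2))) \<in> borel_measurable lborel" by measurable
qed

lemma multiplier_sq_int:
  fixes g :: "real^'n \<Rightarrow> complex"
  assumes m: "(\<lambda>r. m (r\<^sup>2)) \<in> borel_measurable borel" and C: "\<And>l. l \<ge> 0 \<Longrightarrow> \<bar>m l\<bar> \<le> C" and g: "sq_int lebesgue g"
  shows "sq_int lebesgue (\<lambda>\<xi>. complex_of_real (m ((norm \<xi>)\<^sup>2)) * g \<xi>)"
    "l2_norm lebesgue (\<lambda>\<xi>. complex_of_real (m ((norm \<xi>)\<^sup>2)) * g \<xi>) \<le> C * l2_norm lebesgue g"
proof -
  have meas: "(\<lambda>\<xi>. complex_of_real (m ((norm \<xi>)\<^sup>2)) * g \<xi>) \<in> borel_measurable lebesgue"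
    using g by (intro borel_measurable_times multiplier_measurable m) (auto simp: sq_int_def)
  have le: "AE \<xi> in lebesgue. norm (complex_of_real (m ((norm \<xi>)\<^sup>2)) * g \<xi>) \<le> C * norm (g \<xi>)"
    using C by (auto simp: norm_mult intro!: mult_right_mono)
  have "C \<ge> 0" using C[of 0] by simp
  then show "sq_int lebesgue (\<lambda>\<xi>. complex_of_real (m ((norm \<xi>)\<^sup>2)) * g \<xi>)"
    "l2_norm lebesgue (\<lambda>\<xi>. complex_of_real (m ((norm \<xi>)\<^sup>2)) * g \<xi>) \<le> C * l2_norm lebesgue g"
    using sq_int_bound[OF g meas le] l2_norm_bound[OF g meas le] by auto
qed

lemma positive_multiplierD:
  assumes "positive_multiplier TYPE('n::finite) m" "has_fourier (w::real^'n \<Rightarrow> complex) g" "AE x in lebesgue. w x \<in> \<real>\<^sub>\<ge>\<^sub>0"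
    "has_fourier w' (\<lambda>\<xi>. complex_of_real (m ((norm \<xi>)\<^sup>2)) * g \<xi>)"
  shows "AE x in lebesgue. w' x \<in> \<real>\<^sub>\<ge>\<^sub>0"
  using assms unfolding positive_multiplier_def by blast

lemma positive_multiplier_apply:
  assumes "positive_multiplier TYPE('n::finite) m" "has_fourier (w::real^'n \<Rightarrow> complex) g"
  shows "\<exists>w'. has_fourier w' (\<lambda>\<xi>. complex_of_real (m ((norm \<xi>)\<^sup>2)) * g \<xi>)"
  using assms multiplier_sq_int(1)[of m _ g]
  by (intro has_fourier_surj) (auto simp: positive_multiplier_def has_fourier_def L2_fun_sq_int)

lemma positive_multiplier_cong:
  assumes 1: "positive_multiplier TYPE('n::finite) m" and eq: "\<And>l. l \<ge> 0 \<Longrightarrow> m l = m' l"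
  shows "positive_multiplier TYPE('n::finite) m'"
proof -
  have "m (r\<^sup>2) = m' (r\<^sup>2)" for r by (rule eq) simp
  then show ?thesis using 1 eq unfolding positive_multiplier_def by simp
qed

lemma positive_multiplier_const:
  assumes c: "c \<ge> 0"
  shows "positive_multiplier TYPE('n::finite) (\<lambda>l. c)"
  unfolding positive_multiplier_def
proof (intro conjI allI impI)
  fix w :: "real^'n \<Rightarrow> complex" and g w'
  assume *: "has_fourier w g" "AE x in lebesgue. w x \<in> \<real>\<^sub>\<ge>\<^sub>0" "has_fourier w' (\<lambda>\<xi>. complex_of_real c * g \<xi>)"
  have "AE x in lebesgue. w' x = complex_of_real c * w x"
    by (rule has_fourier_inj[OF *(3) has_fourier_cmult[OF *(1), of "complex_of_real c"]]) auto
  then show "AE x in lebesgue. w' x \<in> \<real>\<^sub>\<ge>\<^sub>0" using *(2) by eventually_elim (simp add: c)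
qed auto

lemma positive_multiplier_add:
  assumes 1: "positive_multiplier TYPE('n::finite) m" and 2: "positive_multiplier TYPE('n::finite) m'"
  shows "positive_multiplier TYPE('n::finite) (\<lambda>l. m l + m' l)"
  unfolding positive_multiplier_def
proof (intro conjI allI impI)
  have [measurable]: "(\<lambda>r. m (r\<^sup>2)) \<in> borel_measurable borel" "(\<lambda>r. m' (r\<^sup>2)) \<in> borel_measurable borel"
    using 1 2 by (auto simp: positive_multiplier_def)
  show "(\<lambda>r. m (r\<^sup>2) + m' (r\<^sup>2)) \<in> borel_measurable borel" by measurable
  obtain C C' where "\<forall>l\<ge>0. \<bar>m l\<bar> \<le> C" "\<forall>l\<ge>0. \<bar>m' l\<bar> \<le> C'" using 1 2 by (auto simp: positive_multiplier_def)
  then show "\<exists>C. \<forall>l\<ge>0. \<bar>m l + m' l\<bar> \<le> C"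
    by (intro exI[of _ "C + C'"]) (auto intro: order_trans[OF abs_triangle_ineq] add_mono)
  fix w :: "real^'n \<Rightarrow> complex" and g w'
  assume *: "has_fourier w g" "AE x in lebesgue. w x \<in> \<real>\<^sub>\<ge>\<^sub>0" "has_fourier w' (\<lambda>\<xi>. complex_of_real (m ((norm \<xi>)\<^sup>2) + m' ((norm \<xi>)\<^sup>2)) * g \<xi>)"
  obtain v where v: "has_fourier v (\<lambda>\<xi>. complex_of_real (m ((norm \<xi>)\<^sup>2)) * g \<xi>)" using positive_multiplier_apply[OF 1 *(1)] by blast
  obtain v' where v': "has_fourier v' (\<lambda>\<xi>. complex_of_real (m' ((norm \<xi>)\<^sup>2)) * g \<xi>)" using positive_multiplier_apply[OF 2 *(1)] by blast
  have "AE x in lebesgue. w' x = v x + v' x"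
    by (rule has_fourier_inj[OF *(3) has_fourier_add[OF v v']]) (auto simp: distrib_right)
  then show "AE x in lebesgue. w' x \<in> \<real>\<^sub>\<ge>\<^sub>0"
    using positive_multiplierD[OF 1 *(1,2) v] positive_multiplierD[OF 2 *(1,2) v'] by eventually_elim simp
qed

lemma positive_multiplier_mult:
  assumes 1: "positive_multiplier TYPE('n::finite) m" and 2: "positive_multiplier TYPE('n::finite) m'"
  shows "positive_multiplier TYPE('n::finite) (\<lambda>l. m l * m' l)"
  unfolding positive_multiplier_def
proof (intro conjI allI impI)
  have [measurable]: "(\<lambda>r. m (r\<^sup>2)) \<in> borel_measurable borel" "(\<lambda>r. m' (r\<^sup>2)) \<in> borel_measurable borel"
    using 1 2 by (auto simp: positive_multiplier_def)
  show "(\<lambda>r. m (r\<^sup>2) * m' (r\<^sup>2)) \<in> borel_measurable borel" by measurable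
  obtain C C' where "\<forall>l\<ge>0. \<bar>m l\<bar> \<le> C" "\<forall>l\<ge>0. \<bar>m' l\<bar> \<le> C'" using 1 2 by (auto simp: positive_multiplier_def)
  then show "\<exists>C. \<forall>l\<ge>0. \<bar>m l * m' l\<bar> \<le> C"
    by (intro exI[of _ "C * C'"]) (auto simp: abs_mult intro!: mult_mono order_trans[OF abs_ge_zero])
  fix w :: "real^'n \<Rightarrow> complex" and g w'
  assume *: "has_fourier w g" "AE x in lebesgue. w x \<in> \<real>\<^sub>\<ge>\<^sub>0" "has_fourier w' (\<lambda>\<xi>. complex_of_real (m ((norm \<xi>)\<^sup>2) * m' ((norm \<xi>)\<^sup>2)) * g \<xi>)"
  obtain v where v: "has_fourier v (\<lambda>\<xi>. complex_of_real (m' ((norm \<xi>)\<^sup>2)) * g \<xi>)" using positive_multiplier_apply[OF 2 *(1)] by blast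
  have "has_fourier w' (\<lambda>\<xi>. complex_of_real (m ((norm \<xi>)\<^sup>2)) * (complex_of_real (m' ((norm \<xi>)\<^sup>2)) * g \<xi>))"
    using *(3) by (simp add: mult.assoc)
  from positive_multiplierD[OF 1 v positive_multiplierD[OF 2 *(1,2) v] this]
  show "AE x in lebesgue. w' x \<in> \<real>\<^sub>\<ge>\<^sub>0" .
qed

text \<open>The distance of \<open>z\<close> to the nonnegative half-line is controlled by \<open>|z - r|\<close> for every \<open>r \<ge> 0\<close>, so
  nonnegativity is preserved under \<open>L\<^sup>2\<close> limits.\<close>

lemma norm_diff_pos_part_le:
  assumes "r \<in> \<real>\<^sub>\<ge>\<^sub>0"
  shows "norm (z - complex_of_real (max 0 (Re z))) \<le> norm (z - r)"
proof -
  obtain s where s: "r = complex_of_real s" "s \<ge> 0" using assms by (auto elim: nonneg_Reals_cases)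
  have "(Re z - max 0 (Re z))\<^sup>2 \<le> (Re z - s)\<^sup>2"
    using s(2) by (cases "Re z \<ge> 0") (auto simp: power2_le_iff_abs_le intro!: power_mono_even simp flip: abs_le_square_iff)
  then show ?thesis by (simp add: cmod_def s(1))
qed

text \<open>The common bound \<open>C\<close> gives L^2 convergence on the frequency side, hence by
  isometry L^2 convergence of the nonnegative functions \<open>v i\<close>; the distance of
  \<open>w'\<close> to its own positive part is then 0.\<close>

lemma positive_multiplier_limit:
  assumes m: "\<And>i::nat. positive_multiplier TYPE('n::finite) (m i)" and C: "\<And>i l. l \<ge> 0 \<Longrightarrow> \<bar>m i l\<bar> \<le> C"
    and lim: "\<And>l. l \<ge> 0 \<Longrightarrow> (\<lambda>i. m i l) \<longlonglongrightarrow> M l"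
  shows "positive_multiplier TYPE('n::finite) M"
  unfolding positive_multiplier_def
proof (intro conjI allI impI)
  have mm: "(\<lambda>r. m i (r\<^sup>2)) \<in> borel_measurable borel" for i using m by (auto simp: positive_multiplier_def)
  show Mm: "(\<lambda>r. M (r\<^sup>2)) \<in> borel_measurable borel"
    by (rule borel_measurable_LIMSEQ_real[where u = "\<lambda>i r. m i (r\<^sup>2)"]) (auto intro: lim mm)
  have MC: "\<bar>M l\<bar> \<le> C" if "l \<ge> 0" for l
    by (rule LIMSEQ_le_const2[OF tendsto_rabs[OF lim[OF that]]]) (use C[OF that] in auto)
  then show "\<exists>C. \<forall>l\<ge>0. \<bar>M l\<bar> \<le> C" by blast
  fix w :: "real^'n \<Rightarrow> complex" and g w'
  assume *: "has_fourier w g" "AE x in lebesgue. w x \<in> \<real>\<^sub>\<ge>\<^sub>0" "has_fourier w' (\<lambda>\<xi>. complex_of_real (M ((norm \<xi>)\<^sup>2)) * g \<xi>)"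
  have g: "sq_int lebesgue g" using *(1) by (simp add: has_fourier_def L2_fun_sq_int)
  have w's: "sq_int lebesgue w'" using *(3) by (simp add: has_fourier_def L2_fun_sq_int)
  obtain v where v: "\<And>i. has_fourier (v i) (\<lambda>\<xi>. complex_of_real (m i ((norm \<xi>)\<^sup>2)) * g \<xi>)"
    using positive_multiplier_apply[OF m *(1)] by metis
  have vpos: "AE x in lebesgue. v i x \<in> \<real>\<^sub>\<ge>\<^sub>0" for i by (rule positive_multiplierD[OF m *(1,2) v])
  have vs: "sq_int lebesgue (v i)" for i using v[of i] by (simp add: has_fourier_def L2_fun_sq_int)
  let ?d = "\<lambda>x. w' x - complex_of_real (max 0 (Re (w' x)))"
  have [measurable]: "w' \<in> borel_measurable lebesgue" using w's by (simp add: sq_int_def)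
  have dm: "?d \<in> borel_measurable lebesgue" by measurable
  have le: "l2_norm lebesgue ?d \<le> l2_norm lebesgue (\<lambda>\<xi>. complex_of_real (m i ((norm \<xi>)\<^sup>2)) * g \<xi> - complex_of_real (M ((norm \<xi>)\<^sup>2)) * g \<xi>)"
    and ds: "sq_int lebesgue ?d" for i
  proof -
    have s: "sq_int lebesgue (\<lambda>x. w' x - v i x)" by (intro sq_int_diff w's vs)
    have ae: "AE x in lebesgue. norm (?d x) \<le> 1 * norm (w' x - v i x)"
      using vpos[of i] by eventually_elim (simp add: norm_diff_pos_part_le)
    show "sq_int lebesgue ?d" by (rule sq_int_bound[OF s dm ae])
    have "l2_norm lebesgue ?d \<le> 1 * l2_norm lebesgue (\<lambda>x. w' x - v i x)"
      by (rule l2_norm_bound[OF s dm ae]) simp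
    also have "\<dots> = l2_norm lebesgue (\<lambda>x. v i x - w' x)" by (simp add: l2_norm_minus_commute)
    also have "\<dots> = l2_norm lebesgue (\<lambda>\<xi>. complex_of_real (m i ((norm \<xi>)\<^sup>2)) * g \<xi> - complex_of_real (M ((norm \<xi>)\<^sup>2)) * g \<xi>)"
      using has_fourier_norm_eq[OF has_fourier_diff[OF v[of i] *(3)]] by (simp add: L2_norm_l2_norm)
    finally show "l2_norm lebesgue ?d \<le> l2_norm lebesgue (\<lambda>\<xi>. complex_of_real (m i ((norm \<xi>)\<^sup>2)) * g \<xi> - complex_of_real (M ((norm \<xi>)\<^sup>2)) * g \<xi>)" .
  qed
  have "(\<lambda>i. l2_norm lebesgue (\<lambda>\<xi>. complex_of_real (m i ((norm \<xi>)\<^sup>2)) * g \<xi> - complex_of_real (M ((norm \<xi>)\<^sup>2)) * g \<xi>)) \<longlonglongrightarrow> 0"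
  proof (rule l2_dominated_convergence[OF _ _ g, where C = C])
    show "AE x in lebesgue. (\<lambda>i. complex_of_real (m i ((norm x)\<^sup>2)) * g x) \<longlonglongrightarrow> complex_of_real (M ((norm x)\<^sup>2)) * g x"
      by (intro AE_I2 tendsto_intros lim) simp
    show "AE x in lebesgue. norm (complex_of_real (m i ((norm x)\<^sup>2)) * g x) \<le> C * norm (g x)" for i
      using C by (auto simp: norm_mult intro!: mult_right_mono)
  qed (use g in \<open>auto intro!: borel_measurable_times multiplier_measurable mm Mm simp: sq_int_def\<close>)
  then have "l2_norm lebesgue ?d \<le> 0"
    by (rule LIMSEQ_le_const) (use le in auto)
  then have "l2_norm lebesgue ?d = 0" using l2_norm_nonneg[of lebesgue ?d] by linarith
  from l2_norm_eq_0_imp_AE[OF ds this] show "AE x in lebesgue. w' x \<in> \<real>\<^sub>\<ge>\<^sub>0"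
  proof eventually_elim
    case (elim x)
    then have "w' x = complex_of_real (max 0 (Re (w' x)))" by simp
    then show ?case by (metis max.cobounded1 nonneg_Reals_of_real_iff)
  qed
qed

section \<open>Heat multipliers and resolvents\<close>

lemma is_ft_heat_nonneg:
  fixes w :: "'a::euclidean_space \<Rightarrow> complex"
  assumes 1: "is_ft w g" and pos: "AE x in lborel. w x \<in> \<real>\<^sub>\<ge>\<^sub>0" and d: "d > 0"
    and 2: "is_ft w' (\<lambda>\<xi>. complex_of_real (exp (- d * (norm \<xi>)\<^sup>2)) * g \<xi>)"
  shows "AE x in lborel. w' x \<in> \<real>\<^sub>\<ge>\<^sub>0"
proof -
  note s = is_ft_sq_int[OF 1] is_ft_sq_int[OF 2]
  let ?e = "\<lambda>\<xi>. complex_of_real (exp (- d * (norm (\<xi>::'a))\<^sup>2))"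
  let ?c = "complex_of_real ((2 * pi) powr (- real DIM('a) / 2))"
  have gi: "integrable lborel ?e" using gaussian_integrable[OF d, where 'a = 'a] by (simp add: complex_of_real_integrable_eq)
  have gs: "sq_int lborel ?e"
  proof -
    have "(\<lambda>\<xi>::'a. (norm (?e \<xi>))\<^sup>2) = (\<lambda>\<xi>. exp (- (2 * d) * (norm \<xi>)\<^sup>2))" by (auto simp: exp_double[symmetric] simp flip: exp_of_nat_mult)
    then show ?thesis unfolding sq_int_def using gaussian_integrable[of "2 * d", where 'a = 'a] d by simp
  qed
  have i: "integrable lborel (\<lambda>\<xi>. ?e \<xi> * g \<xi>)" by (rule l2_mult_integrable[OF gs s(2)])
  have "AE x in lborel. cnj (w' x) = ft (\<lambda>\<xi>. cnj (?e \<xi> * g \<xi>)) x"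
    by (rule is_ft_unique[OF is_ft_cnj[OF 2] is_ft_integrable[OF integrable_cnj[OF i] sq_int_cnj[OF s(4)]]])
  then show ?thesis
  proof eventually_elim
    case (elim x)
    \<comment> \<open>A Gaussian modulated by the character of \<open>x\<close>: its transform is a
      multiple of the heat kernel centred at \<open>x\<close>. The symmetry of the transform then
      writes \<open>w' x\<close> as an integral of \<open>w\<close> against this positive
      kernel.\<close>
    define v where "v \<xi> = ?e \<xi> * exp (- \<i> * complex_of_real (\<xi> \<bullet> (- x)))" for \<xi>
    have vi: "integrable lborel v" unfolding v_def by (rule character_integrable[OF gi])
    have vs: "sq_int lborel v"
      by (rule sq_int_bound[OF gs, where C = 1]) (use vi in \<open>auto simp: v_def norm_mult\<close>)
    have ftv: "ft v y = ?c * complex_of_real ((2 * pi) powr real DIM('a) * heat_kernel d (y - x))" for y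
    proof -
      have "v \<xi> * exp (- \<i> * complex_of_real (\<xi> \<bullet> y)) = ?e \<xi> * exp (- \<i> * complex_of_real (\<xi> \<bullet> (y - x)))" for \<xi>
        unfolding v_def by (simp add: mult.assoc exp_add[symmetric] inner_diff_right algebra_simps)
      then show ?thesis unfolding ft_def by (simp only: gaussian_fourier_heat_kernel[OF d])
    qed
    have "w' x = cnj (ft (\<lambda>\<xi>. cnj (?e \<xi> * g \<xi>)) x)" using elim by (metis complex_cnj_cnj)
    also have "\<dots> = ?c * (LINT \<xi>|lborel. cnj (cnj (?e \<xi> * g \<xi>) * exp (- \<i> * complex_of_real (\<xi> \<bullet> x))))"
      unfolding ft_def by (subst Bochner_Integration.integral_cnj)
        (simp only: complex_cnj_mult[of "complex_of_real _"] complex_cnj_complex_of_real)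
    also have "(\<lambda>\<xi>. cnj (cnj (?e \<xi> * g \<xi>) * exp (- \<i> * complex_of_real (\<xi> \<bullet> x)))) = (\<lambda>\<xi>. g \<xi> * v \<xi>)"
      by (auto simp: v_def exp_cnj mult_ac)
    also have "(LINT \<xi>|lborel. g \<xi> * v \<xi>) = (LINT y|lborel. w y * ft v y)"
      by (rule is_ft_mult_formula[OF 1 is_ft_integrable[OF vi vs]])
    also have "\<dots> = (LINT y|lborel. complex_of_real (Re (w y) * ((2 * pi) powr (- real DIM('a) / 2) * ((2 * pi) powr real DIM('a) * heat_kernel d (y - x)))))"
    proof (rule integral_cong_AE)
      show "AE y in lborel. w y * ft v y = complex_of_real (Re (w y) * ((2 * pi) powr (- real DIM('a) / 2) * ((2 * pi) powr real DIM('a) * heat_kernel d (y - x))))"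
        using pos by eventually_elim (auto simp: ftv elim: nonneg_Reals_cases)
    qed (use s vi in \<open>auto simp: sq_int_def\<close>)
    also have "\<dots> = complex_of_real (LINT y|lborel. (Re (w y) * ((2 * pi) powr (- real DIM('a) / 2) * ((2 * pi) powr real DIM('a) * heat_kernel d (y - x)))))"
      by (rule integral_complex_of_real)
    finally have eq: "w' x = complex_of_real ((2 * pi) powr (- real DIM('a) / 2) * (LINT y|lborel. (Re (w y) * ((2 * pi) powr (- real DIM('a) / 2) * ((2 * pi) powr real DIM('a) * heat_kernel d (y - x))))))"
      by simp
    have "(LINT y|lborel. (Re (w y) * ((2 * pi) powr (- real DIM('a) / 2) * ((2 * pi) powr real DIM('a) * heat_kernel d (y - x))))) \<ge> 0"
      by (rule integral_nonneg_AE) (use pos in eventually_elim, auto elim!: nonneg_Reals_cases)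
    then show ?case unfolding eq by (subst nonneg_Reals_of_real_iff) (simp add: zero_le_mult_iff)
  qed
qed

lemma positive_multiplier_exp:
  assumes d: "d \<ge> 0"
  shows "positive_multiplier TYPE('n::finite) (\<lambda>l. exp (- d * l))"
proof (cases "d = 0")
  case True
  then show ?thesis using positive_multiplier_const[of 1] by simp
next
  case False
  then have d0: "d > 0" using d by simp
  show ?thesis unfolding positive_multiplier_def
  proof (intro conjI allI impI)
    show "\<exists>C. \<forall>l\<ge>0. \<bar>exp (- d * l)\<bar> \<le> C" using d by (intro exI[of _ 1]) auto
    fix w :: "real^'n \<Rightarrow> complex" and g w'
    assume *: "has_fourier w g" "AE x in lebesgue. w x \<in> \<real>\<^sub>\<ge>\<^sub>0" "has_fourier w' (\<lambda>\<xi>. complex_of_real (exp (- d * (norm \<xi>)\<^sup>2)) * g \<xi>)"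
    obtain v h where v: "is_ft v h" "AE x in lebesgue. w x = v x" "AE x in lebesgue. g x = h x"
      using has_fourier_representatives[OF *(1)] by blast
    obtain v' h' where v': "is_ft v' h'" "AE x in lebesgue. w' x = v' x" "AE x in lebesgue. complex_of_real (exp (- d * (norm x)\<^sup>2)) * g x = h' x"
      using has_fourier_representatives[OF *(3)] by blast
    have hm [measurable]: "h \<in> borel_measurable borel" "v' \<in> borel_measurable borel"
      using is_ft_sq_int[OF v(1)] is_ft_sq_int[OF v'(1)] by (auto simp: sq_int_def)
    have "AE x in lebesgue. h' x = complex_of_real (exp (- d * (norm x)\<^sup>2)) * h x"
      using v(3) v'(3) by eventually_elim simp
    then have 2: "is_ft v' (\<lambda>x. complex_of_real (exp (- d * (norm x)\<^sup>2)) * h x)"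
      by (intro is_ft_cong_AE[OF v'(1)]) (auto simp: AE_completion_iff)
    have "AE x in lebesgue. v x \<in> \<real>\<^sub>\<ge>\<^sub>0" using *(2) v(2) by eventually_elim simp
    then have "AE x in lborel. v x \<in> \<real>\<^sub>\<ge>\<^sub>0" by (simp add: AE_completion_iff)
    from is_ft_heat_nonneg[OF v(1) this d0 2] have "AE x in lebesgue. v' x \<in> \<real>\<^sub>\<ge>\<^sub>0" by (rule AE_completion)
    then show "AE x in lebesgue. w' x \<in> \<real>\<^sub>\<ge>\<^sub>0" using v'(2) by eventually_elim simp
  qed measurable
qed

lemma positive_multiplier_sum:
  assumes "finite I" "\<And>i. i \<in> I \<Longrightarrow> positive_multiplier TYPE('n::finite) (m i)"
  shows "positive_multiplier TYPE('n::finite) (\<lambda>l. \<Sum>i\<in>I. m i l)"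
  using assms
  by (induction rule: finite_induct) (auto intro: positive_multiplier_const positive_multiplier_add)

text \<open>A Riemann sum of exp (- b \<tau>) with mesh 1 / (j + 1) up to j + 1, evaluated as a
  geometric series. With finite sums and a limit the argument stays within the operations under
  which positive multipliers are closed.\<close>

lemma resolvent_riemann_sum:
  fixes b :: real
  assumes b: "b > 0"
  shows "(\<lambda>j. (\<Sum>k<Suc j * Suc j. (1 / real (Suc j)) * exp (- (b * (real k / real (Suc j)))))) \<longlonglongrightarrow> 1 / b"
proof -
  have "(\<Sum>k<Suc j * Suc j. (1 / real (Suc j)) * exp (- (b * (real k / real (Suc j)))))
     = (1 - exp (- b * real (Suc j))) / (real (Suc j) * (1 - exp (- b / real (Suc j))))" for j
  proof -
    define q where "q = exp (- b / real (Suc j))"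
    have q: "q \<noteq> 1" using b by (simp add: q_def)
    have "(\<Sum>k<Suc j * Suc j. (1 / real (Suc j)) * exp (- (b * (real k / real (Suc j)))))
      = (1 / real (Suc j)) * (\<Sum>k<Suc j * Suc j. q ^ k)"
      unfolding sum_distrib_left q_def exp_of_nat_mult[symmetric]
      by (intro sum.cong refl) (simp add: field_simps)
    also have "(\<Sum>k<Suc j * Suc j. q ^ k) = (1 - q ^ (Suc j * Suc j)) / (1 - q)"
    proof -
      have "(\<Sum>k<n. q ^ k) = (1 - q ^ n) / (1 - q)" for n using q by (simp add: sum_gp_strict)
      then show ?thesis by blast
    qed
    also have "q ^ (Suc j * Suc j) = exp (- b * real (Suc j))"
      unfolding q_def exp_of_nat_mult[symmetric] of_nat_mult by (simp add: field_simps del: of_nat_Suc mult_Suc)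
    finally show ?thesis by (simp add: q_def)
  qed
  moreover have "(\<lambda>j. (1 - exp (- b * real (Suc j))) / (real (Suc j) * (1 - exp (- b / real (Suc j))))) \<longlonglongrightarrow> inverse b"
    using b by real_asymp
  ultimately show ?thesis by (simp add: inverse_eq_divide)
qed

lemma positive_multiplier_resolvent:
  assumes a: "a > 0"
  shows "positive_multiplier TYPE('n::finite) (\<lambda>l. 1 / (l + a))"
proof -
  let ?S = "\<lambda>j l. \<Sum>k<Suc j * Suc j. ((1 / real (Suc j)) * exp (- (a * (real k / real (Suc j))))) * exp (- (real k / real (Suc j)) * l)"
  have S: "?S j l = (\<Sum>k<Suc j * Suc j. (1 / real (Suc j)) * exp (- ((l + a) * (real k / real (Suc j)))))" for j l
    by (intro sum.cong refl) (simp add: mult.assoc exp_add[symmetric] algebra_simps add_divide_distrib)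
  have lim: "(\<lambda>j. ?S j l) \<longlonglongrightarrow> 1 / (l + a)" if "l \<ge> 0" for l
    unfolding S using that a by (intro resolvent_riemann_sum) simp
  \<comment> \<open>The sums decrease in \<open>l\<close>, so their values at \<open>l = 0\<close>,
    which form a convergent sequence, bound them uniformly.\<close>
  have "convergent (\<lambda>j. ?S j 0)" using lim[of 0] by (auto simp: convergent_def)
  then have "Bseq (\<lambda>j. ?S j 0)" by (rule convergent_imp_Bseq)
  then obtain C where C: "\<And>j. norm (?S j 0) \<le> C" by (auto simp: Bseq_def)
  have bd: "\<bar>?S j l\<bar> \<le> C" if "l \<ge> 0" for j l
  proof -
    have "0 \<le> ?S j l" by (intro sum_nonneg) simp
    moreover have "?S j l \<le> ?S j 0"
      using that by (intro sum_mono mult_left_mono) (auto intro!: mult_nonneg_nonneg divide_nonneg_nonneg)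
    ultimately show ?thesis using C[of j] by (simp only: real_norm_def)
  qed
  show ?thesis
  proof (rule positive_multiplier_limit[where m = ?S, OF _ bd lim])
    show "positive_multiplier TYPE('n) (?S j)" for j
      by (intro positive_multiplier_sum positive_multiplier_mult positive_multiplier_const positive_multiplier_exp) auto
  qed
qed

section \<open>Laplace transforms and convolutions\<close>

text \<open>The mean value inequality bounds the difference quotients by \<open>G\<close>; the rest
  is dominated convergence along sequences.\<close>

lemma DERIV_integral:
  fixes f f' :: "real \<Rightarrow> 'a \<Rightarrow> real"
  assumes e: "e > 0"
    and int: "\<And>x. \<bar>x - s\<bar> < e \<Longrightarrow> integrable M (f x)"
    and f' [measurable]: "f' s \<in> borel_measurable M"
    and deriv: "AE r in M. \<forall>x. \<bar>x - s\<bar> < e \<longrightarrow> ((\<lambda>x. f x r) has_real_derivative f' x r) (at x) \<and> \<bar>f' x r\<bar> \<le> G r"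
    and G: "integrable M G"
  shows "((\<lambda>x. LINT r|M. f x r) has_real_derivative (LINT r|M. f' s r)) (at s)"
    and "integrable M (f' s)"
proof -
  show "integrable M (f' s)"
  proof (rule Bochner_Integration.integrable_bound[OF G f'])
    show "AE r in M. norm (f' s r) \<le> norm (G r)"
      using deriv
    proof eventually_elim
      case (elim r)
      then have "\<bar>f' s r\<bar> \<le> G r" using e by simp
      then show ?case by simp
    qed
  qed
  show "((\<lambda>x. LINT r|M. f x r) has_real_derivative (LINT r|M. f' s r)) (at s)"
    unfolding has_field_derivative_iff tendsto_at_iff_sequentially
  proof (intro allI impI)
    fix X :: "nat \<Rightarrow> real" assume X: "\<forall>i. X i \<in> UNIV - {s}" "X \<longlonglongrightarrow> s"
    have "\<forall>\<^sub>F i in sequentially. dist (X i) s < e" using tendstoD[OF X(2) e] .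
    then obtain N where N: "\<And>i. i \<ge> N \<Longrightarrow> \<bar>X i - s\<bar> < e"
      by (auto simp: eventually_sequentially dist_real_def)
    define Y where "Y i = X (i + N)" for i
    have Y: "\<bar>Y i - s\<bar> < e" "Y i \<noteq> s" for i using N X(1) by (auto simp: Y_def)
    have Ys: "Y \<longlonglongrightarrow> s" unfolding Y_def using X(2) by (rule LIMSEQ_ignore_initial_segment)
    have s: "\<bar>s - s\<bar> < e" using e by simp
    have "(\<lambda>i. LINT r|M. (f (Y i) r - f s r) / (Y i - s)) \<longlonglongrightarrow> (LINT r|M. f' s r)"
    proof (rule integral_dominated_convergence[where w = G])
      show "AE r in M. (\<lambda>i. (f (Y i) r - f s r) / (Y i - s)) \<longlonglongrightarrow> f' s r"
        using deriv
      proof eventually_elim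
        case (elim r)
        then have "((\<lambda>x. f x r) has_real_derivative f' s r) (at s)" using s by blast
        then have "((\<lambda>y. (f y r - f s r) / (y - s)) \<longlongrightarrow> f' s r) (at s)"
          by (simp add: has_field_derivative_iff)
        then show ?case using Y Ys unfolding tendsto_at_iff_sequentially by (auto simp: o_def)
      qed
      show "AE r in M. norm ((f (Y i) r - f s r) / (Y i - s)) \<le> G r" for i
        using deriv
      proof eventually_elim
        case (elim r)
        have "\<bar>f (Y i) r - f s r\<bar> \<le> G r * \<bar>Y i - s\<bar>"
        proof -
          have "norm (f (Y i) r - f s r) \<le> G r * norm (Y i - s)"
          proof (rule field_differentiable_bound[where S = "{s - e<..<s + e}" and f' = "\<lambda>x. f' x r"])
            show "((\<lambda>x. f x r) has_real_derivative f' x r) (at x within {s - e<..<s + e})" "norm (f' x r) \<le> G r"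
              if "x \<in> {s - e<..<s + e}" for x
            proof -
              have "\<bar>x - s\<bar> < e" using that by auto
              then have *: "((\<lambda>x. f x r) has_real_derivative f' x r) (at x) \<and> \<bar>f' x r\<bar> \<le> G r"
                using elim by blast
              show "((\<lambda>x. f x r) has_real_derivative f' x r) (at x within {s - e<..<s + e})"
                by (rule has_field_derivative_at_within[OF conjunct1[OF *]])
              show "norm (f' x r) \<le> G r" using * by simp
            qed
          qed (use Y(1)[of i] e in auto)
          then show ?thesis by simp
        qed
        then show ?case using Y(2)[of i] by (simp add: abs_divide pos_divide_le_eq)
      qed
      show "(\<lambda>r. (f (Y i) r - f s r) / (Y i - s)) \<in> borel_measurable M" for i
        using int[OF Y(1)] int[OF s] by measurable
    qed (use G f' in auto)
    moreover have "(LINT r|M. (f (Y i) r - f s r) / (Y i - s)) = ((LINT r|M. f (Y i) r) - (LINT r|M. f s r)) / (Y i - s)" for i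
      using int[OF Y(1)] int[OF s] by simp
    ultimately have "(\<lambda>i. ((LINT r|M. f (Y i) r) - (LINT r|M. f s r)) / (Y i - s)) \<longlonglongrightarrow> (LINT r|M. f' s r)" by (simp only:)
    then have "(\<lambda>i. ((LINT r|M. f (X (i + N)) r) - (LINT r|M. f s r)) / (X (i + N) - s)) \<longlonglongrightarrow> (LINT r|M. f' s r)"
      by (simp add: Y_def)
    then show "((\<lambda>y. ((LINT r|M. f y r) - (LINT r|M. f s r)) / (y - s)) \<circ> X) \<longlonglongrightarrow> (LINT r|M. f' s r)"
      unfolding o_def by (rule LIMSEQ_offset)
  qed
qed

text \<open>Lerch's theorem. In the variable x = exp (- t) the integer values of \<open>s\<close>
  make all moments of \<open>F\<close> vanish; Bernstein polynomials lead to continuous functions of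
  x, and ramps to indicators of x < b, which are half-lines in t.\<close>

lemma laplace_transform_zero_imp_AE:
  fixes f :: "real \<Rightarrow> real"
  assumes int: "\<And>s. s > 0 \<Longrightarrow> integrable lborel (\<lambda>t. indicator {0<..} t * (f t * exp (- t * s)))"
    and zero: "\<And>s. s > 0 \<Longrightarrow> (LINT t|lborel. indicator {0<..} t * (f t * exp (- t * s))) = 0"
  shows "AE t in lborel. t > 0 \<longrightarrow> f t = 0"
proof -
  \<comment> \<open>The factor exp (- t) makes \<open>F\<close> integrable and shifts the moments:
    the m-th moment of \<open>F\<close> is the transform at \<open>s = m + 1\<close>.\<close>
  define F where "F t = indicator {0<..} t * (f t * exp (- t * 1))" for t
  have F: "integrable lborel F" unfolding F_def using int[of 1] by simp
  then have [measurable]: "F \<in> borel_measurable borel" by auto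
  have Fpos: "F t = 0" if "t \<le> 0" for t using that by (simp add: F_def)
  have bounded_int: "integrable lborel (\<lambda>t. F t * h t)"
    if [measurable]: "h \<in> borel_measurable borel" and "\<And>t. t > 0 \<Longrightarrow> \<bar>h t\<bar> \<le> C" for h and C :: real
  proof (rule Bochner_Integration.integrable_bound)
    show "integrable lborel (\<lambda>t. C * F t)" using F by simp
    show "AE t in lborel. norm (F t * h t) \<le> norm (C * F t)"
    proof (rule AE_I2)
      fix t
      show "norm (F t * h t) \<le> norm (C * F t)"
      proof (cases "t > 0")
        case True
        have "\<bar>h t\<bar> \<le> \<bar>C\<bar>" using that(2)[OF True] by simp
        then have "\<bar>F t\<bar> * \<bar>h t\<bar> \<le> \<bar>F t\<bar> * \<bar>C\<bar>" by (intro mult_left_mono) auto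
        then show ?thesis by (simp add: abs_mult mult.commute)
      qed (simp add: Fpos)
    qed
  qed measurable
  \<comment> \<open>Products x^m (1 - x)^j are the shape of Bernstein polynomials. The induction
    expands one factor 1 - x at a time, raising \<open>m\<close>, which is therefore left
    arbitrary.\<close>
  have mono: "(LINT t|lborel. F t * ((exp (- t)) ^ m * (1 - exp (- t)) ^ j)) = 0" for m j
  proof (induction j arbitrary: m)
    case 0
    have "F t * ((exp (- t)) ^ m * (1 - exp (- t)) ^ 0) = indicator {0<..} t * (f t * exp (- t * real (Suc m)))" for t
      by (simp add: F_def exp_of_nat_mult[symmetric] exp_add[symmetric] algebra_simps)
    then show ?case using zero[of "real (Suc m)"] by (simp only:)
  next
    case (Suc j)
    have b: "\<bar>(exp (- t)) ^ m * (1 - exp (- t)) ^ j\<bar> \<le> 1" if "t > 0" for t :: real and m j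
      using that by (auto simp: abs_mult power_abs intro!: mult_le_one power_le_one)
    have "(LINT t|lborel. F t * ((exp (- t)) ^ m * (1 - exp (- t)) ^ Suc j))
      = (LINT t|lborel. F t * ((exp (- t)) ^ m * (1 - exp (- t)) ^ j) - F t * ((exp (- t)) ^ Suc m * (1 - exp (- t)) ^ j))"
      by (intro Bochner_Integration.integral_cong) (auto simp: algebra_simps)
    also have "\<dots> = 0"
      by (subst Bochner_Integration.integral_diff)
        (simp_all only: Suc.IH diff_self, auto intro!: bounded_int[where C = 1] b simp del: power_Suc)
    finally show ?case .
  qed
  have cont: "(LINT t|lborel. F t * \<phi> (exp (- t))) = 0" if \<phi>: "continuous_on UNIV \<phi>" for \<phi> :: "real \<Rightarrow> real"
  proof (rule ccontr)
    define L where "L = (LINT t|lborel. F t * \<phi> (exp (- t)))"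
    assume "(LINT t|lborel. F t * \<phi> (exp (- t))) \<noteq> 0"
    then have L: "\<bar>L\<bar> > 0" by (simp add: L_def)
    define A where "A = (LINT t|lborel. \<bar>F t\<bar>)"
    have A: "A \<ge> 0" unfolding A_def by simp
    define e where "e = \<bar>L\<bar> / (2 * (A + 1))"
    have e: "e > 0" using L A by (simp add: e_def)
    have [measurable]: "\<phi> \<in> borel_measurable borel" using \<phi> by (rule borel_measurable_continuous_onI)
    obtain n where n: "\<And>x. x \<in> {0..1} \<Longrightarrow> \<bar>\<phi> x - (\<Sum>k\<le>n. \<phi> (real k / real n) * Bernstein n k x)\<bar> < e"
      using Bernstein_Weierstrass[OF continuous_on_subset[OF \<phi>] e] by (metis order_refl subset_UNIV)
    let ?p = "\<lambda>x. \<Sum>k\<le>n. \<phi> (real k / real n) * Bernstein n k x"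
    have [measurable]: "?p \<in> borel_measurable borel" unfolding Bernstein_def by measurable
    have "compact (\<phi> ` {0..1})" by (intro compact_continuous_image continuous_on_subset[OF \<phi>]) auto
    then have "bounded (\<phi> ` {0..1})" by (rule compact_imp_bounded)
    then obtain C where "\<forall>y\<in>\<phi> ` {0..1}. norm y \<le> C" by (auto simp: bounded_iff)
    then have C: "\<bar>\<phi> x\<bar> \<le> C" if "x \<in> {0..1}" for x using that by auto
    have pC: "\<bar>?p x\<bar> \<le> C + e" if "x \<in> {0..1}" for x using n[OF that] C[OF that] by linarith
    have i1: "integrable lborel (\<lambda>t. F t * \<phi> (exp (- t)))" by (rule bounded_int[where C = C]) (auto intro!: C)
    have i2: "integrable lborel (\<lambda>t. F t * ?p (exp (- t)))" by (rule bounded_int[where C = "C + e"]) (auto intro!: pC)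
    have bern: "F t * ?p (exp (- t)) = (\<Sum>k\<le>n. (\<phi> (real k / real n) * real (n choose k)) * (F t * ((exp (- t)) ^ k * (1 - exp (- t)) ^ (n - k))))" for t
      unfolding Bernstein_def sum_distrib_left by (intro sum.cong) (auto simp: mult_ac)
    have b: "\<bar>(exp (- t)) ^ m * (1 - exp (- t)) ^ j\<bar> \<le> 1" if "t > 0" for t :: real and m j
      using that by (auto simp: abs_mult power_abs intro!: mult_le_one power_le_one)
    have p0: "(LINT t|lborel. F t * ?p (exp (- t))) = 0"
      unfolding bern
      by (subst Bochner_Integration.integral_sum) (auto simp only: integral_mult_right_zero mono mult_zero_right sum.neutral_const intro!: integrable_mult_right bounded_int[where C = 1] b, measurable)
    have "L = (LINT t|lborel. F t * \<phi> (exp (- t)) - F t * ?p (exp (- t)))"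
      by (subst Bochner_Integration.integral_diff[OF i1 i2]) (simp add: p0 L_def)
    also have "\<bar>\<dots>\<bar> \<le> (LINT t|lborel. e * \<bar>F t\<bar>)"
    proof (rule order_trans[OF integral_abs_bound], rule integral_mono)
      fix t
      show "\<bar>F t * \<phi> (exp (- t)) - F t * ?p (exp (- t))\<bar> \<le> e * \<bar>F t\<bar>"
      proof (cases "t > 0")
        case True
        then have "\<bar>\<phi> (exp (- t)) - ?p (exp (- t))\<bar> \<le> e" using n[of "exp (- t)"] by simp
        then show ?thesis unfolding right_diff_distrib[symmetric] abs_mult mult.commute[of e]
          by (intro mult_left_mono) auto
      qed (simp add: Fpos)
    qed (use i1 i2 F in auto)
    also have "\<dots> = e * A" by (simp add: A_def)
    also have "\<dots> < \<bar>L\<bar>" using L A unfolding e_def by (simp add: field_simps) (smt (verit) mult_nonneg_nonneg)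
    finally show False by simp
  qed
  have tail: "(LINT t|lborel. F t * indicator {..<b} (exp (- t))) = 0" for b :: real
  proof -
    \<comment> \<open>Continuous ramps that converge pointwise to the indicator of x < b.\<close>
    let ?\<phi> = "\<lambda>i x. max 0 (min 1 (real i * (b - x)))"
    have lim: "(\<lambda>i. ?\<phi> i x) \<longlonglongrightarrow> indicator {..<b} x" for x
    proof (cases "x < b")
      case True
      obtain N :: nat where N: "1 / (b - x) < real N" using reals_Archimedean2 by blast
      have "?\<phi> i x = 1" if "i \<ge> N" for i
      proof -
        have "1 / (b - x) \<le> real i" using N that by linarith
        then have "1 \<le> real i * (b - x)" using True by (simp add: divide_le_eq)
        then show ?thesis by simp
      qed
      then have "\<forall>\<^sub>F i in sequentially. ?\<phi> i x = 1" by (auto simp: eventually_sequentially)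
      then show ?thesis using True by (simp add: tendsto_eventually)
    next
      case False
      then have "real i * (b - x) \<le> 0" for i by (intro mult_nonneg_nonpos) auto
      then have "?\<phi> i x = 0" for i by (metis max.absorb1 min.coboundedI2)
      then show ?thesis using False by simp
    qed
    have "(\<lambda>i. LINT t|lborel. F t * ?\<phi> i (exp (- t))) \<longlonglongrightarrow> (LINT t|lborel. F t * indicator {..<b} (exp (- t)))"
    proof (rule integral_dominated_convergence[where w = "\<lambda>t. \<bar>F t\<bar>"])
      show "AE t in lborel. (\<lambda>i. F t * ?\<phi> i (exp (- t))) \<longlonglongrightarrow> F t * indicator {..<b} (exp (- t))"
        by (intro AE_I2 tendsto_mult tendsto_const lim)
      show "AE t in lborel. norm (F t * ?\<phi> i (exp (- t))) \<le> \<bar>F t\<bar>" for i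
        by (intro AE_I2) (simp add: abs_mult mult_left_le)
    qed (use F in auto)
    moreover have "(LINT t|lborel. F t * ?\<phi> i (exp (- t))) = 0" for i
      by (rule cont) (intro continuous_intros)
    ultimately show ?thesis by (simp add: LIMSEQ_const_iff)
  qed
  have "AE t in lborel. F t = 0"
  proof (rule AE_eq_0_generator[where G = "range (\<lambda>a. {a<..})"])
    show "sets lborel = sigma_sets (space lborel) (range (\<lambda>a::real. {a<..}))"
      by (subst sets_lborel, subst borel_Ioi) simp
    show "Int_stable (range (\<lambda>a::real. {a<..}))"
    proof (rule Int_stableI)
      fix a b assume "a \<in> range (\<lambda>a::real. {a<..})" "b \<in> range (\<lambda>a::real. {a<..})"
      then obtain x y where "a = {x<..}" "b = {y<..}" by auto
      then have "a \<inter> b = {max x y<..}" by auto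
      then show "a \<inter> b \<in> range (\<lambda>a::real. {a<..})" by simp
    qed
    \<comment> \<open>The bound 2 exceeds every value of exp (- t) with t > 0, so
      \<open>tail\<close> yields the integral over the whole line.\<close>
    have "F t * indicator {..<2} (exp (- t)) = F t" for t
    proof (cases "t > 0")
      case True
      then have "exp (- t) < exp 0" by (subst exp_less_cancel_iff) simp
      then have "exp (- t) < 2" unfolding exp_zero by linarith
      then show ?thesis by (simp add: indicator_def)
    qed (simp add: Fpos)
    then show "(LINT t|lborel. F t) = 0" using tail[of 2] by (simp only:)
    show "(LINT t|lborel. indicator A t * F t) = 0" if A': "A \<in> range (\<lambda>a. {a<..})" for A
    proof -
      obtain a where A: "A = {a<..}" using A' by (rule rangeE)
      have "indicator A t * F t = F t * indicator {..<exp (- a)} (exp (- t))" for t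
        by (auto simp: A split: split_indicator)
      then show ?thesis using tail[of "exp (- a)"] by (simp only:)
    qed
  qed (use F in auto)
  then show ?thesis by eventually_elim (auto simp: F_def)
qed

section \<open>Convolutions on the half-line\<close>

definition cv :: "(real \<Rightarrow> 'b::{real_normed_field, banach, second_countable_topology}) \<Rightarrow> (real \<Rightarrow> 'b) \<Rightarrow> real \<Rightarrow> 'b" where
  "cv f g t = (LINT \<tau>|lborel. indicator {0<..<t} \<tau> *\<^sub>R (f (t - \<tau>) * g \<tau>))"

lemma lborel_integral_reflect:
  fixes f :: "real \<Rightarrow> 'b::{banach, second_countable_topology}"
  shows "(LINT \<tau>|lborel. f \<tau>) = (LINT \<tau>|lborel. f (t - \<tau>))"
  by (subst lborel_integral_real_affine[of "-1" f t]) auto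

lemma cv_commute: "cv f g t = cv g f t"
proof -
  have i: "indicator {0<..<t} (t - \<tau>) = (indicator {0<..<t} \<tau> :: real)" for \<tau> by (auto split: split_indicator)
  show ?thesis unfolding cv_def
    by (subst lborel_integral_reflect[of _ t]) (simp add: i mult.commute)
qed

text \<open>Extended-valued, so that the convolution rule \<open>lap_nncv\<close> is an instance of
  Tonelli's theorem.\<close>

definition lap :: "(real \<Rightarrow> real) \<Rightarrow> real \<Rightarrow> ennreal" where
  "lap f s = (\<integral>\<^sup>+t. ennreal (f t * exp (- t * s)) * indicator {0<..} t \<partial>lborel)"

definition nncv :: "(real \<Rightarrow> real) \<Rightarrow> (real \<Rightarrow> real) \<Rightarrow> real \<Rightarrow> ennreal" where
  "nncv f g t = (\<integral>\<^sup>+\<tau>. ennreal (f (t - \<tau>) * g \<tau>) * indicator {0<..<t} \<tau> \<partial>lborel)"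

lemma lap_nncv:
  assumes [measurable]: "f \<in> borel_measurable borel" "g \<in> borel_measurable borel"
    and f: "\<And>t. f t \<ge> 0" and g: "\<And>t. g t \<ge> 0"
  shows "(\<integral>\<^sup>+t. nncv f g t * ennreal (exp (- t * s)) * indicator {0<..} t \<partial>lborel) = lap f s * lap g s"
proof -
  have "(\<integral>\<^sup>+t. nncv f g t * ennreal (exp (- t * s)) * indicator {0<..} t \<partial>lborel)
    = (\<integral>\<^sup>+t. (\<integral>\<^sup>+\<tau>. ennreal (g \<tau> * exp (- \<tau> * s)) * indicator {0<..} \<tau> * (ennreal (f (t - \<tau>) * exp (- (t - \<tau>) * s)) * indicator {0<..} (t - \<tau>)) \<partial>lborel) \<partial>lborel)"
  proof (rule nn_integral_cong)
    fix t :: real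
    have "nncv f g t * ennreal (exp (- t * s)) * indicator {0<..} t
       = (\<integral>\<^sup>+\<tau>. (ennreal (f (t - \<tau>) * g \<tau>) * indicator {0<..<t} \<tau>) * (ennreal (exp (- t * s)) * indicator {0<..} t) \<partial>lborel)"
      unfolding nncv_def by (subst nn_integral_multc) (auto simp: mult.assoc)
    also have "\<dots> = (\<integral>\<^sup>+\<tau>. ennreal (g \<tau> * exp (- \<tau> * s)) * indicator {0<..} \<tau> * (ennreal (f (t - \<tau>) * exp (- (t - \<tau>) * s)) * indicator {0<..} (t - \<tau>)) \<partial>lborel)"
    proof (rule nn_integral_cong)
      fix \<tau> :: real
      have "exp (- t * s) = exp (- \<tau> * s) * exp (- (t - \<tau>) * s)" by (simp add: exp_add[symmetric] algebra_simps)
      then have "f (t - \<tau>) * g \<tau> * exp (- t * s) = (g \<tau> * exp (- \<tau> * s)) * (f (t - \<tau>) * exp (- (t - \<tau>) * s))"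
        by (simp add: mult_ac)
      then have "ennreal (f (t - \<tau>) * g \<tau>) * ennreal (exp (- t * s)) = ennreal (g \<tau> * exp (- \<tau> * s)) * ennreal (f (t - \<tau>) * exp (- (t - \<tau>) * s))"
        using f g by (simp flip: ennreal_mult)
      then show "(ennreal (f (t - \<tau>) * g \<tau>) * indicator {0<..<t} \<tau>) * (ennreal (exp (- t * s)) * indicator {0<..} t)
        = ennreal (g \<tau> * exp (- \<tau> * s)) * indicator {0<..} \<tau> * (ennreal (f (t - \<tau>) * exp (- (t - \<tau>) * s)) * indicator {0<..} (t - \<tau>))"
        by (auto split: split_indicator)
    qed
    finally show "nncv f g t * ennreal (exp (- t * s)) * indicator {0<..} t
       = (\<integral>\<^sup>+\<tau>. ennreal (g \<tau> * exp (- \<tau> * s)) * indicator {0<..} \<tau> * (ennreal (f (t - \<tau>) * exp (- (t - \<tau>) * s)) * indicator {0<..} (t - \<tau>)) \<partial>lborel)" .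
  qed
  also have "\<dots> = (\<integral>\<^sup>+\<tau>. (\<integral>\<^sup>+t. ennreal (g \<tau> * exp (- \<tau> * s)) * indicator {0<..} \<tau> * (ennreal (f (t - \<tau>) * exp (- (t - \<tau>) * s)) * indicator {0<..} (t - \<tau>)) \<partial>lborel) \<partial>lborel)"
    by (rule lborel_pair.Fubini') measurable
  also have "\<dots> = (\<integral>\<^sup>+\<tau>. ennreal (g \<tau> * exp (- \<tau> * s)) * indicator {0<..} \<tau> * lap f s \<partial>lborel)"
  proof (rule nn_integral_cong)
    fix \<tau> :: real
    have "lap f s = (\<integral>\<^sup>+t. ennreal (f (t - \<tau>) * exp (- (t - \<tau>) * s)) * indicator {0<..} (t - \<tau>) \<partial>lborel)"
      unfolding lap_def by (subst lborel_nn_integral_affine[of _ 1 "- \<tau>"]) auto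
    then show "(\<integral>\<^sup>+t. ennreal (g \<tau> * exp (- \<tau> * s)) * indicator {0<..} \<tau> * (ennreal (f (t - \<tau>) * exp (- (t - \<tau>) * s)) * indicator {0<..} (t - \<tau>)) \<partial>lborel)
       = ennreal (g \<tau> * exp (- \<tau> * s)) * indicator {0<..} \<tau> * lap f s"
      by (subst nn_integral_cmult) auto
  qed
  also have "\<dots> = lap f s * lap g s"
    unfolding lap_def[of g] by (subst nn_integral_multc) (auto simp: mult.commute)
  finally show ?thesis .
qed

definition locint :: "(real \<Rightarrow> 'b::{real_normed_field, banach, second_countable_topology}) \<Rightarrow> bool" where
  "locint f \<longleftrightarrow> f \<in> borel_measurable borel \<and> (\<forall>T. integrable lborel (\<lambda>t. indicator {0<..<T} t *\<^sub>R f t))"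

lemma locint_measurable [measurable_dest]: "locint f \<Longrightarrow> f \<in> borel_measurable borel"
  by (simp add: locint_def)

lemma cv_integrable:
  fixes f :: "real \<Rightarrow> 'b::{real_normed_field, banach, second_countable_topology}"
  assumes f: "locint f" and g [measurable]: "g \<in> borel_measurable borel" and C: "\<And>\<tau>. 0 < \<tau> \<Longrightarrow> \<tau> < t \<Longrightarrow> norm (g \<tau>) \<le> C"
  shows "integrable lborel (\<lambda>\<tau>. indicator {0<..<t} \<tau> *\<^sub>R (g (t - \<tau>) * f \<tau>))"
    and "norm (cv g f t) \<le> C * (LINT \<tau>|lborel. indicator {0<..<t} \<tau> * norm (f \<tau>))"
proof -
  have [measurable]: "f \<in> borel_measurable borel" using f by (simp add: locint_def)
  have fi: "integrable lborel (\<lambda>\<tau>. indicator {0<..<t} \<tau> *\<^sub>R f \<tau>)" using f by (simp add: locint_def)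
  have fi': "integrable lborel (\<lambda>\<tau>. C * (indicator {0<..<t} \<tau> * norm (f \<tau>)))"
    using integrable_norm[OF fi] by simp
  have le: "norm (indicator {0<..<t} \<tau> *\<^sub>R (g (t - \<tau>) * f \<tau>)) \<le> C * (indicator {0<..<t} \<tau> * norm (f \<tau>))" for \<tau>
    using C[of "t - \<tau>"] by (auto simp: norm_mult intro!: mult_right_mono split: split_indicator)
  show i: "integrable lborel (\<lambda>\<tau>. indicator {0<..<t} \<tau> *\<^sub>R (g (t - \<tau>) * f \<tau>))"
  proof (rule Bochner_Integration.integrable_bound[OF fi'], measurable, rule AE_I2)
    fix \<tau>
    show "norm (indicator {0<..<t} \<tau> *\<^sub>R (g (t - \<tau>) * f \<tau>)) \<le> norm (C * (indicator {0<..<t} \<tau> * norm (f \<tau>)))"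
      by (rule order_trans[OF le]) simp
  qed
  have "norm (cv g f t) \<le> (LINT \<tau>|lborel. norm (indicator {0<..<t} \<tau> *\<^sub>R (g (t - \<tau>) * f \<tau>)))"
    unfolding cv_def by (rule integral_norm_bound)
  also have "\<dots> \<le> (LINT \<tau>|lborel. C * (indicator {0<..<t} \<tau> * norm (f \<tau>)))"
    by (intro integral_mono integrable_norm i fi' le)
  finally show "norm (cv g f t) \<le> C * (LINT \<tau>|lborel. indicator {0<..<t} \<tau> * norm (f \<tau>))" by simp
qed

lemma cv_continuous:
  fixes f g :: "real \<Rightarrow> 'b::{real_normed_field, banach, second_countable_topology}"
  assumes f: "locint f" and g: "continuous_on {0..} g" and gm [measurable]: "g \<in> borel_measurable borel"
  shows "continuous_on {0<..} (cv f g)"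
proof (rule continuous_on_sequentiallyI)
  have [measurable]: "f \<in> borel_measurable borel" using f by (simp add: locint_def)
  fix u :: "nat \<Rightarrow> real" and a
  assume u: "\<forall>n. u n \<in> {0<..}" "a \<in> {0<..}" "u \<longlonglongrightarrow> a"
  obtain T where T: "\<And>n. \<bar>u n\<bar> \<le> T" using convergent_imp_Bseq[of u] u(3) by (auto simp: convergent_def Bseq_def)
  have aT: "a \<le> T" using T by (intro LIMSEQ_le_const2[OF u(3)]) (auto simp: abs_le_iff)
  have "compact (g ` {0..T})" by (intro compact_continuous_image continuous_on_subset[OF g]) auto
  then have "bounded (g ` {0..T})" by (rule compact_imp_bounded)
  then obtain C where "\<forall>y\<in>g ` {0..T}. norm y \<le> C" by (auto simp: bounded_iff)
  then have C: "norm (g x) \<le> C" if "0 \<le> x" "x \<le> T" for x using that by auto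
  have C0: "0 \<le> C" using norm_ge_zero[of "g 0"] C[of 0] T[of 0] by linarith
  have "(\<lambda>n. LINT \<tau>|lborel. indicator {0<..<u n} \<tau> *\<^sub>R (g (u n - \<tau>) * f \<tau>)) \<longlonglongrightarrow> (LINT \<tau>|lborel. indicator {0<..<a} \<tau> *\<^sub>R (g (a - \<tau>) * f \<tau>))"
  proof (rule integral_dominated_convergence[where w = "\<lambda>\<tau>. C * norm (indicator {0<..<T + 1} \<tau> *\<^sub>R f \<tau>)"])
    show "integrable lborel (\<lambda>\<tau>. C * norm (indicator {0<..<T + 1} \<tau> *\<^sub>R f \<tau>))"
      using f by (intro integrable_mult_right integrable_norm) (simp add: locint_def)
    have ne: "AE \<tau> in lborel. \<tau> \<noteq> a" by (rule AE_lborel_singleton)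
    show "AE \<tau> in lborel. (\<lambda>n. indicator {0<..<u n} \<tau> *\<^sub>R (g (u n - \<tau>) * f \<tau>)) \<longlonglongrightarrow> indicator {0<..<a} \<tau> *\<^sub>R (g (a - \<tau>) * f \<tau>)"
      using ne
    proof eventually_elim
      case (elim \<tau>)
      consider "\<tau> \<le> 0" | "0 < \<tau>" "\<tau> < a" | "a < \<tau>" using elim by linarith
      then show ?case
      proof cases
        case 2
        have ev: "\<forall>\<^sub>F n in sequentially. \<tau> < u n" using order_tendstoD(1)[OF u(3) 2(2)] .
        \<comment> \<open>\<open>g\<close> is continuous on the half-line only; \<open>max 0\<close>
          keeps the argument there until \<open>u n\<close> has passed
          \<open>\<tau>\<close>.\<close>
        have "(\<lambda>n. g (max 0 (u n - \<tau>))) \<longlonglongrightarrow> g (a - \<tau>)"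
        proof (rule continuous_on_tendsto_compose[OF g])
          have "(\<lambda>n. max 0 (u n - \<tau>)) \<longlonglongrightarrow> max 0 (a - \<tau>)" by (intro tendsto_intros u)
          then show "(\<lambda>n. max 0 (u n - \<tau>)) \<longlonglongrightarrow> a - \<tau>" using 2 by simp
        qed (use 2 in auto)
        then have "(\<lambda>n. g (max 0 (u n - \<tau>)) * f \<tau>) \<longlonglongrightarrow> g (a - \<tau>) * f \<tau>" by (intro tendsto_intros)
        moreover have "\<forall>\<^sub>F n in sequentially. g (max 0 (u n - \<tau>)) * f \<tau> = indicator {0<..<u n} \<tau> *\<^sub>R (g (u n - \<tau>) * f \<tau>)"
          using ev by eventually_elim (use 2 in auto)
        ultimately show ?thesis using 2 by (auto intro: Lim_transform_eventually)
      next
        case 3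
        have ev: "\<forall>\<^sub>F n in sequentially. u n < \<tau>" using order_tendstoD(2)[OF u(3) 3] .
        have "\<forall>\<^sub>F n in sequentially. indicator {0<..<u n} \<tau> *\<^sub>R (g (u n - \<tau>) * f \<tau>) = 0"
          using ev by eventually_elim auto
        then show ?thesis using 3 by (simp add: tendsto_eventually)
      qed auto
    qed
    show "AE \<tau> in lborel. norm (indicator {0<..<u n} \<tau> *\<^sub>R (g (u n - \<tau>) * f \<tau>)) \<le> C * norm (indicator {0<..<T + 1} \<tau> *\<^sub>R f \<tau>)" for n
      using T[of n] C C0 by (auto intro!: AE_I2 mult_right_mono simp: norm_mult split: split_indicator)
  qed measurable
  then have "(\<lambda>n. cv g f (u n)) \<longlonglongrightarrow> cv g f a" by (simp add: cv_def)
  then show "(\<lambda>n. cv f g (u n)) \<longlonglongrightarrow> cv f g a" by (simp add: cv_commute[of f g])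
qed

section \<open>Partial fractions with interlacing poles\<close>

lemma poly_linear_prod: "poly (\<Prod>k\<in>S. [:a k, 1:]) x = (\<Prod>k\<in>S. (a k + x))"
  by (simp add: poly_prod add.commute)

lemma degree_linear_prod: "finite S \<Longrightarrow> degree (\<Prod>k\<in>S. [:a k, 1 :: real:]) = card S"
  by (subst degree_prod_eq_sum_degree) auto

lemma lead_coeff_linear_prod: "lead_coeff (\<Prod>k\<in>S. [:a k, 1 :: real:]) = 1"
  by (simp add: lead_coeff_prod)

lemma poly_eq_0_many_roots:
  fixes p :: "real poly"
  assumes deg: "degree p < n" and inj: "inj_on a {..<n}" and root: "\<And>j. j < n \<Longrightarrow> poly p (a j) = 0"
  shows "p = 0"
proof (rule ccontr)
  assume p: "p \<noteq> 0"
  have "n = card (a ` {..<n})" using card_image[OF inj] by simp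
  also have "\<dots> \<le> card {x. poly p x = 0}" by (intro card_mono poly_roots_finite p) (auto simp: root)
  also have "\<dots> \<le> degree p" by (rule card_poly_roots_bound[OF p])
  finally show False using deg by simp
qed

lemma sign_prod_interlaced:
  fixes x :: real and b :: "nat \<Rightarrow> real"
  assumes "i \<le> n" and lt: "\<And>k. k < i \<Longrightarrow> b k < x" and gt: "\<And>k. i \<le> k \<Longrightarrow> k < n \<Longrightarrow> x < b k"
  shows "(-1) ^ i * (\<Prod>k<n. (b k - x)) > 0"
proof -
  have "{..<n} = {..<i} \<union> {i..<n}" using assms(1) by auto
  then have "(\<Prod>k<n. (b k - x)) = (\<Prod>k<i. (b k - x)) * (\<Prod>k\<in>{i..<n}. (b k - x))"
    by (simp add: prod.union_disjoint ivl_disj_int)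
  moreover have "(-1) ^ i * (\<Prod>k<i. (b k - x)) = (\<Prod>k<i. (x - b k))"
  proof -
    have "(\<Prod>k<i. (x - b k)) = (\<Prod>k<i. (-1) * (b k - x))" by simp
    then show ?thesis by (simp only: prod.distrib prod_constant card_lessThan)
  qed
  moreover have "(\<Prod>k<i. (x - b k)) > 0" using lt by (intro prod_pos) auto
  moreover have "(\<Prod>k\<in>{i..<n}. (b k - x)) > 0" using gt by (intro prod_pos) auto
  ultimately show ?thesis by (simp only: mult.assoc[symmetric]) simp
qed

text \<open>A kernel transform with finitely many poles at \<open>- r i\<close>. The constant
  \<open>\<epsilon> > 0\<close> gives \<open>Q\<close> the exact degree \<open>m + 1\<close>, which
  produces the root beyond the last node and makes the residues add up to 1.\<close>

locale discrete_stieltjes =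
  fixes m :: nat and r c :: "nat \<Rightarrow> real" and \<epsilon> l :: real
  assumes r0: "\<And>i. i < m \<Longrightarrow> r i > 0" and r_mono: "\<And>i j. i < j \<Longrightarrow> j < m \<Longrightarrow> r i < r j"
    and c0: "\<And>i. i < m \<Longrightarrow> c i > 0" and eps: "\<epsilon> > 0" and l: "l > 0"
begin

definition g where "g s = \<epsilon> + (\<Sum>i<m. c i / (s + r i))"

text \<open>\<open>P\<close> is the common denominator of \<open>g\<close>, \<open>Pd i\<close> are
  its cofactors, \<open>A\<close> is the numerator of g(s) and \<open>Q\<close> that of l + s g(s);
  the fraction to be expanded is \<open>A / Q\<close>.\<close>

definition P where "P = (\<Prod>k<m. [:r k, 1:])"
definition Pd where "Pd i = (\<Prod>k\<in>{..<m} - {i}. [:r k, 1:])"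
definition A where "A = smult \<epsilon> P + (\<Sum>i<m. smult (c i) (Pd i))"
definition Q where "Q = smult l P + pCons 0 A"

lemma poly_P: "poly P x = (\<Prod>k<m. (r k + x))" by (simp add: P_def poly_linear_prod)
lemma poly_Pd: "poly (Pd i) x = (\<Prod>k\<in>{..<m} - {i}. (r k + x))" by (simp add: Pd_def poly_linear_prod)
lemma poly_Q: "poly Q x = l * poly P x + x * poly A x" by (simp add: Q_def)

lemma degree_P: "degree P = m" by (simp add: P_def degree_linear_prod)

lemma degree_Pd: "i < m \<Longrightarrow> degree (Pd i) < m"
  by (simp add: Pd_def degree_linear_prod)

lemma coeff_A: "coeff A m = \<epsilon>"
proof -
  have "coeff (Pd i) m = 0" if "i < m" for i using degree_Pd[OF that] by (rule coeff_eq_0)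
  moreover have "coeff P m = 1" using lead_coeff_linear_prod[of r "{..<m}"] by (simp add: P_def[symmetric] degree_P)
  ultimately show ?thesis by (simp add: A_def coeff_sum)
qed

lemma degree_A: "degree A \<le> m"
  unfolding A_def
  by (intro degree_add_le degree_sum_le order_trans[OF degree_smult_le])
    (auto simp: degree_P intro: less_imp_le[OF degree_Pd])

lemma degree_Q: "degree Q \<le> Suc m"
  unfolding Q_def using degree_A degree_P
  by (intro degree_add_le order_trans[OF degree_smult_le] order_trans[OF degree_pCons_le]) auto

lemma coeff_Q: "coeff Q (Suc m) = \<epsilon>"
  by (simp add: Q_def coeff_A coeff_eq_0 degree_P)

lemma P_Pd: "i < m \<Longrightarrow> poly P x = (r i + x) * poly (Pd i) x"
  unfolding poly_P poly_Pd by (rule prod.remove) auto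

lemma A_g: 
  assumes "\<And>i. i < m \<Longrightarrow> r i + x \<noteq> 0"
  shows "poly A x = g x * poly P x"
proof -
  have "(\<Sum>i<m. c i * poly (Pd i) x) = (\<Sum>i<m. c i / (x + r i) * poly P x)"
  proof (rule sum.cong[OF refl])
    fix i assume "i \<in> {..<m}"
    then have i: "i < m" by simp
    show "c i * poly (Pd i) x = c i / (x + r i) * poly P x"
      using assms[OF i] by (simp add: P_Pd[OF i] add.commute)
  qed
  then show ?thesis by (simp add: A_def g_def poly_sum distrib_right sum_distrib_right)
qed

lemma P_node: "i < m \<Longrightarrow> poly P (- r i) = 0"
  by (simp add: P_Pd)

lemma Pd_node: "i < m \<Longrightarrow> j < m \<Longrightarrow> j \<noteq> i \<Longrightarrow> poly (Pd j) (- r i) = 0"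
  unfolding poly_Pd by (rule prod_zero) auto

lemma A_node: "i < m \<Longrightarrow> poly A (- r i) = c i * poly (Pd i) (- r i)"
proof -
  assume i: "i < m"
  have "(\<Sum>j<m. c j * poly (Pd j) (- r i)) = (\<Sum>j<m. if j = i then c i * poly (Pd i) (- r i) else 0)"
    using i Pd_node[of i] by (intro sum.cong) auto
  then show ?thesis using i by (simp add: A_def poly_sum P_node)
qed

lemma sign_Pd_node:
  assumes i: "i < m"
  shows "(-1) ^ i * poly (Pd i) (- r i) > 0"
proof -
  \<comment> \<open>The nodes other than \<open>r i\<close> in increasing order; exactly
    \<open>i\<close> of them lie below \<open>r i\<close>.\<close>
  let ?b = "\<lambda>k. if k < i then r k else r (Suc k)"
  have "(\<Prod>k\<in>{..<m} - {i}. (r k - r i)) = (\<Prod>k<m-1. (?b k - r i))"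
  proof (rule prod.reindex_bij_witness[where i = "\<lambda>k. if k < i then k else Suc k" and j = "\<lambda>k. if k < i then k else k - 1"])
  qed (use i in \<open>auto split: if_splits\<close>)
  moreover have "(-1) ^ i * (\<Prod>k<m-1. (?b k - r i)) > 0"
    by (rule sign_prod_interlaced) (use i in \<open>auto intro: r_mono\<close>)
  ultimately show ?thesis by (simp add: poly_Pd)
qed

text \<open>\<open>P\<close> vanishes at the node, so only the term s A(s) of \<open>Q\<close>
  survives, and the factor \<open>- r i\<close> reverses the sign of the cofactor.\<close>

lemma sign_Q_node:
  assumes i: "i < m"
  shows "(-1) ^ i * poly Q (- r i) < 0"
proof -
  have "(-1) ^ i * poly Q (- r i) = - (r i * c i * ((-1) ^ i * poly (Pd i) (- r i)))"
    by (simp add: poly_Q P_node A_node i)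
  moreover have "r i * c i * ((-1) ^ i * poly (Pd i) (- r i)) > 0"
    by (intro mult_pos_pos r0 c0 sign_Pd_node i)
  ultimately show ?thesis by linarith
qed

lemma Q_0: "poly Q 0 > 0"
  using r0 l by (auto simp: poly_Q poly_P intro!: mult_pos_pos prod_pos)

text \<open>\<open>Q\<close> changes sign between consecutive nodes and beyond the last one.\<close>

lemma Q_root_exists:
  assumes j: "j \<le> m"
  shows "\<exists>p. p > 0 \<and> (\<forall>k<j. r k < p) \<and> (\<forall>k. j \<le> k \<longrightarrow> k < m \<longrightarrow> p < r k) \<and> poly Q (- p) = 0"
proof -
  define a where "a = (if j = 0 then 0 else r (j - 1))"
  have a: "(-1) ^ j * poly Q (- a) > 0"
  proof (cases j)
    case 0
    then show ?thesis using Q_0 by (simp add: a_def)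
  next
    case (Suc i)
    then show ?thesis using sign_Q_node[of i] j by (simp add: a_def)
  qed
  have a0: "a \<ge> 0" using r0[of "j - 1"] j by (auto simp: a_def less_imp_le)
  have rk: "r k \<le> a" if "k < j" for k
    using that r_mono[of k "j - 1"] j by (cases "k = j - 1") (auto simp: a_def less_imp_le)
  obtain b where b: "a < b" "\<And>k. j \<le> k \<Longrightarrow> k < m \<Longrightarrow> b \<le> r k" "(-1) ^ j * poly Q (- b) < 0"
  proof (cases "j < m")
    case True
    have "a < r j" using r0[OF True] r_mono[of "j - 1" j] True by (auto simp: a_def)
    moreover have "r j \<le> r k" if "j \<le> k" "k < m" for k
      using that r_mono[of j k] by (cases "k = j") (auto simp: less_imp_le)
    ultimately show ?thesis using sign_Q_node[OF True] that by blast
  next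
    case False
    then have jm: "j = m" using j by simp
    let ?T = "\<lambda>x. x * poly A (- x) - l * poly P (- x)"
    have deg: "degree Q = Suc m" using degree_Q coeff_Q eps by (metis coeff_eq_0 le_antisym not_less_eq_eq not_le order_less_irrefl)
    \<comment> \<open>\<open>Q\<close> reflected at 0, with the sign that makes the leading
      coefficient equal to \<open>\<epsilon> > 0\<close>: its growth provides the sign of
      \<open>Q\<close> far to the left of all nodes.\<close>
    define R where "R = smult ((-1) ^ Suc m) (pcompose Q [:0, -1:])"
    have R: "poly R x = (-1) ^ Suc m * poly Q (- x)" for x by (simp add: R_def poly_pcompose)
    have "degree R = Suc m" unfolding R_def by (simp add: deg degree_pcompose)
    moreover have "lead_coeff R = \<epsilon>"
    proof -
      have "lead_coeff (pcompose Q [:0, -1:]) = lead_coeff Q * (-1) ^ degree Q"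
        by (subst lead_coeff_comp) auto
      then show ?thesis unfolding R_def by (simp add: deg coeff_Q power_mult_distrib[symmetric])
    qed
    ultimately have "0 < lead_coeff R" using eps by simp
    from poly_pinfty_gt_lc[OF this] obtain n where n: "\<And>x. x \<ge> n \<Longrightarrow> poly R x \<ge> lead_coeff R" by blast
    define b where "b = max n (a + 1)"
    have "poly R b > 0" using n[of b] \<open>0 < lead_coeff R\<close> by (simp add: b_def)
    then have "(-1) ^ j * poly Q (- b) < 0" by (simp add: R jm)
    then show ?thesis using that[of b] jm by (simp add: b_def)
  qed
  have cont: "continuous_on {a..b} (\<lambda>x. (-1) ^ j * poly Q (- x))" by (intro continuous_intros)
  obtain p where p: "a \<le> p" "p \<le> b" "(-1) ^ j * poly Q (- p) = 0"
    using IVT2'[OF _ _ _ cont, of 0] a b by force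
  then have "p \<noteq> a" "p \<noteq> b" using a b by auto
  then have "a < p" "p < b" using p by auto
  then show ?thesis using p a0 rk b(2) by (intro exI[of _ p]) force
qed

definition p where "p j = (SOME p. p > 0 \<and> (\<forall>k<j. r k < p) \<and> (\<forall>k. j \<le> k \<longrightarrow> k < m \<longrightarrow> p < r k) \<and> poly Q (- p) = 0)"

lemma p: "j \<le> m \<Longrightarrow> p j > 0" "j \<le> m \<Longrightarrow> k < j \<Longrightarrow> r k < p j" "j \<le> m \<Longrightarrow> j \<le> k \<Longrightarrow> k < m \<Longrightarrow> p j < r k"
  "j \<le> m \<Longrightarrow> poly Q (- p j) = 0"
  using someI_ex[OF Q_root_exists, folded p_def] by blast+

lemma p_mono: "i < j \<Longrightarrow> j \<le> m \<Longrightarrow> p i < p j"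
  using p(2)[of j i] p(3)[of i i] by force

lemma p_inj: "inj_on (\<lambda>j. - p j) {..<Suc m}"
proof (rule inj_onI)
  fix x y assume *: "x \<in> {..<Suc m}" "y \<in> {..<Suc m}" "- p x = - p y"
  show "x = y"
  proof (rule ccontr)
    assume "x \<noteq> y"
    then consider "x < y" | "y < x" by linarith
    then show False using p_mono[of x y] p_mono[of y x] * by cases auto
  qed
qed

definition W where "W = (\<Prod>j<Suc m. [:p j, 1:])"
definition Wd where "Wd j = (\<Prod>k\<in>{..<Suc m} - {j}. [:p k, 1:])"
text \<open>The residue of \<open>A / Q\<close> at \<open>- p j\<close>: as \<open>Q\<close> is
  \<open>smult \<epsilon> W\<close>, its derivative at this root is
  \<open>\<epsilon> * poly (Wd j) (- p j)\<close>.\<close>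

definition d where "d j = poly A (- p j) / (\<epsilon> * poly (Wd j) (- p j))"

lemma poly_W: "poly W x = (\<Prod>j<Suc m. (p j + x))" by (simp add: W_def poly_linear_prod del: prod.lessThan_Suc)
lemma poly_Wd: "poly (Wd j) x = (\<Prod>k\<in>{..<Suc m} - {j}. (p k + x))" by (simp add: Wd_def poly_linear_prod)

lemma W_Wd: "j < Suc m \<Longrightarrow> poly W x = (p j + x) * poly (Wd j) x"
  unfolding poly_W poly_Wd by (rule prod.remove) auto

lemma Wd_pole: "i < Suc m \<Longrightarrow> j < Suc m \<Longrightarrow> j \<noteq> i \<Longrightarrow> poly (Wd j) (- p i) = 0"
  unfolding poly_Wd by (rule prod_zero) auto

lemma Wd_nonzero: "j < Suc m \<Longrightarrow> poly (Wd j) (- p j) \<noteq> 0"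
  unfolding poly_Wd using inj_onD[OF p_inj] by auto

lemma degree_Wd: "j < Suc m \<Longrightarrow> degree (Wd j) = m"
  by (simp add: Wd_def degree_linear_prod)

lemma coeff_Wd: "j < Suc m \<Longrightarrow> coeff (Wd j) m = 1"
  using lead_coeff_linear_prod[of p "{..<Suc m} - {j}"] degree_Wd[of j] by (simp add: Wd_def[symmetric])

lemma degree_W: "degree W = Suc m" by (simp add: W_def degree_linear_prod del: prod.lessThan_Suc)

text \<open>The leading coefficients agree, so the difference has degree at most \<open>m\<close>,
  yet it vanishes at the \<open>m + 1\<close> points \<open>- p j\<close>.\<close>

lemma Q_W: "Q = smult \<epsilon> W"
proof -
  have "coeff W (Suc m) = 1"
    using lead_coeff_linear_prod[of p "{..<Suc m}"] degree_W by (simp add: W_def[symmetric] del: prod.lessThan_Suc)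
  then have "coeff (Q - smult \<epsilon> W) (Suc m) = 0" by (simp add: coeff_Q)
  moreover have "degree (Q - smult \<epsilon> W) \<le> Suc m"
    using degree_Q degree_W by (intro degree_diff_le) (auto intro: order_trans[OF degree_smult_le])
  ultimately have "degree (Q - smult \<epsilon> W) < Suc m \<or> Q - smult \<epsilon> W = 0"
    by (metis le_neq_implies_less leading_coeff_0_iff)
  moreover have "poly (Q - smult \<epsilon> W) (- p j) = 0" if "j < Suc m" for j
    using that by (simp add: p(4) W_Wd)
  ultimately have "Q - smult \<epsilon> W = 0" using poly_eq_0_many_roots[OF _ p_inj] by blast
  then show ?thesis by simp
qed

text \<open>Lagrange interpolation of \<open>A\<close>, whose degree is at most \<open>m\<close>, at
  the \<open>m + 1\<close> roots of \<open>Q\<close>.\<close>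

lemma A_Wd: "A = (\<Sum>j<Suc m. smult (\<epsilon> * d j) (Wd j))"
proof -
  let ?B = "\<Sum>j<Suc m. smult (\<epsilon> * d j) (Wd j)"
  have "degree ?B \<le> m"
    by (intro degree_sum_le) (auto intro!: order_trans[OF degree_smult_le] simp: degree_Wd simp del: sum.lessThan_Suc)
  then have "degree (A - ?B) \<le> m" using degree_A by (rule degree_diff_le[rotated])
  then have "degree (A - ?B) < Suc m" by simp
  moreover have "poly (A - ?B) (- p i) = 0" if i: "i < Suc m" for i
  proof -
    have "poly ?B (- p i) = (\<Sum>j<Suc m. \<epsilon> * d j * poly (Wd j) (- p i))" by (simp add: poly_sum del: sum.lessThan_Suc)
    also have "\<dots> = (\<Sum>j<Suc m. if j = i then \<epsilon> * d i * poly (Wd i) (- p i) else 0)"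
      by (intro sum.cong refl) (use i Wd_pole in auto)
    also have "\<dots> = \<epsilon> * d i * poly (Wd i) (- p i)" using i by (subst sum.delta) auto
    also have "\<dots> = poly A (- p i)" using Wd_nonzero[OF i] eps by (simp add: d_def)
    finally show ?thesis by simp
  qed
  ultimately have "A - ?B = 0" by (rule poly_eq_0_many_roots[OF _ p_inj])
  then show ?thesis by simp
qed

text \<open>Comparison of the coefficients of order \<open>m\<close>, which are
  \<open>\<epsilon>\<close> in \<open>A\<close> and 1 in each \<open>Wd j\<close>.\<close>

lemma sum_d: "(\<Sum>j<Suc m. d j) = 1"
proof -
  have "\<epsilon> = coeff (\<Sum>j<Suc m. smult (\<epsilon> * d j) (Wd j)) m" using coeff_A A_Wd by simp
  also have "\<dots> = (\<Sum>j<Suc m. \<epsilon> * d j * coeff (Wd j) m)" by (simp add: coeff_sum del: sum.lessThan_Suc)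
  also have "\<dots> = (\<Sum>j<Suc m. \<epsilon> * d j)" by (intro sum.cong refl) (simp add: coeff_Wd)
  also have "\<dots> = \<epsilon> * (\<Sum>j<Suc m. d j)" by (simp only: sum_distrib_left)
  finally show ?thesis using eps by (simp del: sum.lessThan_Suc)
qed

text \<open>Numerator and denominator both carry the sign \<open>(-1) ^ j\<close>. For
  \<open>A\<close>, the root equation of \<open>Q\<close> equates \<open>p j * A\<close> with
  \<open>l * P\<close> at \<open>- p j\<close>, and exactly \<open>j\<close> nodes lie below
  \<open>p j\<close>; for \<open>Wd j\<close>, exactly \<open>j\<close> of the other roots
  do.\<close>

lemma d_pos:
  assumes j: "j < Suc m"
  shows "d j > 0"
proof -
  have P: "(-1) ^ j * poly P (- p j) > 0"
    unfolding poly_P using sign_prod_interlaced[of j m r "p j"] j p by (simp add: less_Suc_eq_le)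
  have "p j * poly A (- p j) = l * poly P (- p j)" using p(4)[of j] j by (simp add: poly_Q less_Suc_eq_le)
  then have "p j * ((-1) ^ j * poly A (- p j)) = l * ((-1) ^ j * poly P (- p j))" by (simp add: mult.left_commute)
  also have "\<dots> > 0" using P l by simp
  finally have A: "(-1) ^ j * poly A (- p j) > 0" using p(1)[of j] j by (simp add: zero_less_mult_iff less_Suc_eq_le)
  let ?b = "\<lambda>k. if k < j then p k else p (Suc k)"
  have "(\<Prod>k\<in>{..<Suc m} - {j}. (p k - p j)) = (\<Prod>k<m. (?b k - p j))"
  proof (rule prod.reindex_bij_witness[where i = "\<lambda>k. if k < j then k else Suc k" and j = "\<lambda>k. if k < j then k else k - 1"])
  qed (use j in \<open>auto split: if_splits\<close>)
  moreover have "(-1) ^ j * (\<Prod>k<m. (?b k - p j)) > 0"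
    by (rule sign_prod_interlaced) (use j in \<open>auto intro: p_mono\<close>)
  ultimately have Wp: "(-1) ^ j * poly (Wd j) (- p j) > 0" by (simp add: poly_Wd)
  have "((-1) ^ j * poly A (- p j)) / (\<epsilon> * ((-1) ^ j * poly (Wd j) (- p j))) > 0"
    by (rule divide_pos_pos[OF A mult_pos_pos[OF eps Wp]])
  then show ?thesis by (simp add: d_def mult.left_commute[of \<epsilon>])
qed

theorem partial_fractions:
  assumes s: "s > 0"
  shows "(\<Sum>j<Suc m. d j / (s + p j)) = g s / (l + s * g s)"
proof -
  have Ps: "poly P s > 0" unfolding poly_P using r0 s by (intro prod_pos) (auto intro: add_pos_pos)
  have pj: "p j + s \<noteq> 0" if "j < Suc m" for j using p(1)[of j] that s by force
  have A: "poly A s = g s * poly P s" using r0 s by (intro A_g) (metis add_pos_pos less_irrefl)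
  have Q: "poly Q s = (l + s * g s) * poly P s" unfolding poly_Q A by (simp add: algebra_simps)
  have W: "poly W s \<noteq> 0" unfolding poly_W using pj by (auto simp del: prod.lessThan_Suc)
  have "poly A s = (\<Sum>j<Suc m. \<epsilon> * d j * poly (Wd j) s)" by (subst A_Wd) (simp add: poly_sum del: sum.lessThan_Suc)
  also have "\<dots> = (\<Sum>j<Suc m. \<epsilon> * poly W s * (d j / (s + p j)))"
  proof (rule sum.cong[OF refl])
    fix j assume "j \<in> {..<Suc m}"
    then have j: "j < Suc m" by simp
    show "\<epsilon> * d j * poly (Wd j) s = \<epsilon> * poly W s * (d j / (s + p j))"
      using pj[OF j] by (simp add: W_Wd[OF j] add.commute)
  qed
  also have "\<dots> = poly Q s * (\<Sum>j<Suc m. d j / (s + p j))"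
    by (subst sum_distrib_left[symmetric]) (simp add: Q_W)
  finally have "g s * poly P s = ((l + s * g s) * poly P s) * (\<Sum>j<Suc m. d j / (s + p j))" unfolding A Q .
  then have eq: "g s = (l + s * g s) * (\<Sum>j<Suc m. d j / (s + p j))" using Ps by (simp del: sum.lessThan_Suc)
  have "poly Q s \<noteq> 0" unfolding Q_W using W eps by simp
  then have "l + s * g s \<noteq> 0" unfolding Q by simp
  then show ?thesis using eq by (simp add: field_simps del: sum.lessThan_Suc)
qed

end

section \<open>Passage from discrete to general measures\<close>

lemma (in discrete_stieltjes) representing_distribution:
  "\<exists>\<mu>. real_distribution \<mu> \<and> (AE r in \<mu>. r > 0) \<and> (\<forall>s>0. (LINT r|\<mu>. 1 / (s + \<bar>r\<bar>)) = g s / (l + s * g s))"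
proof -
  \<comment> \<open>Point masses \<open>d j\<close>, transported to the points \<open>p j\<close>:
    positivity and sum 1 of the residues are exactly what makes this a probability measure.\<close>
  define N where "N = point_measure {..<Suc m} (\<lambda>j. ennreal (d j))"
  define \<mu> where "\<mu> = distr N borel p"
  have d0: "j < Suc m \<Longrightarrow> d j \<ge> 0" for j using d_pos by (auto intro: less_imp_le)
  have meas: "p \<in> measurable N borel" unfolding N_def by simp
  have "emeasure N (space N) = (\<Sum>j<Suc m. ennreal (d j))"
    unfolding N_def by (subst emeasure_point_measure_finite) (auto simp: space_point_measure simp del: sum.lessThan_Suc)
  also have "\<dots> = ennreal (\<Sum>j<Suc m. d j)" by (rule sum_ennreal) (use d0 in auto)
  also have "\<dots> = 1" by (simp only: sum_d ennreal_1)
  finally have "prob_space N" by (rule prob_spaceI)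
  then have "prob_space \<mu>" unfolding \<mu>_def using meas by (rule prob_space.prob_space_distr)
  then have rd: "real_distribution \<mu>" by (intro real_distribution.intro real_distribution_axioms.intro) (auto simp: \<mu>_def)
  have "AE j in N. p j > 0" unfolding N_def using p(1)
    by (intro AE_I2) (auto simp: space_point_measure less_Suc_eq_le)
  then have pos: "AE r in \<mu>. r > 0" unfolding \<mu>_def using meas by (subst AE_distr_iff) auto
  have "(LINT r|\<mu>. 1 / (s + \<bar>r\<bar>)) = g s / (l + s * g s)" if s: "s > 0" for s
  proof -
    have "(LINT r|\<mu>. 1 / (s + \<bar>r\<bar>)) = (LINT j|N. 1 / (s + \<bar>p j\<bar>))"
      unfolding \<mu>_def using meas by (subst integral_distr) auto
    also have "\<dots> = (\<Sum>j<Suc m. d j / (s + p j))"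
    proof -
      have "(LINT j|N. 1 / (s + \<bar>p j\<bar>)) = (\<Sum>j<Suc m. d j * (1 / (s + \<bar>p j\<bar>)))"
        unfolding N_def by (subst lebesgue_integral_point_measure_finite) (auto simp: d0 simp del: sum.lessThan_Suc)
      also have "\<dots> = (\<Sum>j<Suc m. d j / (s + p j))"
        by (intro sum.cong refl) (use p(1) in \<open>simp add: less_Suc_eq_le abs_of_pos\<close>)
      finally show ?thesis .
    qed
    also have "\<dots> = g s / (l + s * g s)" by (rule partial_fractions[OF s])
    finally show ?thesis .
  qed
  with rd pos show ?thesis by blast
qed

text \<open>For r > s the integrand s / (s + r) is at most 1/2, so s times the transform is at most
  (1 + \<mu>{..s}) / 2. As s H(s) is close to 1 for one large s, nearly all mass lies below that s
  for all but finitely many \<open>n\<close>.\<close>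

lemma stieltjes_tight:
  fixes \<mu> :: "nat \<Rightarrow> real measure"
  assumes rd: "\<And>n. real_distribution (\<mu> n)" and pos: "\<And>n. AE r in \<mu> n. r > 0"
    and lim: "\<And>s. s > 0 \<Longrightarrow> (\<lambda>n. LINT r|\<mu> n. 1 / (s + \<bar>r\<bar>)) \<longlonglongrightarrow> H s"
    and one: "((\<lambda>s. s * H s) \<longlongrightarrow> 1) at_top"
  shows "tight \<mu>"
  unfolding tight_def
proof (intro conjI allI impI rd)
  fix e :: real assume e: "e > 0"
  have meq: "measure (\<mu> n) {0<..b} = measure (\<mu> n) {..b}" for n b
  proof -
    interpret real_distribution "\<mu> n" by (rule rd)
    show ?thesis by (rule measure_eq_AE) (use pos[of n] in auto)
  qed
  have "\<forall>\<^sub>F s in at_top. s > 0 \<and> s * H s > 1 - e / 2"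
    by (intro eventually_conj eventually_gt_at_top order_tendstoD(1)[OF one]) (use e in simp)
  then obtain s where s: "s > 0" "s * H s > 1 - e / 2" by (auto dest: eventually_happens'[rotated])
  have "(\<lambda>n. s * (LINT r|\<mu> n. 1 / (s + \<bar>r\<bar>))) \<longlonglongrightarrow> s * H s" by (intro tendsto_intros lim s)
  from order_tendstoD(1)[OF this s(2)] obtain N where
    N: "\<And>n. n \<ge> N \<Longrightarrow> s * (LINT r|\<mu> n. 1 / (s + \<bar>r\<bar>)) > 1 - e / 2"
    by (auto simp: eventually_sequentially)
  have large: "measure (\<mu> n) {..s} > 1 - e" if n: "n \<ge> N" for n
  proof -
    interpret real_distribution "\<mu> n" by (rule rd)
    have int: "integrable (\<mu> n) (\<lambda>r. s * (1 / (s + \<bar>r\<bar>)))"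
      by (rule integrable_const_bound[where B = 1]) (use s in \<open>auto simp: field_simps\<close>)
    have "s * (LINT r|\<mu> n. 1 / (s + \<bar>r\<bar>)) = (LINT r|\<mu> n. s * (1 / (s + \<bar>r\<bar>)))"
      by (rule integral_mult_right_zero[symmetric])
    also have "\<dots> \<le> (LINT r|\<mu> n. 1 / 2 + 1 / 2 * indicator {..s} r)"
    proof (rule integral_mono[OF int])
      show "integrable (\<mu> n) (\<lambda>r. 1 / 2 + 1 / 2 * indicator {..s} r :: real)"
        by (rule integrable_const_bound[where B = 1]) (auto split: split_indicator)
      show "s * (1 / (s + \<bar>r\<bar>)) \<le> 1 / 2 + 1 / 2 * indicator {..s} r" for r
        using s by (auto simp: field_simps split: split_indicator)
    qed
    also have "\<dots> = 1 / 2 + 1 / 2 * measure (\<mu> n) {..s}"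
    proof -
      have "integrable (\<mu> n) (indicator {..s} :: real \<Rightarrow> real)"
        by (rule integrable_const_bound[where B = 1]) (auto split: split_indicator)
      then have "(LINT r|\<mu> n. 1 / 2 + 1 / 2 * indicator {..s} r) = (LINT r|\<mu> n. 1 / 2 :: real) + (LINT r|\<mu> n. 1 / 2 * indicator {..s} r)"
        by (intro Bochner_Integration.integral_add integrable_mult_right) auto
      then show ?thesis using prob_space by simp
    qed
    finally show ?thesis using N[OF n] by linarith
  qed
  \<comment> \<open>The finitely many measures before \<open>N\<close> are treated one by one and
    absorbed by the maximum \<open>B\<close>.\<close>
  have small: "\<exists>b. measure (\<mu> n) {..b} > 1 - e" for n
  proof -
    interpret real_distribution "\<mu> n" by (rule rd)
    have "\<forall>\<^sub>F b in at_top. cdf (\<mu> n) b > 1 - e"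
      using order_tendstoD(1)[OF cdf_lim_at_top_prob, of "1 - e"] e by simp
    then show ?thesis unfolding cdf_def by (auto dest: eventually_happens'[rotated])
  qed
  then obtain b where b: "\<And>n. measure (\<mu> n) {..b n} > 1 - e" by metis
  define B where "B = Max (insert s (b ` {..<N}))"
  have Bs: "s \<le> B" unfolding B_def by (intro Max_ge) auto
  have Bb: "n < N \<Longrightarrow> b n \<le> B" for n unfolding B_def by (intro Max_ge) auto
  have "measure (\<mu> n) {0<..B} > 1 - e" for n
  proof -
    interpret real_distribution "\<mu> n" by (rule rd)
    show ?thesis
    proof (cases "n < N")
      case True
      have "measure (\<mu> n) {..b n} \<le> measure (\<mu> n) {..B}" using Bb[OF True] by (intro finite_measure_mono) auto
      then show ?thesis using b[of n] by (simp add: meq)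
    next
      case False
      have "measure (\<mu> n) {..s} \<le> measure (\<mu> n) {..B}" using Bs by (intro finite_measure_mono) auto
      then show ?thesis using large[of n] False by (simp add: meq)
    qed
  qed
  then show "\<exists>a b. a < b \<and> (\<forall>n. measure (\<mu> n) {a<..b} > 1 - e)"
    using s(1) Bs by (intro exI[of _ 0] exI[of _ B]) auto
qed

text \<open>Helly's theorem yields a weak limit of a subsequence. The absolute value makes the test
  function bounded and continuous on the whole line, and pushing the limit forward along
  \<open>abs\<close> places it on the half-line. Mass may accumulate at 0, hence
  \<open>r \<ge> 0\<close> in place of \<open>r > 0\<close>.\<close>

lemma stieltjes_limit_distribution:
  fixes \<mu> :: "nat \<Rightarrow> real measure"
  assumes rd: "\<And>n. real_distribution (\<mu> n)" and pos: "\<And>n. AE r in \<mu> n. r > 0"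
    and lim: "\<And>s. s > 0 \<Longrightarrow> (\<lambda>n. LINT r|\<mu> n. 1 / (s + \<bar>r\<bar>)) \<longlonglongrightarrow> H s"
    and one: "((\<lambda>s. s * H s) \<longlongrightarrow> 1) at_top"
  shows "\<exists>\<nu>. real_distribution \<nu> \<and> (AE r in \<nu>. r \<ge> 0) \<and> (\<forall>s>0. (LINT r|\<nu>. 1 / (s + r)) = H s)"
proof -
  have "tight \<mu>" by (rule stieltjes_tight[OF rd pos lim one])
  from tight_imp_convergent_subsubsequence[OF this strict_mono_id] obtain q M
    where q: "strict_mono (q :: nat \<Rightarrow> nat)" "real_distribution M" "weak_conv_m (\<mu> \<circ> id \<circ> q) M" by blast
  interpret M: real_distribution M by fact
  define \<nu> where "\<nu> = distr M borel abs"
  have "real_distribution \<nu>" unfolding \<nu>_def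
    by (intro real_distribution.intro real_distribution_axioms.intro M.prob_space_distr) auto
  moreover have "AE r in \<nu>. r \<ge> 0" unfolding \<nu>_def by (subst AE_distr_iff) auto
  moreover have "(LINT r|\<nu>. 1 / (s + r)) = H s" if s: "s > 0" for s
  proof (rule LIMSEQ_unique)
    have "(\<lambda>n. LINT r|(\<mu> \<circ> id \<circ> q) n. 1 / (s + \<bar>r\<bar>)) \<longlonglongrightarrow> (LINT r|M. 1 / (s + \<bar>r\<bar>))"
    proof (rule weak_conv_imp_integral_bdd_continuous_conv)
      show "isCont (\<lambda>r. 1 / (s + \<bar>r\<bar>)) x" for x using s by (intro continuous_intros) auto
      show "norm (1 / (s + \<bar>x\<bar>)) \<le> 1 / s" for x using s by (simp add: frac_le)
    qed (use q rd in \<open>auto simp: o_def\<close>)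
    then show "(\<lambda>n. LINT r|\<mu> (q n). 1 / (s + \<bar>r\<bar>)) \<longlonglongrightarrow> (LINT r|\<nu>. 1 / (s + r))"
      unfolding \<nu>_def by (subst integral_distr) auto
    show "(\<lambda>n. LINT r|\<mu> (q n). 1 / (s + \<bar>r\<bar>)) \<longlonglongrightarrow> H s"
      using LIMSEQ_subseq_LIMSEQ[OF lim[OF s] q(1)] by (simp add: o_def)
  qed
  ultimately show ?thesis by blast
qed

section \<open>The relaxation functions of a Stieltjes kernel\<close>

text \<open>The transform of an admissible kernel once the terms a / s and b are excluded;
  \<open>g_top\<close> is the half of (C3) that prevents loss of mass at infinity.\<close>

locale stieltjes_kernel =
  fixes \<sigma> :: "real measure" and g :: "real \<Rightarrow> real"
  assumes sets_\<sigma>: "sets \<sigma> = sets (restrict_space borel {0<..})"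
    and int1: "integrable \<sigma> (\<lambda>r. 1 / (1 + r))"
    and g_eq: "\<And>s. s > 0 \<Longrightarrow> g s = (LINT r|\<sigma>. 1 / (s + r))"
    and g_top: "filterlim (\<lambda>s. s * g s) at_top at_top"
begin

lemma space_\<sigma>: "space \<sigma> = {0<..}"
  using sets_eq_imp_space_eq[OF sets_\<sigma>] by (simp add: space_restrict_space)

lemma measurable_\<sigma>: "f \<in> borel_measurable borel \<Longrightarrow> f \<in> borel_measurable \<sigma>"
  by (subst measurable_cong_sets[OF sets_\<sigma> refl]) (rule measurable_restrict_space1)

lemma integrable_dominated:
  fixes f :: "real \<Rightarrow> real"
  assumes "f \<in> borel_measurable borel" "\<And>r. r > 0 \<Longrightarrow> \<bar>f r\<bar> \<le> C / (1 + r)"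
  shows "integrable \<sigma> f"
proof (rule Bochner_Integration.integrable_bound)
  show "integrable \<sigma> (\<lambda>r. C * (1 / (1 + r)))" using int1 by (rule integrable_mult_right)
  show "AE r in \<sigma>. norm (f r) \<le> norm (C * (1 / (1 + r)))"
  proof (rule AE_I2)
    fix r assume "r \<in> space \<sigma>"
    then have "\<bar>f r\<bar> \<le> C / (1 + r)" using assms(2) by (simp add: space_\<sigma>)
    also have "\<dots> \<le> norm (C * (1 / (1 + r)))"
      by (simp only: real_norm_def times_divide_eq_right mult_1_right abs_ge_self)
    finally show "norm (f r) \<le> norm (C * (1 / (1 + r)))" by simp
  qed
qed (rule measurable_\<sigma>[OF assms(1)])

lemma resolvent_bound:
  assumes "s > 0" "r > (0::real)"
  shows "1 / (s + r) \<le> max 1 (1 / s) / (1 + r)"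
proof -
  have "1 + r \<le> max 1 (1 / s) * (s + r)"
  proof -
    have "1 \<le> max 1 (1/s) * s" using assms by (cases "s \<ge> 1") (auto simp: max_def field_simps)
    moreover have "r \<le> max 1 (1/s) * r" using assms by simp
    ultimately show ?thesis by (simp only: distrib_left)
  qed
  then show ?thesis using assms by (simp add: field_simps)
qed

lemma resolvent_integrable: "s > 0 \<Longrightarrow> integrable \<sigma> (\<lambda>r. 1 / (s + r))"
  by (rule integrable_dominated[where C = "max 1 (1 / s)"]) (auto simp: resolvent_bound)

lemma g_nonneg: "s > 0 \<Longrightarrow> g s \<ge> 0"
  by (subst g_eq) (auto intro!: integral_nonneg_AE AE_I2 simp: space_\<sigma>)

lemma emeasure_bounded_interval: "emeasure \<sigma> {a<..b} < \<infinity>" if "0 \<le> a" "a \<le> b"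
proof -
  have I: "{a<..b} \<in> sets \<sigma>" using that unfolding sets_\<sigma> by (subst sets_restrict_space_iff) auto
  have "emeasure \<sigma> {a<..b} = (\<integral>\<^sup>+r. indicator {a<..b} r \<partial>\<sigma>)" using I by simp
  also have "\<dots> \<le> (\<integral>\<^sup>+r. ennreal ((1 + b) * (1 / (1 + r))) \<partial>\<sigma>)"
  proof (rule nn_integral_mono)
    fix r assume "r \<in> space \<sigma>"
    then have "r > 0" by (simp add: space_\<sigma>)
    then show "indicator {a<..b} r \<le> ennreal ((1 + b) * (1 / (1 + r)))"
      by (auto split: split_indicator simp: field_simps simp flip: ennreal_1 intro!: ennreal_leI)
  qed
  also have "\<dots> < \<infinity>"
    using that by (subst nn_integral_eq_integral[OF integrable_mult_right[OF int1]])
      (auto simp: space_\<sigma> intro!: AE_I2)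
  finally show ?thesis .
qed

text \<open>The sums \<open>gN n\<close> discretise \<open>\<sigma>\<close> on \<open>(0, n]\<close> with mesh \<open>1 / n\<close>; the vanishing terms \<open>1 / n\<close> and
  \<open>1 / n\<^sup>3\<close> make the constant and all weights strictly positive.\<close>

definition cN :: "nat \<Rightarrow> nat \<Rightarrow> real" where
  "cN n j = measure \<sigma> {real j / real n<..real (Suc j) / real n} + 1 / real n ^ 3"

definition gN :: "nat \<Rightarrow> real \<Rightarrow> real" where
  "gN n s = 1 / real n + (\<Sum>j<n\<^sup>2. cN n j / (s + real (Suc j) / real n))"

lemma discrete: "n > 0 \<Longrightarrow> l > 0 \<Longrightarrow> discrete_stieltjes (n\<^sup>2) (\<lambda>j. real (Suc j) / real n) (cN n) (1 / real n) l"
  by standard (auto simp: cN_def divide_strict_right_mono add_nonneg_pos)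

lemma discretised_integral:
  assumes n: "n > 0" and s: "s > 0"
  shows "(\<Sum>j<n\<^sup>2. measure \<sigma> {real j / real n<..real (Suc j) / real n} / (s + real (Suc j) / real n))
    = (LINT r|\<sigma>. (if r \<le> real n then 1 / (s + real_of_int \<lceil>real n * r\<rceil> / real n) else 0))"
proof -
  let ?I = "\<lambda>j. {real j / real n<..real (Suc j) / real n}"
  have I: "?I j \<in> sets \<sigma>" for j unfolding sets_\<sigma> using n by (subst sets_restrict_space_iff) (auto intro: le_less_trans[rotated])
  have fin: "emeasure \<sigma> (?I j) < \<infinity>" for j using n by (intro emeasure_bounded_interval) (auto simp: divide_right_mono)
  have "(\<Sum>j<n\<^sup>2. measure \<sigma> (?I j) / (s + real (Suc j) / real n)) = (LINT r|\<sigma>. (\<Sum>j<n\<^sup>2. indicator (?I j) r * (1 / (s + real (Suc j) / real n))))"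
    using I fin by (subst Bochner_Integration.integral_sum) (auto intro!: integrable_mult_left integrable_real_indicator)
  also have "\<dots> = (LINT r|\<sigma>. (if r \<le> real n then 1 / (s + real_of_int \<lceil>real n * r\<rceil> / real n) else 0))"
  proof (rule Bochner_Integration.integral_cong[OF refl])
    fix r assume "r \<in> space \<sigma>"
    then have r: "r > 0" by (simp add: space_\<sigma>)
    \<comment> \<open>The index of the cell containing \<open>r\<close>; cells are open on the left,
      so a right endpoint belongs to its own cell.\<close>
    define c where "c = nat (\<lceil>real n * r\<rceil> - 1)"
    have c1: "\<lceil>real n * r\<rceil> \<ge> 1" using r n by simp
    then have c: "real_of_int \<lceil>real n * r\<rceil> = real (Suc c)" by (simp add: c_def)
    have cl: "real c < real n * r" "real n * r \<le> real (Suc c)" using c by linarith+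
    have ind: "indicator (?I j) r = (if j = c then 1 else 0 :: real)" for j
    proof -
      have "r \<in> ?I j \<longleftrightarrow> real j < real n * r \<and> real n * r \<le> real (Suc j)" using n by (simp add: field_simps)
      also have "\<dots> \<longleftrightarrow> j = c" using cl by (auto simp del: of_nat_Suc)
      finally show ?thesis by (simp add: indicator_def)
    qed
    have "c < n\<^sup>2 \<longleftrightarrow> r \<le> real n"
    proof
      assume "c < n\<^sup>2"
      then have "real (Suc c) \<le> real (n\<^sup>2)" by (subst of_nat_le_iff) simp
      then have "real n * r \<le> real n * real n" using cl(2) by (simp add: power2_eq_square)
      then show "r \<le> real n" using n by simp
    next
      assume "r \<le> real n"
      then have "real n * r \<le> real n * real n" by (intro mult_left_mono) auto
      then have "real c < real (n\<^sup>2)" using cl(1) by (simp add: power2_eq_square)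
      then show "c < n\<^sup>2" by (simp only: of_nat_less_iff)
    qed
    moreover have "(\<Sum>j<n\<^sup>2. (if j = c then 1 else 0) * (1 / (s + real (Suc j) / real n)))
       = (\<Sum>j<n\<^sup>2. if j = c then 1 / (s + real (Suc c) / real n) else 0)"
      by (intro sum.cong) auto
    ultimately show "(\<Sum>j<n\<^sup>2. indicator (?I j) r * (1 / (s + real (Suc j) / real n)))
       = (if r \<le> real n then 1 / (s + real_of_int \<lceil>real n * r\<rceil> / real n) else 0)"
      unfolding ind c by (simp del: of_nat_Suc)
  qed
  finally show ?thesis .
qed

text \<open>Replacing \<open>r\<close> by the right end of its cell only lowers the integrand, so 1
  / (s + r) dominates. The \<open>n\<^sup>2\<close> correction terms of weight
  \<open>1 / n ^ 3\<close> contribute at most 1 / (s n).\<close>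

lemma gN_tendsto:
  assumes s: "s > 0"
  shows "(\<lambda>n. gN (Suc n) s) \<longlonglongrightarrow> g s"
proof -
  let ?h = "\<lambda>n r. if r \<le> real (Suc n) then 1 / (s + real_of_int \<lceil>real (Suc n) * r\<rceil> / real (Suc n)) else 0"
  let ?e = "\<lambda>n. (\<Sum>j<(Suc n)\<^sup>2. (1 / real (Suc n) ^ 3) / (s + real (Suc j) / real (Suc n)))"
  have split: "gN (Suc n) s = 1 / real (Suc n) + (LINT r|\<sigma>. ?h n r) + ?e n" for n
    using discretised_integral[OF _ s, of "Suc n"]
    unfolding gN_def cN_def by (simp add: add_divide_distrib sum.distrib del: of_nat_Suc)
  have ceil: "r \<le> real_of_int \<lceil>real (Suc n) * r\<rceil> / real (Suc n)" "real_of_int \<lceil>real (Suc n) * r\<rceil> / real (Suc n) \<le> r + 1 / real (Suc n)" for n r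
  proof -
    have "real (Suc n) * r \<le> real_of_int \<lceil>real (Suc n) * r\<rceil>" "real_of_int \<lceil>real (Suc n) * r\<rceil> \<le> real (Suc n) * r + 1" by linarith+
    then show "r \<le> real_of_int \<lceil>real (Suc n) * r\<rceil> / real (Suc n)" "real_of_int \<lceil>real (Suc n) * r\<rceil> / real (Suc n) \<le> r + 1 / real (Suc n)"
      by (simp_all add: field_simps del: of_nat_Suc)
  qed
  have hle: "0 \<le> ?h n r \<and> ?h n r \<le> 1 / (s + r)" if r: "r > 0" for n r
  proof -
    have "1 / (s + real_of_int \<lceil>real (Suc n) * r\<rceil> / real (Suc n)) \<le> 1 / (s + r)"
      by (intro frac_le) (use s r ceil(1)[of r n] in linarith)+
    moreover have "0 \<le> 1 / (s + real_of_int \<lceil>real (Suc n) * r\<rceil> / real (Suc n))"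
      by (rule divide_nonneg_nonneg) (use s r ceil(1)[of r n] in linarith)+
    ultimately show ?thesis using s r by simp
  qed
  have "(\<lambda>n. LINT r|\<sigma>. ?h n r) \<longlonglongrightarrow> (LINT r|\<sigma>. 1 / (s + r))"
  proof (rule integral_dominated_convergence[where w = "\<lambda>r. 1 / (s + r)"])
    show "AE r in \<sigma>. (\<lambda>n. ?h n r) \<longlonglongrightarrow> 1 / (s + r)"
    proof (rule AE_I2)
      fix r assume "r \<in> space \<sigma>"
      then have r: "r > 0" by (simp add: space_\<sigma>)
      obtain N :: nat where N: "r \<le> real N" using real_arch_simple by blast
      show "(\<lambda>n. ?h n r) \<longlonglongrightarrow> 1 / (s + r)"
      proof (rule real_tendsto_sandwich)
        have "(\<lambda>n. 1 / (s + (r + 1 / real (Suc n)))) \<longlonglongrightarrow> 1 / (s + (r + 0))"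
          using s r by (intro tendsto_divide tendsto_add tendsto_const LIMSEQ_Suc[OF lim_1_over_n]) auto
        then show "(\<lambda>n. 1 / (s + (r + 1 / real (Suc n)))) \<longlonglongrightarrow> 1 / (s + r)" by simp
        show "\<forall>\<^sub>F n in sequentially. 1 / (s + (r + 1 / real (Suc n))) \<le> ?h n r"
          using eventually_ge_at_top[of N]
        proof eventually_elim
          case (elim n)
          have "0 < s + real_of_int \<lceil>real (Suc n) * r\<rceil> / real (Suc n)" using s r ceil(1)[of r n] by linarith
          then have "1 / (s + (r + 1 / real (Suc n))) \<le> 1 / (s + real_of_int \<lceil>real (Suc n) * r\<rceil> / real (Suc n))"
            using ceil(2)[of n r] s r by (intro divide_left_mono) (auto intro!: mult_pos_pos add_pos_pos)
          then show ?case using elim N by simp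
        qed
        show "\<forall>\<^sub>F n in sequentially. ?h n r \<le> 1 / (s + r)" using hle[OF r] by simp
      qed simp
    qed
    show "AE r in \<sigma>. norm (?h n r) \<le> 1 / (s + r)" for n
      using hle by (intro AE_I2) (simp add: space_\<sigma> abs_of_nonneg)
    show "?h n \<in> borel_measurable \<sigma>" for n by (intro measurable_\<sigma>) measurable
  qed (use resolvent_integrable[OF s] in auto)
  moreover have "?e \<longlonglongrightarrow> 0"
  proof (rule real_tendsto_sandwich)
    show "\<forall>\<^sub>F n in sequentially. 0 \<le> ?e n" using s by (intro always_eventually allI sum_nonneg) simp
    show "\<forall>\<^sub>F n in sequentially. ?e n \<le> (1 / s) * (1 / real (Suc n))"
    proof (intro always_eventually allI)
      fix n
      have "?e n \<le> (\<Sum>j<(Suc n)\<^sup>2. (1 / real (Suc n) ^ 3) / s)"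
        using s by (intro sum_mono divide_left_mono) (auto intro!: mult_pos_pos add_pos_pos)
      also have "\<dots> = (1 / s) * (1 / real (Suc n))"
        by (simp add: power3_eq_cube power2_eq_square field_simps del: of_nat_Suc mult_Suc mult_Suc_right)
      finally show "?e n \<le> (1 / s) * (1 / real (Suc n))" .
    qed
    show "(\<lambda>n. (1 / s) * (1 / real (Suc n))) \<longlonglongrightarrow> 0"
      using tendsto_mult_right_zero[OF LIMSEQ_Suc[OF lim_1_over_n], of "1 / s"] by simp
  qed simp
  ultimately have "(\<lambda>n. 1 / real (Suc n) + (LINT r|\<sigma>. ?h n r) + ?e n) \<longlonglongrightarrow> 0 + (LINT r|\<sigma>. 1 / (s + r)) + 0"
    by (intro tendsto_add LIMSEQ_Suc[OF lim_1_over_n])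
  then show ?thesis unfolding split by (simp add: g_eq[OF s])
qed

text \<open>The limit transform H satisfies s H(s) = x / (l + x) with x = s g(s). As
  \<open>g_top\<close> sends x to infinity, s H(s) tends to 1, which is the tightness
  hypothesis.\<close>

lemma relaxation_measure_exists:
  assumes l: "l > 0"
  shows "\<exists>\<nu>. real_distribution \<nu> \<and> (AE r in \<nu>. r \<ge> 0) \<and> (\<forall>s>0. (LINT r|\<nu>. 1 / (s + r)) = g s / (l + s * g s))"
proof -
  have "\<forall>n. \<exists>\<mu>. real_distribution \<mu> \<and> (AE r in \<mu>. r > 0) \<and> (\<forall>s>0. (LINT r|\<mu>. 1 / (s + \<bar>r\<bar>)) = gN (Suc n) s / (l + s * gN (Suc n) s))"
  proof
    fix n
    interpret discrete_stieltjes "(Suc n)\<^sup>2" "\<lambda>j. real (Suc j) / real (Suc n)" "cN (Suc n)" "1 / real (Suc n)" l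
      by (rule discrete[OF _ l]) simp
    show "\<exists>\<mu>. real_distribution \<mu> \<and> (AE r in \<mu>. r > 0) \<and> (\<forall>s>0. (LINT r|\<mu>. 1 / (s + \<bar>r\<bar>)) = gN (Suc n) s / (l + s * gN (Suc n) s))"
      using representing_distribution unfolding g_def gN_def .
  qed
  then obtain \<mu> where \<mu>: "\<And>n. real_distribution (\<mu> n)" "\<And>n. AE r in \<mu> n. r > 0"
    "\<And>n s. s > 0 \<Longrightarrow> (LINT r|\<mu> n. 1 / (s + \<bar>r\<bar>)) = gN (Suc n) s / (l + s * gN (Suc n) s)"
    by metis
  show ?thesis
  proof (rule stieltjes_limit_distribution[OF \<mu>(1,2)])
    fix s :: real assume s: "s > 0"
    have "l + s * g s > 0" using l s g_nonneg[OF s] by (intro add_pos_nonneg) auto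
    then show "(\<lambda>n. LINT r|\<mu> n. 1 / (s + \<bar>r\<bar>)) \<longlonglongrightarrow> g s / (l + s * g s)"
      unfolding \<mu>(3)[OF s] by (intro tendsto_intros gN_tendsto s) auto
  next
    have "((\<lambda>x. x / (l + x)) \<longlongrightarrow> 1) at_top" using l by real_asymp
    then have "((\<lambda>s. (s * g s) / (l + s * g s)) \<longlongrightarrow> 1) at_top"
      by (rule filterlim_compose[OF _ g_top])
    then show "((\<lambda>s. s * (g s / (l + s * g s))) \<longlongrightarrow> 1) at_top" by simp
  qed
qed

end

lemma mult_exp_neg_le: "x * exp (- x) \<le> exp (- 1 :: real)"
proof -
  have "x \<le> exp (x - 1)" using exp_ge_add_one_self[of "x - 1"] by simp
  then have "x * exp (- x) \<le> exp (x - 1) * exp (- x)" by (intro mult_right_mono) auto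
  then show ?thesis by (simp add: exp_add[symmetric])
qed

text \<open>The maximum of r^j exp (- r t) over r is attained at r = j / t; this is the origin of
  the constants (j / (e t))^j.\<close>

lemma power_exp_neg_le:
  fixes r t :: real
  assumes r: "r \<ge> 0" and t: "t > 0" and j: "j \<ge> 1"
  shows "r ^ j * exp (- r * t) \<le> (real j / (exp 1 * t)) ^ j"
proof -
  let ?x = "r * t / real j"
  have "(?x * exp (- ?x)) ^ j \<le> exp (- 1) ^ j"
    using r t by (intro power_mono mult_exp_neg_le) auto
  moreover have "(exp (- ?x)) ^ j = exp (- r * t)" using j by (simp add: exp_of_nat_mult[symmetric])
  ultimately have "?x ^ j * exp (- r * t) \<le> exp (- 1) ^ j" by (simp only: power_mult_distrib)
  then have "(real j / t) ^ j * (?x ^ j * exp (- r * t)) \<le> (real j / t) ^ j * exp (- 1) ^ j"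
    using t by (intro mult_left_mono) auto
  moreover have "(real j / t) ^ j * ?x ^ j = r ^ j"
    using t j by (simp add: power_mult_distrib[symmetric])
  moreover have "(real j / t) ^ j * exp (- 1) ^ j = (real j / (exp 1 * t)) ^ j"
    unfolding power_mult_distrib[symmetric] by (simp add: exp_minus field_simps)
  ultimately show ?thesis by (simp only: mult.assoc[symmetric])
qed

lemma half_ball: "\<bar>x - s\<bar> < s / 2 \<Longrightarrow> 0 < s \<Longrightarrow> 0 < x \<and> s / 2 \<le> (x::real)"
  by linarith

section \<open>Relaxation functions as Laplace transforms of probability measures\<close>

context stieltjes_kernel begin

lemma g_antimono: "0 < s \<Longrightarrow> s \<le> s' \<Longrightarrow> g s' \<le> g s"
  by (subst (1 2) g_eq) (auto intro!: integral_mono resolvent_integrable frac_le simp: space_\<sigma>)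

lemma g_pos: assumes s: "s > 0" shows "g s > 0"
proof -
  have "\<forall>\<^sub>F x in at_top. s \<le> x \<and> x * g x \<ge> 1"
    using g_top by (intro eventually_conj eventually_ge_at_top) (auto simp: filterlim_at_top)
  then obtain x where x: "s \<le> x" "x * g x \<ge> 1" by (auto dest: eventually_happens'[rotated])
  then have "g x > 0" using s by (smt (verit) mult_nonneg_nonpos)
  then show ?thesis using g_antimono[OF s x(1)] by simp
qed

text \<open>Chosen independently for each \<open>l\<close>, so no regularity in \<open>l\<close>
  comes with it; measurability in \<open>l\<close> is recovered in
  \<open>E_positive_multiplier\<close>.\<close>

definition \<nu> :: "real \<Rightarrow> real measure" where
  "\<nu> l = (SOME M. real_distribution M \<and> (AE r in M. r \<ge> 0) \<and> (\<forall>s>0. (LINT r|M. 1 / (s + r)) = g s / (l + s * g s)))"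

lemma \<nu>:
  assumes l: "l \<ge> 0"
  shows "real_distribution (\<nu> l)" "AE r in \<nu> l. r \<ge> 0" "\<And>s. s > 0 \<Longrightarrow> (LINT r|\<nu> l. 1 / (s + r)) = g s / (l + s * g s)"
proof -
  have "\<exists>M. real_distribution M \<and> (AE r in M. r \<ge> 0) \<and> (\<forall>s>0. (LINT r|M. 1 / (s + r)) = g s / (l + s * g s))"
  proof (cases "l = 0")
    case True
    show ?thesis
    \<comment> \<open>For \<open>l = 0\<close> the quotient is 1 / s, the transform of the unit mass
      at 0.\<close>
    proof (intro exI[of _ "return borel 0"] conjI allI impI)
      show "real_distribution (return borel 0)"
        by (intro real_distribution.intro real_distribution_axioms.intro prob_space_return) auto
      show "AE r in return borel (0::real). r \<ge> 0" by (subst AE_return) auto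
      show "(LINT r|return borel 0. 1 / (s + r)) = g s / (l + s * g s)" if "s > 0" for s
        using True that g_pos[OF that] by (subst integral_return) auto
    qed
  qed (use l in \<open>auto intro: relaxation_measure_exists\<close>)
  from someI_ex[OF this, folded \<nu>_def]
  show "real_distribution (\<nu> l)" "AE r in \<nu> l. r \<ge> 0" "\<And>s. s > 0 \<Longrightarrow> (LINT r|\<nu> l. 1 / (s + r)) = g s / (l + s * g s)"
    by auto
qed

lemma \<nu>_integrable:
  fixes f :: "real \<Rightarrow> real"
  assumes l: "l \<ge> 0" and f: "f \<in> borel_measurable borel" and bd: "\<And>r. r \<ge> 0 \<Longrightarrow> \<bar>f r\<bar> \<le> C"
  shows "integrable (\<nu> l) f" "\<bar>LINT r|\<nu> l. f r\<bar> \<le> C"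
proof -
  interpret real_distribution "\<nu> l" by (rule \<nu>(1)[OF l])
  have ae: "AE r in \<nu> l. \<bar>f r\<bar> \<le> C" using \<nu>(2)[OF l] by eventually_elim (rule bd)
  show i: "integrable (\<nu> l) f" by (rule integrable_const_bound[of _ C]) (use ae f in auto)
  have "\<bar>LINT r|\<nu> l. f r\<bar> \<le> (LINT r|\<nu> l. \<bar>f r\<bar>)" by (rule integral_abs_bound)
  also have "\<dots> \<le> (LINT r|\<nu> l. C)" by (intro integral_mono_AE ae) (use i in auto)
  finally show "\<bar>LINT r|\<nu> l. f r\<bar> \<le> C" using prob_space by simp
qed

text \<open>\<open>E l\<close> is the Laplace transform of \<open>\<nu> l\<close>, and \<open>Ed j l\<close> is its \<open>j\<close>-th derivative.\<close>

definition Ed :: "nat \<Rightarrow> real \<Rightarrow> real \<Rightarrow> real" where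
  "Ed j l t = (LINT r|\<nu> l. (- r) ^ j * exp (- r * t))"

abbreviation E :: "real \<Rightarrow> real \<Rightarrow> real" where "E l t \<equiv> Ed 0 l t"

lemma E_def: "E l t = (LINT r|\<nu> l. exp (- r * t))"
  by (simp add: Ed_def)

lemma E_integrable: "l \<ge> 0 \<Longrightarrow> t \<ge> 0 \<Longrightarrow> integrable (\<nu> l) (\<lambda>r. exp (- r * t))"
  by (rule \<nu>_integrable(1)[where C = 1]) auto

lemma E_nonneg: "E l t \<ge> 0"
  unfolding E_def by simp

lemma E_le_1: "l \<ge> 0 \<Longrightarrow> t \<ge> 0 \<Longrightarrow> E l t \<le> 1"
  using \<nu>_integrable(2)[of l "\<lambda>r. exp (- r * t)" 1] unfolding E_def by simp

lemma E_0: "l \<ge> 0 \<Longrightarrow> E l 0 = 1"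
  unfolding E_def using prob_space.prob_space[of "\<nu> l"] \<nu>(1)[of l] by (simp add: real_distribution_def)

lemma E_antimono:
  assumes l: "l \<ge> 0" and t: "0 \<le> t" "t \<le> t'"
  shows "E l t' \<le> E l t"
  unfolding E_def
proof (rule integral_mono_AE)
  show "AE r in \<nu> l. exp (- r * t') \<le> exp (- r * t)"
    using \<nu>(2)[OF l] by eventually_elim (use t in \<open>auto intro: mult_left_mono\<close>)
  show "integrable (\<nu> l) (\<lambda>r. exp (- r * t'))" by (rule E_integrable) (use l t in auto)
  show "integrable (\<nu> l) (\<lambda>r. exp (- r * t))" by (rule E_integrable) (use l t in auto)
qed

lemma E_measurable [measurable]:
  assumes l: "l \<ge> 0" shows "(\<lambda>t. Ed j l t) \<in> borel_measurable borel"
proof -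
  interpret real_distribution "\<nu> l" by (rule \<nu>(1)[OF l])
  show ?thesis unfolding Ed_def by measurable
qed

lemma E_continuous:
  assumes l: "l \<ge> 0"
  shows "continuous_on {0..} (E l)"
proof (rule continuous_on_sequentiallyI)
  interpret real_distribution "\<nu> l" by (rule \<nu>(1)[OF l])
  fix u :: "nat \<Rightarrow> real" and a
  assume u: "\<forall>n. u n \<in> {0..}" "a \<in> {0..}" "u \<longlonglongrightarrow> a"
  show "(\<lambda>n. E l (u n)) \<longlonglongrightarrow> E l a"
    unfolding E_def
  proof (rule integral_dominated_convergence[where w = "\<lambda>_. 1"])
    show "AE r in \<nu> l. (\<lambda>n. exp (- r * u n)) \<longlonglongrightarrow> exp (- r * a)"
      by (intro AE_I2 tendsto_intros u)
    show "AE r in \<nu> l. norm (exp (- r * u n)) \<le> 1" for n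
      using \<nu>(2)[OF l] by eventually_elim (use u in auto)
  qed auto
qed

lemma Ed_bound:
  assumes l: "l \<ge> 0" and t: "t > 0" and j: "j \<ge> 1"
  shows "\<bar>Ed j l t\<bar> \<le> (real j / (exp 1 * t)) ^ j"
  unfolding Ed_def
  by (rule \<nu>_integrable(2)[OF l]) (use power_exp_neg_le[OF _ t j] in \<open>auto simp: abs_mult power_abs\<close>)

text \<open>For x \<ge> t / 2 the bound \<open>power_exp_neg_le\<close> on the next derivative is
  uniform in \<open>r\<close>, so a constant dominates, integrable because \<open>\<nu> l\<close> is
  a probability measure.\<close>

lemma Ed_deriv:
  assumes l: "l \<ge> 0" and t: "t > 0"
  shows "(Ed j l has_real_derivative Ed (Suc j) l t) (at t)"
proof -
  interpret real_distribution "\<nu> l" by (rule \<nu>(1)[OF l])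
  let ?f = "\<lambda>j t r. (- r) ^ j * exp (- r * t) :: real"
  have bd: "\<bar>?f j x r\<bar> \<le> (if j = 0 then 1 else (real j / (exp 1 * x)) ^ j)" if "x > 0" "r \<ge> 0" for x r j
    using power_exp_neg_le[OF that(2,1), of j] that by (auto simp: abs_mult power_abs)
  have "((\<lambda>x. LINT r|\<nu> l. ?f j x r) has_real_derivative (LINT r|\<nu> l. ?f (Suc j) t r)) (at t)"
  proof (rule DERIV_integral(1)[where e = "t / 2" and f' = "\<lambda>x. ?f (Suc j) x" and G = "\<lambda>_. (real (Suc j) / (exp 1 * (t / 2))) ^ Suc j"])
    show "integrable (\<nu> l) (?f j x)" if "\<bar>x - t\<bar> < t / 2" for x
    proof (rule \<nu>_integrable(1)[OF l])
      show "\<bar>?f j x r\<bar> \<le> (if j = 0 then 1 else (real j / (exp 1 * x)) ^ j)" if "r \<ge> 0" for r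
        by (rule bd) (use half_ball[OF \<open>\<bar>x - t\<bar> < t / 2\<close> t] that in auto)
    qed measurable
    show "AE r in \<nu> l. \<forall>x. \<bar>x - t\<bar> < t / 2 \<longrightarrow> ((\<lambda>x. ?f j x r) has_real_derivative ?f (Suc j) x r) (at x)
        \<and> \<bar>?f (Suc j) x r\<bar> \<le> (real (Suc j) / (exp 1 * (t / 2))) ^ Suc j"
      using \<nu>(2)[OF l]
    proof eventually_elim
      case (elim r)
      show ?case
      proof (intro allI impI conjI)
        fix x assume x: "\<bar>x - t\<bar> < t / 2"
        then have x0: "x > 0" "t / 2 \<le> x" using half_ball[OF x t] by auto
        show "((\<lambda>x. ?f j x r) has_real_derivative ?f (Suc j) x r) (at x)"
          by (auto intro!: derivative_eq_intros)
        have "\<bar>?f (Suc j) x r\<bar> \<le> (real (Suc j) / (exp 1 * x)) ^ Suc j" using bd[OF x0(1) elim, of "Suc j"] by simp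
        also have "\<dots> \<le> (real (Suc j) / (exp 1 * (t / 2))) ^ Suc j"
          using x0 t by (intro power_mono divide_left_mono mult_left_mono) auto
        finally show "\<bar>?f (Suc j) x r\<bar> \<le> (real (Suc j) / (exp 1 * (t / 2))) ^ Suc j" .
      qed
    qed
  qed (use t in auto)
  then show ?thesis unfolding Ed_def[abs_def] by simp
qed

text \<open>\<open>J 0 1\<close> is g and \<open>J 1 2\<close> is the derivative of s g(s). The
  family is nonnegative, and differentiation in \<open>s\<close> maps it into itself up to factors
  that are not positive, which is what the multiplier cone requires.\<close>

definition J :: "nat \<Rightarrow> nat \<Rightarrow> real \<Rightarrow> real" where
  "J q m s = (LINT r|\<sigma>. r ^ q * (1 / (s + r)) ^ m)"

text \<open>Of the \<open>m\<close> resolvents, \<open>q\<close> absorb the powers of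
  \<open>r\<close> and one supplies the decay 1 / (1 + r), whence the condition
  \<open>Suc q \<le> m\<close>; the others are at most 1 / s.\<close>

lemma J_bound:
  fixes s r :: real
  assumes "s > 0" "r > 0" "Suc q \<le> m"
  shows "\<bar>r ^ q * (1 / (s + r)) ^ m\<bar> \<le> ((1 / s) ^ (m - Suc q) * max 1 (1 / s)) / (1 + r)"
proof -
  define u where "u = 1 / (s + r)"
  obtain k where k: "m = Suc q + k" using assms(3) le_Suc_ex by blast
  have "u ^ m = u ^ q * u ^ k * u" by (simp add: k power_add)
  moreover have "(r * u) ^ q = r ^ q * u ^ q" by (rule Power.power_mult_distrib)
  moreover have "m - Suc q = k" by (simp add: k)
  ultimately have "r ^ q * u ^ m = (r * u) ^ q * u ^ (m - Suc q) * u" by simp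
  then have "r ^ q * (1 / (s + r)) ^ m = (r * (1 / (s + r))) ^ q * (1 / (s + r)) ^ (m - Suc q) * (1 / (s + r))"
    by (simp only: u_def)
  also have "\<dots> \<le> 1 * (1 / s) ^ (m - Suc q) * (max 1 (1 / s) / (1 + r))"
    using assms by (intro mult_mono power_mono resolvent_bound mult_nonneg_nonneg power_le_one) (auto simp: frac_le)
  finally show ?thesis using assms by simp
qed

lemma J_integrable: "s > 0 \<Longrightarrow> Suc q \<le> m \<Longrightarrow> integrable \<sigma> (\<lambda>r. r ^ q * (1 / (s + r)) ^ m)"
  by (rule integrable_dominated[OF _ J_bound]) auto

lemma J_nonneg: "s > 0 \<Longrightarrow> J q m s \<ge> 0"
  unfolding J_def by (intro integral_nonneg_AE AE_I2) (auto simp: space_\<sigma>)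

lemma power_resolvent_deriv:
  assumes "s + r > (0::real)"
  shows "((\<lambda>s. r ^ q * (1 / (s + r)) ^ m) has_real_derivative - (real m * (r ^ q * (1 / (s + r)) ^ Suc m))) (at s)"
proof (cases m)
  case 0
  then show ?thesis by simp
next
  case (Suc k)
  have d: "((\<lambda>s. 1 / (s + r)) has_real_derivative - ((1 / (s + r))\<^sup>2)) (at s)"
    using assms by (auto intro!: derivative_eq_intros simp: power2_eq_square)
  have "((\<lambda>s. r ^ q * (1 / (s + r)) ^ m) has_real_derivative r ^ q * (real m * (- ((1 / (s + r))\<^sup>2) * (1 / (s + r)) ^ (m - Suc 0)))) (at s)"
    by (rule DERIV_cmult[OF DERIV_power[OF d]])
  moreover have "r ^ q * (real m * (- (u\<^sup>2) * u ^ (m - Suc 0))) = - (real m * (r ^ q * u ^ Suc m))" for u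
    by (simp add: Suc power2_eq_square mult_ac)
  ultimately show ?thesis by (simp only:)
qed

lemma J_deriv:
  assumes s: "s > 0" and m: "Suc q \<le> m"
  shows "(J q m has_real_derivative - (real m * J q (Suc m) s)) (at s)"
proof -
  let ?f = "\<lambda>m s r. r ^ q * (1 / (s + r)) ^ m :: real"
  have "((\<lambda>x. LINT r|\<sigma>. ?f m x r) has_real_derivative (LINT r|\<sigma>. - (real m * ?f (Suc m) s r))) (at s)"
  proof (rule DERIV_integral(1)[where e = "s / 2" and f' = "\<lambda>x r. - (real m * ?f (Suc m) x r)" and G = "\<lambda>r. real m * ?f (Suc m) (s / 2) r"])
    show "integrable \<sigma> (?f m x)" if "\<bar>x - s\<bar> < s / 2" for x
      by (rule J_integrable[OF _ m]) (use half_ball[OF that s] in auto)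
    show "integrable \<sigma> (\<lambda>r. real m * ?f (Suc m) (s / 2) r)"
      using s m by (intro integrable_mult_right J_integrable) auto
    show "(\<lambda>r. - (real m * ?f (Suc m) s r)) \<in> borel_measurable \<sigma>" by (intro measurable_\<sigma>) measurable
    show "AE r in \<sigma>. \<forall>x. \<bar>x - s\<bar> < s / 2 \<longrightarrow> ((\<lambda>x. ?f m x r) has_real_derivative - (real m * ?f (Suc m) x r)) (at x)
        \<and> \<bar>- (real m * ?f (Suc m) x r)\<bar> \<le> real m * ?f (Suc m) (s / 2) r"
    proof (intro AE_I2 allI impI conjI)
      fix r x assume "r \<in> space \<sigma>" and x: "\<bar>x - s\<bar> < s / 2"
      then have r: "r > 0" by (simp add: space_\<sigma>)
      have x0: "x > 0" "s / 2 \<le> x" using half_ball[OF x s] by auto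
      show "((\<lambda>x. ?f m x r) has_real_derivative - (real m * ?f (Suc m) x r)) (at x)"
        by (rule power_resolvent_deriv) (use x0 r in auto)
      have "\<bar>- (real m * ?f (Suc m) x r)\<bar> = real m * (r ^ q * (1 / (x + r)) ^ Suc m)"
        using x0 r by (simp add: abs_mult power_abs)
      also have "\<dots> \<le> real m * ?f (Suc m) (s / 2) r"
        using x0 r s by (intro mult_left_mono power_mono frac_le) auto
      finally show "\<bar>- (real m * ?f (Suc m) x r)\<bar> \<le> real m * ?f (Suc m) (s / 2) r" .
    qed
  qed (use s in auto)
  then show ?thesis unfolding J_def[abs_def] by (simp only: Bochner_Integration.integral_minus integral_mult_right_zero)
qed

lemma g_J: "s > 0 \<Longrightarrow> g s = J 0 1 s"
  by (simp add: J_def g_eq)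

text \<open>Termwise, s / (s + r) has the derivative r / (s + r)^2.\<close>

lemma sg_deriv:
  assumes s: "s > 0"
  shows "((\<lambda>s. s * g s) has_real_derivative J 1 2 s) (at s)"
proof -
  have "((\<lambda>s. s * J 0 1 s) has_real_derivative s * (- (real 1 * J 0 2 s)) + 1 * J 0 1 s) (at s)"
    using J_deriv[OF s, of 0 1] by (intro DERIV_mult' DERIV_ident) (simp add: numeral_2_eq_2)
  moreover have "s * (- (real 1 * J 0 2 s)) + 1 * J 0 1 s = J 1 2 s"
  proof -
    have "J 0 1 s - s * J 0 2 s = (LINT r|\<sigma>. r ^ 0 * (1 / (s + r)) ^ 1 - s * (r ^ 0 * (1 / (s + r)) ^ 2))"
    proof -
      have i: "integrable \<sigma> (\<lambda>r. r ^ 0 * (1 / (s + r)) ^ 1)" "integrable \<sigma> (\<lambda>r. r ^ 0 * (1 / (s + r)) ^ 2)"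
        by (rule J_integrable[OF s], simp)+
      show ?thesis unfolding J_def
        by (simp only: Bochner_Integration.integral_diff[OF i(1) integrable_mult_right[OF i(2)]] integral_mult_right_zero)
    qed
    also have "\<dots> = J 1 2 s"
      unfolding J_def
    proof (rule Bochner_Integration.integral_cong[OF refl])
      fix r assume "r \<in> space \<sigma>"
      then have u: "1 / (s + r) * (s + r) = 1" using s by (simp add: space_\<sigma>)
      have "r ^ 0 * u ^ 1 - s * (r ^ 0 * u ^ 2) = r ^ 1 * u ^ 2" if "u * (s + r) = 1" for u :: real
      proof -
        have "u = u * (u * (s + r))" using that by simp
        then show ?thesis by (simp add: power2_eq_square algebra_simps)
      qed
      from this[OF u] show "r ^ 0 * (1 / (s + r)) ^ 1 - s * (r ^ 0 * (1 / (s + r)) ^ 2) = r ^ 1 * (1 / (s + r)) ^ 2" .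
    qed
    finally show ?thesis by simp
  qed
  ultimately have "((\<lambda>s. s * J 0 1 s) has_real_derivative J 1 2 s) (at s)" by simp
  then show ?thesis
  proof (rule DERIV_cong_ev[THEN iffD1, rotated 3])
    have "\<forall>\<^sub>F x in nhds s. x > 0" using s by (intro eventually_nhds_in_open[of "{0<..}", simplified]) auto
    then show "\<forall>\<^sub>F x in nhds s. x * J 0 1 x = x * g x" by eventually_elim (simp add: g_J)
  qed auto
qed

text \<open>Functions of \<open>(s, l)\<close> obtained from the kernel and the resolvent \<open>1 / (l + s g(s))\<close>; the cone is
  stable under \<open>- \<partial>\<^sub>s\<close>, and for fixed \<open>s\<close> it consists of positive multipliers.\<close>

inductive multiplier_cone :: "(real \<Rightarrow> real \<Rightarrow> real) \<Rightarrow> bool" where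
  base: "Suc q \<le> m \<Longrightarrow> multiplier_cone (\<lambda>s l. J q m s)"
| res: "multiplier_cone (\<lambda>s l. 1 / (l + s * g s))"
| const: "c \<ge> 0 \<Longrightarrow> multiplier_cone (\<lambda>s l. c)"
| add: "multiplier_cone F \<Longrightarrow> multiplier_cone G \<Longrightarrow> multiplier_cone (\<lambda>s l. F s l + G s l)"
| mult: "multiplier_cone F \<Longrightarrow> multiplier_cone G \<Longrightarrow> multiplier_cone (\<lambda>s l. F s l * G s l)"

lemma multiplier_cone_deriv:
  assumes "multiplier_cone F"
  shows "\<exists>F'. multiplier_cone F' \<and> (\<forall>s>0. \<forall>l\<ge>0. ((\<lambda>s. F s l) has_real_derivative - F' s l) (at s))"
  using assms
proof induction
  case (base q m)
  show ?case
  proof (intro exI conjI allI impI)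
    show "multiplier_cone (\<lambda>s l. real m * J q (Suc m) s)" using base by (intro multiplier_cone.intros) auto
    show "((\<lambda>s. J q m s) has_real_derivative - (real m * J q (Suc m) s)) (at s)" if "s > 0" for s
      by (rule J_deriv[OF that base])
  qed
next
  case res
  show ?case
  proof (intro exI conjI allI impI)
    \<comment> \<open>Differentiating the resolvent brings out the inner derivative (s g(s))' =
      \<open>J 1 2 s\<close>, itself a member of the cone.\<close>
    show "multiplier_cone (\<lambda>s l. (1 / (l + s * g s) * (1 / (l + s * g s))) * J 1 2 s)" by (intro multiplier_cone.intros) auto
    fix s l :: real assume s: "s > 0" and l: "l \<ge> 0"
    have "l + s * g s \<noteq> 0" using l mult_pos_pos[OF s g_pos[OF s]] by simp
    then show "((\<lambda>s. 1 / (l + s * g s)) has_real_derivative - ((1 / (l + s * g s) * (1 / (l + s * g s))) * J 1 2 s)) (at s)"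
      using DERIV_divide[OF DERIV_const DERIV_add[OF DERIV_const sg_deriv[OF s]], of l 1] by simp
  qed
next
  case (const c)
  show ?case by (intro exI[of _ "\<lambda>s l. 0"] conjI multiplier_cone.const) auto
next
  case (add F G)
  then obtain F' G' where *: "multiplier_cone F'" "multiplier_cone G'"
    "\<And>s l. s > 0 \<Longrightarrow> l \<ge> 0 \<Longrightarrow> ((\<lambda>s. F s l) has_real_derivative - F' s l) (at s)"
    "\<And>s l. s > 0 \<Longrightarrow> l \<ge> 0 \<Longrightarrow> ((\<lambda>s. G s l) has_real_derivative - G' s l) (at s)" by blast
  show ?case
  proof (intro exI conjI allI impI)
    show "multiplier_cone (\<lambda>s l. F' s l + G' s l)" by (intro multiplier_cone.add *)
    show "((\<lambda>s. F s l + G s l) has_real_derivative - (F' s l + G' s l)) (at s)" if "s > 0" "l \<ge> 0" for s l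
      using DERIV_add[OF *(3)[OF that] *(4)[OF that]] by simp
  qed
next
  case (mult F G)
  then obtain F' G' where *: "multiplier_cone F'" "multiplier_cone G'"
    "\<And>s l. s > 0 \<Longrightarrow> l \<ge> 0 \<Longrightarrow> ((\<lambda>s. F s l) has_real_derivative - F' s l) (at s)"
    "\<And>s l. s > 0 \<Longrightarrow> l \<ge> 0 \<Longrightarrow> ((\<lambda>s. G s l) has_real_derivative - G' s l) (at s)" by blast
  show ?case
  proof (intro exI conjI allI impI)
    show "multiplier_cone (\<lambda>s l. F' s l * G s l + F s l * G' s l)" by (intro multiplier_cone.add multiplier_cone.mult * mult)
    show "((\<lambda>s. F s l * G s l) has_real_derivative - (F' s l * G s l + F s l * G' s l)) (at s)" if "s > 0" "l \<ge> 0" for s l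
      using DERIV_mult'[OF *(3)[OF that] *(4)[OF that]] by (simp add: algebra_simps)
  qed
qed

text \<open>For fixed \<open>s\<close> the \<open>J\<close> factors are nonnegative constants, and
  the resolvent is \<open>1 / (l + a)\<close> with \<open>a = s * g s > 0\<close>.\<close>

lemma multiplier_cone_positive:
  assumes "multiplier_cone F" and s: "s > 0"
  shows "positive_multiplier TYPE('n::finite) (F s)"
  using assms(1)
proof induction
  case res
  show ?case by (rule positive_multiplier_resolvent) (use s g_pos[OF s] in simp)
qed (auto intro: positive_multiplier_const positive_multiplier_add positive_multiplier_mult J_nonneg s)

definition R :: "nat \<Rightarrow> real \<Rightarrow> real \<Rightarrow> real" where
  "R n s l = (LINT r|\<nu> l. (1 / (s + r)) ^ Suc n)"

lemma R_integrable:
  assumes "l \<ge> 0" "s > 0" shows "integrable (\<nu> l) (\<lambda>r. (1 / (s + r)) ^ m)"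
  using assms by (intro \<nu>_integrable(1)[where C = "(1 / s) ^ m"]) (auto intro!: power_mono frac_le simp: power_abs)

lemma R_deriv:
  assumes l: "l \<ge> 0" and s: "s > 0"
  shows "((\<lambda>s. R n s l) has_real_derivative - (real (Suc n) * R (Suc n) s l)) (at s)"
proof -
  interpret real_distribution "\<nu> l" by (rule \<nu>(1)[OF l])
  let ?f = "\<lambda>m s r. (1 / (s + r)) ^ m :: real"
  have "((\<lambda>x. LINT r|\<nu> l. ?f (Suc n) x r) has_real_derivative (LINT r|\<nu> l. - (real (Suc n) * ?f (Suc (Suc n)) s r))) (at s)"
  proof (rule DERIV_integral(1)[where e = "s / 2" and f' = "\<lambda>x r. - (real (Suc n) * ?f (Suc (Suc n)) x r)" and G = "\<lambda>r. real (Suc n) * ?f (Suc (Suc n)) (s / 2) r"])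
    show "integrable (\<nu> l) (?f (Suc n) x)" if "\<bar>x - s\<bar> < s / 2" for x
      by (rule R_integrable[OF l]) (use half_ball[OF that s] in auto)
    show "integrable (\<nu> l) (\<lambda>r. real (Suc n) * ?f (Suc (Suc n)) (s / 2) r)"
      using s by (intro integrable_mult_right R_integrable l) auto
    show "AE r in \<nu> l. \<forall>x. \<bar>x - s\<bar> < s / 2 \<longrightarrow> ((\<lambda>x. ?f (Suc n) x r) has_real_derivative - (real (Suc n) * ?f (Suc (Suc n)) x r)) (at x)
        \<and> \<bar>- (real (Suc n) * ?f (Suc (Suc n)) x r)\<bar> \<le> real (Suc n) * ?f (Suc (Suc n)) (s / 2) r"
      using \<nu>(2)[OF l]
    proof eventually_elim
      case (elim r)
      show ?case
      proof (intro allI impI conjI)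
        fix x assume x: "\<bar>x - s\<bar> < s / 2"
        have x0: "x > 0" "s / 2 \<le> x" using half_ball[OF x s] by auto
        show "((\<lambda>x. ?f (Suc n) x r) has_real_derivative - (real (Suc n) * ?f (Suc (Suc n)) x r)) (at x)"
          using power_resolvent_deriv[of x r 0 "Suc n"] x0 elim by (simp del: of_nat_Suc power_Suc)
        have "\<bar>- (real (Suc n) * ?f (Suc (Suc n)) x r)\<bar> = real (Suc n) * ((1 / (x + r)) ^ Suc (Suc n))"
          using x0 elim by (simp add: abs_mult power_abs del: of_nat_Suc power_Suc)
        also have "\<dots> \<le> real (Suc n) * ?f (Suc (Suc n)) (s / 2) r"
          using x0 elim s by (intro mult_left_mono power_mono frac_le) auto
        finally show "\<bar>- (real (Suc n) * ?f (Suc (Suc n)) x r)\<bar> \<le> real (Suc n) * ?f (Suc (Suc n)) (s / 2) r" .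
      qed
    qed
  qed (use s in auto)
  then show ?thesis unfolding R_def by (simp del: of_nat_Suc power_Suc)
qed

text \<open>\<open>R 0\<close> is the product of g and the resolvent, and \<open>R (Suc n)\<close>
  is minus the derivative of \<open>R n\<close> divided by \<open>n + 1\<close>, so the cone is
  never left.\<close>

lemma R_multiplier_cone: "\<exists>F. multiplier_cone F \<and> (\<forall>s>0. \<forall>l\<ge>0. R n s l = F s l)"
proof (induction n)
  case 0
  show ?case
  proof (intro exI conjI allI impI)
    show "multiplier_cone (\<lambda>s l. J 0 1 s * (1 / (l + s * g s)))" by (intro multiplier_cone.intros) auto
    show "R 0 s l = J 0 1 s * (1 / (l + s * g s))" if "s > 0" "l \<ge> 0" for s l
      using \<nu>(3)[OF that(2,1)] that by (simp add: R_def g_J)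
  qed
next
  case (Suc n)
  then obtain F where F: "multiplier_cone F" "\<And>s l. s > 0 \<Longrightarrow> l \<ge> 0 \<Longrightarrow> R n s l = F s l" by blast
  from multiplier_cone_deriv[OF F(1)] obtain F' where F': "multiplier_cone F'"
    "\<And>s l. s > 0 \<Longrightarrow> l \<ge> 0 \<Longrightarrow> ((\<lambda>s. F s l) has_real_derivative - F' s l) (at s)" by blast
  show ?case
  proof (intro exI conjI allI impI)
    show "multiplier_cone (\<lambda>s l. (1 / real (Suc n)) * F' s l)" by (intro multiplier_cone.mult multiplier_cone.const F') auto
    fix s l :: real assume s: "s > 0" and l: "l \<ge> 0"
    have "((\<lambda>s. F s l) has_real_derivative - (real (Suc n) * R (Suc n) s l)) (at s)"
    proof (rule DERIV_cong_ev[THEN iffD1, OF refl _ refl R_deriv[OF l s]])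
      have "\<forall>\<^sub>F x in nhds s. x > 0" using s by (intro eventually_nhds_in_open[of "{0<..}", simplified]) auto
      then show "\<forall>\<^sub>F x in nhds s. R n x l = F x l" by eventually_elim (simp add: F(2) l)
    qed
    from DERIV_unique[OF this F'(2)[OF s l]] show "R (Suc n) s l = (1 / real (Suc n)) * F' s l"
      by (simp add: field_simps del: of_nat_Suc)
  qed
qed

text \<open>Post--Widder inversion: up to the factor \<open>(- 1)\<^sup>n / n!\<close>, \<open>R n\<close> is the \<open>n\<close>-th derivative in \<open>s\<close> of
  the Laplace transform of \<open>E l\<close>.\<close>

lemma post_widder:
  assumes l: "l \<ge> 0" and t: "t > 0"
  shows "(\<lambda>n. (real (Suc n) / t) ^ Suc (Suc n) * R (Suc n) (real (Suc n) / t) l) \<longlonglongrightarrow> E l t"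
    and "\<bar>(real (Suc n) / t) ^ Suc (Suc n) * R (Suc n) (real (Suc n) / t) l\<bar> \<le> 1"
proof -
  interpret real_distribution "\<nu> l" by (rule \<nu>(1)[OF l])
  \<comment> \<open>The rescaled kernel at s = (n + 1) / t. Its exponent exceeds n + 1 by one; the
    surplus factor tends to 1.\<close>
  let ?f = "\<lambda>n r. (1 / (1 + r * t / real (Suc n))) ^ Suc (Suc n)"
  have eq: "(real (Suc n) / t) ^ Suc (Suc n) * R (Suc n) (real (Suc n) / t) l = (LINT r|\<nu> l. ?f n r)" for n
  proof -
    have "(real (Suc n) / t) ^ Suc (Suc n) * R (Suc n) (real (Suc n) / t) l
      = (LINT r|\<nu> l. (real (Suc n) / t) ^ Suc (Suc n) * (1 / (real (Suc n) / t + r)) ^ Suc (Suc n))"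
      unfolding R_def by (rule integral_mult_right_zero[symmetric])
    also have "\<dots> = (LINT r|\<nu> l. ?f n r)"
    proof (rule integral_cong_AE)
      show "AE r in \<nu> l. (real (Suc n) / t) ^ Suc (Suc n) * (1 / (real (Suc n) / t + r)) ^ Suc (Suc n) = ?f n r"
        using \<nu>(2)[OF l]
      proof eventually_elim
        case (elim r)
        have "real (Suc n) / t * (1 / (real (Suc n) / t + r)) = 1 / (1 + r * t / real (Suc n))"
          using t elim by (simp add: field_simps del: of_nat_Suc)
        then show ?case by (simp only: power_mult_distrib[symmetric])
      qed
    qed measurable
    finally show ?thesis .
  qed
  have b: "\<bar>?f n r\<bar> \<le> 1" if "r \<ge> 0" for n r
  proof -
    have "0 \<le> r * t / real (Suc n)" using that t by simp
    then have "0 \<le> 1 / (1 + r * t / real (Suc n))" "1 / (1 + r * t / real (Suc n)) \<le> 1" by simp_all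
    then show ?thesis by (subst power_abs, intro power_le_one) simp_all
  qed
  show "\<bar>(real (Suc n) / t) ^ Suc (Suc n) * R (Suc n) (real (Suc n) / t) l\<bar> \<le> 1"
    unfolding eq by (rule \<nu>_integrable(2)[OF l]) (use b in auto)
  have "(\<lambda>n. LINT r|\<nu> l. ?f n r) \<longlonglongrightarrow> (LINT r|\<nu> l. exp (- r * t))"
  proof (rule integral_dominated_convergence[where w = "\<lambda>_. 1"])
    show "AE r in \<nu> l. (\<lambda>n. ?f n r) \<longlonglongrightarrow> exp (- r * t)"
      using \<nu>(2)[OF l]
    proof eventually_elim
      case (elim r)
      have 1: "(\<lambda>n. (1 + r * t / real (Suc n)) ^ Suc n) \<longlonglongrightarrow> exp (r * t)"
        using LIMSEQ_Suc[OF tendsto_exp_limit_sequentially[of "r * t"]] by simp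
      have 2: "(\<lambda>n. 1 + r * t / real (Suc n)) \<longlonglongrightarrow> 1 + 0"
        by (intro tendsto_add tendsto_const LIMSEQ_Suc[OF lim_const_over_n])
      have "(\<lambda>n. 1 / ((1 + r * t / real (Suc n)) * (1 + r * t / real (Suc n)) ^ Suc n)) \<longlonglongrightarrow> 1 / ((1 + 0) * exp (r * t))"
        by (intro tendsto_divide tendsto_const tendsto_mult 1 2) simp
      then show ?case by (simp add: power_divide exp_minus inverse_eq_divide del: of_nat_Suc)
    qed
    show "AE r in \<nu> l. norm (?f n r) \<le> 1" for n using \<nu>(2)[OF l] by eventually_elim (use b in simp)
  qed auto
  then show "(\<lambda>n. (real (Suc n) / t) ^ Suc (Suc n) * R (Suc n) (real (Suc n) / t) l) \<longlonglongrightarrow> E l t"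
    unfolding eq E_def .
qed

text \<open>The Post-Widder terms lie in the cone and are bounded by 1 uniformly in
  \<open>l\<close>, so their pointwise limit is again a positive multiplier.\<close>

lemma E_positive_multiplier:
  assumes t: "t \<ge> 0"
  shows "positive_multiplier TYPE('n::finite) (\<lambda>l. E l t)"
proof (cases "t = 0")
  case True
  show ?thesis by (rule positive_multiplier_cong[OF positive_multiplier_const[of 1]]) (use True in \<open>auto simp: E_0\<close>)
next
  case False
  then have t: "t > 0" using t by simp
  show ?thesis
  proof (rule positive_multiplier_limit[OF _ post_widder(2)[OF _ t] post_widder(1)[OF _ t]])
    fix n
    obtain F where F: "multiplier_cone F" "\<And>s l. s > 0 \<Longrightarrow> l \<ge> 0 \<Longrightarrow> R (Suc n) s l = F s l" using R_multiplier_cone by blast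
    have s: "real (Suc n) / t > 0" using t by simp
    have "positive_multiplier TYPE('n) (\<lambda>l. (real (Suc n) / t) ^ Suc (Suc n) * F (real (Suc n) / t) l)"
      using t by (intro positive_multiplier_mult positive_multiplier_const multiplier_cone_positive F(1)) auto
    then show "positive_multiplier TYPE('n) (\<lambda>l. (real (Suc n) / t) ^ Suc (Suc n) * R (Suc n) (real (Suc n) / t) l)"
      by (rule positive_multiplier_cong) (simp only: F(2)[OF s])
  qed
qed

text \<open>The case \<open>j = 0\<close> is contained in \<open>positive_multiplier\<close>,
  whatever the dimension, so a one-element index type serves; each further derivative in
  \<open>t\<close> is a limit of difference quotients.\<close>

lemma Ed_measurable:
  assumes t: "t > 0"
  shows "(\<lambda>r. Ed j (r\<^sup>2) t) \<in> borel_measurable borel"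
  using t
proof (induction j arbitrary: t)
  case 0
  then show ?case using E_positive_multiplier[of t, where 'n = 1] by (simp add: positive_multiplier_def)
next
  case (Suc j)
  show ?case
  proof (rule borel_measurable_LIMSEQ_real[where u = "\<lambda>i r. (Ed j (r\<^sup>2) (t + 1 / real (Suc i)) - Ed j (r\<^sup>2) t) / (1 / real (Suc i))"])
    fix r :: real
    have "(\<lambda>h. (Ed j (r\<^sup>2) (t + h) - Ed j (r\<^sup>2) t) / h) \<midarrow>0\<rightarrow> Ed (Suc j) (r\<^sup>2) t"
      using Ed_deriv[of "r\<^sup>2" t j] Suc.prems by (simp add: DERIV_def)
    then have *: "\<forall>X. (\<forall>i. X i \<in> UNIV - {0}) \<longrightarrow> X \<longlonglongrightarrow> 0 \<longrightarrow> ((\<lambda>h. (Ed j (r\<^sup>2) (t + h) - Ed j (r\<^sup>2) t) / h) \<circ> X) \<longlonglongrightarrow> Ed (Suc j) (r\<^sup>2) t"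
      by (simp only: tendsto_at_iff_sequentially)
    have "((\<lambda>h. (Ed j (r\<^sup>2) (t + h) - Ed j (r\<^sup>2) t) / h) \<circ> (\<lambda>i. 1 / real (Suc i))) \<longlonglongrightarrow> Ed (Suc j) (r\<^sup>2) t"
      by (rule *[rule_format, OF _ LIMSEQ_Suc[OF lim_1_over_n]]) simp
    then show "(\<lambda>i. (Ed j (r\<^sup>2) (t + 1 / real (Suc i)) - Ed j (r\<^sup>2) t) / (1 / real (Suc i))) \<longlonglongrightarrow> Ed (Suc j) (r\<^sup>2) t"
      by (simp only: o_def)
  next
    show "(\<lambda>r. (Ed j (r\<^sup>2) (t + 1 / real (Suc i)) - Ed j (r\<^sup>2) t) / (1 / real (Suc i))) \<in> borel_measurable borel" for i
      using Suc.IH[of t] Suc.IH[of "t + 1 / real (Suc i)"] Suc.prems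
      by (intro borel_measurable_divide borel_measurable_diff) (auto simp: add_pos_pos)
  qed
qed

end

section \<open>The relaxation equation\<close>

lemma nn_integral_exp:
  assumes c: "c > 0"
  shows "(\<integral>\<^sup>+t. ennreal (exp (- t * c)) * indicator {0<..} t \<partial>lborel) = ennreal (1 / c)"
proof -
  have "(\<integral>\<^sup>+t. ennreal (exp (- t * c)) * indicator {0<..} t \<partial>lborel) = (\<integral>\<^sup>+t. ennreal (exp (- t * c)) * indicator {0..} t \<partial>lborel)"
    by (rule nn_integral_cong_AE) (use AE_lborel_singleton[of 0] in eventually_elim, auto split: split_indicator)
  also have "\<dots> = ennreal (0 - (- exp (- 0 * c) / c))"
  proof (rule nn_integral_FTC_atLeast)
    show "DERIV (\<lambda>t. - exp (- t * c) / c) x :> exp (- x * c)" if "0 \<le> x" for x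
      using c by (auto intro!: derivative_eq_intros)
    show "((\<lambda>t. - exp (- t * c) / c) \<longlongrightarrow> 0) at_top" using c by real_asymp
  qed auto
  finally show ?thesis by simp
qed

text \<open>By Tonelli the Laplace transform of a mixture of exponentials is the Stieltjes transform
  of the mixing measure. Applied to \<open>\<sigma>\<close> for the kernel and to
  \<open>\<nu> l\<close> for \<open>E l\<close>.\<close>

lemma lap_mixture:
  assumes M: "sigma_finite_measure M" and id: "(\<lambda>r. r) \<in> borel_measurable M" and pos: "AE r in M. r \<ge> 0"
    and int: "\<And>t. t > 0 \<Longrightarrow> integrable M (\<lambda>r. exp (- r * t))" and s: "s > 0" and int': "integrable M (\<lambda>r. 1 / (s + r))"
  shows "lap (\<lambda>t. LINT r|M. exp (- r * t)) s = ennreal (LINT r|M. 1 / (s + r))"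
proof -
  interpret M: sigma_finite_measure M by fact
  interpret pair_sigma_finite lborel M ..
  note [measurable] = id
  have "lap (\<lambda>t. LINT r|M. exp (- r * t)) s = (\<integral>\<^sup>+t. (\<integral>\<^sup>+r. ennreal (exp (- t * (s + r))) * indicator {0<..} t \<partial>M) \<partial>lborel)"
    unfolding lap_def
  proof (rule nn_integral_cong)
    fix t :: real
    show "ennreal ((LINT r|M. exp (- r * t)) * exp (- t * s)) * indicator {0<..} t = (\<integral>\<^sup>+r. ennreal (exp (- t * (s + r))) * indicator {0<..} t \<partial>M)"
    proof (cases "t > 0")
      case True
      have "ennreal ((LINT r|M. exp (- r * t)) * exp (- t * s)) = (\<integral>\<^sup>+r. ennreal (exp (- r * t)) \<partial>M) * ennreal (exp (- t * s))"
        using int[OF True] by (subst nn_integral_eq_integral) (auto simp: ennreal_mult)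
      also have "\<dots> = (\<integral>\<^sup>+r. ennreal (exp (- t * (s + r))) \<partial>M)"
        by (subst nn_integral_multc[symmetric]) (auto simp: exp_add[symmetric] algebra_simps simp flip: ennreal_mult)
      finally show ?thesis using True by simp
    qed simp
  qed
  also have "\<dots> = (\<integral>\<^sup>+r. (\<integral>\<^sup>+t. ennreal (exp (- t * (s + r))) * indicator {0<..} t \<partial>lborel) \<partial>M)"
    by (rule Fubini'[symmetric]) measurable
  also have "\<dots> = (\<integral>\<^sup>+r. ennreal (1 / (s + r)) \<partial>M)"
  proof (rule nn_integral_cong_AE)
    show "AE r in M. (\<integral>\<^sup>+t. ennreal (exp (- t * (s + r))) * indicator {0<..} t \<partial>lborel) = ennreal (1 / (s + r))"
      using pos by eventually_elim (rule nn_integral_exp, use s in linarith)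
  qed
  also have "\<dots> = ennreal (LINT r|M. 1 / (s + r))"
    by (rule nn_integral_eq_integral[OF int']) (use pos in eventually_elim, use s in auto)
  finally show ?thesis .
qed

lemma locint_boundedI:
  assumes "f \<in> borel_measurable borel" "\<And>T. \<exists>C. \<forall>t. 0 < t \<longrightarrow> t < T \<longrightarrow> norm (f t) \<le> C"
  shows "locint f"
  unfolding locint_def
proof (intro conjI allI assms(1))
  fix T :: real
  have [measurable]: "f \<in> borel_measurable borel" by fact
  obtain C where C: "\<And>t. 0 < t \<Longrightarrow> t < T \<Longrightarrow> norm (f t) \<le> C" using assms(2) by blast
  show "integrable lborel (\<lambda>t. indicator {0<..<T} t *\<^sub>R f t)"
  proof (rule Bochner_Integration.integrable_bound)
    show "integrable lborel (\<lambda>t. C * indicator {0<..<T} t)" by (cases "0 \<le> T") auto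
    show "AE t in lborel. norm (indicator {0<..<T} t *\<^sub>R f t) \<le> norm (C * indicator {0<..<T} t)"
    proof (rule AE_I2)
      fix t
      show "norm (indicator {0<..<T} t *\<^sub>R f t) \<le> norm (C * indicator {0<..<T} t)"
        using C[of t] by (auto split: split_indicator)
    qed
  qed measurable
qed

lemma locint_const: "locint (\<lambda>_. c)"
  by (rule locint_boundedI) auto

lemma locint_continuous:
  fixes f :: "real \<Rightarrow> 'b::{real_normed_field, banach, second_countable_topology}"
  assumes f: "continuous_on UNIV f"
  shows "locint f"
proof (rule locint_boundedI)
  show "f \<in> borel_measurable borel" using f by (rule borel_measurable_continuous_onI)
  fix T
  have "compact (f ` {0..T})" by (intro compact_continuous_image continuous_on_subset[OF f]) auto
  then have "bounded (f ` {0..T})" by (rule compact_imp_bounded)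
  then obtain C where "\<forall>y\<in>f ` {0..T}. norm y \<le> C" by (auto simp: bounded_iff)
  then show "\<exists>C. \<forall>t. 0 < t \<longrightarrow> t < T \<longrightarrow> norm (f t) \<le> C" by (intro exI[of _ C]) auto
qed

lemma cv_measurable [measurable]:
  assumes [measurable]: "f \<in> borel_measurable borel" "g \<in> borel_measurable borel"
  shows "cv f g \<in> borel_measurable borel"
proof -
  have "cv f g t = (LINT \<tau>|lborel. (if 0 < \<tau> \<and> \<tau> < t then f (t - \<tau>) * g \<tau> else 0))" for t
    unfolding cv_def by (intro Bochner_Integration.integral_cong) auto
  moreover have "(\<lambda>t. LINT \<tau>|lborel. (if 0 < \<tau> \<and> \<tau> < t then f (t - \<tau>) * g \<tau> else 0)) \<in> borel_measurable borel"
  proof (rule lborel.borel_measurable_lebesgue_integral)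
    have "(\<lambda>(t, \<tau>). if 0 < \<tau> \<and> \<tau> < t then f (t - \<tau>) * g \<tau> else 0) \<in> borel_measurable (borel \<Otimes>\<^sub>M borel)"
      by measurable
    then show "(\<lambda>(t, \<tau>). if 0 < \<tau> \<and> \<tau> < t then f (t - \<tau>) * g \<tau> else 0) \<in> borel_measurable (borel \<Otimes>\<^sub>M lborel)"
      by (simp cong: measurable_cong_sets sets_pair_measure_cong)
  qed
  ultimately show ?thesis by (simp cong: measurable_cong)
qed

lemma cv_cong:
  assumes "\<And>\<tau>. 0 < \<tau> \<Longrightarrow> \<tau> < t \<Longrightarrow> f \<tau> = f' \<tau>" "\<And>\<tau>. 0 < \<tau> \<Longrightarrow> \<tau> < t \<Longrightarrow> g \<tau> = g' \<tau>"
  shows "cv f g t = cv f' g' t"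
  unfolding cv_def
proof (rule Bochner_Integration.integral_cong[OF refl])
  fix \<tau>
  show "indicator {0<..<t} \<tau> *\<^sub>R (f (t - \<tau>) * g \<tau>) = indicator {0<..<t} \<tau> *\<^sub>R (f' (t - \<tau>) * g' \<tau>)"
    using assms(1)[of "t - \<tau>"] assms(2)[of \<tau>] by (auto split: split_indicator)
qed

lemma cv_one: "cv (\<lambda>_. 1) f t = (LINT \<tau>|lborel. indicator {0<..<t} \<tau> *\<^sub>R f \<tau>)"
  by (simp add: cv_def)

lemma locint_cv_one:
  fixes f :: "real \<Rightarrow> 'b::{real_normed_field, banach, second_countable_topology}"
  assumes f: "locint f"
  shows "locint (cv (\<lambda>_. 1) f)"
proof (rule locint_boundedI)
  have [measurable]: "f \<in> borel_measurable borel" using f by (simp add: locint_def)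
  show "cv (\<lambda>_. 1) f \<in> borel_measurable borel" by measurable
  fix T
  have i: "integrable lborel (\<lambda>t. indicator {0<..<S} t * norm (f t))" for S
    using integrable_norm[of lborel "\<lambda>t. indicator {0<..<S} t *\<^sub>R f t"] f by (simp add: locint_def)
  have "norm (cv (\<lambda>_. 1) f t) \<le> (LINT \<tau>|lborel. indicator {0<..<T} \<tau> * norm (f \<tau>))" if "t < T" for t
  proof -
    have "norm (cv (\<lambda>_. 1) f t) \<le> 1 * (LINT \<tau>|lborel. indicator {0<..<t} \<tau> * norm (f \<tau>))"
      by (rule cv_integrable(2)[OF f]) auto
    also have "\<dots> \<le> (LINT \<tau>|lborel. indicator {0<..<T} \<tau> * norm (f \<tau>))"
      unfolding mult_1 using that by (intro integral_mono i) (auto split: split_indicator)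
    finally show ?thesis .
  qed
  then show "\<exists>C. \<forall>t. 0 < t \<longrightarrow> t < T \<longrightarrow> norm (cv (\<lambda>_. 1) f t) \<le> C" by blast
qed

text \<open>The function may be singular at 0, so the fundamental theorem of calculus is applied on
  an interval \<open>{a..b}\<close> away from 0, the part up to \<open>a\<close> being
  constant.\<close>

lemma cv_one_deriv:
  fixes f :: "real \<Rightarrow> complex"
  assumes f: "locint f" and cont: "continuous_on {0<..} f" and t: "t > 0"
  shows "(cv (\<lambda>_. 1) f has_vector_derivative f t) (at t)"
proof -
  define a b where "a = t / 2" and "b = 2 * t"
  have ab: "0 < a" "a < t" "t < b" using t by (auto simp: a_def b_def)
  have split: "cv (\<lambda>_. 1) f x = cv (\<lambda>_. 1) f a + integral {a..x} f" if x: "x \<in> {a..b}" for x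
  proof -
    have i1: "integrable lborel (\<lambda>\<tau>. indicator {0<..<a} \<tau> *\<^sub>R f \<tau>)" using f by (simp add: locint_def)
    have si: "set_integrable lborel {a..x} f"
      by (rule borel_integrable_atLeastAtMost') (rule continuous_on_subset[OF cont], use ab in auto)
    have "cv (\<lambda>_. 1) f x = (LINT \<tau>|lborel. indicator {0<..<a} \<tau> *\<^sub>R f \<tau> + indicator {a..x} \<tau> *\<^sub>R f \<tau>)"
      unfolding cv_one
    proof (rule integral_cong_AE)
      show "AE \<tau> in lborel. indicator {0<..<x} \<tau> *\<^sub>R f \<tau> = indicator {0<..<a} \<tau> *\<^sub>R f \<tau> + indicator {a..x} \<tau> *\<^sub>R f \<tau>"
        using AE_lborel_singleton[of x] by eventually_elim (use x ab in \<open>auto split: split_indicator\<close>)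
    qed (use f in \<open>auto simp: locint_def\<close>)
    also have "\<dots> = cv (\<lambda>_. 1) f a + (LINT \<tau>:{a..x}|lborel. f \<tau>)"
      using i1 si unfolding cv_one set_lebesgue_integral_def set_integrable_def by simp
    also have "(LINT \<tau>:{a..x}|lborel. f \<tau>) = integral {a..x} f"
      by (rule set_borel_integral_eq_integral(2)[OF si])
    finally show ?thesis .
  qed
  have "((\<lambda>x. integral {a..x} f) has_vector_derivative f t) (at t within {a..b})"
    by (rule integral_has_vector_derivative[OF continuous_on_subset[OF cont]]) (use ab in auto)
  then have "((\<lambda>x. cv (\<lambda>_. 1) f a + integral {a..x} f) has_vector_derivative 0 + f t) (at t within {a..b})"
    by (intro has_vector_derivative_add has_vector_derivative_const)
  then have "((\<lambda>x. cv (\<lambda>_. 1) f a + integral {a..x} f) has_vector_derivative f t) (at t within {a..b})" by simp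
  then have "(cv (\<lambda>_. 1) f has_vector_derivative f t) (at t within {a..b})"
    by (rule has_vector_derivative_transform[where f = "\<lambda>x. cv (\<lambda>_. 1) f a + integral {a..x} f", rotated 2])
      (use ab in simp, rule split)
  then show ?thesis using ab by (simp add: at_within_Icc_at)
qed

text \<open>Associativity and commutativity combined in the form used for uniqueness: the locally
  integrable \<open>f\<close> stays inside while the two continuous factors change places. Fubini is
  applied on the triangle 0 < \<rho> < \<tau> < t, where boundedness of \<open>g\<close> and
  \<open>h\<close> leaves an integrable translate of \<open>f\<close>.\<close>

lemma cv_assoc:
  fixes f g h :: "real \<Rightarrow> complex"
  assumes f: "locint f" and g: "continuous_on UNIV g" and h: "continuous_on UNIV h"
  shows "cv g (cv f h) t = cv h (cv f g) t"
proof -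
  have [measurable]: "f \<in> borel_measurable borel" "g \<in> borel_measurable borel" "h \<in> borel_measurable borel"
    using f g h by (auto simp: locint_def intro: borel_measurable_continuous_onI)
  have bdd: "\<exists>C. \<forall>x. 0 \<le> x \<longrightarrow> x \<le> t \<longrightarrow> norm (p x) \<le> C" if "continuous_on UNIV p" for p :: "real \<Rightarrow> complex"
  proof -
    have "compact (p ` {0..t})" by (intro compact_continuous_image continuous_on_subset[OF that]) auto
    then have "bounded (p ` {0..t})" by (rule compact_imp_bounded)
    then obtain C where "\<forall>y\<in>p ` {0..t}. norm y \<le> C" by (auto simp: bounded_iff)
    then show ?thesis by (intro exI[of _ C]) auto
  qed
  obtain G where G: "\<And>x. 0 \<le> x \<Longrightarrow> x \<le> t \<Longrightarrow> norm (g x) \<le> G" using bdd[OF g] by blast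
  obtain H where H: "\<And>x. 0 \<le> x \<Longrightarrow> x \<le> t \<Longrightarrow> norm (h x) \<le> H" using bdd[OF h] by blast
  define F where "F x = indicator {0<..<t} x * norm (f x)" for x
  have [measurable]: "F \<in> borel_measurable borel" unfolding F_def by measurable
  have F: "integrable lborel F"
    using integrable_norm[of lborel "\<lambda>x. indicator {0<..<t} x *\<^sub>R f x"] f unfolding F_def[abs_def] by (simp add: locint_def)
  define \<Phi> where "\<Phi> \<rho> \<tau> = (if 0 < \<rho> \<and> \<rho> < \<tau> \<and> \<tau> < t then g (t - \<tau>) * (f (\<tau> - \<rho>) * h \<rho>) else 0)" for \<rho> \<tau>
  have \<Phi>m [measurable]: "(\<lambda>(\<rho>, \<tau>). \<Phi> \<rho> \<tau>) \<in> borel_measurable (borel \<Otimes>\<^sub>M borel)" unfolding \<Phi>_def by measurable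
  have shift: "integrable lborel (\<lambda>\<tau>. F (\<tau> - \<rho>))" "(LINT \<tau>|lborel. F (\<tau> - \<rho>)) = (LINT \<tau>|lborel. F \<tau>)" for \<rho>
    using lborel_integrable_real_affine[OF F, of 1 "- \<rho>"] lborel_integral_real_affine[of 1 F "- \<rho>"] by auto
  have "integrable (lborel \<Otimes>\<^sub>M lborel) (\<lambda>(\<rho>, \<tau>). (G * H) * (indicator {0<..<t} \<rho> * F (\<tau> - \<rho>)))"
  proof (rule lborel_pair.Fubini_integrable)
    have "(LINT \<tau>|lborel. norm ((G * H) * (indicator {0<..<t} \<rho> * F (\<tau> - \<rho>)))) = \<bar>G * H\<bar> * (LINT \<tau>|lborel. F \<tau>) * indicator {0<..<t} \<rho>" for \<rho>
      using shift(2)[of \<rho>] by (simp add: abs_mult F_def)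
    moreover have "integrable lborel (\<lambda>\<rho>. \<bar>G * H\<bar> * (LINT \<tau>|lborel. F \<tau>) * indicator {0<..<t} \<rho>)"
      by (cases "0 \<le> t") auto
    ultimately show "integrable lborel (\<lambda>\<rho>. LINT \<tau>|lborel. norm (case (\<rho>, \<tau>) of (\<rho>, \<tau>) \<Rightarrow> (G * H) * (indicator {0<..<t} \<rho> * F (\<tau> - \<rho>))))"
      by (simp only: prod.case)
  qed (use shift in auto)
  then have \<Phi>i: "integrable (lborel \<Otimes>\<^sub>M lborel) (\<lambda>(\<rho>, \<tau>). \<Phi> \<rho> \<tau>)"
  proof (rule Bochner_Integration.integrable_bound)
    show "AE p in lborel \<Otimes>\<^sub>M lborel. norm (case p of (\<rho>, \<tau>) \<Rightarrow> \<Phi> \<rho> \<tau>) \<le> norm (case p of (\<rho>, \<tau>) \<Rightarrow> (G * H) * (indicator {0<..<t} \<rho> * F (\<tau> - \<rho>)))"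
    proof (rule AE_I2)
      fix p :: "real \<times> real"
      obtain \<rho> \<tau> where p: "p = (\<rho>, \<tau>)" by (cases p)
      have "norm (\<Phi> \<rho> \<tau>) \<le> (G * H) * (indicator {0<..<t} \<rho> * F (\<tau> - \<rho>))" if "0 < \<rho> \<and> \<rho> < \<tau> \<and> \<tau> < t"
      proof -
        have "norm (\<Phi> \<rho> \<tau>) = norm (g (t - \<tau>)) * norm (h \<rho>) * norm (f (\<tau> - \<rho>))" using that by (simp add: \<Phi>_def norm_mult)
        also have "\<dots> \<le> G * H * norm (f (\<tau> - \<rho>))"
          using that G[of "t - \<tau>"] H[of \<rho>] by (intro mult_right_mono mult_mono) (auto intro: order_trans[OF norm_ge_zero])
        finally show ?thesis using that by (simp add: F_def)
      qed
      then have "norm (\<Phi> \<rho> \<tau>) \<le> \<bar>(G * H) * (indicator {0<..<t} \<rho> * F (\<tau> - \<rho>))\<bar>"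
      proof (cases "0 < \<rho> \<and> \<rho> < \<tau> \<and> \<tau> < t")
        case True
        with \<open>0 < \<rho> \<and> \<rho> < \<tau> \<and> \<tau> < t \<Longrightarrow> _\<close> show ?thesis by (meson abs_ge_self order_trans)
      next
        case False
        then show ?thesis by (simp only: \<Phi>_def if_False norm_zero abs_ge_zero)
      qed
      then show "norm (case p of (\<rho>, \<tau>) \<Rightarrow> \<Phi> \<rho> \<tau>) \<le> norm (case p of (\<rho>, \<tau>) \<Rightarrow> (G * H) * (indicator {0<..<t} \<rho> * F (\<tau> - \<rho>)))"
        by (simp add: p)
    qed
  qed measurable
  have "cv g (cv f h) t = (LINT \<tau>|lborel. (LINT \<rho>|lborel. \<Phi> \<rho> \<tau>))"
    unfolding cv_def[of g]
  proof (rule Bochner_Integration.integral_cong[OF refl])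
    fix \<tau>
    have "indicator {0<..<t} \<tau> *\<^sub>R (g (t - \<tau>) * cv f h \<tau>) = (LINT \<rho>|lborel. indicator {0<..<t} \<tau> *\<^sub>R (g (t - \<tau>) * (indicator {0<..<\<tau>} \<rho> *\<^sub>R (f (\<tau> - \<rho>) * h \<rho>))))"
      by (simp only: cv_def integral_scaleR_right integral_mult_right_zero)
    also have "\<dots> = (LINT \<rho>|lborel. \<Phi> \<rho> \<tau>)"
      by (intro Bochner_Integration.integral_cong refl) (auto simp: \<Phi>_def split: split_indicator)
    finally show "indicator {0<..<t} \<tau> *\<^sub>R (g (t - \<tau>) * cv f h \<tau>) = (LINT \<rho>|lborel. \<Phi> \<rho> \<tau>)" .
  qed
  also have "\<dots> = (LINT \<rho>|lborel. (LINT \<tau>|lborel. \<Phi> \<rho> \<tau>))"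
    by (rule lborel_pair.Fubini_integral[OF \<Phi>i])
  also have "\<dots> = (LINT \<rho>|lborel. indicator {0<..<t} \<rho> *\<^sub>R (h \<rho> * cv f g (t - \<rho>)))"
  proof (rule Bochner_Integration.integral_cong[OF refl])
    fix \<rho>
    have "cv f g (t - \<rho>) = (LINT \<tau>|lborel. indicator {0<..<t - \<rho>} (t - \<tau>) *\<^sub>R (f (t - \<rho> - (t - \<tau>)) * g (t - \<tau>)))"
      unfolding cv_def by (rule lborel_integral_reflect)
    then have "indicator {0<..<t} \<rho> *\<^sub>R (h \<rho> * cv f g (t - \<rho>)) = (LINT \<tau>|lborel. indicator {0<..<t} \<rho> *\<^sub>R (h \<rho> * (indicator {0<..<t - \<rho>} (t - \<tau>) *\<^sub>R (f (t - \<rho> - (t - \<tau>)) * g (t - \<tau>)))))"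
      by (simp only: integral_scaleR_right integral_mult_right_zero)
    also have "\<dots> = (LINT \<tau>|lborel. \<Phi> \<rho> \<tau>)"
      by (intro Bochner_Integration.integral_cong refl) (auto simp: \<Phi>_def split: split_indicator)
    finally show "(LINT \<tau>|lborel. \<Phi> \<rho> \<tau>) = indicator {0<..<t} \<rho> *\<^sub>R (h \<rho> * cv f g (t - \<rho>))" by simp
  qed
  also have "\<dots> = cv (cv f g) h t" unfolding cv_def[of "cv f g"] by (simp add: mult.commute)
  also have "\<dots> = cv h (cv f g) t" by (rule cv_commute)
  finally show ?thesis .
qed

lemma nncv_eq_cv:
  assumes "\<And>t. f t \<ge> 0" "\<And>t. g t \<ge> (0::real)" "integrable lborel (\<lambda>\<tau>. indicator {0<..<t} \<tau> *\<^sub>R (f (t - \<tau>) * g \<tau>))"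
  shows "nncv f g t = ennreal (cv f g t)"
  unfolding nncv_def cv_def
  by (subst nn_integral_eq_integral[OF assms(3), symmetric])
    (auto intro!: nn_integral_cong AE_I2 simp: assms(1,2) split: split_indicator)

lemma cv_nonneg: "(\<And>t. f t \<ge> 0) \<Longrightarrow> (\<And>t. g t \<ge> (0::real)) \<Longrightarrow> cv f g t \<ge> 0"
  unfolding cv_def by simp

lemma cv_laplace:
  assumes [measurable]: "f \<in> borel_measurable borel" "g \<in> borel_measurable borel"
    and f: "\<And>t. f t \<ge> 0" and g: "\<And>t. g t \<ge> (0::real)"
    and int: "\<And>t. integrable lborel (\<lambda>\<tau>. indicator {0<..<t} \<tau> *\<^sub>R (f (t - \<tau>) * g \<tau>))"
    and lf: "lap f s = ennreal a" and lg: "lap g s = ennreal b" and ab: "a \<ge> 0" "b \<ge> 0"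
  shows "integrable lborel (\<lambda>t. indicator {0<..} t * (cv f g t * exp (- t * s)))"
    and "(LINT t|lborel. indicator {0<..} t * (cv f g t * exp (- t * s))) = a * b"
proof -
  note c = cv_nonneg[of f g, OF f g]
  have "(\<integral>\<^sup>+t. ennreal (indicator {0<..} t * (cv f g t * exp (- t * s))) \<partial>lborel) = (\<integral>\<^sup>+t. nncv f g t * ennreal (exp (- t * s)) * indicator {0<..} t \<partial>lborel)"
    by (intro nn_integral_cong) (auto simp: nncv_eq_cv[OF f g int] ennreal_mult c split: split_indicator)
  also have "\<dots> = ennreal (a * b)" using lap_nncv[of f g s] f g lf lg ab by (simp add: ennreal_mult)
  finally have nn: "(\<integral>\<^sup>+t. ennreal (indicator {0<..} t * (cv f g t * exp (- t * s))) \<partial>lborel) = ennreal (a * b)" .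
  show "integrable lborel (\<lambda>t. indicator {0<..} t * (cv f g t * exp (- t * s)))"
  proof (rule integrableI_nonneg)
    show "(\<integral>\<^sup>+t. ennreal (indicator {0<..} t * (cv f g t * exp (- t * s))) \<partial>lborel) < \<infinity>" unfolding nn by simp
  qed (auto simp: c)
  show "(LINT t|lborel. indicator {0<..} t * (cv f g t * exp (- t * s))) = a * b"
  proof (rule trans[OF integral_eq_nn_integral])
    show "enn2real (\<integral>\<^sup>+t. ennreal (indicator {0<..} t * (cv f g t * exp (- t * s))) \<partial>lborel) = a * b"
      unfolding nn using ab by simp
  qed (auto simp: c)
qed

text \<open>Freezing \<open>F\<close> to the left of t / 2 gives a function continuous on the line,
  whose zero set is closed and contains almost every point to the right of t / 2.\<close>

lemma continuous_AE_zero: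
  fixes F :: "real \<Rightarrow> real"
  assumes cont: "continuous_on {0<..} F" and ae: "AE t in lborel. t > 0 \<longrightarrow> F t = 0" and t: "t > 0"
  shows "F t = 0"
proof -
  have c: "continuous_on UNIV (\<lambda>x. F (max (t/2) x))"
    by (rule continuous_on_compose2[OF cont]) (use t in \<open>auto intro!: continuous_intros simp: less_max_iff_disj\<close>)
  have "t \<in> {x. F (max (t/2) x) = 0}"
  proof (rule mem_closed_if_AE_lebesgue_open[of "{t/2<..}"])
    show "closed {x. F (max (t/2) x) = 0}" by (intro closed_Collect_eq c continuous_on_const)
    show "AE x\<in>{t/2<..} in lebesgue. x \<in> {x. F (max (t/2) x) = 0}"
      using AE_completion[OF ae] by eventually_elim (use t in \<open>auto simp: max_def\<close>)
  qed (use t in auto)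
  then show ?thesis using t by (simp add: max_def)
qed

section \<open>The kernel as a mixture of exponentials and its relaxation equation\<close>

context stieltjes_kernel begin

lemma sigma_finite_\<sigma>: "sigma_finite_measure \<sigma>"
proof
  have "(\<Union>n. {0<..real n}) = {0<..}" using real_arch_simple by auto
  then show "\<exists>A. countable A \<and> A \<subseteq> sets \<sigma> \<and> \<Union> A = space \<sigma> \<and> (\<forall>a\<in>A. emeasure \<sigma> a \<noteq> \<infinity>)"
    using emeasure_bounded_interval[of 0]
    by (intro exI[of _ "range (\<lambda>n. {0<..real n})"])
      (auto simp: space_\<sigma> sets_\<sigma> sets_restrict_space_iff less_top)
qed

text \<open>The completely monotone representative of the kernel, built from \<open>\<sigma>\<close>
  alone; its agreement with \<open>k\<close> almost everywhere is the content of
  \<open>admissible_caputo_kernel\<close>.\<close>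

definition kap :: "real \<Rightarrow> real" where "kap t = (LINT r|\<sigma>. exp (- r * t))"

lemma kap_integrand_bound:
  fixes t r :: real
  assumes t: "t > 0" and r: "r > 0"
  shows "exp (- r * t) \<le> (1 + 1 / (exp 1 * t)) / (1 + r)"
    and "r * exp (- r * t) \<le> (1 / (exp 1 * t) + (2 / (exp 1 * t))\<^sup>2) / (1 + r)"
proof -
  have 1: "r * exp (- r * t) \<le> 1 / (exp 1 * t)" using power_exp_neg_le[of r t 1] t r by simp
  have 2: "r\<^sup>2 * exp (- r * t) \<le> (2 / (exp 1 * t))\<^sup>2" using power_exp_neg_le[of r t 2] t r by simp
  have 0: "exp (- r * t) \<le> 1" using t r by simp
  have "(1 + r) * exp (- r * t) \<le> 1 + 1 / (exp 1 * t)" unfolding distrib_right using add_mono[OF 0 1] by (simp only: mult_1_left)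
  then show "exp (- r * t) \<le> (1 + 1 / (exp 1 * t)) / (1 + r)" using r by (simp add: pos_le_divide_eq mult.commute)
  have "(1 + r) * (r * exp (- r * t)) = r * exp (- r * t) + r\<^sup>2 * exp (- r * t)" by (simp add: algebra_simps power2_eq_square)
  then have "(1 + r) * (r * exp (- r * t)) \<le> 1 / (exp 1 * t) + (2 / (exp 1 * t))\<^sup>2" using 1 2 by simp
  then show "r * exp (- r * t) \<le> (1 / (exp 1 * t) + (2 / (exp 1 * t))\<^sup>2) / (1 + r)" using r by (simp add: pos_le_divide_eq mult.commute)
qed

lemma kap_integrable:
  assumes t: "t > 0" shows "integrable \<sigma> (\<lambda>r. exp (- r * t))"
proof (rule integrable_dominated)
  show "\<bar>exp (- r * t)\<bar> \<le> (1 + 1 / (exp 1 * t)) / (1 + r)" if "r > 0" for r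
    using kap_integrand_bound(1)[OF t that] by simp
qed measurable

lemma kap_nonneg: "kap t \<ge> 0" unfolding kap_def by simp

lemma kap_measurable [measurable]: "kap \<in> borel_measurable borel"
proof -
  interpret sigma_finite_measure \<sigma> by (rule sigma_finite_\<sigma>)
  have [measurable]: "(\<lambda>r. r) \<in> borel_measurable \<sigma>" by (intro measurable_\<sigma>) auto
  show ?thesis unfolding kap_def[abs_def] by measurable
qed

lemma kap_continuous: "continuous_on {0<..} kap"
proof -
  have "isCont kap t" if t: "t > 0" for t
  proof -
    have "((\<lambda>x. LINT r|\<sigma>. exp (- r * x)) has_real_derivative (LINT r|\<sigma>. - r * exp (- r * t))) (at t)"
    proof (rule DERIV_integral(1)[where e = "t / 2" and f' = "\<lambda>x r. - r * exp (- r * x)" and G = "\<lambda>r. r * exp (- r * (t / 2))"])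
      show "integrable \<sigma> (\<lambda>r. exp (- r * x))" if "\<bar>x - t\<bar> < t / 2" for x
        by (rule kap_integrable) (use half_ball[OF that t] in simp)
      have "0 < t / 2" using t by simp
      show "integrable \<sigma> (\<lambda>r. r * exp (- r * (t / 2)))"
      proof (rule integrable_dominated)
        show "\<bar>r * exp (- r * (t / 2))\<bar> \<le> (1 / (exp 1 * (t / 2)) + (2 / (exp 1 * (t / 2)))\<^sup>2) / (1 + r)" if "r > 0" for r
          using kap_integrand_bound(2)[OF \<open>0 < t / 2\<close> that] that by (simp add: abs_mult)
      qed measurable
      show "(\<lambda>r. - r * exp (- r * t)) \<in> borel_measurable \<sigma>" by (intro measurable_\<sigma>) measurable
      show "AE r in \<sigma>. \<forall>x. \<bar>x - t\<bar> < t / 2 \<longrightarrow> ((\<lambda>x. exp (- r * x)) has_real_derivative - r * exp (- r * x)) (at x)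
        \<and> \<bar>- r * exp (- r * x)\<bar> \<le> r * exp (- r * (t / 2))"
      proof (intro AE_I2 allI impI conjI)
        fix r x assume "r \<in> space \<sigma>" and x: "\<bar>x - t\<bar> < t / 2"
        then have r: "r > 0" by (simp add: space_\<sigma>)
        show "((\<lambda>x. exp (- r * x)) has_real_derivative - r * exp (- r * x)) (at x)"
          by (auto intro!: derivative_eq_intros)
        have "exp (- r * x) \<le> exp (- r * (t / 2))"
          using half_ball[OF x t] r by (subst exp_le_cancel_iff) (simp add: mult_left_mono)
        then show "\<bar>- r * exp (- r * x)\<bar> \<le> r * exp (- r * (t / 2))"
          using r by (simp only: abs_mult abs_minus abs_of_pos abs_exp_cancel mult_left_mono less_imp_le)
      qed
    qed (use t in auto)
    then show ?thesis unfolding kap_def[abs_def] by (rule DERIV_isCont)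
  qed
  then show ?thesis by (intro continuous_at_imp_continuous_on) auto
qed

lemma lap_kap: "s > 0 \<Longrightarrow> lap kap s = ennreal (g s)"
  unfolding kap_def[abs_def] g_eq
proof (rule lap_mixture[OF sigma_finite_\<sigma>])
  show "integrable \<sigma> (\<lambda>r. exp (- r * t))" if "t > 0" for t by (rule kap_integrable[OF that])
qed (auto intro!: measurable_\<sigma> AE_I2 resolvent_integrable simp: space_\<sigma>)

lemma lap_E:
  assumes l: "l \<ge> 0" and s: "s > 0"
  shows "lap (E l) s = ennreal (g s / (l + s * g s))"
proof -
  interpret real_distribution "\<nu> l" by (rule \<nu>(1)[OF l])
  have "lap (\<lambda>t. LINT r|\<nu> l. exp (- r * t)) s = ennreal (LINT r|\<nu> l. 1 / (s + r))"
    by (rule lap_mixture[OF sigma_finite_measure_axioms _ \<nu>(2)[OF l] E_integrable[OF l] s])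
      (use R_integrable[OF l s, of 1] in auto)
  then show ?thesis unfolding E_def[abs_def] by (simp only: \<nu>(3)[OF l s])
qed

lemma lap_one: "s > 0 \<Longrightarrow> lap (\<lambda>_. 1) s = ennreal (1 / s)"
  unfolding lap_def using nn_integral_exp[of s] by simp

text \<open>Finiteness of the Laplace transform at \<open>s = 1\<close> suffices, as exp (- t) \<ge>
  exp (- T) on (0, T).\<close>

lemma locint_kap: "locint kap"
  unfolding locint_def
proof (intro conjI allI kap_measurable)
  fix T :: real
  show "integrable lborel (\<lambda>t. indicator {0<..<T} t *\<^sub>R kap t)"
  proof (rule integrableI_nonneg)
    have "(\<integral>\<^sup>+t. ennreal (indicator {0<..<T} t *\<^sub>R kap t) \<partial>lborel)
      \<le> (\<integral>\<^sup>+t. ennreal (exp T) * (ennreal (kap t * exp (- t * 1)) * indicator {0<..} t) \<partial>lborel)"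
    proof (rule nn_integral_mono)
      fix t
      have "kap t \<le> exp T * (kap t * exp (- t * 1))" if "t < T"
      proof -
        have "1 \<le> exp (T - t)" using that by simp
        then have "kap t * 1 \<le> kap t * exp (T - t)" by (rule mult_left_mono) (rule kap_nonneg)
        then show ?thesis by (simp add: exp_diff exp_minus field_simps)
      qed
      then show "ennreal (indicator {0<..<T} t *\<^sub>R kap t) \<le> ennreal (exp T) * (ennreal (kap t * exp (- t * 1)) * indicator {0<..} t)"
        by (auto split: split_indicator intro!: ennreal_leI simp: kap_nonneg simp flip: ennreal_mult)
    qed
    also have "\<dots> = ennreal (exp T) * lap kap 1" unfolding lap_def by (rule nn_integral_cmult) measurable
    also have "\<dots> < \<infinity>" by (simp add: lap_kap ennreal_mult_less_top)
    finally show "(\<integral>\<^sup>+t. ennreal (indicator {0<..<T} t *\<^sub>R kap t) \<partial>lborel) < \<infinity>" .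
  qed (auto simp: kap_nonneg)
qed

lemma locint_E: "l \<ge> 0 \<Longrightarrow> locint (E l)"
  by (rule locint_boundedI) (auto intro!: exI[of _ 1] simp: E_nonneg E_le_1)

lemma cv_kap_E_integrable:
  assumes l: "l \<ge> 0"
  shows "integrable lborel (\<lambda>\<tau>. indicator {0<..<t} \<tau> *\<^sub>R (E l (t - \<tau>) * kap \<tau>))"
  by (rule cv_integrable(1)[OF locint_kap E_measurable[OF l], where C = 1]) (auto simp: E_nonneg E_le_1 l)

text \<open>Both sides have the same Laplace transform: with H = g / (l + s g), the left side gives
  g H + l H / s = H (l + s g) / s = g / s. Uniqueness of transforms gives equality almost
  everywhere, and continuity of the three convolutions gives it at every
  \<open>t > 0\<close>.\<close>

lemma E_equation:
  assumes l: "l \<ge> 0" and t: "t > 0"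
  shows "cv kap (E l) t + l * cv (\<lambda>_. 1) (E l) t = cv (\<lambda>_. 1) kap t"
proof -
  note Em [measurable] = E_measurable[OF l, of 0]
  define F where "F t = cv (E l) kap t + l * cv (\<lambda>_. 1) (E l) t - cv (\<lambda>_. 1) kap t" for t
  have i2: "integrable lborel (\<lambda>\<tau>. indicator {0<..<t} \<tau> *\<^sub>R ((\<lambda>_. 1) (t - \<tau>) * E l \<tau>))" for t
    using locint_E[OF l] by (simp add: locint_def)
  have i3: "integrable lborel (\<lambda>\<tau>. indicator {0<..<t} \<tau> *\<^sub>R ((\<lambda>_. 1) (t - \<tau>) * kap \<tau>))" for t
    using locint_kap by (simp add: locint_def)
  have "AE t in lborel. t > 0 \<longrightarrow> F t = 0"
  proof (rule laplace_transform_zero_imp_AE)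
    fix s :: real assume s: "s > 0"
    have lgp: "l + s * g s > 0" using l mult_pos_pos[OF s g_pos[OF s]] by simp
    have eq: "indicator {0<..} t * (F t * exp (- t * s))
       = indicator {0<..} t * (cv (E l) kap t * exp (- t * s)) + l * (indicator {0<..} t * (cv (\<lambda>_. 1) (E l) t * exp (- t * s)))
         - indicator {0<..} t * (cv (\<lambda>_. 1) kap t * exp (- t * s))" for t
      unfolding F_def by (simp add: algebra_simps)
    have q0: "0 \<le> g s / (l + s * g s)" using g_pos[OF s] lgp by (auto intro: divide_nonneg_pos)
    note c1 = cv_laplace[OF Em kap_measurable E_nonneg kap_nonneg cv_kap_E_integrable[OF l] lap_E[OF l s] lap_kap[OF s] q0 g_nonneg[OF s]]
    have one: "0 \<le> 1 / s" using s by simp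
    note c2 = cv_laplace[OF borel_measurable_const Em _ E_nonneg i2 lap_one[OF s] lap_E[OF l s] one q0]
    note c3 = cv_laplace[OF borel_measurable_const kap_measurable _ kap_nonneg i3 lap_one[OF s] lap_kap[OF s] one g_nonneg[OF s]]
    show "integrable lborel (\<lambda>t. indicator {0<..} t * (F t * exp (- t * s)))"
      unfolding eq by (intro Bochner_Integration.integrable_add Bochner_Integration.integrable_diff integrable_mult_right c1(1) c2(1) c3(1)) auto
    have "(LINT t|lborel. indicator {0<..} t * (F t * exp (- t * s)))
      = g s / (l + s * g s) * g s + l * (1 / s * (g s / (l + s * g s))) - 1 / s * g s"
      unfolding eq using c1 c2 c3 by simp
    also have "\<dots> = g s / (l + s * g s) * (g s + l * (1 / s)) - 1 / s * g s"
    proof -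
      have "q * u + l * (1 / s * q) - x = q * (u + l * (1 / s)) - x" for q u x :: real by (simp add: algebra_simps)
      then show ?thesis .
    qed
    also have "g s + l * (1 / s) = (l + s * g s) / s" using s by (simp add: field_simps)
    also have "g s / (l + s * g s) * ((l + s * g s) / s) - 1 / s * g s = 0" using lgp by simp
    finally show "(LINT t|lborel. indicator {0<..} t * (F t * exp (- t * s))) = 0" .
  qed
  moreover have "continuous_on {0<..} F"
  proof -
    have "F = (\<lambda>t. cv kap (E l) t + l * cv (E l) (\<lambda>_. 1) t - cv kap (\<lambda>_. 1) t)"
      by (rule ext) (simp only: F_def cv_commute[of "E l" kap] cv_commute[of "\<lambda>_. 1" kap] cv_commute[of "\<lambda>_. 1" "E l"])
    then show ?thesis by (simp only:) (intro continuous_intros cv_continuous[OF locint_kap E_continuous[OF l] Em]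
        cv_continuous[OF locint_E[OF l] continuous_on_const] cv_continuous[OF locint_kap continuous_on_const], auto)
  qed
  ultimately have "F t = 0" using t continuous_AE_zero by blast
  then show ?thesis by (simp add: F_def cv_commute[of "E l" kap])
qed

text \<open>If the mass vanished, \<open>kap\<close> would be 0 at some positive time; its integrand
  being strictly positive, \<open>\<sigma>\<close> would be the null measure, contrary to g(1) > 0.
  This allows the division by the mass in the decay estimate.\<close>

lemma kap_mass_pos:
  assumes t: "t > 0"
  shows "cv (\<lambda>_. 1) kap t > 0"
proof (rule ccontr)
  assume "\<not> cv (\<lambda>_. 1) kap t > 0"
  then have "cv (\<lambda>_. 1) kap t = 0" using cv_nonneg[of "\<lambda>_. 1" kap t] kap_nonneg by force
  then have "(LINT \<tau>|lborel. indicator {0<..<t} \<tau> *\<^sub>R kap \<tau>) = 0" by (simp add: cv_one)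
  then have "AE \<tau> in lborel. indicator {0<..<t} \<tau> *\<^sub>R kap \<tau> = 0"
    using locint_kap by (subst (asm) integral_nonneg_eq_0_iff_AE) (auto simp: kap_nonneg locint_def)
  then have "AE \<tau> in lborel. \<tau> \<notin> {0<..<t}"
  proof eventually_elim
    case (elim \<tau>)
    have "kap \<tau> \<noteq> 0" if \<tau>: "\<tau> > 0"
    proof
      assume "kap \<tau> = 0"
      then have "AE r in \<sigma>. exp (- r * \<tau>) = 0"
        unfolding kap_def by (subst (asm) integral_nonneg_eq_0_iff_AE[OF kap_integrable[OF \<tau>]]) auto
      then have "AE r in \<sigma>. 1 / (1 + r) = 0" by eventually_elim simp
      then have "g 1 = (LINT r|\<sigma>. 0)" unfolding g_eq[OF zero_less_one] by (rule integral_cong_AE[rotated 2]) (auto intro!: measurable_\<sigma>)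
      then show False using g_pos[of 1] by simp
    qed
    then show ?case using elim by auto
  qed
  then have "emeasure lborel {0<..<t} = 0" by (subst (asm) AE_iff_measurable[of "{0<..<t}"]) auto
  then show False using t by simp
qed

text \<open>Since \<open>E l\<close> is nonincreasing, both convolutions in the relaxation equation are bounded below by \<open>E l t\<close>
  times the mass of their kernel.\<close>

lemma E_decay:
  assumes l: "l \<ge> 0" and t: "t > 0"
  shows "E l t \<le> 1 / (1 + (t / cv (\<lambda>_. 1) kap t) * l)"
proof -
  let ?K = "cv (\<lambda>_. 1) kap t"
  note K = kap_mass_pos[OF t]
  have "E l t * ?K = (LINT \<tau>|lborel. indicator {0<..<t} \<tau> *\<^sub>R (E l t * kap \<tau>))"
    unfolding cv_one by (subst integral_mult_right_zero[symmetric]) (simp add: ac_simps)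
  also have "\<dots> \<le> cv (E l) kap t"
    unfolding cv_def
  proof (rule integral_mono[OF _ cv_kap_E_integrable[OF l]])
    show "integrable lborel (\<lambda>\<tau>. indicator {0<..<t} \<tau> *\<^sub>R (E l t * kap \<tau>))"
    proof -
      have "integrable lborel (\<lambda>\<tau>. E l t * (indicator {0<..<t} \<tau> *\<^sub>R kap \<tau>))"
        by (rule integrable_mult_right) (use locint_kap in \<open>simp add: locint_def\<close>)
      then show ?thesis by (simp add: ac_simps)
    qed
    show "indicator {0<..<t} \<tau> *\<^sub>R (E l t * kap \<tau>) \<le> indicator {0<..<t} \<tau> *\<^sub>R (E l (t - \<tau>) * kap \<tau>)" for \<tau>
      using E_antimono[OF l, of "t - \<tau>" t] kap_nonneg[of \<tau>] by (auto intro!: mult_right_mono split: split_indicator)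
  qed
  finally have 1: "E l t * ?K \<le> cv kap (E l) t" by (simp add: cv_commute[of kap])
  have "E l t * t = (LINT \<tau>|lborel. indicator {0<..<t} \<tau> *\<^sub>R E l t)" using t by simp
  also have "\<dots> \<le> cv (\<lambda>_. 1) (E l) t"
    unfolding cv_one
  proof (rule integral_mono)
    show "integrable lborel (\<lambda>\<tau>. indicator {0<..<t} \<tau> *\<^sub>R E l \<tau>)" using locint_E[OF l] by (simp add: locint_def)
    show "integrable lborel (\<lambda>\<tau>. indicator {0<..<t} \<tau> *\<^sub>R E l t)" using t by simp
    show "indicator {0<..<t} \<tau> *\<^sub>R E l t \<le> indicator {0<..<t} \<tau> *\<^sub>R E l \<tau>" for \<tau>
      using E_antimono[OF l, of \<tau> t] by (auto split: split_indicator)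
  qed
  finally have "E l t * ?K + l * (E l t * t) \<le> ?K"
    using 1 E_equation[OF l t] mult_left_mono[of "E l t * t" "cv (\<lambda>_. 1) (E l) t" l] l by linarith
  then have "E l t * (?K + l * t) \<le> ?K" by (simp add: algebra_simps)
  moreover have "?K + l * t > 0" using K l t by (simp add: add_pos_nonneg)
  ultimately have "E l t \<le> ?K / (?K + l * t)" by (simp add: pos_le_divide_eq)
  also have "\<dots> = 1 / (1 + (t / ?K) * l)" using K by (simp add: field_simps)
  finally show ?thesis .
qed

section \<open>The complex-valued relaxation equation and uniqueness\<close>

abbreviation "ckap \<equiv> \<lambda>t. complex_of_real (kap t)"

lemma cv_of_real: "cv (\<lambda>t. complex_of_real (f t)) (\<lambda>t. complex_of_real (h t)) t = complex_of_real (cv f h t)"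
  unfolding cv_def by (subst integral_complex_of_real[symmetric]) (simp add: scaleR_conv_of_real)

lemma locint_of_real: "locint f \<Longrightarrow> locint (\<lambda>t. complex_of_real (f t))"
proof -
  assume f: "locint f"
  then have "(\<lambda>t. complex_of_real (f t)) \<in> borel_measurable borel" by (auto simp: locint_def intro: borel_measurable_of_real)
  moreover have "integrable lborel (\<lambda>t. complex_of_real (indicator {0<..<T} t *\<^sub>R f t))" for T
    by (rule integrable_of_real) (use f in \<open>simp add: locint_def\<close>)
  ultimately show "locint (\<lambda>t. complex_of_real (f t))" by (simp add: locint_def scaleR_conv_of_real)
qed

lemma E_equation_complex:
  assumes l: "l \<ge> 0" and t: "t > 0"
  shows "cv ckap (\<lambda>t. complex_of_real (E l t)) t = cv (\<lambda>_. 1) ckap t - l * cv (\<lambda>_. 1) (\<lambda>t. complex_of_real (E l t)) t"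
proof -
  have "cv ckap (\<lambda>t. complex_of_real (E l t)) t = complex_of_real (cv kap (E l) t)" by (rule cv_of_real)
  also have "cv kap (E l) t = cv (\<lambda>_. 1) kap t - l * cv (\<lambda>_. 1) (E l) t" using E_equation[OF l t] by simp
  also have "complex_of_real \<dots> = complex_of_real (cv (\<lambda>_. 1) kap t) - l * complex_of_real (cv (\<lambda>_. 1) (E l) t)" by simp
  also have "complex_of_real (cv (\<lambda>_. 1) kap t) = cv (\<lambda>_. 1) ckap t" using cv_of_real[of "\<lambda>_. 1" kap t] by simp
  also have "complex_of_real (cv (\<lambda>_. 1) (E l) t) = cv (\<lambda>_. 1) (\<lambda>t. complex_of_real (E l t)) t" using cv_of_real[of "\<lambda>_. 1" "E l" t] by simp
  finally show ?thesis .
qed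

text \<open>The relaxation equation exhibits the convolution of the kernel with \<open>E l\<close>
  as a combination of antiderivatives of continuous functions, so it is differentiable at every
  \<open>t > 0\<close> although the kernel may be singular at 0.\<close>

lemma E_caputo:
  assumes l: "l \<ge> 0" and t: "t > 0"
  shows "(cv ckap (\<lambda>t. complex_of_real (E l t)) has_vector_derivative complex_of_real (kap t - l * E l t)) (at t)"
proof -
  have "((\<lambda>t. cv (\<lambda>_. 1) ckap t - l * cv (\<lambda>_. 1) (\<lambda>t. complex_of_real (E l t)) t) has_vector_derivative ckap t - l * complex_of_real (E l t)) (at t)"
    by (intro has_vector_derivative_diff has_vector_derivative_mult_right cv_one_deriv locint_of_real locint_kap locint_E l t
        continuous_on_of_real kap_continuous continuous_on_subset[OF E_continuous[OF l]]) auto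
  then have "((\<lambda>t. cv (\<lambda>_. 1) ckap t - l * cv (\<lambda>_. 1) (\<lambda>t. complex_of_real (E l t)) t) has_vector_derivative complex_of_real (kap t - l * E l t)) (at t)"
    by simp
  then show ?thesis
    by (rule has_vector_derivative_transform_within_open[where S = "{0<..}"]) (use t E_equation_complex[OF l] in auto)
qed

lemma caputo_uniqueness:
  assumes l: "l > 0" and W: "continuous_on UNIV W" and W0: "W 0 = 0"
    and deriv: "\<And>t. t > 0 \<Longrightarrow> (cv ckap W has_vector_derivative - (complex_of_real l * W t)) (at t)"
    and t: "t > 0"
  shows "W t = 0"
proof -
  have K: "locint ckap" by (intro locint_of_real locint_kap)
  have Wl: "locint W" by (rule locint_continuous[OF W])
  have [measurable]: "W \<in> borel_measurable borel" using Wl by (simp add: locint_def)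
  have Wbd: "\<exists>C. \<forall>x. 0 \<le> x \<longrightarrow> x \<le> T \<longrightarrow> norm (W x) \<le> C" for T
  proof -
    have "compact (W ` {0..T})" by (intro compact_continuous_image continuous_on_subset[OF W]) auto
    then have "bounded (W ` {0..T})" by (rule compact_imp_bounded)
    then obtain C where "\<forall>y\<in>W ` {0..T}. norm y \<le> C" by (auto simp: bounded_iff)
    then show ?thesis by (intro exI[of _ C]) auto
  qed
  \<comment> \<open>The hypothesis in integrated form. The combination \<open>?D\<close> has
    derivative 0 on the open half-line, and its constant value is 0 because both convolutions tend
    to 0 at the origin, \<open>W\<close> being bounded there.\<close>
  have eq1: "cv ckap W t = - (complex_of_real l * cv (\<lambda>_. 1) W t)" if t: "t > 0" for t
  proof -
    let ?D = "\<lambda>t. cv ckap W t + complex_of_real l * cv (\<lambda>_. 1) W t"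
    have d: "(?D has_vector_derivative 0) (at x)" if "x > 0" for x
    proof -
      have "(?D has_vector_derivative - (complex_of_real l * W x) + complex_of_real l * W x) (at x)"
        by (intro has_vector_derivative_add has_vector_derivative_mult_right deriv cv_one_deriv Wl continuous_on_subset[OF W] that) auto
      then show ?thesis by simp
    qed
    obtain c where c: "\<And>x. x \<in> {0<..} \<Longrightarrow> ?D x = c"
      by (rule has_vector_derivative_zero_constant[of "{0<..}" ?D]) (auto intro: has_vector_derivative_at_within d)
    obtain C where C: "\<And>x. 0 \<le> x \<Longrightarrow> x \<le> 1 \<Longrightarrow> norm (W x) \<le> C" using Wbd by blast
    have small: "(\<lambda>n. LINT \<tau>|lborel. indicator {0<..<1 / real (Suc n)} \<tau> * p \<tau>) \<longlonglongrightarrow> 0"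
      if p: "locint p" "\<And>t. p t \<ge> 0" for p :: "real \<Rightarrow> real"
    proof -
      have [measurable]: "p \<in> borel_measurable borel" using p by (simp add: locint_def)
      have "(\<lambda>n. LINT \<tau>|lborel. indicator {0<..<1 / real (Suc n)} \<tau> * p \<tau>) \<longlonglongrightarrow> (LINT \<tau>::real|lborel. (0::real))"
      proof (rule integral_dominated_convergence[where w = "\<lambda>\<tau>. indicator {0<..<1} \<tau> *\<^sub>R p \<tau>"])
        show "integrable lborel (\<lambda>\<tau>. indicator {0<..<1} \<tau> *\<^sub>R p \<tau>)" using p by (simp add: locint_def)
        show "AE \<tau> in lborel. (\<lambda>n. indicator {0<..<1 / real (Suc n)} \<tau> * p \<tau>) \<longlonglongrightarrow> 0"
        proof (rule AE_I2, rule tendsto_eventually)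
          fix \<tau> :: real
          show "\<forall>\<^sub>F n in sequentially. indicator {0<..<1 / real (Suc n)} \<tau> * p \<tau> = 0"
          proof (cases "\<tau> > 0")
            case True
            have "\<forall>\<^sub>F n in sequentially. 1 / real (Suc n) < \<tau>"
              using order_tendstoD(2)[OF LIMSEQ_Suc[OF lim_1_over_n] True] .
            then show ?thesis by eventually_elim (auto split: split_indicator)
          qed auto
        qed
        have le1: "1 / real (Suc n) \<le> 1" for n by simp
        show "AE \<tau> in lborel. norm (indicator {0<..<1 / real (Suc n)} \<tau> * p \<tau>) \<le> indicator {0<..<1} \<tau> *\<^sub>R p \<tau>" for n
        proof (rule AE_I2)
          fix \<tau>
          have "\<tau> < 1 / real (Suc n) \<Longrightarrow> \<tau> < 1" using le1[of n] by linarith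
          then show "norm (indicator {0<..<1 / real (Suc n)} \<tau> * p \<tau>) \<le> indicator {0<..<1} \<tau> *\<^sub>R p \<tau>"
            using p(2)[of \<tau>] by (auto split: split_indicator simp del: of_nat_Suc)
        qed
      qed measurable
      then show ?thesis by simp
    qed
    have le1: "0 < 1 / real (Suc n)" "1 / real (Suc n) \<le> 1" for n by simp_all
    have cb: "norm c \<le> C * (LINT \<tau>|lborel. indicator {0<..<1 / real (Suc n)} \<tau> * kap \<tau>) + l * (C * (LINT \<tau>|lborel. indicator {0<..<1 / real (Suc n)} \<tau> * 1))" for n
    proof -
      let ?x = "1 / real (Suc n)"
      have 1: "norm (cv ckap W ?x) \<le> C * (LINT \<tau>|lborel. indicator {0<..<?x} \<tau> * kap \<tau>)"
        using cv_integrable(2)[OF K, of W ?x C] C le1[of n] unfolding cv_commute[of ckap]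
        by (simp add: kap_nonneg del: of_nat_Suc)
      have 2: "norm (cv (\<lambda>_. 1) W ?x) \<le> C * (LINT \<tau>|lborel. indicator {0<..<?x} \<tau> * 1)"
        using cv_integrable(2)[OF locint_const[of "1::complex"], of W ?x C] C le1[of n] unfolding cv_commute[of "\<lambda>_. 1"]
        by (simp del: of_nat_Suc)
      have "c = ?D ?x" using c le1[of n] by simp
      then have "norm c \<le> norm (cv ckap W ?x) + l * norm (cv (\<lambda>_. 1) W ?x)"
        using norm_triangle_ineq[of "cv ckap W ?x" "complex_of_real l * cv (\<lambda>_. 1) W ?x"] l by (simp add: norm_mult)
      also have "\<dots> \<le> C * (LINT \<tau>|lborel. indicator {0<..<?x} \<tau> * kap \<tau>) + l * (C * (LINT \<tau>|lborel. indicator {0<..<?x} \<tau> * 1))"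
        using 1 2 l by (intro add_mono mult_left_mono) auto
      finally show ?thesis .
    qed
    have "(\<lambda>n. C * (LINT \<tau>|lborel. indicator {0<..<1 / real (Suc n)} \<tau> * kap \<tau>) + l * (C * (LINT \<tau>|lborel. indicator {0<..<1 / real (Suc n)} \<tau> * 1))) \<longlonglongrightarrow> C * 0 + l * (C * 0)"
      by (intro tendsto_add tendsto_mult tendsto_const small locint_kap kap_nonneg locint_const) auto
    then have "norm c \<le> C * 0 + l * (C * 0)" by (rule LIMSEQ_le_const) (use cb in auto)
    then have "?D t = 0" using c[of t] t by simp
    then show ?thesis by (simp add: add_eq_0_iff2)
  qed
  \<comment> \<open>Constant continuation to negative times gives the continuity on the line that
    \<open>cv_assoc\<close> asks for, and changes no convolution.\<close>
  define e where "e t = complex_of_real (E l (max 0 t))" for t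
  have ec: "continuous_on UNIV e"
    unfolding e_def by (intro continuous_on_of_real continuous_on_compose2[OF E_continuous]) (use l in \<open>auto intro!: continuous_intros\<close>)
  have el: "locint e" by (rule locint_continuous[OF ec])
  have eE: "cv f e s = cv f (\<lambda>t. complex_of_real (E l t)) s" for f s
    by (rule cv_cong) (auto simp: e_def)
  \<comment> \<open>The triple convolution of \<open>W\<close>, kernel and \<open>e\<close> is
    computed twice: by exchanging factors and using \<open>eq1\<close>, and by inserting the
    relaxation equation. The terms with \<open>l\<close> cancel and the remaining one must
    vanish.\<close>
  have zero: "cv (\<lambda>_. 1) (cv ckap W) s = 0" if s: "s > 0" for s
  proof -
    let ?l = "complex_of_real l"
    have 1: "cv W (cv ckap e) s = - ?l * cv W (cv (\<lambda>_. 1) e) s"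
    proof -
      have "cv W (cv ckap e) s = cv e (cv ckap W) s" by (rule cv_assoc[OF K W ec])
      also have "\<dots> = cv e (\<lambda>\<tau>. - ?l * cv (\<lambda>_. 1) W \<tau>) s" by (rule cv_cong) (auto simp: eq1)
      also have "\<dots> = - ?l * cv e (cv (\<lambda>_. 1) W) s"
        unfolding cv_def[of e] by (subst integral_mult_right_zero[symmetric]) (simp add: ac_simps scaleR_conv_of_real)
      also have "cv e (cv (\<lambda>_. 1) W) s = cv W (cv (\<lambda>_. 1) e) s" by (rule cv_assoc[OF locint_const ec W])
      finally show ?thesis .
    qed
    obtain C where C: "\<And>x. 0 < x \<Longrightarrow> x < s \<Longrightarrow> norm (W x) \<le> C" using Wbd[of s] by (meson less_imp_le)
    have i1: "integrable lborel (\<lambda>\<tau>. indicator {0<..<s} \<tau> *\<^sub>R (W (s - \<tau>) * cv (\<lambda>_. 1) ckap \<tau>))"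
      by (rule cv_integrable(1)[OF locint_cv_one[OF K] _ C]) auto
    have i2: "integrable lborel (\<lambda>\<tau>. indicator {0<..<s} \<tau> *\<^sub>R (W (s - \<tau>) * cv (\<lambda>_. 1) e \<tau>))"
      by (rule cv_integrable(1)[OF locint_cv_one[OF el] _ C]) auto
    have "cv W (cv ckap e) s = cv W (\<lambda>\<tau>. cv (\<lambda>_. 1) ckap \<tau> - ?l * cv (\<lambda>_. 1) e \<tau>) s"
      by (rule cv_cong) (use E_equation_complex l in \<open>auto simp: eE\<close>)
    also have "\<dots> = (LINT \<tau>|lborel. indicator {0<..<s} \<tau> *\<^sub>R (W (s - \<tau>) * cv (\<lambda>_. 1) ckap \<tau>) - ?l * (indicator {0<..<s} \<tau> *\<^sub>R (W (s - \<tau>) * cv (\<lambda>_. 1) e \<tau>)))"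
      unfolding cv_def[of W] by (intro Bochner_Integration.integral_cong) (auto simp: algebra_simps scaleR_conv_of_real)
    also have "\<dots> = cv W (cv (\<lambda>_. 1) ckap) s - ?l * cv W (cv (\<lambda>_. 1) e) s"
      unfolding cv_def[of W]
      by (simp only: Bochner_Integration.integral_diff[OF i1 integrable_mult_right[OF i2]] integral_mult_right_zero)
    finally have "cv W (cv (\<lambda>_. 1) ckap) s = 0" using 1 by simp
    moreover have "cv (\<lambda>_. 1) ckap = cv ckap (\<lambda>_. 1)" by (rule ext) (rule cv_commute)
    moreover have "cv W (cv ckap (\<lambda>_. 1)) s = cv (\<lambda>_. 1) (cv ckap W) s" by (rule cv_assoc[OF K W continuous_on_const])
    ultimately show ?thesis by simp
  qed
  \<comment> \<open>By \<open>eq1\<close> the double integral of \<open>W\<close> vanishes; one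
    differentiation gives that its simple integral does, and \<open>eq1\<close> leads back to the
    kernel. The last differentiation, of \<open>cv ckap W\<close>, is supplied by the hypothesis
    \<open>deriv\<close>.\<close>
  have KW0: "cv ckap W s = 0" if s: "s > 0" for s
  proof -
    have "cv (\<lambda>_. 1) (cv (\<lambda>_. 1) W) x = 0" if "x > 0" for x
    proof -
      have "cv (\<lambda>_. 1) (cv ckap W) x = cv (\<lambda>_. 1) (\<lambda>\<tau>. - complex_of_real l * cv (\<lambda>_. 1) W \<tau>) x" by (rule cv_cong) (auto simp: eq1)
      also have "\<dots> = - complex_of_real l * cv (\<lambda>_. 1) (cv (\<lambda>_. 1) W) x"
        unfolding cv_one[of "\<lambda>\<tau>. - complex_of_real l * cv (\<lambda>_. 1) W \<tau>"] cv_one[of "cv (\<lambda>_. 1) W"]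
        by (subst integral_mult_right_zero[symmetric]) (simp add: ac_simps scaleR_conv_of_real)
      finally show ?thesis using zero[OF that] l by simp
    qed
    note z = this
    have "continuous_on {0<..} (cv (\<lambda>_. 1) W)"
    proof -
      have "continuous_on {0<..} (cv W (\<lambda>_. 1))" by (rule cv_continuous[OF Wl continuous_on_const]) auto
      moreover have "cv (\<lambda>_. 1) W = cv W (\<lambda>_. 1)" by (rule ext) (rule cv_commute)
      ultimately show "continuous_on {0<..} (cv (\<lambda>_. 1) W)" by simp
    qed
    from cv_one_deriv[OF locint_cv_one[OF Wl] this s]
    have "((\<lambda>x. 0::complex) has_vector_derivative cv (\<lambda>_. 1) W s) (at s)"
      by (rule has_vector_derivative_transform_within_open[where S = "{0<..}"]) (use s z in auto)
    from vector_derivative_unique_at[OF this has_vector_derivative_const] have "cv (\<lambda>_. 1) W s = 0" .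
    then show ?thesis using eq1[OF s] by simp
  qed
  have "((\<lambda>x. 0::complex) has_vector_derivative - (complex_of_real l * W t)) (at t)"
    using deriv[OF t] by (rule has_vector_derivative_transform_within_open[where S = "{0<..}"]) (use t KW0 in auto)
  from vector_derivative_unique_at[OF this has_vector_derivative_const] show ?thesis using l by simp
qed

end

text \<open>The Stieltjes integral is nonnegative, so b is at most the limit of the transform at
  infinity, and a at most the limit of s times the transform at 0; both limits are 0, by (C3) and
  (C4).\<close>

lemma admissible_stieltjes_kernel:
  assumes k: "admissible_kernel k"
  shows "\<exists>\<sigma>. stieltjes_kernel \<sigma> (laplace k)"
proof -
  have k': "(laplace k \<longlongrightarrow> 0) at_top" "filterlim (\<lambda>s. s * laplace k s) at_top at_top" "((\<lambda>s. s * laplace k s) \<longlongrightarrow> 0) (at_right 0)"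
    using k by (auto simp: admissible_kernel_def)
  obtain a b \<sigma> where ab: "a \<ge> 0" "b \<ge> 0" and \<sigma>: "sets \<sigma> = sets (restrict_space borel {0<..})" "integrable \<sigma> (\<lambda>r. 1 / (1 + r))"
    and eq: "\<And>s. s > 0 \<Longrightarrow> laplace k s = a / s + b + (LINT r|\<sigma>. 1 / (s + r))"
    using k unfolding admissible_kernel_def stieltjes_function_def by blast
  have sp: "space \<sigma> = {0<..}" using sets_eq_imp_space_eq[OF \<sigma>(1)] by (simp add: space_restrict_space)
  have nn: "(LINT r|\<sigma>. 1 / (s + r)) \<ge> 0" if "s > 0" for s
    using that by (intro integral_nonneg_AE AE_I2) (simp add: sp)
  have "b \<le> 0"
  proof (rule tendsto_lowerbound[OF k'(1)])
    show "\<forall>\<^sub>F s in at_top. b \<le> laplace k s"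
      using eventually_gt_at_top[of 0]
    proof eventually_elim
      case (elim s)
      then show ?case using eq[OF elim] nn[OF elim] ab by simp
    qed
  qed simp
  then have b: "b = 0" using ab by simp
  have "a \<le> 0"
  proof (rule tendsto_lowerbound[OF k'(3)])
    show "\<forall>\<^sub>F s in at_right 0. a \<le> s * laplace k s"
      using eventually_at_right_less[of 0]
    proof eventually_elim
      case (elim s)
      have "s * laplace k s = a + s * (LINT r|\<sigma>. 1 / (s + r))" using eq[OF elim] elim b by (simp add: distrib_left)
      then show ?case using nn[OF elim] elim by simp
    qed
  qed simp
  then have "a = 0" using ab by simp
  with b eq \<sigma> k'(2) have "stieltjes_kernel \<sigma> (laplace k)" by unfold_locales auto
  then show ?thesis by blast
qed

lemma (in stieltjes_kernel) kap_laplace: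
  assumes s: "s > 0"
  shows "integrable lborel (\<lambda>t. indicator {0<..} t * (kap t * exp (- t * s)))"
    "(LINT t|lborel. indicator {0<..} t * (kap t * exp (- t * s))) = g s"
proof -
  have nn: "(\<integral>\<^sup>+t. ennreal (indicator {0<..} t * (kap t * exp (- t * s))) \<partial>lborel) = ennreal (g s)"
    unfolding lap_kap[OF s, symmetric] lap_def by (intro nn_integral_cong) (auto split: split_indicator)
  show "integrable lborel (\<lambda>t. indicator {0<..} t * (kap t * exp (- t * s)))"
  proof (rule integrableI_nonneg)
    show "(\<integral>\<^sup>+t. ennreal (indicator {0<..} t * (kap t * exp (- t * s))) \<partial>lborel) < \<infinity>" unfolding nn by simp
  qed (auto simp: kap_nonneg)
  show "(LINT t|lborel. indicator {0<..} t * (kap t * exp (- t * s))) = g s"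
  proof (rule trans[OF integral_eq_nn_integral])
    show "enn2real (\<integral>\<^sup>+t. ennreal (indicator {0<..} t * (kap t * exp (- t * s))) \<partial>lborel) = g s"
      unfolding nn using g_nonneg[OF s] by simp
  qed (auto simp: kap_nonneg)
qed

locale caputo_kernel = stieltjes_kernel \<sigma> g for \<sigma> g +
  fixes k :: "real \<Rightarrow> real"
  assumes k_eq: "AE t in lebesgue. t > 0 \<longrightarrow> k t = kap t"

text \<open>Uniqueness of Laplace transforms, applied to a Borel version of \<open>k\<close>.
  Measurability is read off from the integrability of \<open>k\<close> times exp (- t); the Borel
  version \<open>f1\<close> is chosen for this product and the exponential is divided out in
  \<open>f\<close>.\<close>

lemma admissible_caputo_kernel:
  assumes k: "admissible_kernel k" and \<sigma>: "stieltjes_kernel \<sigma> (laplace k)"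
  shows "caputo_kernel \<sigma> (laplace k) k"
proof -
  interpret stieltjes_kernel \<sigma> "laplace k" by fact
  have kint: "integrable lebesgue (\<lambda>t. indicator {0<..} t *\<^sub>R (k t * exp (- t * s)))" if "s > 0" for s
    using k that by (simp add: admissible_kernel_def set_integrable_def)
  have "(\<lambda>t. indicator {0<..} t *\<^sub>R (k t * exp (- t * 1))) \<in> borel_measurable lebesgue"
    using kint[OF zero_less_one] by (rule borel_measurable_integrable)
  from completion_ex_borel_measurable_real[OF this]
  obtain f1 where f1: "f1 \<in> borel_measurable lborel"
    and ae1: "AE t in lborel. indicator {0<..} t *\<^sub>R (k t * exp (- t * 1)) = f1 t"
    by blast
  have [measurable]: "f1 \<in> borel_measurable borel" using f1 by simp
  define f where "f t = f1 t * exp t" for t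
  have [measurable]: "f \<in> borel_measurable borel" unfolding f_def by measurable
  have ae: "AE t in lebesgue. t > 0 \<longrightarrow> k t = f t"
    using AE_completion[OF ae1] by eventually_elim (auto simp: f_def exp_minus field_simps)
  have ae': "AE t in lebesgue. indicator {0<..} t *\<^sub>R (k t * exp (- t * s)) = indicator {0<..} t * (f t * exp (- t * s))" for s
    using ae by eventually_elim (auto split: split_indicator)
  have fm: "(\<lambda>t. indicator {0<..} t * (f t * exp (- t * s))) \<in> borel_measurable borel" for s by measurable
  have fml: "(\<lambda>t. indicator {0<..} t * (f t * exp (- t * s))) \<in> borel_measurable lebesgue" for s
    by (intro measurable_completion) (simp add: fm)
  have fi: "integrable lborel (\<lambda>t. indicator {0<..} t * (f t * exp (- t * s)))" if s: "s > 0" for s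
  proof -
    have "integrable lebesgue (\<lambda>t. indicator {0<..} t * (f t * exp (- t * s)))"
      using kint[OF s] by (rule Bochner_Integration.integrable_cong_AE[THEN iffD1, rotated 3]) (use kint[OF s] fml ae' in auto)
    then show ?thesis using fm by (subst (asm) integrable_completion) auto
  qed
  have fl: "(LINT t|lborel. indicator {0<..} t * (f t * exp (- t * s))) = laplace k s" if s: "s > 0" for s
  proof -
    have "laplace k s = (LINT t|lebesgue. indicator {0<..} t * (f t * exp (- t * s)))"
      unfolding laplace_def set_lebesgue_integral_def using kint[OF s] fml ae' by (intro integral_cong_AE) auto
    then show ?thesis using fm by (simp add: integral_completion)
  qed
  have "AE t in lborel. t > 0 \<longrightarrow> f t - kap t = 0"
  proof (rule laplace_transform_zero_imp_AE)
    fix s :: real assume s: "s > 0"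
    have eq: "indicator {0<..} t * ((f t - kap t) * exp (- t * s)) = indicator {0<..} t * (f t * exp (- t * s)) - indicator {0<..} t * (kap t * exp (- t * s))" for t
      by (simp add: algebra_simps)
    show "integrable lborel (\<lambda>t. indicator {0<..} t * ((f t - kap t) * exp (- t * s)))"
      unfolding eq by (intro Bochner_Integration.integrable_diff fi kap_laplace s)
    show "(LINT t|lborel. indicator {0<..} t * ((f t - kap t) * exp (- t * s))) = 0"
      unfolding eq by (simp only: Bochner_Integration.integral_diff[OF fi[OF s] kap_laplace(1)[OF s]] fl[OF s] kap_laplace(2)[OF s])
  qed
  from AE_completion[OF this] have "AE t in lebesgue. t > 0 \<longrightarrow> k t = kap t"
    using ae by eventually_elim auto
  then show ?thesis by unfold_locales
qed

lemma integral_lebesgue_AE_borel: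
  fixes f h :: "real \<Rightarrow> 'b::euclidean_space"
  assumes h: "h \<in> borel_measurable borel" and ae: "AE x in lebesgue. f x = h x"
  shows "(LINT x|lebesgue. f x) = (LINT x|lborel. h x)"
proof -
  have hl: "h \<in> borel_measurable lebesgue" by (intro measurable_completion) (simp add: h)
  have "AE x in lebesgue. h x = f x" using ae by eventually_elim simp
  from borel_measurable_AE[OF hl this] have fl: "f \<in> borel_measurable lebesgue" .
  have "(LINT x|lebesgue. f x) = (LINT x|lebesgue. h x)" by (rule integral_cong_AE[OF fl hl ae])
  then show ?thesis using h by (simp add: integral_completion)
qed

context caputo_kernel begin

text \<open>The null set on which \<open>k\<close> and \<open>kap\<close> differ is reflected by
  \<tau> \<mapsto> t - \<tau> and stays null. Extending \<open>v\<close> by its value at 0 makes it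
  continuous on the line without affecting the integral.\<close>

lemma conv_eq_cv:
  assumes v: "continuous_on {0..} v"
  shows "conv k v t = cv ckap (\<lambda>\<tau>. v (max 0 \<tau>)) t"
proof -
  have vc: "continuous_on UNIV (\<lambda>\<tau>. v (max 0 \<tau>))"
    by (rule continuous_on_compose2[OF v]) (auto intro!: continuous_intros)
  have [measurable]: "(\<lambda>\<tau>. v (max 0 \<tau>)) \<in> borel_measurable borel" by (rule borel_measurable_continuous_onI[OF vc])
  have "AE t in lborel. t > 0 \<longrightarrow> k t = kap t" using k_eq by (simp add: AE_completion_iff)
  then obtain N where N: "{x \<in> space lborel. \<not> (x > 0 \<longrightarrow> k x = kap x)} \<subseteq> N" "emeasure lborel N = 0" "N \<in> sets lborel"
    by (rule AE_E)
  have "AE x in lborel. x \<notin> N" using N by (intro AE_not_in) auto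
  then have "AE x in lborel. t + - 1 * x \<notin> N" by (rule AE_borel_affine[rotated 2]) (use N in auto)
  then have N': "AE x in lebesgue. t - x \<notin> N" by (intro AE_completion) simp
  have kk: "k x = kap x" if "x \<notin> N" "x > 0" for x using N(1) that by auto
  from N' have "AE \<tau> in lebesgue. indicator {0<..<t} \<tau> *\<^sub>R (k (t - \<tau>) *\<^sub>R v \<tau>) = indicator {0<..<t} \<tau> *\<^sub>R (ckap (t - \<tau>) * v (max 0 \<tau>))"
    by eventually_elim (auto simp: scaleR_conv_of_real kk split: split_indicator)
  then show ?thesis unfolding conv_def set_lebesgue_integral_def cv_def
    by (intro integral_lebesgue_AE_borel) auto
qed

text \<open>For h < t the averages only see values on (0, \<infinity>), where \<open>k\<close> and
  the continuous \<open>kap\<close> agree almost everywhere.\<close>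

lemma lebesgue_value_kernel:
  assumes t: "t > 0"
  shows "lebesgue_value k t = kap t"
proof -
  have eq: "(LINT s:{t-h..t+h}|lebesgue. k s) = (LINT s:{t-h..t+h}|lebesgue. kap s)" if "h < t" for h
  proof -
    have m: "(\<lambda>s. indicator {t-h..t+h} s *\<^sub>R kap s) \<in> borel_measurable borel" by measurable
    have "(LINT s:{t-h..t+h}|lebesgue. k s) = (LINT s|lborel. indicator {t-h..t+h} s *\<^sub>R kap s)"
      unfolding set_lebesgue_integral_def
      by (rule integral_lebesgue_AE_borel[OF m]) (use k_eq in eventually_elim, use that in \<open>auto split: split_indicator\<close>)
    also have "\<dots> = (LINT s:{t-h..t+h}|lebesgue. kap s)"
      unfolding set_lebesgue_integral_def by (rule integral_lebesgue_AE_borel[OF m, symmetric]) simp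
    finally show ?thesis .
  qed
  have "\<forall>\<^sub>F h in at_right 0. h < t" using t by (auto simp: eventually_at_right_field)
  then have ev: "\<forall>\<^sub>F h in at_right 0. (LINT s:{t-h..t+h}|lebesgue. k s) / (2 * h) = (LINT s:{t-h..t+h}|lebesgue. kap s) / (2 * h)"
    by eventually_elim (simp add: eq)
  have "lebesgue_value k t = lebesgue_value kap t"
    unfolding lebesgue_value_def t2_space_class.Lim_def by (simp only: tendsto_cong[OF ev])
  then show ?thesis using lebesgue_value_continuous[OF kap_continuous t] by simp
qed

text \<open>As \<open>kap\<close> is nonnegative, its integral over (0, t) is the L^1 norm of
  \<open>k\<close> there.\<close>

lemma kernel_mass: "(LINT s:{0<..<t}|lebesgue. \<bar>k s\<bar>) = cv (\<lambda>_. 1) kap t"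
  unfolding cv_one set_lebesgue_integral_def
  by (rule integral_lebesgue_AE_borel) (measurable, use k_eq in eventually_elim, auto simp: kap_nonneg split: split_indicator)

lemma E_solves:
  assumes l: "l \<ge> 0" and t: "t > 0"
  shows "caputo_exists k (\<lambda>s. complex_of_real (E l s) * c) t"
    and "caputo k (\<lambda>s. complex_of_real (E l s) * c) t = - complex_of_real l * (complex_of_real (E l t) * c)"
proof -
  let ?v = "\<lambda>s. complex_of_real (E l s) * c"
  have cont: "continuous_on {0..} ?v" by (intro continuous_intros E_continuous l)
  have "conv k ?v x = cv ckap (\<lambda>t. complex_of_real (E l t)) x * c" for x
  proof -
    have "conv k ?v x = cv ckap ?v x" unfolding conv_eq_cv[OF cont] by (rule cv_cong) auto
    also have "\<dots> = (LINT \<tau>|lborel. (indicator {0<..<x} \<tau> *\<^sub>R (ckap (x - \<tau>) * complex_of_real (E l \<tau>))) * c)"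
      unfolding cv_def by (simp add: mult.assoc)
    also have "\<dots> = cv ckap (\<lambda>t. complex_of_real (E l t)) x * c" unfolding cv_def by (rule integral_mult_left_zero)
    finally show ?thesis .
  qed
  then have "conv k ?v = (\<lambda>x. cv ckap (\<lambda>t. complex_of_real (E l t)) x * c)" by (rule ext)
  then have d: "(conv k ?v has_vector_derivative complex_of_real (kap t - l * E l t) * c) (at t)"
    using has_vector_derivative_mult_left[OF E_caputo[OF l t], of c] by (simp only:)
  then show "caputo_exists k ?v t" unfolding caputo_exists_def by (rule differentiableI_vector)
  have "vector_derivative (conv k ?v) (at t) = complex_of_real (kap t - l * E l t) * c" by (rule vector_derivative_at[OF d])
  \<comment> \<open>The term \<open>kap t\<close> of the derivative cancels against the
    \<open>lebesgue_value\<close> term because \<open>E l 0 = 1\<close>.\<close>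
  then show "caputo k ?v t = - complex_of_real l * (complex_of_real (E l t) * c)"
    unfolding caputo_def lebesgue_value_kernel[OF t] by (simp add: E_0[OF l] scaleR_conv_of_real algebra_simps)
qed

lemma caputo_solution_unique:
  assumes l: "l > 0" and v: "continuous_on {0..} v" and v0: "v 0 = c"
    and sol: "\<And>t. t > 0 \<Longrightarrow> caputo_exists k v t \<and> caputo k v t = - complex_of_real l * v t"
    and t: "t \<ge> 0"
  shows "v t = complex_of_real (E l t) * c"
proof -
  have l0: "l \<ge> 0" using l by simp
  let ?u = "\<lambda>s. complex_of_real (E l s) * c"
  have u: "continuous_on {0..} ?u" by (intro continuous_intros E_continuous l0)
  have ext: "continuous_on UNIV (\<lambda>s. w (max 0 s))" if "continuous_on {0..} w" for w :: "real \<Rightarrow> complex"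
    by (rule continuous_on_compose2[OF that]) (auto intro!: continuous_intros)
  define W where "W s = v (max 0 s) - ?u (max 0 s)" for s
  have int: "integrable lborel (\<lambda>\<tau>. indicator {0<..<x} \<tau> *\<^sub>R (w (max 0 (x - \<tau>)) * ckap \<tau>))" if w: "continuous_on {0..} w" for w x
  proof -
    have "compact (w ` {0..x})" by (intro compact_continuous_image continuous_on_subset[OF w]) auto
    then have "bounded (w ` {0..x})" by (rule compact_imp_bounded)
    then obtain C where C: "\<forall>y\<in>w ` {0..x}. norm y \<le> C" by (auto simp: bounded_iff)
    show ?thesis
      by (rule cv_integrable(1)[where g = "\<lambda>s. w (max 0 s)", OF locint_of_real[OF locint_kap] borel_measurable_continuous_onI[OF ext[OF w]], of x C])
        (use C in auto)
  qed
  have cvW: "cv ckap W x = conv k v x - conv k ?u x" for x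
  proof -
    have "cv ckap W x = cv W ckap x" by (rule cv_commute)
    also have "\<dots> = (LINT \<tau>|lborel. indicator {0<..<x} \<tau> *\<^sub>R (v (max 0 (x - \<tau>)) * ckap \<tau>) - indicator {0<..<x} \<tau> *\<^sub>R (?u (max 0 (x - \<tau>)) * ckap \<tau>))"
      unfolding cv_def W_def by (simp only: left_diff_distrib scaleR_diff_right)
    also have "\<dots> = cv (\<lambda>s. v (max 0 s)) ckap x - cv (\<lambda>s. ?u (max 0 s)) ckap x"
      unfolding cv_def by (rule Bochner_Integration.integral_diff[OF int[OF v] int[OF u]])
    finally show ?thesis unfolding conv_eq_cv[OF v] conv_eq_cv[OF u] by (simp only: cv_commute[of ckap])
  qed
  have "W s = 0" if s: "s > 0" for s
  proof (rule caputo_uniqueness[OF l _ _ _ s])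
    show "continuous_on UNIV W" unfolding W_def by (intro continuous_on_diff ext v u)
    show "W 0 = 0" by (simp add: W_def v0 E_0 l0)
    fix x :: real assume x: "x > 0"
    have dv: "(conv k w has_vector_derivative vector_derivative (conv k w) (at x)) (at x)" if "caputo_exists k w x" for w
      using that unfolding caputo_exists_def by (simp add: vector_derivative_works)
    have "((\<lambda>x. conv k v x - conv k ?u x) has_vector_derivative
       vector_derivative (conv k v) (at x) - vector_derivative (conv k ?u) (at x)) (at x)"
      using sol[OF x] E_solves(1)[OF l0 x, of c] by (intro has_vector_derivative_diff dv) auto
    moreover have "vector_derivative (conv k v) (at x) - vector_derivative (conv k ?u) (at x) = caputo k v x - caputo k ?u x"
      unfolding caputo_def by (simp add: v0 E_0 l0)
    moreover have "caputo k v x - caputo k ?u x = - (complex_of_real l * W x)"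
      using sol[OF x] E_solves(2)[OF l0 x, of c] x by (simp add: W_def algebra_simps)
    ultimately show "(cv ckap W has_vector_derivative - (complex_of_real l * W x)) (at x)"
      unfolding cvW[abs_def] by simp
  qed
  then show ?thesis using t by (cases "t = 0") (force simp: W_def v0 E_0 l0)+
qed

lemma nth_deriv_E:
  assumes l: "l \<ge> 0" and t: "t > 0"
  shows "nth_deriv j (\<lambda>s. complex_of_real (E l s) * c) t = complex_of_real (Ed j l t) * c"
    and "nth_deriv j (\<lambda>s. complex_of_real (E l s) * c) differentiable (at t)"
proof -
  let ?f = "\<lambda>s. complex_of_real (E l s) * c"
  \<comment> \<open>Claimed for all positive times at once, since the derivative at a point depends
    on \<open>nth_deriv j ?f\<close> in a neighbourhood.\<close>
  have *: "\<forall>t>0. nth_deriv j ?f t = complex_of_real (Ed j l t) * c \<and>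
     (nth_deriv j ?f has_vector_derivative complex_of_real (Ed (Suc j) l t) * c) (at t)" for j
  proof (induction j)
    case 0
    have "(?f has_vector_derivative complex_of_real (Ed (Suc 0) l t) * c) (at t)" if "t > 0" for t
      using Ed_deriv[OF l that, of 0]
      by (intro has_vector_derivative_mult_left has_vector_derivative_of_real) (simp add: has_real_derivative_iff_has_vector_derivative)
    then show ?case by (simp add: nth_deriv_def)
  next
    case (Suc j)
    have eq: "nth_deriv (Suc j) ?f t = complex_of_real (Ed (Suc j) l t) * c" if "t > 0" for t
      using vector_derivative_at[of "nth_deriv j ?f" _ t] Suc.IH that by (simp add: nth_deriv_def)
    have "(nth_deriv (Suc j) ?f has_vector_derivative complex_of_real (Ed (Suc (Suc j)) l t) * c) (at t)" if t: "t > 0" for t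
    proof -
      have "((\<lambda>t. complex_of_real (Ed (Suc j) l t) * c) has_vector_derivative complex_of_real (Ed (Suc (Suc j)) l t) * c) (at t)"
        using Ed_deriv[OF l t, of "Suc j"]
        by (intro has_vector_derivative_mult_left has_vector_derivative_of_real) (simp add: has_real_derivative_iff_has_vector_derivative)
      then show ?thesis
        by (rule has_vector_derivative_transform_within_open[where S = "{0<..}"]) (use t eq in auto)
    qed
    with eq show ?case by blast
  qed
  show "nth_deriv j ?f t = complex_of_real (Ed j l t) * c" using * t by blast
  show "nth_deriv j ?f differentiable (at t)" using * t by (blast intro: differentiableI_vector)
qed

section \<open>The solution of the Cauchy problem\<close>

definition sol_hat :: "(real^'n \<Rightarrow> complex) \<Rightarrow> real \<Rightarrow> real^'n \<Rightarrow> complex" where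
  "sol_hat u0 t \<xi> = complex_of_real (E ((norm \<xi>)\<^sup>2) t) * fourier u0 \<xi>"

definition sol :: "(real^'n \<Rightarrow> complex) \<Rightarrow> real \<Rightarrow> real^'n \<Rightarrow> complex" where
  "sol u0 t = (SOME w. has_fourier w (sol_hat u0 t))"

text \<open>Its L^2 norm is the H^2 norm of \<open>u0\<close>. Multipliers commute with the weight,
  so each H^2 estimate is the corresponding L^2 estimate for this function.\<close>

definition weighted_hat :: "(real^'n \<Rightarrow> complex) \<Rightarrow> real^'n \<Rightarrow> complex" where
  "weighted_hat u0 \<xi> = complex_of_real (1 + (norm \<xi>)\<^sup>2) * fourier u0 \<xi>"

lemma H2_fun_transform:
  assumes u0: "H2_fun u0"
  shows "has_fourier u0 (fourier u0)" "sq_int lebesgue (fourier u0)" "sq_int lebesgue (weighted_hat u0)"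
    "l2_norm lebesgue (fourier u0) = L2_norm u0" "l2_norm lebesgue (weighted_hat u0) = H2_norm u0"
proof -
  show f: "has_fourier u0 (fourier u0)" using u0 by (auto simp: H2_fun_def intro: has_fourier_fourier)
  show "sq_int lebesgue (fourier u0)" using f by (simp add: has_fourier_def L2_fun_sq_int)
  show "sq_int lebesgue (weighted_hat u0)" using u0 by (simp add: H2_fun_def L2_fun_sq_int weighted_hat_def[abs_def])
  show "l2_norm lebesgue (fourier u0) = L2_norm u0" using has_fourier_norm_eq[OF f] by (simp add: L2_norm_l2_norm)
  show "l2_norm lebesgue (weighted_hat u0) = H2_norm u0" by (simp add: H2_norm_def L2_norm_l2_norm weighted_hat_def[abs_def])
qed

lemma multiplier_H2:
  fixes u0 :: "real^'n \<Rightarrow> complex"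
  assumes u0: "H2_fun u0" and m: "(\<lambda>r. m (r\<^sup>2)) \<in> borel_measurable borel" and C: "\<And>l. l \<ge> 0 \<Longrightarrow> \<bar>m l\<bar> \<le> C"
    and w: "has_fourier w (\<lambda>\<xi>. complex_of_real (m ((norm \<xi>)\<^sup>2)) * fourier u0 \<xi>)"
  shows "L2_norm w \<le> C * L2_norm u0" "H2_fun w" "H2_norm w \<le> C * H2_norm u0"
proof -
  note d = H2_fun_transform[OF u0]
  show "L2_norm w \<le> C * L2_norm u0"
    using multiplier_sq_int(2)[OF m C d(2)] has_fourier_norm_eq[OF w] d(4) by (simp add: L2_norm_l2_norm)
  have eq: "(\<lambda>\<xi>. complex_of_real (1 + (norm \<xi>)\<^sup>2) * (complex_of_real (m ((norm \<xi>)\<^sup>2)) * fourier u0 \<xi>)) = (\<lambda>\<xi>. complex_of_real (m ((norm \<xi>)\<^sup>2)) * weighted_hat u0 \<xi>)"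
    by (auto simp: weighted_hat_def)
  show "H2_fun w" unfolding H2_via_has_fourier(1)[OF w] eq L2_fun_sq_int by (rule multiplier_sq_int(1)[OF m C d(3)])
  show "H2_norm w \<le> C * H2_norm u0" unfolding H2_via_has_fourier(2)[OF w] eq L2_norm_l2_norm
    using multiplier_sq_int(2)[OF m C d(3)] d(5) by simp
qed

lemma E_square_measurable: "t \<ge> 0 \<Longrightarrow> (\<lambda>r. E (r\<^sup>2) t) \<in> borel_measurable borel"
  using E_positive_multiplier[of t, where 'n = 1] by (simp add: positive_multiplier_def)

lemma abs_E_le_1: "l \<ge> 0 \<Longrightarrow> t \<ge> 0 \<Longrightarrow> \<bar>E l t\<bar> \<le> 1"
  by (simp add: E_nonneg E_le_1)

lemma sol_fourier:
  assumes u0: "H2_fun u0" and t: "t \<ge> 0"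
  shows "has_fourier (sol u0 t) (sol_hat u0 t)"
proof -
  have "L2_fun (sol_hat u0 t)" unfolding L2_fun_sq_int sol_hat_def[abs_def]
    by (rule multiplier_sq_int(1)[OF E_square_measurable[OF t] abs_E_le_1[OF _ t] H2_fun_transform(2)[OF u0]])
  from has_fourier_surj[OF this] show ?thesis unfolding sol_def by (rule someI_ex)
qed

lemma sol_bounds:
  assumes u0: "H2_fun u0" and t: "t \<ge> 0"
  shows "L2_norm (sol u0 t) \<le> L2_norm u0" "H2_fun (sol u0 t)" "H2_norm (sol u0 t) \<le> H2_norm u0"
  using multiplier_H2[OF u0 E_square_measurable[OF t] abs_E_le_1[OF _ t] sol_fourier[OF u0 t, unfolded sol_hat_def[abs_def]]] by auto

lemma sol_diff_H2_norm:
  assumes u0: "H2_fun u0" and s: "s \<ge> 0" and t: "t \<ge> 0"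
  shows "H2_fun (\<lambda>x. sol u0 s x - sol u0 t x)"
    "H2_norm (\<lambda>x. sol u0 s x - sol u0 t x) = l2_norm lebesgue (\<lambda>\<xi>. complex_of_real (E ((norm \<xi>)\<^sup>2) s) * weighted_hat u0 \<xi> - complex_of_real (E ((norm \<xi>)\<^sup>2) t) * weighted_hat u0 \<xi>)"
proof -
  have f: "has_fourier (\<lambda>x. sol u0 s x - sol u0 t x) (\<lambda>\<xi>. sol_hat u0 s \<xi> - sol_hat u0 t \<xi>)"
    by (intro has_fourier_diff sol_fourier u0 s t)
  have eq: "(\<lambda>\<xi>. complex_of_real (1 + (norm \<xi>)\<^sup>2) * (sol_hat u0 s \<xi> - sol_hat u0 t \<xi>))
     = (\<lambda>\<xi>. complex_of_real (E ((norm \<xi>)\<^sup>2) s) * weighted_hat u0 \<xi> - complex_of_real (E ((norm \<xi>)\<^sup>2) t) * weighted_hat u0 \<xi>)"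
    by (auto simp: weighted_hat_def sol_hat_def algebra_simps)
  show "H2_fun (\<lambda>x. sol u0 s x - sol u0 t x)"
    unfolding H2_via_has_fourier(1)[OF f] eq L2_fun_sq_int
    by (intro sq_int_diff multiplier_sq_int(1)[OF E_square_measurable abs_E_le_1] H2_fun_transform u0 s t)
  show "H2_norm (\<lambda>x. sol u0 s x - sol u0 t x) = l2_norm lebesgue (\<lambda>\<xi>. complex_of_real (E ((norm \<xi>)\<^sup>2) s) * weighted_hat u0 \<xi> - complex_of_real (E ((norm \<xi>)\<^sup>2) t) * weighted_hat u0 \<xi>)"
    unfolding H2_via_has_fourier(2)[OF f] eq L2_norm_l2_norm ..
qed

text \<open>Dominated convergence on the frequency side: \<open>E\<close> is continuous in time at
  each frequency and bounded by 1.\<close>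

lemma sol_continuous_H2:
  fixes u0 :: "real^'n \<Rightarrow> complex"
  assumes u0: "H2_fun u0" and t: "t \<ge> 0"
  shows "((\<lambda>s. H2_norm (\<lambda>x. sol u0 s x - sol u0 t x)) \<longlongrightarrow> 0) (at t within {0..})"
  unfolding tendsto_at_iff_sequentially
proof (intro allI impI)
  fix X assume X: "\<forall>i. X i \<in> {0..} - {t}" "X \<longlonglongrightarrow> t"
  then have X0: "X i \<ge> 0" for i by auto
  note d = H2_fun_transform[OF u0]
  have m: "(\<lambda>\<xi>::real^'n. complex_of_real (E ((norm \<xi>)\<^sup>2) s) * weighted_hat u0 \<xi>) \<in> borel_measurable lebesgue" if "s \<ge> 0" for s
    using d(3) by (intro borel_measurable_times multiplier_measurable E_square_measurable that) (simp add: sq_int_def)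
  have "(\<lambda>i. l2_norm lebesgue (\<lambda>\<xi>::real^'n. complex_of_real (E ((norm \<xi>)\<^sup>2) (X i)) * weighted_hat u0 \<xi> - complex_of_real (E ((norm \<xi>)\<^sup>2) t) * weighted_hat u0 \<xi>)) \<longlonglongrightarrow> 0"
  proof (rule l2_dominated_convergence[OF m[OF X0] m[OF t] d(3), where C = 1])
    show "AE \<xi>::real^'n in lebesgue. (\<lambda>i. complex_of_real (E ((norm \<xi>)\<^sup>2) (X i)) * weighted_hat u0 \<xi>) \<longlonglongrightarrow> complex_of_real (E ((norm \<xi>)\<^sup>2) t) * weighted_hat u0 \<xi>"
    proof (rule AE_I2)
      fix \<xi> :: "real^'n"
      have "(\<lambda>i. E ((norm \<xi>)\<^sup>2) (X i)) \<longlonglongrightarrow> E ((norm \<xi>)\<^sup>2) t"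
        by (rule continuous_on_tendsto_compose[OF E_continuous X(2)]) (use X0 t in auto)
      then show "(\<lambda>i. complex_of_real (E ((norm \<xi>)\<^sup>2) (X i)) * weighted_hat u0 \<xi>) \<longlonglongrightarrow> complex_of_real (E ((norm \<xi>)\<^sup>2) t) * weighted_hat u0 \<xi>"
        by (intro tendsto_intros)
    qed
    show "AE \<xi>::real^'n in lebesgue. norm (complex_of_real (E ((norm \<xi>)\<^sup>2) (X i)) * weighted_hat u0 \<xi>) \<le> 1 * norm (weighted_hat u0 \<xi>)" for i
      using abs_E_le_1[OF _ X0[of i]] by (intro AE_I2) (auto simp: norm_mult intro!: mult_left_le_one_le)
  qed
  then show "((\<lambda>s. H2_norm (\<lambda>x. sol u0 s x - sol u0 t x)) \<circ> X) \<longlonglongrightarrow> 0"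
    by (simp add: o_def sol_diff_H2_norm(2)[OF u0 X0 t])
qed

lemma sol_C_H2_Linf:
  fixes u0 :: "real^'n \<Rightarrow> complex"
  assumes dim: "CARD('n::finite) \<in> {1, 2, 3}" and u0: "H2_fun u0"
  shows "C_H2_Linf (sol u0)"
  unfolding C_H2_Linf_def
proof (intro allI impI conjI)
  fix t :: real assume t: "t \<ge> 0"
  let ?c = "(2 * pi) powr (- real CARD('n) / 2) * weight_const TYPE('n)"
  have meas: "H2_fun w \<Longrightarrow> w \<in> borel_measurable lebesgue" for w :: "real^'n \<Rightarrow> complex" by (simp add: H2_fun_def L2_fun_def)
  show "H2_fun (sol u0 t)" by (rule sol_bounds[OF u0 t])
  then show "Linf_fun (sol u0 t)" using Linf_boundI(1)[OF meas H2_sup_bound[OF dim]] by blast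
  show "((\<lambda>s. H2_norm (\<lambda>x. sol u0 s x - sol u0 t x) + Linf_norm (\<lambda>x. sol u0 s x - sol u0 t x)) \<longlongrightarrow> 0) (at t within {0..})"
  proof (rule Lim_null_comparison)
    \<comment> \<open>By the Sobolev embedding the supremum norm of a difference is at most
      \<open>?c\<close> times its H^2 norm, so continuity in H^2 carries over to the sum of both
      norms.\<close>
    show "((\<lambda>s. (1 + ?c) * H2_norm (\<lambda>x. sol u0 s x - sol u0 t x)) \<longlongrightarrow> 0) (at t within {0..})"
      using tendsto_mult_right_zero[OF sol_continuous_H2[OF u0 t]] by simp
    have "norm (H2_norm (\<lambda>x. sol u0 s x - sol u0 t x) + Linf_norm (\<lambda>x. sol u0 s x - sol u0 t x)) \<le> (1 + ?c) * H2_norm (\<lambda>x. sol u0 s x - sol u0 t x)"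
      if s: "s \<ge> 0" for s
    proof -
      note w = sol_diff_H2_norm(1)[OF u0 s t]
      have "0 \<le> H2_norm (\<lambda>x. sol u0 s x - sol u0 t x)" by (simp add: H2_norm_def L2_norm_l2_norm)
      then show ?thesis using Linf_boundI(2,3)[OF meas[OF w] H2_sup_bound[OF dim w]] by (simp add: algebra_simps)
    qed
    then show "\<forall>\<^sub>F s in at t within {0..}. norm (H2_norm (\<lambda>x. sol u0 s x - sol u0 t x) + Linf_norm (\<lambda>x. sol u0 s x - sol u0 t x)) \<le> (1 + ?c) * H2_norm (\<lambda>x. sol u0 s x - sol u0 t x)"
      by (auto simp: eventually_at_filter)
  qed
qed

lemma sol_fourier_rep:
  assumes u0: "H2_fun u0"
  shows "fourier_rep (sol u0) (sol_hat u0)"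
  unfolding fourier_rep_def
proof (intro conjI allI impI sol_fourier u0 AE_I2)
  show "continuous_on {0..} (\<lambda>t. sol_hat u0 t \<xi>)" for \<xi>
    unfolding sol_hat_def by (intro continuous_intros E_continuous) simp
qed

lemma sol_solves:
  assumes u0: "H2_fun u0"
  shows "solves_cauchy k u0 (sol u0)"
  unfolding solves_cauchy_def
proof (intro exI[of _ "sol_hat u0"] conjI sol_fourier_rep u0 AE_I2 allI impI)
  fix \<xi>
  show "sol_hat u0 0 \<xi> = fourier u0 \<xi>" by (simp add: sol_hat_def E_0)
  fix t :: real assume t: "t > 0"
  show "caputo_exists k (\<lambda>s. sol_hat u0 s \<xi>) t" unfolding sol_hat_def by (rule E_solves(1)[OF _ t]) simp
  show "caputo k (\<lambda>s. sol_hat u0 s \<xi>) t = - complex_of_real ((norm \<xi>)\<^sup>2) * sol_hat u0 t \<xi>"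
    unfolding sol_hat_def by (rule E_solves(2)[OF _ t]) simp
qed

text \<open>The frequency 0, excluded in \<open>caputo_solution_unique\<close>, is a null set. At
  almost every other frequency the two transforms coincide at time \<open>t\<close>, and injectivity
  of the transform leads back to the functions.\<close>

lemma sol_unique:
  assumes u0: "H2_fun u0" and v: "solves_cauchy k u0 v" and t: "t \<ge> 0"
  shows "AE x in lebesgue. v t x = sol u0 t x"
proof -
  obtain V where V: "fourier_rep v V" "AE \<xi> in lebesgue. V 0 \<xi> = fourier u0 \<xi> \<and>
        (\<forall>t>0. caputo_exists k (\<lambda>s. V s \<xi>) t \<and> caputo k (\<lambda>s. V s \<xi>) t = - complex_of_real ((norm \<xi>)\<^sup>2) * V t \<xi>)"
    using v unfolding solves_cauchy_def by blast
  have c: "AE \<xi> in lebesgue. continuous_on {0..} (\<lambda>t. V t \<xi>)" using V(1) by (simp add: fourier_rep_def)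
  have ne: "AE \<xi>::real^'a in lebesgue. \<xi> \<noteq> 0" by (rule AE_completion[OF AE_lborel_singleton])
  have "AE \<xi> in lebesgue. V t \<xi> = sol_hat u0 t \<xi>"
    using V(2) c ne
  proof eventually_elim
    case (elim \<xi>)
    have l: "(norm \<xi>)\<^sup>2 > 0" using elim(3) by simp
    show ?case unfolding sol_hat_def
      by (rule caputo_solution_unique[OF l elim(2) _ _ t]) (use elim(1) in auto)
  qed
  moreover have "has_fourier (v t) (V t)" using V(1) t by (simp add: fourier_rep_def)
  ultimately show ?thesis using has_fourier_inj[OF _ sol_fourier[OF u0 t]] by blast
qed

lemma sol_time_deriv:
  fixes u0 :: "real^'n \<Rightarrow> complex"
  assumes u0: "H2_fun u0" and t: "t > 0" and j: "j \<ge> 1"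
  shows "\<exists>w. has_time_deriv j (sol u0) t w \<and> L2_norm w \<le> (real j / (exp 1 * t)) ^ j * L2_norm u0 \<and>
    H2_fun w \<and> H2_norm w \<le> (real j / (exp 1 * t)) ^ j * H2_norm u0"
proof -
  note b = Ed_bound[OF _ t j]
  have "L2_fun (\<lambda>\<xi>. complex_of_real (Ed j ((norm \<xi>)\<^sup>2) t) * fourier u0 \<xi>)" unfolding L2_fun_sq_int
    by (rule multiplier_sq_int(1)[OF Ed_measurable[OF t] b H2_fun_transform(2)[OF u0]])
  from has_fourier_surj[OF this] obtain w where w: "has_fourier w (\<lambda>\<xi>. complex_of_real (Ed j ((norm \<xi>)\<^sup>2) t) * fourier u0 \<xi>)" by blast
  have "has_time_deriv j (sol u0) t w"
    unfolding has_time_deriv_def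
  proof (intro exI[of _ "sol_hat u0"] conjI sol_fourier_rep u0 AE_I2 allI impI)
    show "nth_deriv i (\<lambda>r. sol_hat u0 r \<xi>) differentiable (at s)" if "s > 0" for i s \<xi>
      unfolding sol_hat_def by (rule nth_deriv_E(2)[OF _ that]) simp
    have "nth_deriv j (\<lambda>r. sol_hat u0 r \<xi>) t = complex_of_real (Ed j ((norm \<xi>)\<^sup>2) t) * fourier u0 \<xi>" for \<xi>
      unfolding sol_hat_def by (rule nth_deriv_E(1)[OF _ t]) simp
    then show "has_fourier w (\<lambda>\<xi>. nth_deriv j (\<lambda>r. sol_hat u0 r \<xi>) t)" using w by simp
  qed
  with multiplier_H2[OF u0 Ed_measurable[OF t] b w] show ?thesis by blast
qed

text \<open>On the frequency side the operator multiplies the solution by - |\<xi>|^2, and |\<xi>|^2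
  E \<le> 1 + |\<xi>|^2; this is how the H^2 norm of the data enters an L^2 bound.\<close>

lemma sol_has_caputo:
  fixes u0 :: "real^'n \<Rightarrow> complex"
  assumes u0: "H2_fun u0" and t: "t > 0"
  shows "\<exists>w. has_caputo k (sol u0) t w \<and> L2_norm w \<le> H2_norm u0"
proof -
  note d = H2_fun_transform[OF u0]
  let ?D = "\<lambda>\<xi>. - complex_of_real ((norm \<xi>)\<^sup>2) * sol_hat u0 t \<xi>"
  have t0: "t \<ge> 0" using t by simp
  have Um: "sol_hat u0 t \<in> borel_measurable lebesgue" using sol_fourier[OF u0 t0] by (simp add: has_fourier_def L2_fun_def)
  have Dm: "?D \<in> borel_measurable lebesgue"
    by (intro borel_measurable_times[OF continuous_lebesgue_measurable Um] continuous_intros)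
  have le: "AE \<xi> in lebesgue. norm (?D \<xi>) \<le> 1 * norm (weighted_hat u0 \<xi>)"
  proof (rule AE_I2)
    fix \<xi> :: "real^'n"
    have "norm (?D \<xi>) = (norm \<xi>)\<^sup>2 * (E ((norm \<xi>)\<^sup>2) t * norm (fourier u0 \<xi>))"
      by (simp add: sol_hat_def norm_mult norm_power E_nonneg)
    also have "\<dots> \<le> (1 + (norm \<xi>)\<^sup>2) * (1 * norm (fourier u0 \<xi>))"
      using E_le_1[OF _ t0] by (intro mult_mono mult_right_mono) (auto simp: E_nonneg)
    also have "\<dots> = norm (weighted_hat u0 \<xi>)"
    proof -
      have "norm (complex_of_real (1 + (norm \<xi>)\<^sup>2)) = 1 + (norm \<xi>)\<^sup>2" by (simp only: norm_of_real) simp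
      then show ?thesis by (simp only: weighted_hat_def norm_mult mult_1_left)
    qed
    finally show "norm (?D \<xi>) \<le> 1 * norm (weighted_hat u0 \<xi>)" by simp
  qed
  have "L2_fun ?D" unfolding L2_fun_sq_int by (rule sq_int_bound[OF d(3) Dm le])
  from has_fourier_surj[OF this] obtain w where w: "has_fourier w ?D" by blast
  have "L2_norm w \<le> H2_norm u0"
    using l2_norm_bound[OF d(3) Dm le] has_fourier_norm_eq[OF w] d(5) by (simp add: L2_norm_l2_norm)
  moreover have "has_caputo k (sol u0) t w"
    unfolding has_caputo_def
  proof (intro exI[of _ "sol_hat u0"] conjI sol_fourier_rep u0 AE_I2)
    show "caputo_exists k (\<lambda>s. sol_hat u0 s \<xi>) t" for \<xi> unfolding sol_hat_def by (rule E_solves(1)[OF _ t]) simp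
    have "caputo k (\<lambda>s. sol_hat u0 s \<xi>) t = ?D \<xi>" for \<xi>
      unfolding sol_hat_def by (rule E_solves(2)[OF _ t]) simp
    then show "has_fourier w (\<lambda>\<xi>. caputo k (\<lambda>s. sol_hat u0 s \<xi>) t)" using w by simp
  qed
  ultimately show ?thesis by blast
qed

text \<open>\<open>E_decay\<close> is the pointwise hypothesis of
  \<open>has_fourier_weighted_sup_bound\<close> with \<tau> = t / ||k||.\<close>

lemma sol_decay:
  fixes u0 :: "real^'n \<Rightarrow> complex"
  assumes dim: "CARD('n::finite) \<in> {1, 2, 3}" and u0: "H2_fun u0" and t: "t > 0"
  shows "Linf_norm (sol u0 t) \<le> (2 * pi) powr (- real CARD('n) / 2) * weight_const TYPE('n) * L2_norm u0 *
    ((LINT s:{0<..<t}|lebesgue. \<bar>k s\<bar>) / t) powr (real CARD('n) / 4)"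
proof -
  let ?K = "cv (\<lambda>_. 1) kap t"
  have K: "?K > 0" by (rule kap_mass_pos[OF t])
  have t0: "t \<ge> 0" using t by simp
  note d = H2_fun_transform[OF u0]
  note f = sol_fourier[OF u0 t0]
  have \<tau>: "t / ?K > 0" using K t by simp
  have "AE x in lebesgue. norm (sol u0 t x) \<le> (2 * pi) powr (- real CARD('n) / 2) * weight_const TYPE('n) * l2_norm lebesgue (fourier u0) * (t / ?K) powr (- real CARD('n) / 4)"
  proof (rule has_fourier_weighted_sup_bound[OF dim \<tau> f d(2)], rule AE_I2)
    fix \<xi> :: "real^'n"
    have "norm (sol_hat u0 t \<xi>) = E ((norm \<xi>)\<^sup>2) t * norm (fourier u0 \<xi>)" by (simp add: sol_hat_def norm_mult E_nonneg)
    also have "\<dots> \<le> 1 / (1 + (t / ?K) * (norm \<xi>)\<^sup>2) * norm (fourier u0 \<xi>)"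
      by (intro mult_right_mono E_decay t) auto
    finally show "norm (sol_hat u0 t \<xi>) \<le> norm (fourier u0 \<xi>) / (1 + t / ?K * (norm \<xi>)\<^sup>2)" by simp
  qed
  moreover have "(t / ?K) powr (- real CARD('n) / 4) = (?K / t) powr (real CARD('n) / 4)"
    using K t by (simp add: powr_divide powr_minus_divide)
  ultimately have "AE x in lebesgue. norm (sol u0 t x) \<le> (2 * pi) powr (- real CARD('n) / 2) * weight_const TYPE('n) * L2_norm u0 * (?K / t) powr (real CARD('n) / 4)"
    by (simp only: d(4))
  then show ?thesis unfolding kernel_mass
    by (rule Linf_boundI(2)[rotated]) (use f in \<open>simp add: has_fourier_def L2_fun_def\<close>)
qed

text \<open>\<open>sol u0 0\<close> and \<open>u0\<close> share a transform but may differ on a null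
  set, so the norms of the two differences are compared through their transforms.\<close>

lemma sol_initial:
  assumes u0: "H2_fun u0"
  shows "((\<lambda>t. H2_norm (\<lambda>x. sol u0 t x - u0 x)) \<longlongrightarrow> 0) (at_right 0)"
proof -
  note d = H2_fun_transform[OF u0]
  have U0: "sol_hat u0 0 = fourier u0" by (rule ext) (simp add: sol_hat_def E_0)
  have eq: "H2_norm (\<lambda>x. sol u0 t x - u0 x) = H2_norm (\<lambda>x. sol u0 t x - sol u0 0 x)" if t: "t > 0" for t
  proof -
    have t0: "t \<ge> 0" using t by simp
    have "has_fourier (\<lambda>x. sol u0 t x - u0 x) (\<lambda>\<xi>. sol_hat u0 t \<xi> - fourier u0 \<xi>)"
      "has_fourier (\<lambda>x. sol u0 t x - sol u0 0 x) (\<lambda>\<xi>. sol_hat u0 t \<xi> - fourier u0 \<xi>)"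
      using has_fourier_diff[OF sol_fourier[OF u0 t0] d(1)] has_fourier_diff[OF sol_fourier[OF u0 t0] sol_fourier[OF u0 order_refl]]
      by (simp_all add: U0)
    then show ?thesis by (simp only: H2_via_has_fourier(2))
  qed
  have "((\<lambda>t. H2_norm (\<lambda>x. sol u0 t x - sol u0 0 x)) \<longlongrightarrow> 0) (at_right 0)"
    by (rule tendsto_within_subset[OF sol_continuous_H2[OF u0 order_refl]]) auto
  moreover have "\<forall>\<^sub>F t in at_right 0. H2_norm (\<lambda>x. sol u0 t x - sol u0 0 x) = H2_norm (\<lambda>x. sol u0 t x - u0 x)"
    using eventually_at_right_less[of 0] by eventually_elim (simp add: eq)
  ultimately show ?thesis by (rule Lim_transform_eventually)
qed

end

theorem theorem2p1:
  assumes dim: "CARD('n::finite) \<in> {1, 2, 3}"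
  shows "\<exists>K::real. \<forall>(k :: real \<Rightarrow> real) (u0 :: real ^ 'n \<Rightarrow> complex).
    admissible_kernel k \<longrightarrow> H2_fun u0 \<longrightarrow>
    (\<exists>u :: real \<Rightarrow> real ^ 'n \<Rightarrow> complex.
       C_H2_Linf u \<and> solves_cauchy k u0 u \<and>
       (\<forall>v. C_H2_Linf v \<and> solves_cauchy k u0 v \<longrightarrow> (\<forall>t\<ge>0. AE x in lebesgue. v t x = u t x)) \<and>
       (\<forall>t\<ge>0. L2_norm (u t) \<le> L2_norm u0) \<and>
       (\<forall>t\<ge>0. H2_norm (u t) \<le> H2_norm u0) \<and>
       ((\<lambda>t. H2_norm (\<lambda>x. u t x - u0 x)) \<longlongrightarrow> 0) (at_right 0) \<and>
       (\<forall>j\<ge>1. \<forall>t>0. \<exists>w. has_time_deriv j u t w \<and>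
          L2_norm w \<le> (real j / (exp 1 * t)) ^ j * L2_norm u0 \<and>
          H2_fun w \<and> H2_norm w \<le> (real j / (exp 1 * t)) ^ j * H2_norm u0) \<and>
       (\<forall>t>0. \<exists>w. has_caputo k u t w \<and> L2_norm w \<le> H2_norm u0) \<and>
       (\<forall>t>0. Linf_norm (u t) \<le>
          K * L2_norm u0 * ((LINT s:{0<..<t}|lebesgue. \<bar>k s\<bar>) / t) powr (real CARD('n) / 4)) \<and>
       ((AE x in lebesgue. u0 x \<in> \<real>\<^sub>\<ge>\<^sub>0) \<longrightarrow> (\<forall>t\<ge>0. AE x in lebesgue. u t x \<in> \<real>\<^sub>\<ge>\<^sub>0)) \<and>
       ((\<exists>C. AE x in lebesgue. norm (u0 x) \<le> C) \<longrightarrow>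
          (\<exists>C. \<forall>t\<ge>0. AE x in lebesgue. norm (u t x) \<le> C)))"
\<comment> \<open>The constant is fixed before \<open>k\<close> and \<open>u0\<close>, so it depends
  on the dimension only.\<close>
proof (rule exI[of _ "(2 * pi) powr (- real CARD('n) / 2) * weight_const TYPE('n)"], intro allI impI)
  fix k :: "real \<Rightarrow> real" and u0 :: "real ^ 'n \<Rightarrow> complex"
  assume k: "admissible_kernel k" and u0: "H2_fun u0"
  obtain \<sigma> where \<sigma>: "stieltjes_kernel \<sigma> (laplace k)" using admissible_stieltjes_kernel[OF k] by blast
  interpret caputo_kernel \<sigma> "laplace k" k by (rule admissible_caputo_kernel[OF k \<sigma>])
  let ?c = "(2 * pi) powr (- real CARD('n) / 2) * weight_const TYPE('n)"
  have nonneg: "\<forall>t\<ge>0. AE x in lebesgue. sol u0 t x \<in> \<real>\<^sub>\<ge>\<^sub>0" if "AE x in lebesgue. u0 x \<in> \<real>\<^sub>\<ge>\<^sub>0"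
    using positive_multiplierD[OF E_positive_multiplier H2_fun_transform(1)[OF u0] that] sol_fourier[OF u0]
    unfolding sol_hat_def[abs_def] by blast
  \<comment> \<open>The Sobolev embedding at each time, with the H^2 norm bounded by that of the
    data, gives one constant for all times.\<close>
  have bounded: "\<exists>C. \<forall>t\<ge>0. AE x in lebesgue. norm (sol u0 t x) \<le> C"
  proof (intro exI[of _ "?c * H2_norm u0"] allI impI)
    fix t :: real assume t: "t \<ge> 0"
    have le: "?c * H2_norm (sol u0 t) \<le> ?c * H2_norm u0"
      by (intro mult_left_mono sol_bounds(3)[OF u0 t] mult_nonneg_nonneg) (auto simp: weight_const_def)
    show "AE x in lebesgue. norm (sol u0 t x) \<le> ?c * H2_norm u0"
      using H2_sup_bound[OF dim sol_bounds(2)[OF u0 t]] by eventually_elim (erule order_trans[OF _ le])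
  qed
  show "\<exists>u :: real \<Rightarrow> real ^ 'n \<Rightarrow> complex.
       C_H2_Linf u \<and> solves_cauchy k u0 u \<and>
       (\<forall>v. C_H2_Linf v \<and> solves_cauchy k u0 v \<longrightarrow> (\<forall>t\<ge>0. AE x in lebesgue. v t x = u t x)) \<and>
       (\<forall>t\<ge>0. L2_norm (u t) \<le> L2_norm u0) \<and>
       (\<forall>t\<ge>0. H2_norm (u t) \<le> H2_norm u0) \<and>
       ((\<lambda>t. H2_norm (\<lambda>x. u t x - u0 x)) \<longlongrightarrow> 0) (at_right 0) \<and>
       (\<forall>j\<ge>1. \<forall>t>0. \<exists>w. has_time_deriv j u t w \<and>
          L2_norm w \<le> (real j / (exp 1 * t)) ^ j * L2_norm u0 \<and>
          H2_fun w \<and> H2_norm w \<le> (real j / (exp 1 * t)) ^ j * H2_norm u0) \<and>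
       (\<forall>t>0. \<exists>w. has_caputo k u t w \<and> L2_norm w \<le> H2_norm u0) \<and>
       (\<forall>t>0. Linf_norm (u t) \<le>
          ?c * L2_norm u0 * ((LINT s:{0<..<t}|lebesgue. \<bar>k s\<bar>) / t) powr (real CARD('n) / 4)) \<and>
       ((AE x in lebesgue. u0 x \<in> \<real>\<^sub>\<ge>\<^sub>0) \<longrightarrow> (\<forall>t\<ge>0. AE x in lebesgue. u t x \<in> \<real>\<^sub>\<ge>\<^sub>0)) \<and>
       ((\<exists>C. AE x in lebesgue. norm (u0 x) \<le> C) \<longrightarrow>
          (\<exists>C. \<forall>t\<ge>0. AE x in lebesgue. norm (u t x) \<le> C))"
  proof (intro exI[of _ "sol u0"] conjI)
    show "\<forall>v. C_H2_Linf v \<and> solves_cauchy k u0 v \<longrightarrow> (\<forall>t\<ge>0. AE x in lebesgue. v t x = sol u0 t x)"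
      using sol_unique[OF u0] by blast
    show "\<forall>t>0. Linf_norm (sol u0 t) \<le> ?c * L2_norm u0 * ((LINT s:{0<..<t}|lebesgue. \<bar>k s\<bar>) / t) powr (real CARD('n) / 4)"
      using sol_decay[OF dim u0] by blast
  qed (use sol_C_H2_Linf[OF dim u0] sol_solves[OF u0] sol_bounds[OF u0] sol_initial[OF u0] sol_time_deriv[OF u0] sol_has_caputo[OF u0] nonneg bounded in blast)+
qed

end
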